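(* Let $\mathcal{A}=\{H_1,\dots,H_n\}$ be an essential arrangement of affine hyperplanes in $\mathbb{C}^\ell$ with complement $M$. Let $\lambda\in\mathbb{C}^n$ be non-resonant, i.e. $\lambda$ minimizes $\sum_{q=0}^{\ell}\dim_{\mathbb{C}} H^q(M;\mathcal{L}_\lambda)$ among all weight vectors in $\mathbb{C}^n$. Then $H^q(M;\mathcal{L}_\lambda)=0$ for all $q\neq \ell$, and $\dim_{\mathbb{C}} H^\ell(M;\mathcal{L}_\lambda)=|e(M)|$, where $e(M)$ is the Euler characteristic of $M$.
   Context: An arrangement $\mathcal{A}=\{H_1,\dots,H_n\}$ of affine complex hyperplanes in $\mathbb{C}^\ell$ is essential if it contains $\ell$ hyperplanes whose defining linear forms are linearly independent. Its complement is $M=\mathbb{C}^\ell\setminus\bigcup_j H_j$. For a weight vector $\lambda=(\lambda_1,\dots,\lambda_n)\in\mathbb{C}^n$, $\mathcal{L}_\lambda$ denotes the rank one complex local system on $M$ given by the representation $\pi_1(M)\to\mathbb{C}^*$ sending any meridian loop $\gamma_j$ about $H_j$ to $t_j=\exp(2\pi i\lambda_j)$. *)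

theory Defs
  imports "HOL-Homology.Homology" "HOL-Library.Extended_Nat"
begin

definition std_vertex :: "nat \<Rightarrow> nat \<Rightarrow> real" where
  "std_vertex k = (\<lambda>i. if i = k then 1 else 0)"

definition edge10 :: "((nat \<Rightarrow> real) \<Rightarrow> 'a) \<Rightarrow> real \<Rightarrow> 'a" where
  "edge10 \<sigma> s = \<sigma> (\<lambda>i. (1 - s) * std_vertex 1 i + s * std_vertex 0 i)"

definition log_change :: "(real \<Rightarrow> complex) \<Rightarrow> complex" where
  "log_change \<gamma> = (THE d. \<exists>h. continuous_on {0..1} h \<and> (\<forall>s\<in>{0..1}. exp (h s) = \<gamma> s)
                              \<and> d = h 1 - h 0)"

text \<open>Singular q-cochains of X with values in a rank one local system: the value on a simplex
  lies in the fibre over its vertex 0 (identified with the complex numbers).\<close>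
definition tw_cochains :: "'a topology \<Rightarrow> nat \<Rightarrow> (((nat \<Rightarrow> real) \<Rightarrow> 'a) \<Rightarrow> complex) set" where
  "tw_cochains X q = {\<phi>. \<forall>\<sigma>. \<not> singular_simplex q X \<sigma> \<longrightarrow> \<phi> \<sigma> = 0}"

text \<open>Twisted coboundary; T sigma is the parallel transport of the local system from the fibre
  over vertex 1 of sigma to the fibre over vertex 0 of sigma along the edge.\<close>
definition tw_coboundary ::
  "'a topology \<Rightarrow> (((nat \<Rightarrow> real) \<Rightarrow> 'a) \<Rightarrow> complex) \<Rightarrow> nat
     \<Rightarrow> (((nat \<Rightarrow> real) \<Rightarrow> 'a) \<Rightarrow> complex) \<Rightarrow> (((nat \<Rightarrow> real) \<Rightarrow> 'a) \<Rightarrow> complex)" where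
  "tw_coboundary X T q \<phi> = (\<lambda>\<sigma>. if singular_simplex (Suc q) X \<sigma>
      then T \<sigma> * \<phi> (singular_face (Suc q) 0 \<sigma>)
           + (\<Sum>i\<in>{1..Suc q}. (-1) ^ i * \<phi> (singular_face (Suc q) i \<sigma>))
      else 0)"

definition tw_cocycles where
  "tw_cocycles X T q = {\<phi> \<in> tw_cochains X q. tw_coboundary X T q \<phi> = (\<lambda>_. 0)}"

definition tw_coboundaries where
  "tw_coboundaries X T q =
     (if q = 0 then {\<lambda>_. 0} else tw_coboundary X T (q - 1) ` tw_cochains X (q - 1))"

definition cspan :: "('b \<Rightarrow> complex) set \<Rightarrow> ('b \<Rightarrow> complex) set" where
  "cspan S = {f. \<exists>B c. finite B \<and> B \<subseteq> S \<and> f = (\<lambda>x. \<Sum>g\<in>B. c g * g x)}"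

text \<open>Dimension of the quotient V/W (W a subspace of the subspace V), possibly infinite:
  least number of elements of V generating V modulo W.\<close>
definition qdim :: "('b \<Rightarrow> complex) set \<Rightarrow> ('b \<Rightarrow> complex) set \<Rightarrow> enat" where
  "qdim V W = (if \<exists>B. finite B \<and> B \<subseteq> V \<and> V \<subseteq> cspan (B \<union> W)
     then enat (LEAST k. \<exists>B. finite B \<and> B \<subseteq> V \<and> card B = k \<and> V \<subseteq> cspan (B \<union> W))
     else \<infinity>)"

definition tw_cohom_dim where
  "tw_cohom_dim X T q = qdim (tw_cocycles X T q) (tw_coboundaries X T q)"

text \<open>Complex Betti numbers and Euler characteristic (finitely many nonzero Betti numbers).\<close>
definition betti :: "'a topology \<Rightarrow> nat \<Rightarrow> enat" where
  "betti X q = tw_cohom_dim X (\<lambda>_. 1) q"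

definition euler_char :: "'a topology \<Rightarrow> int" where
  "euler_char X = (\<Sum>q\<in>{q. betti X q \<noteq> 0}. (-1) ^ q * int (the_enat (betti X q)))"

definition hyp_form :: "(nat \<Rightarrow> complex ^ 'l) \<Rightarrow> (nat \<Rightarrow> complex) \<Rightarrow> nat \<Rightarrow> complex ^ 'l \<Rightarrow> complex" where
  "hyp_form a b j z = (\<Sum>i\<in>UNIV. a j $ i * z $ i) - b j"

definition hyperplane_of :: "(nat \<Rightarrow> complex ^ 'l) \<Rightarrow> (nat \<Rightarrow> complex) \<Rightarrow> nat \<Rightarrow> (complex ^ 'l) set" where
  "hyperplane_of a b j = {z. hyp_form a b j z = 0}"

definition arr_complement :: "nat \<Rightarrow> (nat \<Rightarrow> complex ^ 'l) \<Rightarrow> (nat \<Rightarrow> complex) \<Rightarrow> (complex ^ 'l) set" where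
  "arr_complement n a b = UNIV - (\<Union>j<n. hyperplane_of a b j)"

definition arr_top :: "nat \<Rightarrow> (nat \<Rightarrow> complex ^ 'l) \<Rightarrow> (nat \<Rightarrow> complex) \<Rightarrow> (complex ^ 'l) topology" where
  "arr_top n a b = subtopology euclidean (arr_complement n a b)"

text \<open>Transport of L_lambda: local flat sections are branches of prod_j f_j^lambda_j, so a
  meridian about H_j acts by t_j = exp(2 pi i lambda_j).\<close>
definition arr_transport where
  "arr_transport n a b lam \<sigma> =
     exp (\<Sum>j<n. lam j * log_change (\<lambda>s. hyp_form a b j (edge10 \<sigma> s)))"

definition ls_cohom_dim where
  "ls_cohom_dim n a b lam q = tw_cohom_dim (arr_top n a b) (arr_transport n a b lam) q"

definition essential_arr :: "nat \<Rightarrow> (nat \<Rightarrow> complex ^ 'l) \<Rightarrow> bool" where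
  "essential_arr n a = (\<exists>S. S \<subseteq> {..<n} \<and> card S = CARD('l) \<and>
      (\<forall>c. (\<Sum>j\<in>S. c j *s a j) = 0 \<longrightarrow> (\<forall>j\<in>S. c j = 0)))"

end

theory Submission
  imports Defs "HOL-Complex_Analysis.Complex_Analysis" "HOL-Library.Function_Algebras"
begin

text \<open>
  Twisted cochains are equivariant cochains on the abelian cover of the complement on which the
  logarithms of all defining forms exist. Covering the complement by the convex cells in which every
  form lies in one of three half planes, Leray's theorem yields a finite complex whose matrices depend
  holomorphically on the weights. So the Euler characteristic does not depend on the weights, and each
  dimension is upper semicontinuous in them.

  Vanishing above degree \<open>\<ell>\<close> holds for all weights. It is proved by sweeping an affine space with a
  coordinate: away from finitely many critical values a vector field almost tangent to the hyperplanes
  pushes everything into a fibre of smaller dimension, and near a critical value one passes to a thinner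
  tube, until only a central arrangement is left, whose sectors retract to an affine section.

  Vanishing below degree \<open>\<ell>\<close> holds for generic weights. For a basis of forms a rotation acts by a
  nontrivial scalar and by the identity on cohomology. Further hyperplanes are first added with weight
  zero, by a Gysin argument, and then semicontinuity applies. A nonresonant weight is compared with a
  generic one whose top cohomology is not larger.
\<close>

section \<open>Natural chain operators\<close>

text \<open>The obstacle is noncompactness: a displacement can be followed by principal logarithms
  only while each form changes by less than its own value, so an unbounded region is never swept in
  one go. What replaces limits is that the cells of a convex region are convex. The dimensions then
  depend on the region only through the pattern of nonempty intersections of cells, a finite datum,
  and one may truncate at a large radius, shrink a tube, or rescale towards a point whenever this
  pattern is preserved. The constants by which the local logarithms differ depend neither on the
  region nor on the weights. The concluding comparison: a generic \<open>mu\<close> has cohomology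
  only in degree d = \<open>CARD('l)\<close>, and can be chosen with top dimension at most that of
  \<open>lam\<close>. Minimality gives h^0(lam) + ... + h^d(lam) <= h^d(mu) <= h^d(lam). All terms
  are finite, so the lower ones vanish and the top ones agree; the Euler characteristic, computed at
  \<open>mu\<close>, has only one term.\<close>

abbreviation simplex_top :: "nat \<Rightarrow> (nat \<Rightarrow> real) topology" where
  "simplex_top p \<equiv> subtopology (powertop_real UNIV) (standard_simplex p)"

abbreviation cyl :: "'a topology \<Rightarrow> (real \<times> 'a) topology" where
  "cyl X \<equiv> prod_topology (top_of_set {0..1::real}) X"

definition iota :: "nat \<Rightarrow> (nat \<Rightarrow> real) chain" where
  "iota p = frag_of (restrict id (standard_simplex p))"

definition cyl_map :: "('a \<Rightarrow> 'b) \<Rightarrow> real \<times> 'a \<Rightarrow> real \<times> 'b" where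
  "cyl_map g z = (fst z, g (snd z))"

lemma cyl_map_Pair [simp]: "cyl_map g (s, x) = (s, g x)"
  by (simp add: cyl_map_def)

text \<open>The natural operator with model \<open>k\<close>: a chain on the cylinder over the
  standard simplex is pushed forward along every simplex of \<open>c\<close>. One choice of
  \<open>k\<close> acts on all spaces at once and commutes with induced maps.\<close>

definition cyl_ext :: "nat \<Rightarrow> (real \<times> (nat \<Rightarrow> real)) chain \<Rightarrow> 'a chain \<Rightarrow> (real \<times> 'a) chain" where
  "cyl_ext q k c = frag_extend (\<lambda>\<sigma>. chain_map q (cyl_map \<sigma>) k) c"

lemma cyl_ext_0 [simp]: "cyl_ext q k 0 = 0"
  and cyl_ext_of [simp]: "cyl_ext q k (frag_of \<sigma>) = chain_map q (cyl_map \<sigma>) k"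
  and cyl_ext_diff: "cyl_ext q k (a - b) = cyl_ext q k a - cyl_ext q k b"
  by (simp_all add: cyl_ext_def frag_extend_diff)

lemma cyl_ext_0_left [simp]: "cyl_ext q 0 c = 0"
  by (simp add: cyl_ext_def frag_extend_eq_0)

lemma cyl_ext_diff_left: "cyl_ext q (k - l) c = cyl_ext q k c - cyl_ext q l c"
proof (induction c rule: frag_induction[OF subset_UNIV])
  case 3
  then show ?case by (simp add: cyl_ext_diff)
qed (simp_all add: chain_map_diff)

lemma chain_map_chain_map: "chain_map p g (chain_map p f c) = chain_map p (\<lambda>x. g (f x)) c"
  using chain_map_compose[of p g f] by (simp add: fun_eq_iff comp_def)

lemma continuous_map_prod_id:
  assumes "continuous_map X Y f"
  shows "continuous_map (cyl X) (cyl Y) (cyl_map f)"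
proof -
  have "continuous_map (cyl X) (cyl Y) (\<lambda>(x,y). (x, f y))"
    using assms by (subst continuous_map_prod_top) auto
  moreover have "(\<lambda>(x,y). (x, f y)) = cyl_map f" by auto
  ultimately show ?thesis by simp
qed

lemma iota_chain [simp]: "singular_chain p (simplex_top p) (iota p)"
  by (simp add: simplicial_imp_singular_chain iota_def)

lemma singular_chain_cyl_ext:
  assumes "singular_chain q (cyl (simplex_top p)) k" "singular_chain p X c"
  shows "singular_chain q (cyl X) (cyl_ext q k c)"
  unfolding cyl_ext_def
proof (rule singular_chain_extend)
  fix \<sigma> assume "\<sigma> \<in> Poly_Mapping.keys c"
  then have "singular_simplex p X \<sigma>"
    using assms by (auto simp: singular_chain_def)
  then show "singular_chain q (cyl X) (chain_map q (cyl_map \<sigma>) k)"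
    by (intro singular_chain_chain_map[OF assms(1)] continuous_map_prod_id) (simp add: singular_simplex_def)
qed

lemma cyl_ext_chain_map:
  assumes k: "singular_chain q (cyl (simplex_top p)) k" and "singular_chain p X c"
  shows "cyl_ext q k (chain_map p g c) = chain_map q (cyl_map g) (cyl_ext q k c)"
  using assms(2) unfolding singular_chain_def
proof (induction c rule: frag_induction)
  case (one \<sigma>)
  have "chain_map q (cyl_map (simplex_map p g \<sigma>)) k = chain_map q (\<lambda>z. cyl_map g (cyl_map \<sigma> z)) k"
    by (rule chain_map_eq[OF k]) (auto simp: simplex_map_def)
  then show ?case by (simp add: chain_map_chain_map)
next
  case (diff a b)
  then show ?case by (simp add: cyl_ext_diff chain_map_diff)
qed auto

lemma chain_boundary_cyl_ext:
  assumes k: "singular_chain (Suc q) (cyl (simplex_top p)) k"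
  shows "chain_boundary (Suc q) (cyl_ext (Suc q) k c) = cyl_ext q (chain_boundary (Suc q) k) c"
proof (induction c rule: frag_induction[OF subset_UNIV])
  case (2 \<sigma>)
  then show ?case using chain_boundary_chain_map[OF k] by simp
next
  case 3
  then show ?case by (simp add: cyl_ext_diff chain_boundary_diff)
qed auto

text \<open>Every simplex is the image of the fundamental one, so a composite with the boundary is
  known once it is known on the boundary of \<open>iota\<close>. This carries the recursion in
  \<open>htpy_model\<close> over to arbitrary chains.\<close>

lemma cyl_ext_cyl_ext_boundary:
  assumes k: "singular_chain q (cyl (simplex_top p)) k" and "singular_chain (Suc p) X c"
  shows "cyl_ext q (cyl_ext q k (chain_boundary (Suc p) (iota (Suc p)))) c = cyl_ext q k (chain_boundary (Suc p) c)"
  using assms(2) unfolding singular_chain_def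
proof (induction c rule: frag_induction)
  case (one \<sigma>)
  then have s: "singular_simplex (Suc p) X \<sigma>" by simp
  have b: "singular_chain p (simplex_top (Suc p)) (chain_boundary (Suc p) (iota (Suc p)))"
    by (rule singular_chain_boundary_alt) simp
  have "chain_map q (cyl_map \<sigma>) (cyl_ext q k (chain_boundary (Suc p) (iota (Suc p))))
      = cyl_ext q k (chain_map p \<sigma> (chain_boundary (Suc p) (iota (Suc p))))"
    by (simp add: cyl_ext_chain_map[OF k b])
  also have "chain_map p \<sigma> (chain_boundary (Suc p) (iota (Suc p))) = chain_boundary (Suc p) (frag_of \<sigma>)"
    using chain_boundary_chain_map[OF iota_chain, of "Suc p" \<sigma>] singular_simplex_chain_map_id[OF s] by (simp add: iota_def)
  finally show ?case by simp
next
  case (diff a b)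
  then show ?case by (simp add: cyl_ext_diff chain_boundary_diff)
qed auto

text \<open>The space \<open>[0,1] \<times> \<Delta>\<^sup>q\<close> is acyclic; this is what makes natural chain homotopies exist.\<close>

lemma cyl_simplex_homotopic:
  "homotopic_with (\<lambda>h. h \<in> {} \<rightarrow> {}) (cyl (simplex_top q)) (cyl (simplex_top q)) id (\<lambda>_. (0, \<lambda>j. if j = 0 then 1 else 0))"
proof -
  let ?e = "\<lambda>j::nat. if j = 0 then 1 else (0::real)"
  let ?B = "{0..1::real} \<times> standard_simplex q"
  have eq: "cyl (simplex_top q) = top_of_set ?B"
    by (simp add: subtopology_Times[symmetric] euclidean_product_topology)
  define h where "h = (\<lambda>z::real \<times> (real \<times> (nat \<Rightarrow> real)).
     ((1 - fst z) * fst (snd z), \<lambda>i. (1 - fst z) * snd (snd z) i + fst z * ?e i))"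
  have c: "continuous_on X h" for X
    unfolding h_def
    by (intro continuous_on_Pair continuous_intros continuous_on_coordinatewise_then_product
          continuous_on_product_coordinates[THEN continuous_on_compose2[where f="\<lambda>z. snd (snd z)"]]) auto
  have mem: "h z \<in> ?B" if "z \<in> {0..1} \<times> ?B" for z
    using that convex_standard_simplex[of "snd (snd z)" q ?e "fst z"]
    by (auto simp: h_def mult_le_one)
  have "continuous_map (prod_topology (top_of_set {0..1}) (top_of_set ?B)) (top_of_set ?B) h"
    using c mem by (auto simp: subtopology_Times[symmetric] continuous_map_in_subtopology)
  moreover have "h (0,x) = id x" "h (1,x) = (0, ?e)" for x
    by (auto simp: h_def)
  ultimately show ?thesis
    unfolding eq homotopic_with_def by auto
qed

text \<open>The identity is homotopic to a constant map, so a cycle is homologous to one at a point.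
  In degree 0 such a cycle need not bound; there \<open>aug\<close> demands that the coefficients
  add up to 0.\<close>

lemma cyl_simplex_acyclic:
  assumes c: "singular_chain p (cyl (simplex_top q)) c" "chain_boundary p c = 0"
    and aug: "p = 0 \<Longrightarrow> chain_map 0 (\<lambda>_. (0, \<lambda>j. if j = 0 then 1 else 0)) c = (0 :: (real \<times> (nat \<Rightarrow> real)) chain)"
  obtains d where "singular_chain (Suc p) (cyl (simplex_top q)) d" "chain_boundary (Suc p) d = c"
proof -
  let ?pt = "(0::real, \<lambda>j::nat. if j = 0 then 1 else 0::real)"
  let ?X = "cyl (simplex_top q)"
  have rc: "singular_relcycle p ?X {} c" using c by (simp add: singular_cycle)
  have h: "homologous_rel p ?X {} (chain_map p id c) (chain_map p (\<lambda>_. ?pt) c)"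
    using homotopic_imp_homologous_rel_chain_maps[OF cyl_simplex_homotopic rc] .
  have pt: "?pt \<in> topspace ?X" by auto
  have "singular_relboundary p ?X {} (chain_map p (\<lambda>_. ?pt) c)"
  proof (cases "p = 0")
    case True
    then show ?thesis using aug by simp
  next
    case False
    let ?P = "subtopology ?X {?pt}"
    have tP: "topspace ?P = {?pt}" using pt by auto
    have "continuous_map ?X ?P (\<lambda>_. ?pt)" using pt by (auto simp: continuous_map_in_subtopology)
    then have "singular_relcycle p ?P {} (chain_map p (\<lambda>_. ?pt) c)"
      using singular_relcycle_chain_map[OF rc, of ?P "\<lambda>_. ?pt" "{}"] by blast
    then have "singular_relboundary p ?P {} (chain_map p (\<lambda>_. ?pt) c)"
      using singular_boundary_eq_cycle_singleton[OF tP] False by simp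
    then show ?thesis
      unfolding singular_boundary by (meson singular_chain_subtopology)
  qed
  moreover have "chain_map p id c = c" using c chain_map_ident by blast
  ultimately have "singular_relboundary p ?X {} c"
    using h unfolding homologous_rel_def by (metis diff_add_cancel singular_relboundary_add)
  then show ?thesis using that unfolding singular_boundary by blast
qed

text \<open>\<open>a\<close> models a chain map that is to be null homotopic and \<open>k\<close>
  the homotopy; the equation is d k = a - k d on the fundamental simplex.\<close>

definition htpy_model :: "(nat \<Rightarrow> (real \<times> (nat \<Rightarrow> real)) chain) \<Rightarrow> (nat \<Rightarrow> (real \<times> (nat \<Rightarrow> real)) chain) \<Rightarrow> bool" where
  "htpy_model a k \<longleftrightarrow> (\<forall>p. singular_chain p (cyl (simplex_top p)) (a p) \<and> singular_chain (Suc p) (cyl (simplex_top p)) (k p) \<and>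
     chain_boundary (Suc p) (k p) = a p - (if p = 0 then 0 else cyl_ext p (k (p - 1)) (chain_boundary p (iota p))))"

lemma htpy_model_chain: "htpy_model a k \<Longrightarrow> singular_chain (Suc p) (cyl (simplex_top p)) (k p)"
  by (simp add: htpy_model_def)

lemma htpy_model_chain_boundary:
  assumes m: "htpy_model a k" and c: "singular_chain p X c"
  shows "chain_boundary (Suc p) (cyl_ext (Suc p) (k p) c)
     = cyl_ext p (a p) c - (if p = 0 then 0 else cyl_ext p (k (p - 1)) (chain_boundary p c))"
proof -
  have "singular_chain (Suc p) (cyl (simplex_top p)) (k p)"
    using m by (auto simp: htpy_model_def)
  then have "chain_boundary (Suc p) (cyl_ext (Suc p) (k p) c)
     = cyl_ext p (a p - (if p = 0 then 0 else cyl_ext p (k (p - 1)) (chain_boundary p (iota p)))) c"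
    unfolding chain_boundary_cyl_ext[OF htpy_model_chain[OF m]]
    using m[unfolded htpy_model_def, rule_format, of p] by (elim conjE) (erule arg_cong[where f="\<lambda>d. cyl_ext p d c"])
  moreover have "cyl_ext p (cyl_ext p (k (p - 1)) (chain_boundary p (iota p))) c = cyl_ext p (k (p - 1)) (chain_boundary p c)"
    if "p \<noteq> 0"
  proof -
    define r where "r = p - 1"
    have r: "p = Suc r" using that by (simp add: r_def)
    have kc: "singular_chain (Suc r) (cyl (simplex_top r)) (k r)"
      using m by (auto simp: htpy_model_def)
    show ?thesis using cyl_ext_cyl_ext_boundary[OF kc] c by (simp add: r)
  qed
  ultimately show ?thesis by (auto simp: cyl_ext_diff_left)
qed

text \<open>The method of acyclic models: \<open>k p\<close> is chosen recursively as a filling of a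
  cycle in the cylinder over the \<open>p\<close>-simplex. In degree 0 the condition
  \<open>a0\<close> makes the filling possible.\<close>

lemma htpy_model_exists:
  assumes a: "\<And>p. singular_chain p (cyl (simplex_top p)) (a p)"
    and da: "\<And>p. chain_boundary (Suc p) (a (Suc p)) = cyl_ext p (a p) (chain_boundary (Suc p) (iota (Suc p)))"
    and a0: "chain_map 0 (\<lambda>_. (0, \<lambda>j. if j = 0 then 1 else 0)) (a 0) = (0 :: (real \<times> (nat \<Rightarrow> real)) chain)"
  shows "\<exists>k. htpy_model a k"
proof -
  let ?db = "\<lambda>p. chain_boundary (Suc p) (iota (Suc p))"
  \<comment> \<open>The last conjunct is carried along because it says exactly that the chain to be
    filled in the next degree is a cycle.\<close>
  define P where "P = (\<lambda>p k. singular_chain (Suc p) (cyl (simplex_top p)) k \<and> (p = 0 \<longrightarrow> chain_boundary (Suc p) k = a 0) \<and>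
      chain_boundary (Suc p) (cyl_ext (Suc p) k (?db p)) = cyl_ext p (a p) (?db p))"
  define Q where "Q = (\<lambda>p k k'. chain_boundary (Suc (Suc p)) k' = a (Suc p) - cyl_ext (Suc p) k (?db p))"
  have db: "singular_chain p (simplex_top (Suc p)) (?db p)" for p
    by (rule singular_chain_boundary_alt) simp
  have base: "\<exists>k. P 0 k"
  proof -
    have "chain_boundary 0 (a 0) = 0" by (simp add: chain_boundary_def)
    then obtain d where d: "singular_chain (Suc 0) (cyl (simplex_top 0)) d" "chain_boundary (Suc 0) d = a 0"
      using cyl_simplex_acyclic[OF a[of 0] _ a0] by blast
    then show ?thesis unfolding P_def using chain_boundary_cyl_ext[OF d(1)] by auto
  qed
  have step: "\<exists>k'. P (Suc p) k' \<and> Q p k k'" if P: "P p k" for p k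
  proof -
    let ?c = "a (Suc p) - cyl_ext (Suc p) k (?db p)"
    have kc: "singular_chain (Suc p) (cyl (simplex_top p)) k" using P by (simp add: P_def)
    have c: "singular_chain (Suc p) (cyl (simplex_top (Suc p))) ?c"
      using a singular_chain_cyl_ext[OF kc db] by (simp add: singular_chain_diff)
    have "chain_boundary (Suc p) ?c = 0"
      using P by (simp add: chain_boundary_diff da P_def)
    then obtain k' where k': "singular_chain (Suc (Suc p)) (cyl (simplex_top (Suc p))) k'" "chain_boundary (Suc (Suc p)) k' = ?c"
      using cyl_simplex_acyclic[OF c] by blast
    have "chain_boundary (Suc (Suc p)) (cyl_ext (Suc (Suc p)) k' (?db (Suc p))) = cyl_ext (Suc p) ?c (?db (Suc p))"
      using chain_boundary_cyl_ext[OF k'(1)] k'(2) by simp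
    also have "\<dots> = cyl_ext (Suc p) (a (Suc p)) (?db (Suc p)) - cyl_ext (Suc p) k (chain_boundary (Suc p) (?db (Suc p)))"
      using cyl_ext_cyl_ext_boundary[OF kc db] by (simp add: cyl_ext_diff_left)
    also have "chain_boundary (Suc p) (?db (Suc p)) = 0"
      by (rule chain_boundary_boundary_alt[OF iota_chain])
    finally have "P (Suc p) k'" unfolding P_def using k' by simp
    then show ?thesis using k' by (auto simp: Q_def)
  qed
  obtain k where k: "\<And>p. P p (k p)" "\<And>p. Q p (k p) (k (Suc p))"
    using dependent_nat_choice[of P Q, OF base step] by blast
  have "htpy_model a k"
    unfolding htpy_model_def
  proof (intro allI conjI)
    fix p
    show "singular_chain p (cyl (simplex_top p)) (a p)" by (rule a)
    show "singular_chain (Suc p) (cyl (simplex_top p)) (k p)" using k(1) by (simp add: P_def)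
    show "chain_boundary (Suc p) (k p) = a p - (if p = 0 then 0 else cyl_ext p (k (p - 1)) (chain_boundary p (iota p)))"
    proof (cases p)
      case 0
      then show ?thesis using k(1)[of 0] by (simp add: P_def)
    next
      case (Suc r)
      then show ?thesis using k(2)[of r] by (simp add: Q_def)
    qed
  qed
  then show ?thesis by blast
qed

lemma cyl_ext_chain_map_Pair:
  assumes d: "singular_chain p (simplex_top p) d" 
  shows "cyl_ext p (chain_map p (Pair s) d) c = chain_map p (Pair s) (frag_extend (\<lambda>\<sigma>. chain_map p \<sigma> d) c)"
proof (induction c rule: frag_induction[OF subset_UNIV])
  case (2 \<sigma>)
  show ?case by (simp add: chain_map_chain_map)
next
  case 3
  then show ?case by (simp add: cyl_ext_diff chain_map_diff frag_extend_diff)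
qed auto

lemma frag_extend_chain_map_iota:
  assumes "singular_chain p X c"
  shows "frag_extend (\<lambda>\<sigma>. chain_map p \<sigma> (iota p)) c = c"
  using assms unfolding singular_chain_def
proof (induction c rule: frag_induction)
  case (one x)
  then show ?case using singular_simplex_chain_map_id[of p X x] by (simp add: iota_def)
next
  case (diff a b)
  then show ?case by (simp add: frag_extend_diff)
qed simp

lemma continuous_map_Pair_cyl: "s \<in> {0..1} \<Longrightarrow> continuous_map X (cyl X) (Pair s)"
  by (intro continuous_map_pairedI continuous_map_id[unfolded id_def]) auto

section \<open>The two natural homotopies: prisms and subdivision\<close>

definition prism_ends :: "nat \<Rightarrow> (real \<times> (nat \<Rightarrow> real)) chain" where
  "prism_ends p = chain_map p (Pair 1) (iota p) - chain_map p (Pair 0) (iota p)"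

text \<open>Subdivision involves no motion. Its difference from the identity is placed over the end
  0 of the interval so that models on cylinders can be reused; \<open>subdiv_op\<close> forgets the
  interval by \<open>snd\<close>.\<close>

definition subdiv_ends :: "nat \<Rightarrow> (real \<times> (nat \<Rightarrow> real)) chain" where
  "subdiv_ends p = chain_map p (Pair 0) (singular_subdivision p (iota p) - iota p)"

lemma cyl_ext_prism_ends:
  "singular_chain p X c \<Longrightarrow> cyl_ext p (prism_ends p) c = chain_map p (Pair 1) c - chain_map p (Pair 0) c"
  by (simp add: prism_ends_def cyl_ext_diff_left cyl_ext_chain_map_Pair frag_extend_chain_map_iota del: chain_map_of)

lemma singular_subdivision_iota: "singular_subdivision p (iota p) = simplicial_subdivision p (iota p)"
  by (rule singular_subdivision_simplicial_simplex[of p "standard_simplex p"]) (simp add: iota_def)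

lemma cyl_ext_subdiv_ends:
  assumes "singular_chain p X c"
  shows "cyl_ext p (subdiv_ends p) c = chain_map p (Pair 0) (singular_subdivision p c - c)"
proof -
  have "frag_extend (\<lambda>\<sigma>. chain_map p \<sigma> (singular_subdivision p (iota p) - iota p)) c
    = frag_extend (\<lambda>\<sigma>. chain_map p \<sigma> (singular_subdivision p (iota p))) c - frag_extend (\<lambda>\<sigma>. chain_map p \<sigma> (iota p)) c"
  proof (induction c rule: frag_induction[OF subset_UNIV])
    case 3 then show ?case by (simp add: frag_extend_diff)
  qed (auto simp: chain_map_diff)
  moreover have "frag_extend (\<lambda>\<sigma>. chain_map p \<sigma> (singular_subdivision p (iota p))) c = singular_subdivision p c"
    unfolding singular_subdivision_iota by (simp add: singular_subdivision_def iota_def)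
  moreover have "singular_chain p (simplex_top p) (singular_subdivision p (iota p) - iota p)"
    by (intro singular_chain_diff singular_chain_singular_subdivision iota_chain)
  ultimately show ?thesis
    using assms by (simp add: subdiv_ends_def cyl_ext_chain_map_Pair frag_extend_chain_map_iota)
qed

definition prism_model :: "nat \<Rightarrow> (real \<times> (nat \<Rightarrow> real)) chain" where
  "prism_model = (SOME k. htpy_model prism_ends k)"

definition subdiv_model :: "nat \<Rightarrow> (real \<times> (nat \<Rightarrow> real)) chain" where
  "subdiv_model = (SOME k. htpy_model subdiv_ends k)"

lemma prism_model: "htpy_model prism_ends prism_model"
  unfolding prism_model_def
proof (rule someI_ex[where P="htpy_model _"], rule htpy_model_exists)
  show "singular_chain p (cyl (simplex_top p)) (prism_ends p)" for p
    unfolding prism_ends_def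
    by (intro singular_chain_diff singular_chain_chain_map[OF iota_chain] continuous_map_Pair_cyl) auto
  show "chain_boundary (Suc p) (prism_ends (Suc p)) = cyl_ext p (prism_ends p) (chain_boundary (Suc p) (iota (Suc p)))" for p
    using singular_chain_boundary_alt[OF iota_chain, of p]
    by (subst cyl_ext_prism_ends, assumption)
       (simp add: prism_ends_def chain_boundary_diff chain_boundary_chain_map[OF iota_chain] del: chain_map_of)
  have *: "(\<lambda>_. x) \<circ> Pair s = (\<lambda>_. x)" for x :: "real \<times> (nat \<Rightarrow> real)" and s::real by auto
  show "chain_map 0 (\<lambda>_. (0, \<lambda>j. if j = 0 then 1 else 0)) (prism_ends 0) = (0 :: (real \<times> (nat \<Rightarrow> real)) chain)"
    unfolding prism_ends_def chain_map_diff
    by (simp add: chain_map_chain_map)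
qed

lemma subdiv_model: "htpy_model subdiv_ends subdiv_model"
  unfolding subdiv_model_def
proof (rule someI_ex[where P="htpy_model _"], rule htpy_model_exists)
  show "singular_chain p (cyl (simplex_top p)) (subdiv_ends p)" for p
    unfolding subdiv_ends_def
    by (intro singular_chain_chain_map[of p "simplex_top p"] singular_chain_diff singular_chain_singular_subdivision iota_chain continuous_map_Pair_cyl) auto
  show "chain_boundary (Suc p) (subdiv_ends (Suc p)) = cyl_ext p (subdiv_ends p) (chain_boundary (Suc p) (iota (Suc p)))" for p
  proof -
    have "singular_chain (Suc p) (simplex_top (Suc p)) (singular_subdivision (Suc p) (iota (Suc p)) - iota (Suc p))"
      by (intro singular_chain_diff singular_chain_singular_subdivision iota_chain)
    then show ?thesis
      unfolding cyl_ext_subdiv_ends[OF singular_chain_boundary_alt[OF iota_chain]]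
      by (simp add: subdiv_ends_def chain_boundary_diff chain_boundary_chain_map chain_boundary_singular_subdivision[OF iota_chain] del: chain_map_of)
  qed
  show "chain_map 0 (\<lambda>_. (0, \<lambda>j. if j = 0 then 1 else 0)) (subdiv_ends 0) = (0 :: (real \<times> (nat \<Rightarrow> real)) chain)"
    by (simp add: subdiv_ends_def singular_subdivision_zero[OF iota_chain])
qed

definition prism_op :: "(real \<times> 'a \<Rightarrow> 'b) \<Rightarrow> nat \<Rightarrow> 'a chain \<Rightarrow> 'b chain" where
  "prism_op H p c = chain_map (Suc p) H (cyl_ext (Suc p) (prism_model p) c)"

definition subdiv_op :: "nat \<Rightarrow> 'a chain \<Rightarrow> 'a chain" where
  "subdiv_op p c = chain_map (Suc p) snd (cyl_ext (Suc p) (subdiv_model p) c)"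

lemma prism_op_0 [simp]: "prism_op H p 0 = 0"
  and prism_op_diff: "prism_op H p (a - b) = prism_op H p a - prism_op H p b"
  and subdiv_op_0 [simp]: "subdiv_op p 0 = 0"
  and subdiv_op_diff: "subdiv_op p (a - b) = subdiv_op p a - subdiv_op p b"
  by (simp_all add: prism_op_def subdiv_op_def cyl_ext_diff chain_map_diff)

lemma singular_chain_prism_op:
  assumes "singular_chain p X c" "continuous_map (cyl X) Y H"
  shows "singular_chain (Suc p) Y (prism_op H p c)"
  unfolding prism_op_def
  by (intro singular_chain_chain_map[OF _ assms(2)] singular_chain_cyl_ext[OF htpy_model_chain[OF prism_model] assms(1)])

lemma singular_chain_subdiv_op:
  assumes "singular_chain p X c"
  shows "singular_chain (Suc p) X (subdiv_op p c)"
  unfolding subdiv_op_def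
  by (rule singular_chain_chain_map[OF _ continuous_map_snd]) (rule singular_chain_cyl_ext[OF htpy_model_chain[OF subdiv_model] assms(1)])

lemma chain_boundary_prism_op:
  assumes c: "singular_chain p X c"
  shows "chain_boundary (Suc p) (prism_op H p c)
    = chain_map p (\<lambda>x. H (1, x)) c - chain_map p (\<lambda>x. H (0, x)) c - (if p = 0 then 0 else prism_op H (p - 1) (chain_boundary p c))"
proof -
  have k: "singular_chain (Suc p) (cyl X) (cyl_ext (Suc p) (prism_model p) c)"
    using singular_chain_cyl_ext[OF htpy_model_chain[OF prism_model] c] .
  have e: "chain_map p H (chain_map p (Pair s) c) = chain_map p (\<lambda>x. H (s,x)) c" for s
    by (simp add: chain_map_chain_map)
  show ?thesis
    unfolding prism_op_def chain_boundary_chain_map[OF k]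
    using c by (auto simp: htpy_model_chain_boundary[OF prism_model c] cyl_ext_prism_ends chain_map_diff e)
qed

lemma chain_boundary_subdiv_op:
  assumes c: "singular_chain p X c"
  shows "chain_boundary (Suc p) (subdiv_op p c)
    = singular_subdivision p c - c - (if p = 0 then 0 else subdiv_op (p - 1) (chain_boundary p c))"
proof -
  have k: "singular_chain (Suc p) (cyl X) (cyl_ext (Suc p) (subdiv_model p) c)"
    using singular_chain_cyl_ext[OF htpy_model_chain[OF subdiv_model] c] .
  have e: "chain_map p snd (chain_map p (Pair (0::real)) d) = d" if "singular_chain p X d" for d
  proof -
    show ?thesis unfolding chain_map_chain_map by (rule chain_map_id_gen[OF that]) simp
  qed
  show ?thesis
    unfolding subdiv_op_def chain_boundary_chain_map[OF k] htpy_model_chain_boundary[OF subdiv_model c]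
      cyl_ext_subdiv_ends[OF c] chain_map_diff
    using e[OF c] e[OF singular_chain_singular_subdivision[OF c]] by (auto simp: chain_map_diff)
qed

text \<open>With deck transformations for \<open>g\<close> and \<open>g'\<close>, this makes the
  prism operator of an equivariant homotopy equivariant.\<close>

lemma prism_op_chain_map:
  assumes c: "singular_chain p X c"
    and g: "\<And>s x. s \<in> {0..1} \<Longrightarrow> x \<in> topspace X \<Longrightarrow> H (s, g x) = g' (H (s, x))"
  shows "prism_op H p (chain_map p g c) = chain_map (Suc p) g' (prism_op H p c)"
proof -
  note m = htpy_model_chain[OF prism_model]
  have "prism_op H p (chain_map p g c) = chain_map (Suc p) (\<lambda>z. H (cyl_map g z)) (cyl_ext (Suc p) (prism_model p) c)"
    by (simp add: prism_op_def cyl_ext_chain_map[OF m c] chain_map_chain_map)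
  also have "\<dots> = chain_map (Suc p) (\<lambda>z. g' (H z)) (cyl_ext (Suc p) (prism_model p) c)"
    by (rule chain_map_eq[OF singular_chain_cyl_ext[OF m c]]) (auto simp: g)
  finally show ?thesis by (simp add: prism_op_def chain_map_chain_map)
qed

lemma subdiv_op_chain_map:
  assumes c: "singular_chain p X c"
  shows "subdiv_op p (chain_map p g c) = chain_map (Suc p) g (subdiv_op p c)"
proof -
  have "singular_chain (Suc p) (cyl (simplex_top p)) (subdiv_model p)"
    using subdiv_model by (simp add: htpy_model_def)
  then have "subdiv_op p (chain_map p g c) = chain_map (Suc p) (snd \<circ> cyl_map g) (cyl_ext (Suc p) (subdiv_model p) c)"
    using c by (simp add: subdiv_op_def cyl_ext_chain_map chain_map_chain_map comp_def)
  also have "snd \<circ> cyl_map g = (\<lambda>z. g (snd z))" by auto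
  finally show ?thesis by (simp add: subdiv_op_def chain_map_chain_map)
qed

section \<open>Equivariant cochains\<close>

definition cev :: "('s \<Rightarrow> complex) \<Rightarrow> ('s \<Rightarrow>\<^sub>0 int) \<Rightarrow> complex" where
  "cev \<phi> c = (\<Sum>\<sigma>\<in>Poly_Mapping.keys c. of_int (Poly_Mapping.lookup c \<sigma>) * \<phi> \<sigma>)"

lemma cev_superset:
  assumes "finite S" "Poly_Mapping.keys c \<subseteq> S"
  shows "cev \<phi> c = (\<Sum>\<sigma>\<in>S. of_int (Poly_Mapping.lookup c \<sigma>) * \<phi> \<sigma>)"
  unfolding cev_def using assms by (intro sum.mono_neutral_left) (auto simp: in_keys_iff)

lemma cev_0 [simp]: "cev \<phi> 0 = 0" by (simp add: cev_def)

lemma cev_of [simp]: "cev \<phi> (frag_of \<sigma>) = \<phi> \<sigma>"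
  by (simp add: cev_def)

lemma cev_diff: "cev \<phi> (a - b) = cev \<phi> a - cev \<phi> b"
proof -
  let ?S = "Poly_Mapping.keys a \<union> Poly_Mapping.keys b"
  have s: "finite ?S" by simp
  show ?thesis
    using keys_diff[of a b]
    by (simp add: cev_superset[OF s] lookup_minus algebra_simps sum_subtractf)
qed

lemma cev_minus: "cev \<phi> (- a) = - cev \<phi> a"
  using cev_diff[of \<phi> 0 a] by simp

lemma cev_add: "cev \<phi> (a + b) = cev \<phi> a + cev \<phi> b"
  using cev_diff[of \<phi> a "- b"] by (simp add: cev_minus)

lemma cev_sum: "cev \<phi> (sum F I) = (\<Sum>i\<in>I. cev \<phi> (F i))"
  by (induction I rule: infinite_finite_induct) (auto simp: cev_add)

lemma cev_cmul: "cev \<phi> (frag_cmul n a) = of_int n * cev \<phi> a"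
proof -
  have "Poly_Mapping.keys (frag_cmul n a) \<subseteq> Poly_Mapping.keys a"
    by (auto simp: in_keys_iff)
  then show ?thesis
    by (simp add: cev_superset[OF finite_keys[of a]] sum_distrib_left algebra_simps)
qed

lemma cev_cong: "(\<And>\<sigma>. \<sigma> \<in> Poly_Mapping.keys c \<Longrightarrow> \<phi> \<sigma> = \<psi> \<sigma>) \<Longrightarrow> cev \<phi> c = cev \<psi> c"
  by (simp add: cev_def)

lemma cev_fun_linear:
  "cev (\<lambda>\<sigma>. a * \<phi> \<sigma> + b * \<psi> \<sigma>) c = a * cev \<phi> c + b * cev \<psi> c"
  by (simp add: cev_def sum.distrib sum_distrib_left algebra_simps)

lemma cev_fun_diff: "cev (\<lambda>\<sigma>. \<phi> \<sigma> - \<psi> \<sigma>) c = cev \<phi> c - cev \<psi> c"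
  using cev_fun_linear[of 1 \<phi> "-1" \<psi> c] by simp

lemma cev_additive:
  assumes "\<And>a b. K (a - b) = K a - K b"
  shows "cev (\<lambda>\<sigma>. cev \<phi> (K (frag_of \<sigma>))) c = cev \<phi> (K c)"
proof (induction c rule: frag_induction[OF subset_UNIV])
  case 1
  have "K 0 = 0" using assms[of 0 0] by simp
  then show ?case by simp
next
  case 3 then show ?case by (simp add: assms cev_diff)
qed auto

definition cobd :: "nat \<Rightarrow> (((nat \<Rightarrow> real) \<Rightarrow> 'b) \<Rightarrow> complex) \<Rightarrow> ((nat \<Rightarrow> real) \<Rightarrow> 'b) \<Rightarrow> complex" where
  "cobd q \<phi> \<sigma> = cev \<phi> (chain_boundary (Suc q) (frag_of \<sigma>))"

lemma cobd_alt: "cobd q \<phi> \<sigma> = (\<Sum>k\<le>Suc q. (-1) ^ k * \<phi> (singular_face (Suc q) k \<sigma>))"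
  unfolding cobd_def chain_boundary_of by (simp add: cev_sum cev_cmul del: sum.atMost_Suc)

lemma cev_cobd: "cev (cobd q \<phi>) c = cev \<phi> (chain_boundary (Suc q) c)"
  unfolding cobd_def by (rule cev_additive) (simp add: chain_boundary_diff)

lemma cobd_linear: "cobd q (\<lambda>\<sigma>. a * \<phi> \<sigma> + b * \<psi> \<sigma>) \<sigma> = a * cobd q \<phi> \<sigma> + b * cobd q \<psi> \<sigma>"
  by (simp add: cobd_def cev_fun_linear)

lemma cobd_diff: "cobd q (\<lambda>\<sigma>. \<phi> \<sigma> - \<psi> \<sigma>) \<sigma> = cobd q \<phi> \<sigma> - cobd q \<psi> \<sigma>"
  by (simp add: cobd_def cev_fun_diff)

text \<open>A point together with a value for the logarithm of each form; \<open>deck\<close>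
  changes the branches.\<close>

type_synonym 'a cov = "'a \<times> (nat \<Rightarrow> complex)"

definition deck :: "(nat \<Rightarrow> int) \<Rightarrow> 'a cov \<Rightarrow> 'a cov" where
  "deck g z = (fst z, \<lambda>j. snd z j + 2 * pi * \<i> * of_int (g j))"

definition Gam :: "nat set \<Rightarrow> (nat \<Rightarrow> int) set" where
  "Gam J = {g. \<forall>j. j \<notin> J \<longrightarrow> g j = 0}"

text \<open>The sign is that of \<open>wt\<close>, the factor exp(- sum lam_j log f_j) which turns
  cochains of the local system into equivariant ones; see \<open>wt_deck\<close>.\<close>

definition chi :: "nat set \<Rightarrow> (nat \<Rightarrow> complex) \<Rightarrow> (nat \<Rightarrow> int) \<Rightarrow> complex" where
  "chi J lam g = exp (- (\<Sum>j\<in>J. lam j * (2 * pi * \<i> * of_int (g j))))"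

lemma deck_inverse [simp]: "deck (\<lambda>j. - g j) (deck g z) = z" "deck g (deck (\<lambda>j. - g j) z) = z"
  by (simp_all add: deck_def)

lemma Gam_uminus: "g \<in> Gam J \<Longrightarrow> (\<lambda>j. - g j) \<in> Gam J"
  by (simp add: Gam_def)

lemma continuous_on_snd_coord: "continuous_on S (\<lambda>z::'a::topological_space cov. snd z j)"
  by (rule continuous_on_product_then_coordinatewise) (intro continuous_on_snd continuous_on_id)

lemma continuous_deck: "continuous_on S (deck g :: 'a::topological_space cov \<Rightarrow> _)"
  unfolding deck_def
  by (intro continuous_on_Pair continuous_on_coordinatewise_then_product continuous_on_add continuous_on_const
      continuous_on_fst continuous_on_id continuous_on_snd_coord)

type_synonym 'b ssys = "nat \<Rightarrow> ((nat \<Rightarrow> real) \<Rightarrow> 'b) set"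

text \<open>A deck invariant subcomplex of the singular complex. Such families treat alike all
  simplices in a set, the small simplices of a cover, and the simplices lying in several members of
  it.\<close>

definition ssys :: "nat set \<Rightarrow> 'a::topological_space cov ssys \<Rightarrow> bool" where
  "ssys J S \<longleftrightarrow> (\<forall>q. \<forall>\<sigma>\<in>S q. singular_simplex q euclidean \<sigma>) \<and>
     (\<forall>q k. \<forall>\<sigma>\<in>S (Suc q). k \<le> Suc q \<longrightarrow> singular_face (Suc q) k \<sigma> \<in> S q) \<and>
     (\<forall>q. \<forall>g\<in>Gam J. \<forall>\<sigma>\<in>S q. simplex_map q (deck g) \<sigma> \<in> S q)"

definition eqvt :: "nat set \<Rightarrow> (nat \<Rightarrow> complex) \<Rightarrow> 'a::topological_space cov ssys \<Rightarrow> nat \<Rightarrow> (((nat \<Rightarrow> real) \<Rightarrow> 'a cov) \<Rightarrow> complex) \<Rightarrow> bool" where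
  "eqvt J lam S q \<phi> \<longleftrightarrow> (\<forall>\<sigma>\<in>S q. \<forall>g\<in>Gam J. \<phi> (simplex_map q (deck g) \<sigma>) = chi J lam g * \<phi> \<sigma>)"

text \<open>Values outside \<open>S\<close> are left free. If \<open>ssys J S\<close> holds, a
  function vanishing on \<open>S q\<close> belongs to \<open>Zc\<close> and to \<open>Bc\<close>, so
  the quotient is the cohomology of the equivariant cochains on \<open>S\<close>.\<close>

definition Zc where
  "Zc J lam S q = {\<phi>. eqvt J lam S q \<phi> \<and> (\<forall>\<sigma>\<in>S (Suc q). cobd q \<phi> \<sigma> = 0)}"

definition Bc where
  "Bc J lam S q = {\<phi>. if q = 0 then \<forall>\<sigma>\<in>S q. \<phi> \<sigma> = 0
     else \<exists>\<psi>. eqvt J lam S (q - 1) \<psi> \<and> (\<forall>\<sigma>\<in>S q. \<phi> \<sigma> = cobd (q - 1) \<psi> \<sigma>)}"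

lemma eqvt_linear: "eqvt J lam S q \<phi> \<Longrightarrow> eqvt J lam S q \<psi> \<Longrightarrow> eqvt J lam S q (\<lambda>\<sigma>. a * \<phi> \<sigma> + b * \<psi> \<sigma>)"
  by (simp add: eqvt_def algebra_simps)

lemma eqvt_diff: "eqvt J lam S q \<phi> \<Longrightarrow> eqvt J lam S q \<psi> \<Longrightarrow> eqvt J lam S q (\<lambda>\<sigma>. \<phi> \<sigma> - \<psi> \<sigma>)"
  by (simp add: eqvt_def algebra_simps)

lemma eqvt_mono: "eqvt J lam S q \<phi> \<Longrightarrow> S' q \<subseteq> S q \<Longrightarrow> eqvt J lam S' q \<phi>"
  by (auto simp: eqvt_def)

lemma Zc_linear: "\<phi> \<in> Zc J lam S q \<Longrightarrow> \<psi> \<in> Zc J lam S q \<Longrightarrow> (\<lambda>\<sigma>. a * \<phi> \<sigma> + b * \<psi> \<sigma>) \<in> Zc J lam S q"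
  by (simp add: Zc_def eqvt_linear cobd_linear)

lemma Zc_diff: "\<phi> \<in> Zc J lam S q \<Longrightarrow> \<psi> \<in> Zc J lam S q \<Longrightarrow> (\<lambda>\<sigma>. \<phi> \<sigma> - \<psi> \<sigma>) \<in> Zc J lam S q"
  using Zc_linear[of \<phi> J lam S q \<psi> 1 "-1"] by simp

lemma Bc_linear: "\<phi> \<in> Bc J lam S q \<Longrightarrow> \<psi> \<in> Bc J lam S q \<Longrightarrow> (\<lambda>\<sigma>. a * \<phi> \<sigma> + b * \<psi> \<sigma>) \<in> Bc J lam S q"
proof (cases "q = 0")
  case False
  assume "\<phi> \<in> Bc J lam S q" "\<psi> \<in> Bc J lam S q"
  with False obtain u v where "eqvt J lam S (q-1) u" "\<forall>\<sigma>\<in>S q. \<phi> \<sigma> = cobd (q - 1) u \<sigma>"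
     "eqvt J lam S (q-1) v" "\<forall>\<sigma>\<in>S q. \<psi> \<sigma> = cobd (q - 1) v \<sigma>"
    by (auto simp: Bc_def)
  then show ?thesis using False
    unfolding Bc_def by (auto intro!: exI[of _ "\<lambda>\<sigma>. a * u \<sigma> + b * v \<sigma>"] simp: eqvt_linear cobd_linear)
qed (auto simp: Bc_def)

lemma Bc_diff: "\<phi> \<in> Bc J lam S q \<Longrightarrow> \<psi> \<in> Bc J lam S q \<Longrightarrow> (\<lambda>\<sigma>. \<phi> \<sigma> - \<psi> \<sigma>) \<in> Bc J lam S q"
  using Bc_linear[of \<phi> J lam S q \<psi> 1 "-1"] by simp

lemma Bc_cong: "\<phi> \<in> Bc J lam S q \<Longrightarrow> (\<And>\<sigma>. \<sigma> \<in> S q \<Longrightarrow> \<phi> \<sigma> = \<psi> \<sigma>) \<Longrightarrow> \<psi> \<in> Bc J lam S q"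
  unfolding Bc_def by (auto split: if_splits)

lemma Zc_mono: "\<phi> \<in> Zc J lam S q \<Longrightarrow> (\<And>q. S' q \<subseteq> S q) \<Longrightarrow> \<phi> \<in> Zc J lam S' q"
  unfolding Zc_def by (fastforce intro: eqvt_mono)

lemma Bc_mono:
  assumes "\<phi> \<in> Bc J lam S q" "\<And>q. S' q \<subseteq> S q" shows "\<phi> \<in> Bc J lam S' q"
proof (cases "q = 0")
  case False
  then obtain \<psi> where "eqvt J lam S (q - 1) \<psi>" "\<forall>\<sigma>\<in>S q. \<phi> \<sigma> = cobd (q - 1) \<psi> \<sigma>"
    using assms by (auto simp: Bc_def)
  moreover from this have "eqvt J lam S' (q - 1) \<psi>" using eqvt_mono assms(2) by blast
  ultimately show ?thesis using False assms(2) unfolding Bc_def by auto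
qed (use assms in \<open>auto simp: Bc_def\<close>)

definition chains_in :: "'b ssys \<Rightarrow> nat \<Rightarrow> 'b chain \<Rightarrow> bool" where
  "chains_in S q c \<longleftrightarrow> Poly_Mapping.keys c \<subseteq> S q"

lemma chains_in_0 [simp]: "chains_in S q 0"
  and chains_in_of [simp]: "chains_in S q (frag_of \<sigma>) \<longleftrightarrow> \<sigma> \<in> S q"
  and chains_in_diff: "chains_in S q a \<Longrightarrow> chains_in S q b \<Longrightarrow> chains_in S q (a - b)"
  and chains_in_add: "chains_in S q a \<Longrightarrow> chains_in S q b \<Longrightarrow> chains_in S q (a + b)"
  and chains_in_cmul: "chains_in S q a \<Longrightarrow> chains_in S q (frag_cmul n a)"
  using keys_diff[of a b] keys_add[of a b] by (auto simp: chains_in_def)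

lemma chains_in_sum: "(\<And>i. i \<in> I \<Longrightarrow> chains_in S q (F i)) \<Longrightarrow> chains_in S q (sum F I)"
  by (induction I rule: infinite_finite_induct) (auto simp: chains_in_add)

lemma chains_in_additive:
  assumes K: "\<And>a b. K (a - b) = K a - K b" and "\<And>\<sigma>. \<sigma> \<in> S q \<Longrightarrow> chains_in S' q' (K (frag_of \<sigma>))" and "chains_in S q c"
  shows "chains_in S' q' (K c)"
  using assms(3) unfolding chains_in_def[of S]
proof (induction c rule: frag_induction)
  case zero
  have "K 0 = 0" using K[of 0 0] by simp
  then show ?case by simp
qed (auto simp: K assms chains_in_diff)

lemma chains_in_boundary:
  assumes "ssys J S" "chains_in S (Suc q) c"
  shows "chains_in S q (chain_boundary (Suc q) c)"
  by (rule chains_in_additive[OF _ _ assms(2)])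
    (use assms(1) in \<open>auto simp: chain_boundary_diff chain_boundary_of ssys_def intro!: chains_in_sum chains_in_cmul chains_in_diff chains_in_add simp del: sum.atMost_Suc\<close>)

lemma cev_cocycle:
  assumes "\<phi> \<in> Zc J lam S q" "chains_in S (Suc q) c"
  shows "cev \<phi> (chain_boundary (Suc q) c) = 0"
proof -
  have "cev (cobd q \<phi>) c = cev (\<lambda>_. 0) c"
    by (rule cev_cong) (use assms in \<open>auto simp: Zc_def chains_in_def\<close>)
  then show ?thesis by (simp add: cev_cobd cev_def[of "\<lambda>_. 0"])
qed

lemma cev_eqvt:
  assumes "eqvt J lam S q \<phi>" "chains_in S q c" "g \<in> Gam J"
  shows "cev \<phi> (chain_map q (deck g) c) = chi J lam g * cev \<phi> c"
  using assms(2) unfolding chains_in_def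
proof (induction c rule: frag_induction)
  case (one x)
  then show ?case using assms by (simp add: eqvt_def)
qed (auto simp: chain_map_diff cev_diff algebra_simps)

lemma chains_in_deck:
  assumes "ssys J S" "chains_in S q c" "g \<in> Gam J"
  shows "chains_in S q (chain_map q (deck g) c)"
  by (rule chains_in_additive[OF _ _ assms(2)]) (use assms in \<open>auto simp: chain_map_diff ssys_def\<close>)

lemma eqvt_pullback:
  assumes phi: "eqvt J lam S' q' \<phi>"
    and K: "\<And>a b. K (a - b) = K a - K b"
    and KS: "\<And>\<sigma>. \<sigma> \<in> S q \<Longrightarrow> chains_in S' q' (K (frag_of \<sigma>))"
    and deck: "\<And>\<sigma> g. \<sigma> \<in> S q \<Longrightarrow> g \<in> Gam J \<Longrightarrow> K (chain_map q (deck g) (frag_of \<sigma>)) = chain_map q' (deck g) (K (frag_of \<sigma>))"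
  shows "eqvt J lam S q (\<lambda>\<sigma>. cev \<phi> (K (frag_of \<sigma>)))"
  unfolding eqvt_def
proof (intro ballI)
  fix \<sigma> g assume s: "\<sigma> \<in> S q" "g \<in> Gam J"
  show "cev \<phi> (K (frag_of (simplex_map q (deck g) \<sigma>))) = chi J lam g * cev \<phi> (K (frag_of \<sigma>))"
    using deck[OF s] cev_eqvt[OF phi KS[OF s(1)] s(2)] by simp
qed

definition sys_of :: "'a::topological_space cov set \<Rightarrow> 'a cov ssys" where
  "sys_of A q = {\<sigma>. singular_simplex q (top_of_set A) \<sigma>}"

definition deck_inv :: "nat set \<Rightarrow> 'a cov set \<Rightarrow> bool" where
  "deck_inv J A \<longleftrightarrow> (\<forall>g\<in>Gam J. \<forall>x\<in>A. deck g x \<in> A)"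

lemma sys_of_mono: "A \<subseteq> B \<Longrightarrow> sys_of A q \<subseteq> sys_of B q"
  by (auto simp: sys_of_def intro: singular_simplex_mono)

lemma sys_of_iff: "\<sigma> \<in> sys_of A q \<longleftrightarrow> singular_simplex q euclidean \<sigma> \<and> \<sigma> ` standard_simplex q \<subseteq> A"
  by (simp add: sys_of_def singular_simplex_subtopology)

lemma sys_of_Int: "sys_of (A \<inter> B) q = sys_of A q \<inter> sys_of B q"
  by (auto simp: sys_of_iff)

lemma chains_in_sys_of: "chains_in (sys_of A) q c \<longleftrightarrow> singular_chain q (top_of_set A) c"
  by (auto simp: chains_in_def sys_of_def singular_chain_def)

lemma deck_inv_continuous_map:
  "deck_inv J A \<Longrightarrow> g \<in> Gam J \<Longrightarrow> continuous_map (top_of_set A) (top_of_set A) (deck g)"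
  using continuous_deck[of A g] by (auto simp: deck_inv_def continuous_map_in_subtopology)

lemma ssys_sys_of: "deck_inv J A \<Longrightarrow> ssys J (sys_of A)"
  unfolding ssys_def sys_of_def
  using singular_simplex_singular_face[of "Suc _" "top_of_set A"]
  by (auto simp: singular_simplex_subtopology[of _ _ A, symmetric] intro: singular_simplex_simplex_map deck_inv_continuous_map)
     (auto simp: singular_simplex_subtopology)

lemma ssys_Union: "(\<And>U. U \<in> \<U> \<Longrightarrow> ssys J (S U)) \<Longrightarrow> ssys J (\<lambda>q. \<Union>U\<in>\<U>. S U q)"
  unfolding ssys_def by fast

text \<open>Evaluating the cocycle on prisms gives a cochain of one degree less whose coboundary is
  the difference. It is equivariant because the homotopy commutes with deck transformations.\<close>

lemma pullback_homotopy:
  fixes H :: "real \<times> 'a::topological_space cov \<Rightarrow> 'b::topological_space cov"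
  assumes A: "deck_inv J A" and A': "deck_inv J A'"
    and H: "continuous_map (cyl (top_of_set A)) (top_of_set A') H"
    and eq: "\<And>s x g. s \<in> {0..1} \<Longrightarrow> x \<in> A \<Longrightarrow> g \<in> Gam J \<Longrightarrow> H (s, deck g x) = deck g (H (s, x))"
    and phi: "\<phi> \<in> Zc J lam (sys_of A') q"
  shows "(\<lambda>\<sigma>. \<phi> (simplex_map q (\<lambda>x. H (1, x)) \<sigma>) - \<phi> (simplex_map q (\<lambda>x. H (0, x)) \<sigma>)) \<in> Bc J lam (sys_of A) q"
proof -
  have main: "\<phi> (simplex_map q (\<lambda>x. H (1, x)) \<sigma>) - \<phi> (simplex_map q (\<lambda>x. H (0, x)) \<sigma>)
    = (if q = 0 then 0 else cev \<phi> (prism_op H (q - 1) (chain_boundary q (frag_of \<sigma>))))" if s: "\<sigma> \<in> sys_of A q" for \<sigma>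
  proof -
    have c: "singular_chain q (top_of_set A) (frag_of \<sigma>)"
      using s by (simp add: sys_of_def singular_chain_of)
    have "cev \<phi> (chain_boundary (Suc q) (prism_op H q (frag_of \<sigma>))) = 0"
      using cev_cocycle[OF phi] singular_chain_prism_op[OF c H] by (simp add: chains_in_sys_of)
    then show ?thesis
      by (auto simp: chain_boundary_prism_op[OF c] cev_diff)
  qed
  show ?thesis
  proof (cases q)
    case 0
    then show ?thesis using main by (simp add: Bc_def)
  next
    case (Suc r)
    let ?\<psi> = "\<lambda>\<tau>. cev \<phi> (prism_op H r (frag_of \<tau>))"
    have "eqvt J lam (sys_of A) r ?\<psi>"
    proof (rule eqvt_pullback)
      show "eqvt J lam (sys_of A') q \<phi>" using phi by (simp add: Zc_def)
      show "chains_in (sys_of A') q (prism_op H r (frag_of \<sigma>))" if "\<sigma> \<in> sys_of A r" for \<sigma>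
        using that singular_chain_prism_op[OF _ H, of r "frag_of \<sigma>"] Suc
        unfolding chains_in_sys_of by (simp add: sys_of_def singular_chain_of)
      show "prism_op H r (chain_map r (deck g) (frag_of \<sigma>)) = chain_map q (deck g) (prism_op H r (frag_of \<sigma>))"
        if "\<sigma> \<in> sys_of A r" "g \<in> Gam J" for \<sigma> g
        using that unfolding Suc
        by (intro prism_op_chain_map[of r "top_of_set A"]) (auto simp: sys_of_def singular_chain_of eq)
    qed (simp add: prism_op_diff)
    moreover have "\<phi> (simplex_map q (\<lambda>x. H (1, x)) \<sigma>) - \<phi> (simplex_map q (\<lambda>x. H (0, x)) \<sigma>) = cobd r ?\<psi> \<sigma>"
      if "\<sigma> \<in> sys_of A q" for \<sigma>
      using main[OF that] Suc by (simp add: cobd_def cev_additive prism_op_diff)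
    ultimately show ?thesis
      unfolding Bc_def using Suc by auto
  qed
qed

lemma Zc_pullback:
  fixes h :: "'a::topological_space cov \<Rightarrow> 'b::topological_space cov"
  assumes h: "continuous_map (top_of_set A) (top_of_set A') h"
    and eq: "\<And>x g. x \<in> A \<Longrightarrow> g \<in> Gam J \<Longrightarrow> h (deck g x) = deck g (h x)"
    and phi: "\<phi> \<in> Zc J lam (sys_of A') q"
  shows "(\<lambda>\<sigma>. \<phi> (simplex_map q h \<sigma>)) \<in> Zc J lam (sys_of A) q"
    and Bc_pullback_aux: "eqvt J lam (sys_of A') r \<psi> \<Longrightarrow> eqvt J lam (sys_of A) r (\<lambda>\<sigma>. \<psi> (simplex_map r h \<sigma>))"
    and cobd_pullback: "\<sigma> \<in> sys_of A (Suc r) \<Longrightarrow> cobd r (\<lambda>\<sigma>. \<psi> (simplex_map r h \<sigma>)) \<sigma> = cobd r \<psi> (simplex_map (Suc r) h \<sigma>)"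
proof -
  show e: "eqvt J lam (sys_of A) r (\<lambda>\<sigma>. \<psi> (simplex_map r h \<sigma>))" if "eqvt J lam (sys_of A') r \<psi>" for r \<psi>
    unfolding eqvt_def
  proof (intro ballI)
    fix \<sigma> g assume s: "\<sigma> \<in> sys_of A r" and g: "g \<in> Gam J"
    have "h (deck g (\<sigma> x)) = deck g (h (\<sigma> x))" if "x \<in> standard_simplex r" for x
      using s that by (intro eq g) (auto simp: sys_of_iff)
    then have "simplex_map r h (simplex_map r (deck g) \<sigma>) = simplex_map r (deck g) (simplex_map r h \<sigma>)"
      by (auto simp: simplex_map_def restrict_def fun_eq_iff)
    moreover have "simplex_map r h \<sigma> \<in> sys_of A' r"
      using s h by (auto simp: sys_of_def intro: singular_simplex_simplex_map)
    ultimately show "\<psi> (simplex_map r h (simplex_map r (deck g) \<sigma>)) = chi J lam g * \<psi> (simplex_map r h \<sigma>)"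
      using that g by (simp add: eqvt_def)
  qed
  show c: "cobd r (\<lambda>\<sigma>. \<psi> (simplex_map r h \<sigma>)) \<sigma> = cobd r \<psi> (simplex_map (Suc r) h \<sigma>)"
    if "\<sigma> \<in> sys_of A (Suc r)" for r \<psi> \<sigma>
  proof -
    have "singular_chain (Suc r) (top_of_set A) (frag_of \<sigma>)" using that by (simp add: sys_of_def singular_chain_of)
    from chain_boundary_chain_map[OF this, of h]
    have "chain_boundary (Suc r) (frag_of (simplex_map (Suc r) h \<sigma>)) = chain_map r h (chain_boundary (Suc r) (frag_of \<sigma>))" by simp
    then show ?thesis
      unfolding cobd_def using cev_additive[of "chain_map r h" \<psi>] by (simp add: chain_map_diff)
  qed
  show "(\<lambda>\<sigma>. \<phi> (simplex_map q h \<sigma>)) \<in> Zc J lam (sys_of A) q"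
    using phi e[of q \<phi>] singular_simplex_simplex_map[OF _ h, of "Suc q"] unfolding Zc_def
    by (auto simp: c) (auto simp: sys_of_def)
qed

lemma Bc_pullback:
  fixes h :: "'a::topological_space cov \<Rightarrow> 'b::topological_space cov"
  assumes h: "continuous_map (top_of_set A) (top_of_set A') h"
    and eq: "\<And>x g. x \<in> A \<Longrightarrow> g \<in> Gam J \<Longrightarrow> h (deck g x) = deck g (h x)"
    and phi: "\<phi> \<in> Bc J lam (sys_of A') q"
  shows "(\<lambda>\<sigma>. \<phi> (simplex_map q h \<sigma>)) \<in> Bc J lam (sys_of A) q"
proof -
  have m: "simplex_map q h \<sigma> \<in> sys_of A' q" if "\<sigma> \<in> sys_of A q" for \<sigma>
    using that h by (auto simp: sys_of_def intro: singular_simplex_simplex_map)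
  \<comment> \<open>The auxiliary facts were proved jointly with \<open>Zc_pullback\<close> and
    carry its cocycle premise; the zero cochain discharges it.\<close>
  have z: "(\<lambda>_. 0) \<in> Zc J lam (sys_of A') 0" by (simp add: Zc_def eqvt_def cobd_alt)
  show ?thesis
  proof (cases q)
    case 0
    then show ?thesis using phi m by (auto simp: Bc_def)
  next
    case (Suc r)
    then obtain \<psi> where "eqvt J lam (sys_of A') r \<psi>" "\<forall>\<sigma>\<in>sys_of A' q. \<phi> \<sigma> = cobd r \<psi> \<sigma>"
      using phi by (auto simp: Bc_def)
    then show ?thesis
      unfolding Bc_def
      using Suc m Bc_pullback_aux[OF h eq z] cobd_pullback[OF h eq z]
      by (auto intro!: exI[of _ "\<lambda>\<sigma>. \<psi> (simplex_map r h \<sigma>)"])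
  qed
qed

section \<open>Small simplices and Mayer--Vietoris\<close>

definition small :: "'a::topological_space cov set set \<Rightarrow> 'a cov ssys" where
  "small \<U> q = (\<Union>U\<in>\<U>. sys_of U q)"

definition mlev :: "'a::topological_space cov set set \<Rightarrow> nat \<Rightarrow> ((nat \<Rightarrow> real) \<Rightarrow> 'a cov) \<Rightarrow> nat" where
  "mlev \<U> q \<sigma> = (LEAST m. chains_in (small \<U>) q ((singular_subdivision q ^^ m) (frag_of \<sigma>)))"

text \<open>The level of a simplex is made at least that of its faces.\<close>

primrec mx :: "'a::topological_space cov set set \<Rightarrow> nat \<Rightarrow> ((nat \<Rightarrow> real) \<Rightarrow> 'a cov) \<Rightarrow> nat" where
  "mx \<U> 0 \<sigma> = mlev \<U> 0 \<sigma>"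
| "mx \<U> (Suc q) \<sigma> = max (mlev \<U> (Suc q) \<sigma>) (Max ((\<lambda>k. mx \<U> q (singular_face (Suc q) k \<sigma>)) ` {..Suc q}))"

text \<open>The homotopy from the identity to \<open>m\<close>-fold subdivision, the sum of the
  homotopies of the single subdivisions; see \<open>chain_boundary_Dm\<close>.\<close>

definition Dm :: "nat \<Rightarrow> nat \<Rightarrow> 'b chain \<Rightarrow> 'b chain" where
  "Dm q m c = (\<Sum>i<m. subdiv_op q ((singular_subdivision q ^^ i) c))"

lemma Dm_diff: "Dm q m (a - b) = Dm q m a - Dm q m b"
  by (simp add: Dm_def singular_subdivision_power_diff subdiv_op_diff sum_subtractf)

lemma singular_chain_power_subdivision:
  "singular_chain q X c \<Longrightarrow> singular_chain q X ((singular_subdivision q ^^ i) c)"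
  by (induction i) (auto intro: singular_chain_singular_subdivision)

lemma chain_boundary_power_subdivision:
  "singular_chain q X c \<Longrightarrow> chain_boundary q ((singular_subdivision q ^^ i) c) = (singular_subdivision (q - Suc 0) ^^ i) (chain_boundary q c)"
  by (induction i) (auto simp: chain_boundary_singular_subdivision[OF singular_chain_power_subdivision])

lemma power_subdivision_chain_map:
  "singular_chain q X c \<Longrightarrow> (singular_subdivision q ^^ i) (chain_map q g c) = chain_map q g ((singular_subdivision q ^^ i) c)"
  by (induction i) (auto simp: naturality_singular_subdivision[OF singular_chain_power_subdivision])

lemma chain_boundary_Dm:
  assumes c: "singular_chain q X c"
  shows "chain_boundary (Suc q) (Dm q m c) = (singular_subdivision q ^^ m) c - c - (if q = 0 then 0 else Dm (q - 1) m (chain_boundary q c))"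
proof (induction m)
  case 0 then show ?case by (simp add: Dm_def)
next
  case (Suc m)
  have "Dm q (Suc m) c = Dm q m c + subdiv_op q ((singular_subdivision q ^^ m) c)" for q and c :: "'a chain"
    by (simp add: Dm_def)
  then show ?case
    by (simp add: chain_boundary_add Suc chain_boundary_subdiv_op[OF singular_chain_power_subdivision[OF c]]
      chain_boundary_power_subdivision[OF c])
qed

lemma Dm_deck:
  assumes c: "singular_chain q X c"
  shows "Dm q m (chain_map q g c) = chain_map (Suc q) g (Dm q m c)"
  unfolding Dm_def
  by (simp add: chain_map_sum power_subdivision_chain_map[OF c] subdiv_op_chain_map[OF singular_chain_power_subdivision[OF c]])

lemma singular_chain_Dm: "singular_chain q X c \<Longrightarrow> singular_chain (Suc q) X (Dm q m c)"
  unfolding Dm_def by (intro singular_chain_sum singular_chain_subdiv_op singular_chain_power_subdivision)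

definition Dop :: "'a::topological_space cov set set \<Rightarrow> nat \<Rightarrow> 'a cov chain \<Rightarrow> 'a cov chain" where
  "Dop \<U> q c = frag_extend (\<lambda>\<sigma>. Dm q (mx \<U> q \<sigma>) (frag_of \<sigma>)) c"

text \<open>Simplices need different numbers of subdivisions, and subdividing each as often as it
  requires is no chain map. Adding dD + Dd to the identity, with D the homotopy of the required
  length, gives a chain map that is homotopic to the identity and still has small values
  (\<open>rho_small\<close>).\<close>

definition rho :: "'a::topological_space cov set set \<Rightarrow> nat \<Rightarrow> 'a cov chain \<Rightarrow> 'a cov chain" where
  "rho \<U> q c = c + chain_boundary (Suc q) (Dop \<U> q c) + (if q = 0 then 0 else Dop \<U> (q - 1) (chain_boundary q c))"

lemma Dop_diff: "Dop \<U> q (a - b) = Dop \<U> q a - Dop \<U> q b"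
  and Dop_of [simp]: "Dop \<U> q (frag_of \<sigma>) = Dm q (mx \<U> q \<sigma>) (frag_of \<sigma>)"
  and Dop_0 [simp]: "Dop \<U> q 0 = 0"
  by (simp_all add: Dop_def frag_extend_diff)

lemma rho_diff: "rho \<U> q (a - b) = rho \<U> q a - rho \<U> q b"
  by (simp add: rho_def Dop_diff chain_boundary_diff algebra_simps)

lemma singular_chain_Dop: "singular_chain q X c \<Longrightarrow> singular_chain (Suc q) X (Dop \<U> q c)"
  unfolding Dop_def
  by (rule singular_chain_extend, rule singular_chain_Dm) (auto simp: singular_chain_def)

lemma singular_face_simplex_map_deck:
  assumes "k \<le> Suc q"
  shows "singular_face (Suc q) k (simplex_map (Suc q) f \<sigma>) = simplex_map q f (singular_face (Suc q) k \<sigma>)"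
  using singular_face_simplex_map[of "Suc q" k f \<sigma>] assms
  by (simp add: simplex_map_def singular_face_def fun_eq_iff restrict_def)

context
  fixes J :: "nat set" and \<U> :: "'a::topological_space cov set set" and A :: "'a cov set"
  assumes AU: "A = \<Union>\<U>" and opn: "\<And>U. U \<in> \<U> \<Longrightarrow> openin (top_of_set A) U"
    and inv: "\<And>U. U \<in> \<U> \<Longrightarrow> deck_inv J U"
begin

lemma deck_inv_A: "deck_inv J A"
  using inv AU unfolding deck_inv_def by blast

lemma ssys_small: "ssys J (small \<U>)"
  unfolding small_def[abs_def] by (rule ssys_Union) (simp add: ssys_sys_of inv)

lemma small_sub: "small \<U> q \<subseteq> sys_of A q"
  using sys_of_mono AU unfolding small_def by (metis UN_least Union_upper)

lemma chains_in_small_preserve: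
  assumes K: "\<And>a b. K (a - b) = K a - K b"
    and X: "\<And>X c. singular_chain q X c \<Longrightarrow> singular_chain r X (K c)" and c: "chains_in (small \<U>) q c"
  shows "chains_in (small \<U>) r (K c)"
proof (rule chains_in_additive[OF K _ c])
  fix \<sigma> assume "\<sigma> \<in> small \<U> q"
  then obtain U where U: "U \<in> \<U>" "\<sigma> \<in> sys_of U q" by (auto simp: small_def)
  then have "chains_in (sys_of U) r (K (frag_of \<sigma>))"
    using X[of "top_of_set U" "frag_of \<sigma>"] by (simp add: chains_in_sys_of) (simp add: sys_of_def singular_chain_of)
  then show "chains_in (small \<U>) r (K (frag_of \<sigma>))"
    using U(1) by (auto simp: chains_in_def small_def)
qed

lemma small_subdivision: "chains_in (small \<U>) q c \<Longrightarrow> chains_in (small \<U>) q (singular_subdivision q c)"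
  by (rule chains_in_small_preserve) (auto simp: singular_subdivision_diff singular_chain_singular_subdivision)

lemma small_subdiv_op: "chains_in (small \<U>) q c \<Longrightarrow> chains_in (small \<U>) (Suc q) (subdiv_op q c)"
  by (rule chains_in_small_preserve) (auto simp: subdiv_op_diff singular_chain_subdiv_op)

lemma small_power_mono:
  assumes "chains_in (small \<U>) q ((singular_subdivision q ^^ m) c)" "m \<le> n"
  shows "chains_in (small \<U>) q ((singular_subdivision q ^^ n) c)"
  using assms(2,1) by (induction rule: dec_induct) (auto intro: small_subdivision)

lemma small_mlev:
  assumes s: "\<sigma> \<in> sys_of A q" and "mlev \<U> q \<sigma> \<le> m"
  shows "chains_in (small \<U>) q ((singular_subdivision q ^^ m) (frag_of \<sigma>))"
proof -
  have c: "singular_chain q (top_of_set A) (frag_of \<sigma>)" using s by (simp add: sys_of_def singular_chain_of)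
  obtain n where n: "\<And>m f. n \<le> m \<Longrightarrow> f \<in> Poly_Mapping.keys ((singular_subdivision q ^^ m) (frag_of \<sigma>)) \<Longrightarrow> \<exists>V\<in>\<U>. f \<in> standard_simplex q \<rightarrow> V"
    using sufficient_iterated_singular_subdivision_exists[of \<U> "top_of_set A" q "frag_of \<sigma>"] opn AU c by auto
  have "chains_in (small \<U>) q ((singular_subdivision q ^^ n) (frag_of \<sigma>))"
    unfolding chains_in_def
  proof
    fix f assume f: "f \<in> Poly_Mapping.keys ((singular_subdivision q ^^ n) (frag_of \<sigma>))"
    then obtain V where "V \<in> \<U>" "f \<in> standard_simplex q \<rightarrow> V" using n by blast
    moreover have "singular_simplex q (top_of_set A) f"
      using singular_chain_power_subdivision[OF c, of n] f by (auto simp: singular_chain_def)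
    ultimately show "f \<in> small \<U> q" by (auto simp: small_def sys_of_iff singular_simplex_subtopology)
  qed
  then have "chains_in (small \<U>) q ((singular_subdivision q ^^ mlev \<U> q \<sigma>) (frag_of \<sigma>))"
    unfolding mlev_def by (rule LeastI)
  then show ?thesis using small_power_mono assms(2) by blast
qed

lemma mlev_le_mx: "mlev \<U> q \<sigma> \<le> mx \<U> q \<sigma>" by (cases q) auto

lemma mx_face_le: "k \<le> Suc q \<Longrightarrow> mx \<U> q (singular_face (Suc q) k \<sigma>) \<le> mx \<U> (Suc q) \<sigma>"
  by (auto intro!: max.coboundedI2 Max_ge simp del: atMost_Suc)

text \<open>Faces of small simplices are small, so nothing is to be subdivided. This is why
  \<open>rho\<close> fixes small simplices.\<close>

lemma mx_small: "\<sigma> \<in> small \<U> q \<Longrightarrow> mx \<U> q \<sigma> = 0"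
proof (induction q arbitrary: \<sigma>)
  case 0 then show ?case by (simp add: mlev_def)
next
  case (Suc q)
  then have "singular_face (Suc q) k \<sigma> \<in> small \<U> q" if "k \<le> Suc q" for k
    using ssys_small that by (auto simp: ssys_def)
  then have "(\<lambda>k. mx \<U> q (singular_face (Suc q) k \<sigma>)) ` {..Suc q} = {0}"
    using Suc.IH by (auto simp del: atMost_Suc)
  moreover have "mlev \<U> (Suc q) \<sigma> = 0" using Suc.prems by (simp add: mlev_def)
  ultimately show ?case by (simp del: atMost_Suc)
qed

lemma mlev_deck:
  assumes s: "\<sigma> \<in> sys_of A q" and g: "g \<in> Gam J"
  shows "mlev \<U> q (simplex_map q (deck g) \<sigma>) = mlev \<U> q \<sigma>"
proof -
  have c: "singular_chain q euclidean (frag_of \<sigma>)" using s by (simp add: sys_of_iff singular_chain_of)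
  have "chains_in (small \<U>) q ((singular_subdivision q ^^ m) (frag_of (simplex_map q (deck g) \<sigma>)))
     \<longleftrightarrow> chains_in (small \<U>) q ((singular_subdivision q ^^ m) (frag_of \<sigma>))" (is "?l \<longleftrightarrow> ?r") for m
  proof -
    have e: "(singular_subdivision q ^^ m) (frag_of (simplex_map q (deck g) \<sigma>)) = chain_map q (deck g) ((singular_subdivision q ^^ m) (frag_of \<sigma>))"
      using power_subdivision_chain_map[OF c, of m "deck g"] by simp
    have "chain_map q (deck (\<lambda>j. - g j)) (chain_map q (deck g) ((singular_subdivision q ^^ m) (frag_of \<sigma>))) = (singular_subdivision q ^^ m) (frag_of \<sigma>)"
      unfolding chain_map_chain_map by (rule chain_map_id_gen[OF singular_chain_power_subdivision[OF c]]) simp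
    then show ?thesis
      unfolding e using chains_in_deck[OF ssys_small _ g] chains_in_deck[OF ssys_small _ Gam_uminus[OF g]] by metis
  qed
  then show ?thesis by (simp add: mlev_def)
qed

lemma mx_deck:
  assumes "\<sigma> \<in> sys_of A q" and g: "g \<in> Gam J"
  shows "mx \<U> q (simplex_map q (deck g) \<sigma>) = mx \<U> q \<sigma>"
  using assms(1)
proof (induction q arbitrary: \<sigma>)
  case 0 then show ?case using mlev_deck[OF 0 g] by simp
next
  case (Suc q)
  have "mx \<U> q (singular_face (Suc q) k (simplex_map (Suc q) (deck g) \<sigma>)) = mx \<U> q (singular_face (Suc q) k \<sigma>)" if "k \<le> Suc q" for k
    using that Suc.IH Suc.prems ssys_sys_of[OF deck_inv_A] by (simp add: singular_face_simplex_map_deck ssys_def)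
  then have "(\<lambda>k. mx \<U> q (singular_face (Suc q) k (simplex_map (Suc q) (deck g) \<sigma>))) ` {..Suc q}
      = (\<lambda>k. mx \<U> q (singular_face (Suc q) k \<sigma>)) ` {..Suc q}" by (intro image_cong) auto
  then show ?case using mlev_deck[OF Suc.prems g] by (simp del: atMost_Suc)
qed

text \<open>On a simplex of level \<open>M\<close> the map is the \<open>M\<close>-fold subdivision
  plus, for each face, the homotopy of the face's own length minus that of length \<open>M\<close>.
  As faces have level at most \<open>M\<close>, what remains are homotopies applied to subdivisions
  beyond the level of the face, and these are small already.\<close>

lemma rho_small:
  assumes s: "\<sigma> \<in> sys_of A q"
  shows "chains_in (small \<U>) q (rho \<U> q (frag_of \<sigma>))"
proof -
  define M where "M = mx \<U> q \<sigma>"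
  have c: "singular_chain q (top_of_set A) (frag_of \<sigma>)" using s by (simp add: sys_of_def singular_chain_of)
  have sd: "chains_in (small \<U>) q ((singular_subdivision q ^^ M) (frag_of \<sigma>))"
    using small_mlev[OF s] mlev_le_mx M_def by blast
  have e: "rho \<U> q (frag_of \<sigma>) = (singular_subdivision q ^^ M) (frag_of \<sigma>)
      + (if q = 0 then 0 else Dop \<U> (q - 1) (chain_boundary q (frag_of \<sigma>)) - Dm (q - 1) M (chain_boundary q (frag_of \<sigma>)))"
    unfolding rho_def Dop_of M_def[symmetric] by (simp add: chain_boundary_Dm[OF c])
  show ?thesis
  proof (cases q)
    case 0
    then show ?thesis using e sd by simp
  next
    case (Suc r)
    let ?S = "\<lambda>_::nat. {\<tau> \<in> sys_of A r. mx \<U> r \<tau> \<le> M}"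
    have "chains_in (small \<U>) q (Dop \<U> r (chain_boundary q (frag_of \<sigma>)) - Dm r M (chain_boundary q (frag_of \<sigma>)))"
    proof (rule chains_in_additive[where S="?S" and q=0 and K="\<lambda>c. Dop \<U> r c - Dm r M c"])
      fix \<tau> assume t: "\<tau> \<in> {\<tau> \<in> sys_of A r. mx \<U> r \<tau> \<le> M}"
      have "Dm r (mx \<U> r \<tau>) (frag_of \<tau>) - Dm r M (frag_of \<tau>)
         = - (\<Sum>i\<in>{mx \<U> r \<tau>..<M}. subdiv_op r ((singular_subdivision r ^^ i) (frag_of \<tau>)))"
        using t sum.atLeastLessThan_concat[of 0 "mx \<U> r \<tau>" M "\<lambda>i. subdiv_op r ((singular_subdivision r ^^ i) (frag_of \<tau>))"]
        by (auto simp: Dm_def lessThan_atLeast0 algebra_simps)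
      moreover have "chains_in (small \<U>) q (\<Sum>i\<in>{mx \<U> r \<tau>..<M}. subdiv_op r ((singular_subdivision r ^^ i) (frag_of \<tau>)))"
        using t mlev_le_mx[of r \<tau>] unfolding Suc by (intro chains_in_sum small_subdiv_op small_mlev) auto
      ultimately show "chains_in (small \<U>) q (Dop \<U> r (frag_of \<tau>) - Dm r M (frag_of \<tau>))"
        using chains_in_diff[OF chains_in_0] by (metis Dop_of diff_0)
    next
      have "singular_face q k \<sigma> \<in> {\<tau> \<in> sys_of A r. mx \<U> r \<tau> \<le> M}" if "k \<le> q" for k
        using that s mx_face_le[of k r \<sigma>] ssys_sys_of[OF deck_inv_A] unfolding Suc M_def by (auto simp: ssys_def)
      then show "chains_in ?S 0 (chain_boundary q (frag_of \<sigma>))"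
        unfolding chain_boundary_of using Suc
        by (auto intro!: chains_in_sum chains_in_cmul simp del: sum.atMost_Suc)
    qed (auto simp: Dop_diff Dm_diff)
    then show ?thesis unfolding e using sd Suc by (auto intro: chains_in_add)
  qed
qed

lemma rho_of_small:
  assumes "\<sigma> \<in> small \<U> q"
  shows "rho \<U> q (frag_of \<sigma>) = frag_of \<sigma>"
proof -
  have z: "Dop \<U> r c = 0" if "chains_in (small \<U>) r c" for r c
    unfolding Dop_def by (rule frag_extend_eq_0) (use that in \<open>auto simp: chains_in_def mx_small Dm_def\<close>)
  have "Dop \<U> (q - 1) (chain_boundary q (frag_of \<sigma>)) = 0" if "q \<noteq> 0"
    using z chains_in_boundary[OF ssys_small, of "q - 1"] assms that by (simp add: Suc_diff_1[symmetric] del: Suc_diff_1)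
  then show ?thesis using z[of q "frag_of \<sigma>"] assms by (auto simp: rho_def)
qed

lemma Dop_deck:
  assumes "chains_in (sys_of A) q c" and g: "g \<in> Gam J"
  shows "Dop \<U> q (chain_map q (deck g) c) = chain_map (Suc q) (deck g) (Dop \<U> q c)"
  using assms(1) unfolding chains_in_def
proof (induction c rule: frag_induction)
  case (one \<sigma>)
  then have "singular_chain q euclidean (frag_of \<sigma>)" by (simp add: sys_of_iff singular_chain_of)
  from Dm_deck[OF this] show ?case using mx_deck[OF one g] by simp
qed (auto simp: Dop_diff chain_map_diff)

lemma rho_deck:
  assumes s: "\<sigma> \<in> sys_of A q" and g: "g \<in> Gam J"
  shows "rho \<U> q (chain_map q (deck g) (frag_of \<sigma>)) = chain_map q (deck g) (rho \<U> q (frag_of \<sigma>))"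
proof -
  have c: "singular_chain q euclidean (frag_of \<sigma>)" using s by (simp add: sys_of_iff singular_chain_of)
  have ci: "chains_in (sys_of A) q (frag_of \<sigma>)" using s by simp
  have b: "chains_in (sys_of A) (q - 1) (chain_boundary q (frag_of \<sigma>))" if "q \<noteq> 0"
    using chains_in_boundary[OF ssys_sys_of[OF deck_inv_A], of "q - 1"] ci that by simp
  have 1: "chain_boundary (Suc q) (Dop \<U> q (chain_map q (deck g) (frag_of \<sigma>)))
     = chain_map q (deck g) (chain_boundary (Suc q) (Dop \<U> q (frag_of \<sigma>)))"
    unfolding Dop_deck[OF ci g] using chain_boundary_chain_map[OF singular_chain_Dop[OF c]] by simp
  have 2: "Dop \<U> (q - 1) (chain_boundary q (chain_map q (deck g) (frag_of \<sigma>)))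
     = chain_map q (deck g) (Dop \<U> (q - 1) (chain_boundary q (frag_of \<sigma>)))" if "q \<noteq> 0"
    using Dop_deck[OF b[OF that] g] chain_boundary_chain_map[OF c, of "deck g"] that by simp
  show ?thesis
    unfolding rho_def chain_map_add 1 using 2 by auto
qed

lemma chain_boundary_rho:
  assumes "singular_chain (Suc q) X c"
  shows "chain_boundary (Suc q) (rho \<U> (Suc q) c) = rho \<U> q (chain_boundary (Suc q) c)"
  using chain_boundary_boundary_alt[OF singular_chain_Dop[OF assms, of \<U>]] chain_boundary_boundary_alt[OF assms]
  by (simp add: rho_def chain_boundary_add)

text \<open>The cochain kills \<open>rho\<close> of a simplex, which is small, and it kills
  boundaries. By the definition of \<open>rho\<close> it is then minus the coboundary of its
  evaluation on \<open>Dop\<close>.\<close>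

lemma small_vanishing_cocycle:
  assumes phi: "\<phi> \<in> Zc J lam (sys_of A) q" and z: "\<And>\<sigma>. \<sigma> \<in> small \<U> q \<Longrightarrow> \<phi> \<sigma> = 0"
  shows "\<phi> \<in> Bc J lam (sys_of A) q"
proof -
  have main: "\<phi> \<sigma> = - (if q = 0 then 0 else cev \<phi> (Dop \<U> (q - 1) (chain_boundary q (frag_of \<sigma>))))" if s: "\<sigma> \<in> sys_of A q" for \<sigma>
  proof -
    have c: "singular_chain q (top_of_set A) (frag_of \<sigma>)" using s by (simp add: sys_of_def singular_chain_of)
    have "cev \<phi> (rho \<U> q (frag_of \<sigma>)) = cev (\<lambda>_. 0) (rho \<U> q (frag_of \<sigma>))"
      by (rule cev_cong) (use rho_small[OF s] z in \<open>auto simp: chains_in_def\<close>)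
    also have "\<dots> = 0" by (simp add: cev_def)
    finally have "cev \<phi> (rho \<U> q (frag_of \<sigma>)) = 0" .
    moreover have "cev \<phi> (chain_boundary (Suc q) (Dop \<U> q (frag_of \<sigma>))) = 0"
      by (rule cev_cocycle[OF phi]) (simp only: chains_in_sys_of singular_chain_Dop[OF c])
    ultimately show ?thesis by (auto simp: rho_def cev_add add_eq_0_iff)
  qed
  show ?thesis
  proof (cases q)
    case 0 then show ?thesis using main by (simp add: Bc_def)
  next
    case (Suc r)
    let ?\<psi> = "\<lambda>\<tau>. cev \<phi> (Dop \<U> r (frag_of \<tau>))"
    have "eqvt J lam (sys_of A) r ?\<psi>"
    proof (rule eqvt_pullback)
      show "eqvt J lam (sys_of A) q \<phi>" using phi by (simp add: Zc_def)
      show "chains_in (sys_of A) q (Dop \<U> r (frag_of \<sigma>))" if "\<sigma> \<in> sys_of A r" for \<sigma>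
        unfolding Suc chains_in_sys_of by (rule singular_chain_Dop) (use that in \<open>simp add: sys_of_def singular_chain_of\<close>)
      show "Dop \<U> r (chain_map r (deck g) (frag_of \<sigma>)) = chain_map q (deck g) (Dop \<U> r (frag_of \<sigma>))"
        if "\<sigma> \<in> sys_of A r" "g \<in> Gam J" for \<sigma> g
        unfolding Suc by (rule Dop_deck) (use that in auto)
    qed (simp add: Dop_diff)
    then have "eqvt J lam (sys_of A) r (\<lambda>\<tau>. - ?\<psi> \<tau>)" by (simp add: eqvt_def)
    moreover have "\<phi> \<sigma> = cobd r (\<lambda>\<tau>. - ?\<psi> \<tau>) \<sigma>" if "\<sigma> \<in> sys_of A q" for \<sigma>
      using main[OF that] Suc cobd_linear[of r "-1" ?\<psi> 0 ?\<psi> \<sigma>] by (simp add: cobd_def cev_additive Dop_diff del: Dop_of)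
    ultimately show ?thesis unfolding Bc_def using Suc by auto
  qed
qed

text \<open>The extension is the pullback along \<open>rho\<close>, an equivariant chain map into
  small chains that fixes small simplices.\<close>

lemma small_cocycle_extends:
  assumes psi: "\<psi> \<in> Zc J lam (small \<U>) q"
  obtains \<phi> where "\<phi> \<in> Zc J lam (sys_of A) q" "\<And>\<sigma>. \<sigma> \<in> small \<U> q \<Longrightarrow> \<phi> \<sigma> = \<psi> \<sigma>"
proof
  let ?\<phi> = "\<lambda>\<sigma>. cev \<psi> (rho \<U> q (frag_of \<sigma>))"
  show "?\<phi> \<in> Zc J lam (sys_of A) q"
    unfolding Zc_def
  proof (intro CollectI conjI ballI)
    show "eqvt J lam (sys_of A) q ?\<phi>"
      by (rule eqvt_pullback[where S'="small \<U>" and q'=q]) (use psi in \<open>auto simp: Zc_def rho_diff rho_small rho_deck simp del: chain_map_of\<close>)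
    fix \<sigma> assume s: "\<sigma> \<in> sys_of A (Suc q)"
    then have c: "singular_chain (Suc q) euclidean (frag_of \<sigma>)" by (simp add: sys_of_iff singular_chain_of)
    have "cobd q ?\<phi> \<sigma> = cev \<psi> (chain_boundary (Suc q) (rho \<U> (Suc q) (frag_of \<sigma>)))"
      unfolding cobd_def by (subst cev_additive) (auto simp: rho_diff chain_boundary_rho[OF c])
    also have "\<dots> = 0" by (rule cev_cocycle[OF psi rho_small[OF s]])
    finally show "cobd q ?\<phi> \<sigma> = 0" .
  qed
qed (simp add: rho_of_small)

end

section \<open>Mayer-Vietoris for equivariant cochains\<close>

lemma sys_of_deck_iff:
  assumes "deck_inv J A" "g \<in> Gam J" "singular_simplex q euclidean \<sigma>"
  shows "simplex_map q (deck g) \<sigma> \<in> sys_of A q \<longleftrightarrow> \<sigma> \<in> sys_of A q"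
proof
  assume l: "simplex_map q (deck g) \<sigma> \<in> sys_of A q"
  have "simplex_map q (deck (\<lambda>j. - g j)) (simplex_map q (deck g) \<sigma>) \<in> sys_of A q"
    using ssys_sys_of[OF assms(1)] Gam_uminus[OF assms(2)] l by (auto simp: ssys_def)
  moreover have "simplex_map q (deck (\<lambda>j. - g j)) (simplex_map q (deck g) \<sigma>) = \<sigma>"
    using assms(3) by (auto simp: simplex_map_def singular_simplex_def restrict_def fun_eq_iff extensional_def)
  ultimately show "\<sigma> \<in> sys_of A q" by simp
next
  assume "\<sigma> \<in> sys_of A q" then show "simplex_map q (deck g) \<sigma> \<in> sys_of A q"
    using ssys_sys_of[OF assms(1)] assms(2) by (auto simp: ssys_def)
qed

text \<open>Whether a simplex lies in \<open>A\<close> is invariant under deck transformations, so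
  extension by zero keeps equivariance. Restriction of cochains to a smaller set is therefore
  surjective, as Mayer-Vietoris requires.\<close>

lemma eqvt_extend0:
  assumes "eqvt J lam (sys_of A) q \<phi>" "deck_inv J A"
  shows "eqvt J lam (sys_of B) q (\<lambda>\<sigma>. if \<sigma> \<in> sys_of A q then \<phi> \<sigma> else 0)"
  unfolding eqvt_def
proof (intro ballI)
  fix \<sigma> g assume "\<sigma> \<in> sys_of B q" and g: "g \<in> Gam J"
  then have "singular_simplex q euclidean \<sigma>" by (simp add: sys_of_iff)
  from sys_of_deck_iff[OF assms(2) g this] assms(1) g
  show "(if simplex_map q (deck g) \<sigma> \<in> sys_of A q then \<phi> (simplex_map q (deck g) \<sigma>) else 0) = chi J lam g * (if \<sigma> \<in> sys_of A q then \<phi> \<sigma> else 0)"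
    by (auto simp: eqvt_def)
qed

lemma cobd_cobd:
  assumes "singular_simplex (Suc (Suc q)) euclidean \<sigma>"
  shows "cobd (Suc q) (cobd q \<phi>) \<sigma> = 0"
  unfolding cobd_def[of "Suc q"] cev_cobd
  using chain_boundary_boundary_alt[of "Suc q" euclidean "frag_of \<sigma>"] assms by (simp add: singular_chain_of)

lemma cobd_cong:
  assumes "\<And>k. k \<le> Suc q \<Longrightarrow> \<phi> (singular_face (Suc q) k \<sigma>) = \<psi> (singular_face (Suc q) k \<sigma>)"
  shows "cobd q \<phi> \<sigma> = cobd q \<psi> \<sigma>"
  unfolding cobd_alt by (intro sum.cong refl) (use assms in auto)

lemma sys_of_face: "\<sigma> \<in> sys_of A (Suc q) \<Longrightarrow> k \<le> Suc q \<Longrightarrow> singular_face (Suc q) k \<sigma> \<in> sys_of A q"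
  using singular_simplex_singular_face[of "Suc q" "top_of_set A" \<sigma> k] by (simp add: sys_of_def)

lemma eqvt_cobd:
  assumes "eqvt J lam (sys_of A) q \<phi>" "deck_inv J A"
  shows "eqvt J lam (sys_of A) (Suc q) (cobd q \<phi>)"
  unfolding eqvt_def
proof (intro ballI)
  fix \<sigma> g assume s: "\<sigma> \<in> sys_of A (Suc q)" and g: "g \<in> Gam J"
  have "chains_in (sys_of A) q (chain_boundary (Suc q) (frag_of \<sigma>))"
    using chains_in_boundary[OF ssys_sys_of[OF assms(2)]] s by simp
  from cev_eqvt[OF assms(1) this g]
  show "cobd q \<phi> (simplex_map (Suc q) (deck g) \<sigma>) = chi J lam g * cobd q \<phi> \<sigma>"
    using chain_boundary_chain_map[of "Suc q" euclidean "frag_of \<sigma>" "deck g"] s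
    by (simp add: cobd_def sys_of_iff singular_chain_of)
qed

lemma Bc_sub_Zc:
  assumes "deck_inv J A" "\<phi> \<in> Bc J lam (sys_of A) q" "eqvt J lam (sys_of A) q \<phi>"
  shows "\<phi> \<in> Zc J lam (sys_of A) q"
  unfolding Zc_def
proof (intro CollectI conjI ballI assms(3))
  fix \<sigma> assume s: "\<sigma> \<in> sys_of A (Suc q)"
  show "cobd q \<phi> \<sigma> = 0"
  proof (cases q)
    case 0
    then show ?thesis using assms(2) sys_of_face[OF s] by (auto simp: cobd_alt Bc_def)
  next
    case (Suc r)
    then obtain \<psi> where p: "\<forall>\<sigma>\<in>sys_of A q. \<phi> \<sigma> = cobd r \<psi> \<sigma>" using assms(2) by (auto simp: Bc_def)
    have "cobd q \<phi> \<sigma> = cobd q (cobd r \<psi>) \<sigma>" by (rule cobd_cong) (use p sys_of_face[OF s] in auto)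
    also have "\<dots> = 0" unfolding Suc by (rule cobd_cobd) (use s Suc in \<open>simp add: sys_of_iff\<close>)
    finally show ?thesis .
  qed
qed

context
  fixes J :: "nat set" and A1 A2 :: "'a::topological_space cov set"
  assumes op1: "openin (top_of_set (A1 \<union> A2)) A1" and op2: "openin (top_of_set (A1 \<union> A2)) A2"
    and inv1: "deck_inv J A1" and inv2: "deck_inv J A2"
begin

lemma inv12: "deck_inv J (A1 \<inter> A2)" "deck_inv J (A1 \<union> A2)"
  using inv1 inv2 by (auto simp: deck_inv_def)

text \<open>Primitives on the two pieces differ on the intersection by a cocycle of degree
  \<open>q - 1\<close>, which is exact there. Correcting one primitive makes the two agree, and
  together they form a primitive on all small simplices.\<close>

lemma MV_inj:
  assumes phi: "\<phi> \<in> Zc J lam (sys_of (A1 \<union> A2)) q"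
    and b1: "\<phi> \<in> Bc J lam (sys_of A1) q" and b2: "\<phi> \<in> Bc J lam (sys_of A2) q"
    and 12: "q \<noteq> 0 \<Longrightarrow> Zc J lam (sys_of (A1 \<inter> A2)) (q - 1) \<subseteq> Bc J lam (sys_of (A1 \<inter> A2)) (q - 1)"
  shows "\<phi> \<in> Bc J lam (sys_of (A1 \<union> A2)) q"
proof -
  have U: "A1 \<union> A2 = \<Union>{A1,A2}" by auto
  note sv = small_vanishing_cocycle[of "A1 \<union> A2" "{A1,A2}" J, OF U]
  have sm: "small {A1,A2} r = sys_of A1 r \<union> sys_of A2 r" for r by (auto simp: small_def)
  show ?thesis
  proof (cases q)
    case 0
    show ?thesis by (rule sv) (use phi b1 b2 0 op1 op2 inv1 inv2 in \<open>auto simp: sm Bc_def\<close>)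
  next
    case (Suc r)
    obtain \<psi>1 where p1: "eqvt J lam (sys_of A1) r \<psi>1" "\<forall>\<sigma>\<in>sys_of A1 q. \<phi> \<sigma> = cobd r \<psi>1 \<sigma>"
      using b1 Suc by (auto simp: Bc_def)
    obtain \<psi>2 where p2: "eqvt J lam (sys_of A2) r \<psi>2" "\<forall>\<sigma>\<in>sys_of A2 q. \<phi> \<sigma> = cobd r \<psi>2 \<sigma>"
      using b2 Suc by (auto simp: Bc_def)
    have m: "sys_of (A1 \<inter> A2) s = sys_of A1 s \<inter> sys_of A2 s" for s by (rule sys_of_Int)
    have "(\<lambda>\<sigma>. \<psi>1 \<sigma> - \<psi>2 \<sigma>) \<in> Zc J lam (sys_of (A1 \<inter> A2)) r"
      unfolding Zc_def using p1 p2 Suc eqvt_diff[OF eqvt_mono[OF p1(1)] eqvt_mono[OF p2(1)]]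
      by (auto simp: m cobd_diff)
    then have "(\<lambda>\<sigma>. \<psi>1 \<sigma> - \<psi>2 \<sigma>) \<in> Bc J lam (sys_of (A1 \<inter> A2)) r" using 12 Suc by auto
    \<comment> \<open>The difference of the primitives is to be continued to \<open>A1\<close> as a
      cocycle. Its extension by zero need not be closed; instead its own primitive \<open>u\<close>
      is extended by zero and the coboundary is taken afterwards.\<close>
    then obtain \<theta> where th: "eqvt J lam (sys_of A1) r \<theta>" "\<forall>\<sigma>\<in>sys_of A1 q. cobd r \<theta> \<sigma> = 0"
       "\<forall>\<sigma>\<in>sys_of (A1 \<inter> A2) r. \<psi>1 \<sigma> - \<psi>2 \<sigma> = \<theta> \<sigma>"
    proof (cases r)
      case 0
      assume a: "\<And>\<theta>. eqvt J lam (sys_of A1) r \<theta> \<Longrightarrow> \<forall>\<sigma>\<in>sys_of A1 q. cobd r \<theta> \<sigma> = 0 \<Longrightarrow>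
        \<forall>\<sigma>\<in>sys_of (A1 \<inter> A2) r. \<psi>1 \<sigma> - \<psi>2 \<sigma> = \<theta> \<sigma> \<Longrightarrow> thesis" "(\<lambda>\<sigma>. \<psi>1 \<sigma> - \<psi>2 \<sigma>) \<in> Bc J lam (sys_of (A1 \<inter> A2)) r"
      show ?thesis by (rule a(1)[of "\<lambda>_. 0"]) (use a(2) 0 in \<open>auto simp: Bc_def eqvt_def cobd_alt\<close>)
    next
      case (Suc r')
      assume a: "\<And>\<theta>. eqvt J lam (sys_of A1) r \<theta> \<Longrightarrow> \<forall>\<sigma>\<in>sys_of A1 q. cobd r \<theta> \<sigma> = 0 \<Longrightarrow>
        \<forall>\<sigma>\<in>sys_of (A1 \<inter> A2) r. \<psi>1 \<sigma> - \<psi>2 \<sigma> = \<theta> \<sigma> \<Longrightarrow> thesis" "(\<lambda>\<sigma>. \<psi>1 \<sigma> - \<psi>2 \<sigma>) \<in> Bc J lam (sys_of (A1 \<inter> A2)) r"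
      obtain u where u: "eqvt J lam (sys_of (A1 \<inter> A2)) r' u" "\<forall>\<sigma>\<in>sys_of (A1 \<inter> A2) r. \<psi>1 \<sigma> - \<psi>2 \<sigma> = cobd r' u \<sigma>"
        using a(2) Suc by (auto simp: Bc_def)
      define u' where "u' = (\<lambda>\<sigma>. if \<sigma> \<in> sys_of (A1 \<inter> A2) r' then u \<sigma> else 0)"
      show ?thesis
      proof (rule a(1)[of "cobd r' u'"])
        show "eqvt J lam (sys_of A1) r (cobd r' u')"
          unfolding Suc u'_def by (rule eqvt_cobd[OF eqvt_extend0[OF u(1) inv12(1)] inv1])
        show "\<forall>\<sigma>\<in>sys_of A1 q. cobd r (cobd r' u') \<sigma> = 0"
          using \<open>q = Suc r\<close> Suc by (auto intro!: cobd_cobd simp: sys_of_iff)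
        show "\<forall>\<sigma>\<in>sys_of (A1 \<inter> A2) r. \<psi>1 \<sigma> - \<psi>2 \<sigma> = cobd r' u' \<sigma>"
          using u(2) Suc sys_of_face[of _ "A1 \<inter> A2" r'] unfolding u'_def by (auto intro!: cobd_cong)
      qed
    qed
    define \<psi> where "\<psi> = (\<lambda>\<sigma>. if \<sigma> \<in> sys_of A1 r then \<psi>1 \<sigma> - \<theta> \<sigma> else if \<sigma> \<in> sys_of A2 r then \<psi>2 \<sigma> else 0)"
    have psi2: "\<psi> \<sigma> = \<psi>2 \<sigma>" if "\<sigma> \<in> sys_of A2 r" for \<sigma>
      using bspec[OF th(3), of \<sigma>] that by (auto simp: \<psi>_def m algebra_simps)
    have e: "eqvt J lam (sys_of (A1 \<union> A2)) r \<psi>"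
    proof -
      have "eqvt J lam (sys_of (A1 \<union> A2)) r (\<lambda>\<sigma>. if \<sigma> \<in> sys_of A1 r then \<psi>1 \<sigma> - \<theta> \<sigma> else 0)"
        by (rule eqvt_extend0[OF eqvt_diff[OF p1(1) th(1)] inv1])
      moreover have "eqvt J lam (sys_of (A1 \<union> A2)) r (\<lambda>\<sigma>. if \<sigma> \<in> sys_of A2 r then \<psi>2 \<sigma> else 0)"
        by (rule eqvt_extend0[OF p2(1) inv2])
      ultimately show ?thesis
        unfolding eqvt_def \<psi>_def using sys_of_deck_iff[OF inv1, of _ r] by (auto simp: sys_of_iff split: if_splits)
    qed
    have "(\<lambda>\<sigma>. \<phi> \<sigma> - cobd r \<psi> \<sigma>) \<in> Bc J lam (sys_of (A1 \<union> A2)) q"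
    proof (rule sv)
      have "cobd r \<psi> \<in> Zc J lam (sys_of (A1 \<union> A2)) q"
        unfolding Zc_def Suc using eqvt_cobd[OF e inv12(2)] by (auto simp: sys_of_iff intro: cobd_cobd)
      then show "(\<lambda>\<sigma>. \<phi> \<sigma> - cobd r \<psi> \<sigma>) \<in> Zc J lam (sys_of (A1 \<union> A2)) q" by (rule Zc_diff[OF phi])
      fix \<sigma> assume "\<sigma> \<in> small {A1,A2} q"
      then consider "\<sigma> \<in> sys_of A1 q" | "\<sigma> \<in> sys_of A2 q" by (auto simp: sm)
      then show "\<phi> \<sigma> - cobd r \<psi> \<sigma> = 0"
      proof cases
        case 1
        then have "cobd r \<psi> \<sigma> = cobd r (\<lambda>\<sigma>. \<psi>1 \<sigma> - \<theta> \<sigma>) \<sigma>"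
          using sys_of_face[of \<sigma> A1 r] Suc by (intro cobd_cong) (auto simp: \<psi>_def)
        then show ?thesis using 1 p1 th by (simp add: cobd_diff)
      next
        case 2
        then have "cobd r \<psi> \<sigma> = cobd r \<psi>2 \<sigma>"
          using sys_of_face[of \<sigma> A2 r] Suc psi2 by (intro cobd_cong) auto
        then show ?thesis using 2 p2 by simp
      qed
    qed (use op1 op2 inv1 inv2 in auto)
    moreover have "cobd r \<psi> \<in> Bc J lam (sys_of (A1 \<union> A2)) q" using e Suc by (auto simp: Bc_def)
    ultimately show ?thesis using Bc_linear[of "\<lambda>\<sigma>. \<phi> \<sigma> - cobd r \<psi> \<sigma>" J lam _ q "cobd r \<psi>" 1 1] by simp
  qed
qed

text \<open>After subtracting from \<open>\<phi>1\<close> the coboundary of a primitive extended by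
  zero, both cocycles agree on the intersection. They define a cocycle on small simplices, which
  extends to the union.\<close>

lemma MV_glue:
  assumes z1: "\<phi>1 \<in> Zc J lam (sys_of A1) q" and z2: "\<phi>2 \<in> Zc J lam (sys_of A2) q"
    and 12: "(\<lambda>\<sigma>. \<phi>1 \<sigma> - \<phi>2 \<sigma>) \<in> Bc J lam (sys_of (A1 \<inter> A2)) q"
  obtains \<phi> where "\<phi> \<in> Zc J lam (sys_of (A1 \<union> A2)) q"
    "(\<lambda>\<sigma>. \<phi> \<sigma> - \<phi>1 \<sigma>) \<in> Bc J lam (sys_of A1) q" "(\<lambda>\<sigma>. \<phi> \<sigma> - \<phi>2 \<sigma>) \<in> Bc J lam (sys_of A2) q"
proof -
  have U: "A1 \<union> A2 = \<Union>{A1,A2}" by auto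
  have sm: "small {A1,A2} r = sys_of A1 r \<union> sys_of A2 r" for r by (auto simp: small_def)
  have m: "sys_of (A1 \<inter> A2) s = sys_of A1 s \<inter> sys_of A2 s" for s by (rule sys_of_Int)
  obtain \<theta> where th: "\<theta> \<in> Zc J lam (sys_of A1) q" "\<theta> \<in> Bc J lam (sys_of A1) q"
      "\<forall>\<sigma>\<in>sys_of (A1 \<inter> A2) q. \<phi>1 \<sigma> - \<phi>2 \<sigma> = \<theta> \<sigma>"
  proof (cases q)
    case 0
    show ?thesis by (rule that[of "\<lambda>_. 0"]) (use 0 12 in \<open>auto simp: Bc_def Zc_def eqvt_def cobd_alt\<close>)
  next
    case (Suc r')
    obtain u where u: "eqvt J lam (sys_of (A1 \<inter> A2)) r' u" "\<forall>\<sigma>\<in>sys_of (A1 \<inter> A2) q. \<phi>1 \<sigma> - \<phi>2 \<sigma> = cobd r' u \<sigma>"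
      using 12 Suc by (auto simp: Bc_def)
    define u' where "u' = (\<lambda>\<sigma>. if \<sigma> \<in> sys_of (A1 \<inter> A2) r' then u \<sigma> else 0)"
    have e: "eqvt J lam (sys_of A1) r' u'" unfolding u'_def by (rule eqvt_extend0[OF u(1) inv12(1)])
    show ?thesis
    proof (rule that[of "cobd r' u'"])
      show b: "cobd r' u' \<in> Bc J lam (sys_of A1) q" using e Suc by (auto simp: Bc_def)
      show "cobd r' u' \<in> Zc J lam (sys_of A1) q"
        by (rule Bc_sub_Zc[OF inv1 b]) (simp add: Suc eqvt_cobd[OF e inv1])
      show "\<forall>\<sigma>\<in>sys_of (A1 \<inter> A2) q. \<phi>1 \<sigma> - \<phi>2 \<sigma> = cobd r' u' \<sigma>"
        using u(2) Suc sys_of_face[of _ "A1 \<inter> A2" r'] unfolding u'_def by (auto intro!: cobd_cong)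
    qed
  qed
  define \<psi> where "\<psi> = (\<lambda>\<sigma>. if \<sigma> \<in> sys_of A1 q then \<phi>1 \<sigma> - \<theta> \<sigma> else \<phi>2 \<sigma>)"
  have psi1: "\<psi> \<sigma> = \<phi>1 \<sigma> - \<theta> \<sigma>" if "\<sigma> \<in> sys_of A1 q" for \<sigma> using that by (simp add: \<psi>_def)
  have psi2: "\<psi> \<sigma> = \<phi>2 \<sigma>" if "\<sigma> \<in> sys_of A2 q" for \<sigma>
    using bspec[OF th(3), of \<sigma>] that by (auto simp: \<psi>_def m algebra_simps)
  have d: "(\<lambda>\<sigma>. \<phi>1 \<sigma> - \<theta> \<sigma>) \<in> Zc J lam (sys_of A1) q" by (rule Zc_diff[OF z1 th(1)])
  have "\<psi> \<in> Zc J lam (small {A1,A2}) q"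
    unfolding Zc_def
  proof (intro CollectI conjI ballI)
    have "eqvt J lam (sys_of A1) q \<psi>" "eqvt J lam (sys_of A2) q \<psi>"
      using d z2 psi1 psi2 ssys_sys_of[OF inv1] ssys_sys_of[OF inv2] unfolding Zc_def eqvt_def ssys_def by auto
    then show "eqvt J lam (small {A1,A2}) q \<psi>" by (auto simp: eqvt_def sm)
    fix \<sigma> assume "\<sigma> \<in> small {A1,A2} (Suc q)"
    then consider "\<sigma> \<in> sys_of A1 (Suc q)" | "\<sigma> \<in> sys_of A2 (Suc q)" by (auto simp: sm)
    then show "cobd q \<psi> \<sigma> = 0"
    proof cases
      case 1
      then have "cobd q \<psi> \<sigma> = cobd q (\<lambda>\<sigma>. \<phi>1 \<sigma> - \<theta> \<sigma>) \<sigma>"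
        using sys_of_face[of \<sigma> A1 q] psi1 by (intro cobd_cong) auto
      then show ?thesis using 1 d by (simp add: Zc_def)
    next
      case 2
      then have "cobd q \<psi> \<sigma> = cobd q \<phi>2 \<sigma>"
        using sys_of_face[of \<sigma> A2 q] psi2 by (intro cobd_cong) auto
      then show ?thesis using 2 z2 by (simp add: Zc_def)
    qed
  qed
  then obtain \<phi> where phi: "\<phi> \<in> Zc J lam (sys_of (A1 \<union> A2)) q" "\<And>\<sigma>. \<sigma> \<in> small {A1,A2} q \<Longrightarrow> \<phi> \<sigma> = \<psi> \<sigma>"
    using small_cocycle_extends[of "A1 \<union> A2" "{A1,A2}" J, OF U] op1 op2 inv1 inv2 by blast
  show ?thesis
  proof (rule that[OF phi(1)])
    have "(\<lambda>\<sigma>. 0 - \<theta> \<sigma>) \<in> Bc J lam (sys_of A1) q"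
      using Bc_linear[OF th(2) th(2), of "-1" 0] by simp
    then show "(\<lambda>\<sigma>. \<phi> \<sigma> - \<phi>1 \<sigma>) \<in> Bc J lam (sys_of A1) q"
      by (rule Bc_cong) (simp add: phi(2) sm psi1)
    have "(\<lambda>_. 0) \<in> Bc J lam (sys_of A2) q"
      using Bc_linear[OF Bc_mono[OF th(2)], of "\<lambda>_. {}"] by (auto simp: Bc_def eqvt_def cobd_alt intro!: exI[of _ "\<lambda>_. 0"])
    then show "(\<lambda>\<sigma>. \<phi> \<sigma> - \<phi>2 \<sigma>) \<in> Bc J lam (sys_of A2) q"
      by (rule Bc_cong) (simp add: phi(2) sm psi2)
  qed
qed

end

section \<open>The logarithmic cover\<close>

text \<open>The pullback, along the forms, of the exponential map on each factor; the coordinates of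
  the fibre are logarithms of the forms. Coordinates outside \<open>J\<close> are pinned to 0, so
  that \<open>Gam J\<close> is exactly the group moving the points of a fibre.\<close>

definition cover :: "nat set \<Rightarrow> (nat \<Rightarrow> 'a \<Rightarrow> complex) \<Rightarrow> 'a set \<Rightarrow> 'a cov set" where
  "cover J f Y = {z. fst z \<in> Y \<and> (\<forall>j\<in>J. exp (snd z j) = f j (fst z)) \<and> (\<forall>j. j \<notin> J \<longrightarrow> snd z j = 0)}"

definition lift :: "nat set \<Rightarrow> ('a \<Rightarrow> 'b) \<Rightarrow> (nat \<Rightarrow> 'a \<Rightarrow> complex) \<Rightarrow> 'a cov \<Rightarrow> 'b cov" where
  "lift J h g z = (h (fst z), \<lambda>j. if j \<in> J then snd z j + g j (fst z) else 0)"

abbreviation ZZ where "ZZ J f lam Y q \<equiv> Zc J lam (sys_of (cover J f Y)) q"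
abbreviation BB where "BB J f lam Y q \<equiv> Bc J lam (sys_of (cover J f Y)) q"

definition van :: "nat set \<Rightarrow> (nat \<Rightarrow> 'a::topological_space \<Rightarrow> complex) \<Rightarrow> (nat \<Rightarrow> complex) \<Rightarrow> 'a set \<Rightarrow> nat \<Rightarrow> bool" where
  "van J f lam Y q \<longleftrightarrow> ZZ J f lam Y q \<subseteq> BB J f lam Y q"

text \<open>\<open>g j\<close> is a continuous logarithm of the ratio between the target form at
  \<open>h x\<close> and the source form at \<open>x\<close>. This is the datum that lifts
  \<open>h\<close> to the covers. It is not determined by \<open>h\<close>, and
  \<open>van_rotation\<close> exploits precisely this.\<close>

definition mor :: "nat set \<Rightarrow> (nat \<Rightarrow> 'a::topological_space \<Rightarrow> complex) \<Rightarrow> 'a set \<Rightarrow> (nat \<Rightarrow> 'b::topological_space \<Rightarrow> complex) \<Rightarrow> 'b set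
    \<Rightarrow> ('a \<Rightarrow> 'b) \<Rightarrow> (nat \<Rightarrow> 'a \<Rightarrow> complex) \<Rightarrow> bool" where
  "mor J f Y f' Y' h g \<longleftrightarrow> continuous_on Y h \<and> (\<forall>j\<in>J. continuous_on Y (g j)) \<and>
     (\<forall>x\<in>Y. h x \<in> Y' \<and> (\<forall>j\<in>J. f' j (h x) = f j x * exp (g j x)))"

definition hmor :: "nat set \<Rightarrow> (nat \<Rightarrow> 'a::topological_space \<Rightarrow> complex) \<Rightarrow> 'a set \<Rightarrow> (nat \<Rightarrow> 'b::topological_space \<Rightarrow> complex) \<Rightarrow> 'b set
    \<Rightarrow> (real \<Rightarrow> 'a \<Rightarrow> 'b) \<Rightarrow> (real \<Rightarrow> nat \<Rightarrow> 'a \<Rightarrow> complex) \<Rightarrow> bool" where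
  "hmor J f Y f' Y' H G \<longleftrightarrow> continuous_on ({0..1} \<times> Y) (\<lambda>z. H (fst z) (snd z)) \<and>
     (\<forall>j\<in>J. continuous_on ({0..1} \<times> Y) (\<lambda>z. G (fst z) j (snd z))) \<and>
     (\<forall>s\<in>{0..1}. \<forall>x\<in>Y. H s x \<in> Y' \<and> (\<forall>j\<in>J. f' j (H s x) = f j x * exp (G s j x)))"

lemma exp_2pi_int: "exp (2 * complex_of_real pi * \<i> * complex_of_int n) = 1"
  using exp_2pi_1_int[of n] by (simp only: ac_simps)

lemma deck_inv_cover: "deck_inv J (cover J f Y)"
  unfolding deck_inv_def cover_def Gam_def
  by (auto simp: deck_def exp_add exp_2pi_int)

lemma lift_deck: "g \<in> Gam J \<Longrightarrow> lift J h u (deck g z) = deck g (lift J h u z)"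
  by (auto simp: lift_def deck_def Gam_def fun_eq_iff)

lemma cover_Int: "cover J f (Y1 \<inter> Y2) = cover J f Y1 \<inter> cover J f Y2"
  and cover_Un: "cover J f (Y1 \<union> Y2) = cover J f Y1 \<union> cover J f Y2"
  and cover_mono: "Y1 \<subseteq> Y2 \<Longrightarrow> cover J f Y1 \<subseteq> cover J f Y2"
  by (auto simp: cover_def)

lemma openin_cover:
  assumes "openin (top_of_set Y) Y1" "Y1 \<subseteq> Y"
  shows "openin (top_of_set (cover J f Y)) (cover J f Y1)"
proof -
  obtain T where "open T" and T: "Y1 = Y \<inter> T" using assms by (auto simp: openin_open)
  moreover have "cover J f Y1 = cover J f Y \<inter> T \<times> UNIV" unfolding T by (auto simp: cover_def)
  ultimately show ?thesis using open_Times[OF \<open>open T\<close> open_UNIV] unfolding openin_open by metis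
qed

lemma continuous_on_fst_cover: "continuous_on Y h \<Longrightarrow> continuous_on (cover J f Y) (\<lambda>z. h (fst z))"
  by (rule continuous_on_compose2[of Y h]) (auto simp: cover_def intro: continuous_on_fst continuous_on_id)

lemma mor_continuous_map:
  assumes "mor J f Y f' Y' h g"
  shows "continuous_map (top_of_set (cover J f Y)) (top_of_set (cover J f' Y')) (lift J h g)"
proof -
  have "continuous_on (cover J f Y) (\<lambda>z. if j \<in> J then snd z j + g j (fst z) else 0)" for j
    using assms by (cases "j \<in> J") (auto simp: mor_def intro!: continuous_on_add continuous_on_snd_coord continuous_on_fst_cover)
  then have "continuous_on (cover J f Y) (lift J h g)"
    unfolding lift_def using assms
    by (intro continuous_on_Pair continuous_on_coordinatewise_then_product continuous_on_fst_cover) (auto simp: mor_def)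
  moreover have "lift J h g \<in> cover J f Y \<rightarrow> cover J f' Y'"
    using assms by (auto simp: mor_def lift_def cover_def exp_add)
  ultimately show ?thesis by (simp add: continuous_map_in_subtopology)
qed

lemma mor_ZZ: "mor J f Y f' Y' h g \<Longrightarrow> \<phi> \<in> ZZ J f' lam Y' q \<Longrightarrow> (\<lambda>\<sigma>. \<phi> (simplex_map q (lift J h g) \<sigma>)) \<in> ZZ J f lam Y q"
  by (rule Zc_pullback[OF mor_continuous_map]) (auto simp: lift_deck)

lemma mor_BB: "mor J f Y f' Y' h g \<Longrightarrow> \<phi> \<in> BB J f' lam Y' q \<Longrightarrow> (\<lambda>\<sigma>. \<phi> (simplex_map q (lift J h g) \<sigma>)) \<in> BB J f lam Y q"
  by (rule Bc_pullback[OF mor_continuous_map]) (auto simp: lift_deck)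

lemma hmor_BB:
  assumes h: "hmor J f Y f' Y' H G" and phi: "\<phi> \<in> ZZ J f' lam Y' q"
  shows "(\<lambda>\<sigma>. \<phi> (simplex_map q (lift J (H 1) (G 1)) \<sigma>) - \<phi> (simplex_map q (lift J (H 0) (G 0)) \<sigma>)) \<in> BB J f lam Y q"
proof -
  define L where "L = (\<lambda>z. lift J (H (fst z)) (G (fst z)) (snd z))"
  let ?C = "{0..1::real} \<times> cover J f Y"
  have f: "continuous_on ?C (\<lambda>z. (fst z, fst (snd z)))"
    by (intro continuous_on_Pair continuous_on_fst continuous_on_snd continuous_on_id)
  have im: "(\<lambda>z. (fst z, fst (snd z))) ` ?C \<subseteq> {0..1} \<times> Y" by (auto simp: cover_def)
  have c1: "continuous_on ?C (\<lambda>z. H (fst z) (fst (snd z)))"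
    using h continuous_on_compose2[of "{0..1} \<times> Y" "\<lambda>z. H (fst z) (snd z)" ?C, OF _ f im] by (simp add: hmor_def)
  have c2: "continuous_on ?C (\<lambda>z. G (fst z) j (fst (snd z)))" if "j \<in> J" for j
    using h that continuous_on_compose2[of "{0..1} \<times> Y" "\<lambda>z. G (fst z) j (snd z)" ?C, OF _ f im] by (simp add: hmor_def)
  have c3: "continuous_on ?C (\<lambda>z. snd (snd z) j)" for j
    by (rule continuous_on_product_then_coordinatewise) (intro continuous_on_snd continuous_on_id)
  have "continuous_on ?C (\<lambda>z. if j \<in> J then snd (snd z) j + G (fst z) j (fst (snd z)) else 0)" for j
    by (cases "j \<in> J") (auto intro: continuous_on_add c2 c3)
  then have "continuous_on ?C L"
    unfolding L_def lift_def by (intro continuous_on_Pair continuous_on_coordinatewise_then_product c1)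
  moreover have "L \<in> ?C \<rightarrow> cover J f' Y'"
    using h by (auto simp: hmor_def L_def lift_def cover_def exp_add)
  ultimately have "continuous_map (cyl (top_of_set (cover J f Y))) (top_of_set (cover J f' Y')) L"
    by (simp add: continuous_map_in_subtopology flip: subtopology_Times)
  from pullback_homotopy[OF deck_inv_cover deck_inv_cover this _ phi] show ?thesis
    by (simp add: L_def lift_deck)
qed

lemma lift_id:
  assumes "\<sigma> \<in> sys_of (cover J f Y) q" "\<And>x j. x \<in> Y \<Longrightarrow> h x = x" "\<And>x j. x \<in> Y \<Longrightarrow> j \<in> J \<Longrightarrow> g j x = 0"
  shows "simplex_map q (lift J h g) \<sigma> = \<sigma>"
proof (rule simplex_map_id_gen)
  show "singular_simplex q (top_of_set (cover J f Y)) \<sigma>" using assms by (simp add: sys_of_def)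
  fix z assume "z \<in> topspace (top_of_set (cover J f Y))"
  then show "lift J h g z = z" using assms by (auto simp: lift_def cover_def prod_eq_iff fun_eq_iff)
qed

lemma lift_lift:
  assumes "\<sigma> \<in> sys_of (cover J f Y) q"
  shows "simplex_map q (lift J h2 g2) (simplex_map q (lift J h1 g1) \<sigma>) = simplex_map q (lift J (\<lambda>x. h2 (h1 x)) (\<lambda>j x. g1 j x + g2 j (h1 x))) \<sigma>"
  by (auto simp: simplex_map_def lift_def fun_eq_iff)

lemma lift_cong:
  assumes "\<sigma> \<in> sys_of (cover J f Y) q" "\<And>x. x \<in> Y \<Longrightarrow> h x = h' x" "\<And>x j. x \<in> Y \<Longrightarrow> j \<in> J \<Longrightarrow> g j x = g' j x"
  shows "simplex_map q (lift J h g) \<sigma> = simplex_map q (lift J h' g') \<sigma>"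
proof (rule simplex_map_eq)
  show "singular_simplex q (top_of_set (cover J f Y)) \<sigma>" using assms by (simp add: sys_of_def)
  fix z assume "z \<in> topspace (top_of_set (cover J f Y))"
  then show "lift J h g z = lift J h' g' z" using assms by (auto simp: lift_def cover_def prod_eq_iff fun_eq_iff)
qed

text \<open>The identity of \<open>Y\<close> is homotopic to a map that factors through
  \<open>Y'\<close>. Since logarithms are part of the data, the forms on \<open>Y'\<close> may
  differ from those on \<open>Y\<close>.\<close>

lemma van_factor:
  assumes H: "hmor J f Y f Y H G" and H0: "\<And>x. x \<in> Y \<Longrightarrow> H 0 x = x" "\<And>x j. x \<in> Y \<Longrightarrow> j \<in> J \<Longrightarrow> G 0 j x = 0"
    and m1: "mor J f Y f' Y' h1 g1" and m2: "mor J f' Y' f Y h2 g2"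
    and H1: "\<And>x. x \<in> Y \<Longrightarrow> H 1 x = h2 (h1 x)" "\<And>x j. x \<in> Y \<Longrightarrow> j \<in> J \<Longrightarrow> G 1 j x = g1 j x + g2 j (h1 x)"
    and v: "van J f' lam Y' q"
  shows "van J f lam Y q"
  unfolding van_def
proof
  fix \<phi> assume phi: "\<phi> \<in> ZZ J f lam Y q"
  have "(\<lambda>\<sigma>. \<phi> (simplex_map q (lift J h2 g2) \<sigma>)) \<in> BB J f' lam Y' q"
    using mor_ZZ[OF m2 phi] v by (auto simp: van_def)
  from mor_BB[OF m1 this]
  have "(\<lambda>\<sigma>. \<phi> (simplex_map q (lift J h2 g2) (simplex_map q (lift J h1 g1) \<sigma>))) \<in> BB J f lam Y q" .
  then have a: "(\<lambda>\<sigma>. \<phi> (simplex_map q (lift J (H 1) (G 1)) \<sigma>)) \<in> BB J f lam Y q"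
    by (rule Bc_cong) (subst lift_lift, assumption, rule arg_cong[where f=\<phi>], rule lift_cong, auto simp: H1)
  have "(\<lambda>\<sigma>. \<phi> (simplex_map q (lift J (H 1) (G 1)) \<sigma>) - \<phi> (simplex_map q (lift J (H 0) (G 0)) \<sigma>)) \<in> BB J f lam Y q"
    by (rule hmor_BB[OF H phi])
  from Bc_diff[OF a this] have "(\<lambda>\<sigma>. \<phi> (simplex_map q (lift J (H 0) (G 0)) \<sigma>)) \<in> BB J f lam Y q" by simp
  then show "\<phi> \<in> BB J f lam Y q" by (rule Bc_cong) (simp add: lift_id H0)
qed

lemma mor_inclusion: "Y \<subseteq> Y' \<Longrightarrow> mor J f Y f Y' (\<lambda>x. x) (\<lambda>_ _. 0)"
  by (auto simp: mor_def)

lemma hmor_at: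
  assumes "hmor J f Y f' Y' H G" "s \<in> {0..1}" "\<And>x. x \<in> Y \<Longrightarrow> H s x \<in> Y''"
  shows "mor J f Y f' Y'' (H s) (G s)"
proof -
  have i: "continuous_on Y (\<lambda>x. (s, x))" by (intro continuous_on_Pair continuous_on_const continuous_on_id)
  have im: "(\<lambda>x. (s, x)) ` Y \<subseteq> {0..1} \<times> Y" using assms(2) by auto
  have 1: "continuous_on Y (\<lambda>x. H s x)"
    using continuous_on_compose2[of "{0..1} \<times> Y" "\<lambda>z. H (fst z) (snd z)" Y, OF _ i im] assms by (simp add: hmor_def)
  have 2: "continuous_on Y (\<lambda>x. G s j x)" if "j \<in> J" for j
    using continuous_on_compose2[of "{0..1} \<times> Y" "\<lambda>z. G (fst z) j (snd z)" Y, OF _ i im] assms that by (simp add: hmor_def)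
  from 1 2 show ?thesis using assms by (auto simp: mor_def hmor_def)
qed

lemma van_retract:
  assumes H: "hmor J f Y f Y H G" and H0: "\<And>x. x \<in> Y \<Longrightarrow> H 0 x = x" "\<And>x j. x \<in> Y \<Longrightarrow> j \<in> J \<Longrightarrow> G 0 j x = 0"
    and Y': "Y' \<subseteq> Y" "\<And>x. x \<in> Y \<Longrightarrow> H 1 x \<in> Y'" and v: "van J f lam Y' q"
  shows "van J f lam Y q"
  by (rule van_factor[OF H H0 hmor_at[OF H] mor_inclusion[OF Y'(1)] _ _ v]) (auto simp: Y')

text \<open>The homotopy keeps \<open>Y1\<close> inside itself but need not fix its points. That is
  enough for restriction to \<open>Y1\<close> to be injective and surjective on cohomology
  (\<open>deform_inj\<close>, \<open>deform_surj\<close>).\<close>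

definition deform :: "nat set \<Rightarrow> (nat \<Rightarrow> 'a::topological_space \<Rightarrow> complex) \<Rightarrow> 'a set \<Rightarrow> 'a set \<Rightarrow> bool" where
  "deform J f Y Y1 \<longleftrightarrow> Y1 \<subseteq> Y \<and> (\<exists>H G. hmor J f Y f Y H G \<and> hmor J f Y1 f Y1 H G \<and>
      (\<forall>x\<in>Y. H 0 x = x \<and> H 1 x \<in> Y1 \<and> (\<forall>j\<in>J. G 0 j x = 0)))"

lemma deform_inj:
  assumes "deform J f Y Y1" and phi: "\<phi> \<in> ZZ J f lam Y q" and b: "\<phi> \<in> BB J f lam Y1 q"
  shows "\<phi> \<in> BB J f lam Y q"
proof -
  from assms obtain H G where H: "hmor J f Y f Y H G" "\<forall>x\<in>Y. H 0 x = x \<and> H 1 x \<in> Y1 \<and> (\<forall>j\<in>J. G 0 j x = 0)"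
    by (auto simp: deform_def)
  have "mor J f Y f Y1 (H 1) (G 1)" by (rule hmor_at[OF H(1)]) (use H in auto)
  from mor_BB[OF this b] have a: "(\<lambda>\<sigma>. \<phi> (simplex_map q (lift J (H 1) (G 1)) \<sigma>)) \<in> BB J f lam Y q" .
  from Bc_diff[OF a hmor_BB[OF H(1) phi]] have "(\<lambda>\<sigma>. \<phi> (simplex_map q (lift J (H 0) (G 0)) \<sigma>)) \<in> BB J f lam Y q" by simp
  then show ?thesis by (rule Bc_cong) (use H(2) in \<open>simp add: lift_id\<close>)
qed

lemma deform_surj:
  assumes "deform J f Y Y1" and psi: "\<psi> \<in> ZZ J f lam Y1 q"
  obtains \<phi> where "\<phi> \<in> ZZ J f lam Y q" "(\<lambda>\<sigma>. \<phi> \<sigma> - \<psi> \<sigma>) \<in> BB J f lam Y1 q"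
proof -
  from assms obtain H G where H: "hmor J f Y f Y H G" "hmor J f Y1 f Y1 H G" "\<forall>x\<in>Y. H 0 x = x \<and> H 1 x \<in> Y1 \<and> (\<forall>j\<in>J. G 0 j x = 0)"
    and Y1: "Y1 \<subseteq> Y" by (auto simp: deform_def)
  have m: "mor J f Y f Y1 (H 1) (G 1)" by (rule hmor_at[OF H(1)]) (use H in auto)
  show ?thesis
  proof (rule that[OF mor_ZZ[OF m psi]])
    show "(\<lambda>\<sigma>. \<psi> (simplex_map q (lift J (H 1) (G 1)) \<sigma>) - \<psi> \<sigma>) \<in> BB J f lam Y1 q"
      by (rule Bc_cong[OF hmor_BB[OF H(2) psi]])
        (subst lift_id[where h="H 0" and g="G 0"], assumption, use H(3) Y1 in auto)
  qed
qed

lemma ZZ_mono: "\<phi> \<in> ZZ J f lam Y q \<Longrightarrow> Y' \<subseteq> Y \<Longrightarrow> \<phi> \<in> ZZ J f lam Y' q"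
  by (erule Zc_mono) (intro sys_of_mono cover_mono)

lemma BB_mono: "\<phi> \<in> BB J f lam Y q \<Longrightarrow> Y' \<subseteq> Y \<Longrightarrow> \<phi> \<in> BB J f lam Y' q"
  by (erule Bc_mono) (intro sys_of_mono cover_mono)

lemma BB_mv:
  assumes o: "openin (top_of_set (Y1 \<union> Y2)) Y1" "openin (top_of_set (Y1 \<union> Y2)) Y2"
    and phi: "\<phi> \<in> ZZ J f lam (Y1 \<union> Y2) q" "\<phi> \<in> BB J f lam Y1 q" "\<phi> \<in> BB J f lam Y2 q"
    and v: "q \<noteq> 0 \<Longrightarrow> van J f lam (Y1 \<inter> Y2) (q - 1)"
  shows "\<phi> \<in> BB J f lam (Y1 \<union> Y2) q"
proof -
  have o': "openin (top_of_set (cover J f Y1 \<union> cover J f Y2)) (cover J f Y1)"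
      "openin (top_of_set (cover J f Y1 \<union> cover J f Y2)) (cover J f Y2)"
    using openin_cover[OF o(1)] openin_cover[OF o(2)] by (auto simp flip: cover_Un)
  show ?thesis
    using MV_inj[OF o' deck_inv_cover deck_inv_cover _ phi(2,3)] phi(1) v by (simp add: van_def cover_Un cover_Int)
qed

lemma van_mv:
  assumes "openin (top_of_set (Y1 \<union> Y2)) Y1" "openin (top_of_set (Y1 \<union> Y2)) Y2"
    and v: "van J f lam Y1 q" "van J f lam Y2 q" "q \<noteq> 0 \<Longrightarrow> van J f lam (Y1 \<inter> Y2) (q - 1)"
  shows "van J f lam (Y1 \<union> Y2) q"
  unfolding van_def
proof
  fix \<phi> assume phi: "\<phi> \<in> ZZ J f lam (Y1 \<union> Y2) q"
  show "\<phi> \<in> BB J f lam (Y1 \<union> Y2) q"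
    using ZZ_mono[OF phi, of Y1] ZZ_mono[OF phi, of Y2] v by (intro BB_mv assms(1,2) phi) (auto simp: van_def)
qed

lemma van_empty: "van J f lam {} q"
proof -
  have "sys_of (cover J f {}) q = {}" for q
    using nonempty_standard_simplex[of q] by (auto simp: sys_of_iff cover_def)
  then show ?thesis by (auto simp: van_def Bc_def eqvt_def)
qed

text \<open>The homotopy returns to the identity of \<open>Y\<close>, whereas its lift ends at the
  deck transformation \<open>g\<close>. Hence \<open>chi J lam g - 1\<close> times any cocycle is a
  coboundary, and this factor is invertible.\<close>

lemma van_rotation:
  assumes H: "hmor J f Y f Y H G" and H0: "\<And>x. x \<in> Y \<Longrightarrow> H 0 x = x" "\<And>x j. x \<in> Y \<Longrightarrow> j \<in> J \<Longrightarrow> G 0 j x = 0"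
    and H1: "\<And>x. x \<in> Y \<Longrightarrow> H 1 x = x" "\<And>x j. x \<in> Y \<Longrightarrow> j \<in> J \<Longrightarrow> G 1 j x = 2 * pi * \<i> * of_int (g j)"
    and g: "g \<in> Gam J" "chi J lam g \<noteq> 1"
  shows "van J f lam Y q"
  unfolding van_def
proof
  fix \<phi> assume phi: "\<phi> \<in> ZZ J f lam Y q"
  let ?c = "chi J lam g - 1"
  have "(\<lambda>\<sigma>. ?c * \<phi> \<sigma>) \<in> BB J f lam Y q"
  proof (rule Bc_cong[OF hmor_BB[OF H phi]])
    fix \<sigma> assume s: "\<sigma> \<in> sys_of (cover J f Y) q"
    have "simplex_map q (lift J (H 1) (G 1)) \<sigma> = simplex_map q (deck g) \<sigma>"
    proof (rule simplex_map_eq)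
      show "singular_simplex q (top_of_set (cover J f Y)) \<sigma>" using s by (simp add: sys_of_def)
      fix z assume "z \<in> topspace (top_of_set (cover J f Y))"
      then show "lift J (H 1) (G 1) z = deck g z"
        using g by (auto simp: lift_def deck_def cover_def Gam_def prod_eq_iff fun_eq_iff H1)
    qed
    moreover have "\<phi> (simplex_map q (deck g) \<sigma>) = chi J lam g * \<phi> \<sigma>"
      using phi s g by (auto simp: Zc_def eqvt_def)
    ultimately show "\<phi> (simplex_map q (lift J (H 1) (G 1)) \<sigma>) - \<phi> (simplex_map q (lift J (H 0) (G 0)) \<sigma>) = ?c * \<phi> \<sigma>"
      using lift_id[OF s, of "H 0" "G 0"] H0 by (simp add: algebra_simps)
  qed
  from Bc_linear[OF this this, of "1 / ?c" 0] show "\<phi> \<in> BB J f lam Y q"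
    using g(2) by simp
qed

text \<open>The values are multiples of 2 pi i, so distinct ones are at distance at least 2 pi, and
  a continuous function with discrete range is constant on a connected set.\<close>

lemma constant_log:
  fixes d :: "'a::topological_space \<Rightarrow> complex"
  assumes "connected S" "continuous_on S d" "\<And>x. x \<in> S \<Longrightarrow> exp (d x) = 1"
  shows "d constant_on S"
proof (rule continuous_discrete_range_constant[OF assms(1,2)])
  fix x assume x: "x \<in> S"
  have "2 * pi \<le> cmod (d y - d x)" if y: "y \<in> S" "d y \<noteq> d x" for y
  proof -
    obtain n m :: int where "d y = 2 * of_int n * pi * \<i>" "d x = 2 * of_int m * pi * \<i>"
      using assms(3)[OF y(1)] assms(3)[OF x] exp_eq[of "d y" 0] exp_eq[of "d x" 0] by auto
    then have e: "d y - d x = complex_of_real (2 * real_of_int (n - m) * pi) * \<i>" by (simp add: algebra_simps)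
    then have "n - m \<noteq> 0" using y by auto
    then have "1 \<le> \<bar>real_of_int (n - m)\<bar>" by linarith
    moreover have "cmod (d y - d x) = \<bar>2 * real_of_int (n - m) * pi\<bar>"
      unfolding e by (simp only: norm_mult norm_ii norm_of_real mult_1_right)
    ultimately show ?thesis by (simp add: abs_mult)
  qed
  then show "\<exists>e>0. \<forall>y. y \<in> S \<and> d y \<noteq> d x \<longrightarrow> e \<le> cmod (d y - d x)"
    by (intro exI[of _ "2 * pi"]) auto
qed

lemma connected_standard_simplex: "connected (standard_simplex q)"
  using connectedin_standard_simplex[of q] unfolding euclidean_product_topology connectedin_iff_connected .

lemma sys_of_continuous: "\<sigma> \<in> sys_of A q \<Longrightarrow> continuous_on (standard_simplex q) \<sigma>"
  by (simp add: sys_of_iff singular_simplex_def euclidean_product_topology)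

lemma sys_of_cover_point:
  assumes s: "\<sigma> \<in> sys_of (cover J f {x0}) q" and "x \<in> standard_simplex q" "y \<in> standard_simplex q"
  shows "\<sigma> x = \<sigma> y"
proof -
  have c: "\<sigma> z \<in> cover J f {x0}" if "z \<in> standard_simplex q" for z using s that by (auto simp: sys_of_iff)
  have "snd (\<sigma> x) j = snd (\<sigma> y) j" for j
  proof (cases "j \<in> J")
    case True
    let ?d = "\<lambda>z. snd (\<sigma> z) j - snd (\<sigma> x) j"
    have "continuous_on (standard_simplex q) (\<lambda>z. snd (\<sigma> z) j)"
      by (rule continuous_on_product_then_coordinatewise, rule continuous_on_snd, rule sys_of_continuous[OF s])
    then have "continuous_on (standard_simplex q) ?d"
      by (intro continuous_on_diff continuous_on_const)
    moreover have "exp (?d z) = 1" if "z \<in> standard_simplex q" for z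
      using c[OF that] c[OF assms(2)] True exp_not_eq_zero[of "snd (\<sigma> x) j"] by (simp add: cover_def exp_diff)
    ultimately have "?d constant_on standard_simplex q" by (intro constant_log connected_standard_simplex)
    then obtain k where "\<And>z. z \<in> standard_simplex q \<Longrightarrow> ?d z = k" by (auto simp: constant_on_def)
    from this[OF assms(2)] this[OF assms(3)] show ?thesis by simp
  qed (use c assms in \<open>auto simp: cover_def\<close>)
  then show ?thesis using c[OF assms(2)] c[OF assms(3)] by (auto simp: cover_def prod_eq_iff fun_eq_iff)
qed

lemma singular_face_const: "k \<le> Suc q \<Longrightarrow> singular_face (Suc q) k (restrict (\<lambda>_. z) (standard_simplex (Suc q))) = restrict (\<lambda>_. z) (standard_simplex q)"
  using simplical_face_in_standard_simplex[of "Suc q" k] by (auto simp: singular_face_def restrict_def fun_eq_iff)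

lemma sum_alternating: "(\<Sum>k\<le>n. (-1::complex) ^ k) = (if even n then 1 else 0)"
  by (induction n) auto

text \<open>Simplices over a point are constant because their logarithms are. On constant simplices
  the coboundary is alternately zero and the identity: in odd degree cocycles vanish, and in even
  positive degree a cocycle, read one degree lower, is its own primitive.\<close>

lemma van_point:
  assumes "q > 0"
  shows "van J f lam {x0} q"
  unfolding van_def
proof
  fix \<phi> assume phi: "\<phi> \<in> ZZ J f lam {x0} q"
  let ?c = "\<lambda>q z. restrict (\<lambda>_. z) (standard_simplex q)"
  let ?e = "\<lambda>j::nat. if j = 0 then 1 else (0::real)"
  have const: "\<sigma> = ?c q (\<sigma> ?e)" if "\<sigma> \<in> sys_of (cover J f {x0}) q" for \<sigma> q
  proof
    fix x show "\<sigma> x = ?c q (\<sigma> ?e) x"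
      using that sys_of_cover_point[OF that, of x ?e] by (auto simp: sys_of_iff singular_simplex_def extensional_def)
  qed
  have mem: "?c q z \<in> sys_of (cover J f {x0}) q \<longleftrightarrow> z \<in> cover J f {x0}" for q z
    using nonempty_standard_simplex[of q] by (auto simp: sys_of_iff singular_simplex_def)
  obtain r where r: "q = Suc r" using assms by (cases q) auto
  show "\<phi> \<in> BB J f lam {x0} q"
  proof (cases "even q")
    case False
    have "\<phi> \<sigma> = 0" if s: "\<sigma> \<in> sys_of (cover J f {x0}) q" for \<sigma>
    proof -
      have "\<sigma> ?e \<in> cover J f {x0}" using s by (auto simp: sys_of_iff)
      then have "cobd q \<phi> (?c (Suc q) (\<sigma> ?e)) = 0" using phi mem by (auto simp: Zc_def)
      moreover have "cobd q \<phi> (?c (Suc q) (\<sigma> ?e)) = (\<Sum>k\<le>Suc q. (-1) ^ k * \<phi> (?c q (\<sigma> ?e)))"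
        unfolding cobd_alt by (intro sum.cong refl) (simp only: atMost_iff singular_face_const)
      ultimately have "\<phi> (?c q (\<sigma> ?e)) = 0" using False
        by (simp add: sum_distrib_right[symmetric] sum_alternating del: sum.atMost_Suc)
      then show ?thesis using const[OF s] by simp
    qed
    then show ?thesis using r by (auto simp: Bc_def eqvt_def cobd_alt intro!: exI[of _ "\<lambda>_. 0"])
  next
    case True
    let ?\<psi> = "\<lambda>\<tau>. \<phi> (?c q (\<tau> ?e))"
    have "eqvt J lam (sys_of (cover J f {x0})) r ?\<psi>"
      unfolding eqvt_def
    proof (intro ballI)
      fix \<tau> g assume t: "\<tau> \<in> sys_of (cover J f {x0}) r" and g: "g \<in> Gam J"
      then have "?c q (\<tau> ?e) \<in> sys_of (cover J f {x0}) q" unfolding mem by (auto simp: sys_of_iff)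
      moreover have "?c q (simplex_map r (deck g) \<tau> ?e) = simplex_map q (deck g) (?c q (\<tau> ?e))"
        by (auto simp: simplex_map_def)
      ultimately show "?\<psi> (simplex_map r (deck g) \<tau>) = chi J lam g * ?\<psi> \<tau>"
        using phi g by (auto simp: Zc_def eqvt_def)
    qed
    moreover have "\<phi> \<sigma> = cobd r ?\<psi> \<sigma>" if s: "\<sigma> \<in> sys_of (cover J f {x0}) q" for \<sigma>
    proof -
      have "cobd r ?\<psi> (?c (Suc r) (\<sigma> ?e)) = (\<Sum>k\<le>Suc r. (-1) ^ k * \<phi> (?c q (\<sigma> ?e)))"
        unfolding cobd_alt by (intro sum.cong refl) (simp add: singular_face_const del: singular_face_restrict)
      also have "\<dots> = \<phi> (?c q (\<sigma> ?e))" using True r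
        by (simp add: sum_distrib_right[symmetric] sum_alternating del: sum.atMost_Suc)
      finally show ?thesis using const[OF s] r by simp
    qed
    ultimately show ?thesis using r by (auto simp: Bc_def)
  qed
qed

section \<open>Dimensions of quotients\<close>

definition csub :: "('b \<Rightarrow> complex) set \<Rightarrow> bool" where
  "csub V \<longleftrightarrow> (\<lambda>_. 0) \<in> V \<and> (\<forall>u\<in>V. \<forall>v\<in>V. \<forall>a b. (\<lambda>x. a * u x + b * v x) \<in> V)"

lemma csubD: "csub V \<Longrightarrow> u \<in> V \<Longrightarrow> v \<in> V \<Longrightarrow> (\<lambda>x. a * u x + b * v x) \<in> V"
  by (simp add: csub_def)

lemma csub_sum:
  assumes "csub V" "finite I" "\<And>i. i \<in> I \<Longrightarrow> u i \<in> V"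
  shows "(\<lambda>x. \<Sum>i\<in>I. c i * u i x) \<in> V"
  using assms(2,3)
proof (induction I rule: finite_induct)
  case empty then show ?case using assms(1) by (simp add: csub_def)
next
  case (insert i I)
  then have "(\<lambda>x. c i * u i x + 1 * (\<Sum>i\<in>I. c i * u i x)) \<in> V"
    by (intro csubD[OF assms(1)]) auto
  then show ?case using insert by simp
qed

lemma csub_diff: "csub V \<Longrightarrow> u \<in> V \<Longrightarrow> v \<in> V \<Longrightarrow> (\<lambda>x. u x - v x) \<in> V"
  using csubD[of V u v 1 "-1"] by simp

text \<open>Generation by an indexed family. Repetitions are allowed, so the notion is monotone in
  \<open>k\<close> and passes through linear correspondences without any injectivity.\<close>

definition gens :: "('b \<Rightarrow> complex) set \<Rightarrow> ('b \<Rightarrow> complex) set \<Rightarrow> nat \<Rightarrow> bool" where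
  "gens V W k \<longleftrightarrow> (\<exists>u. (\<forall>i<k. u i \<in> V) \<and> (\<forall>v\<in>V. \<exists>c. (\<lambda>x. v x - (\<Sum>i<k. c i * u i x)) \<in> W))"

lemma gens_mono:
  assumes "csub V" "gens V W k" "k \<le> l" shows "gens V W l"
proof -
  obtain u where u: "\<forall>i<k. u i \<in> V" "\<forall>v\<in>V. \<exists>c. (\<lambda>x. v x - (\<Sum>i<k. c i * u i x)) \<in> W"
    using assms by (auto simp: gens_def)
  define u' where "u' i = (if i < k then u i else (\<lambda>_. 0))" for i
  show ?thesis
    unfolding gens_def
  proof (intro exI[of _ u'] conjI allI ballI impI)
    show "u' i \<in> V" for i using u assms by (auto simp: u'_def csub_def)
    fix v assume "v \<in> V"
    then obtain c where c: "(\<lambda>x. v x - (\<Sum>i<k. c i * u i x)) \<in> W" using u by blast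
    have "(\<Sum>i<l. c i * u' i x) = (\<Sum>i<k. c i * u i x)" for x
      using assms(3) by (intro sum.mono_neutral_cong_right) (auto simp: u'_def)
    then show "\<exists>c. (\<lambda>x. v x - (\<Sum>i<l. c i * u' i x)) \<in> W" using c by (intro exI[of _ c]) simp
  qed
qed

lemma gens_set:
  assumes V: "csub V" and W: "csub W" and B: "finite B" "B \<subseteq> V"
  shows "V \<subseteq> cspan (B \<union> W) \<longleftrightarrow> (\<forall>v\<in>V. \<exists>c. (\<lambda>x. v x - (\<Sum>b\<in>B. c b * b x)) \<in> W)" (is "?l \<longleftrightarrow> ?r")
proof
  assume l: ?l
  show ?r
  proof
    fix v assume "v \<in> V"
    then obtain C c where C: "finite C" "C \<subseteq> B \<union> W" "v = (\<lambda>x. \<Sum>g\<in>C. c g * g x)"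
      using l by (auto simp: cspan_def)
    define c' where "c' b = (if b \<in> C then c b else 0)" for b
    have 1: "(\<Sum>g\<in>C. c g * g x) = (\<Sum>g\<in>C \<inter> B. c g * g x) + (\<Sum>g\<in>C - B. c g * g x)" for x
      using C(1) by (rule sum.Int_Diff)
    have 2: "(\<Sum>g\<in>C \<inter> B. c g * g x) = (\<Sum>b\<in>B. c' b * b x)" for x
      using B(1) by (intro sum.mono_neutral_cong_left) (auto simp: c'_def)
    have "(\<lambda>x. \<Sum>g\<in>C - B. c g * g x) \<in> W"
      using csub_sum[OF W, of "C - B" "\<lambda>g. g" c] C by auto
    moreover have "(\<lambda>x. v x - (\<Sum>b\<in>B. c' b * b x)) = (\<lambda>x. \<Sum>g\<in>C - B. c g * g x)"
      unfolding C(3) 1 2 by simp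
    ultimately show "\<exists>c. (\<lambda>x. v x - (\<Sum>b\<in>B. c b * b x)) \<in> W" by (intro exI[of _ c']) simp
  qed
next
  assume r: ?r
  show ?l
  proof
    fix v assume "v \<in> V"
    then obtain c w where w: "w \<in> W" "\<And>x. w x = v x - (\<Sum>b\<in>B. c b * b x)" using r by fastforce
    \<comment> \<open>The remainder \<open>w\<close> may itself lie in \<open>B\<close>; its
      coefficient 1 is then added to the one it has there.\<close>
    define c' where "c' g = (if g \<in> B then c g else 0) + (if g = w then 1 else 0)" for g
    have "v x = (\<Sum>g\<in>insert w B. c' g * g x)" for x
    proof -
      have "(\<Sum>g\<in>insert w B. c' g * g x) = (\<Sum>g\<in>insert w B. (if g \<in> B then c g else 0) * g x)
          + (\<Sum>g\<in>insert w B. (if g = w then 1 else 0) * g x)"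
        by (simp only: c'_def distrib_right sum.distrib)
      also have "(\<Sum>g\<in>insert w B. (if g \<in> B then c g else 0) * g x) = (\<Sum>b\<in>B. c b * b x)"
        using B(1) by (intro sum.mono_neutral_cong_right) auto
      also have "(\<Sum>g\<in>insert w B. (if g = w then 1 else 0) * g x) = (\<Sum>g\<in>{w}. 1 * g x)"
        using B(1) by (intro sum.mono_neutral_cong_right) auto
      finally show ?thesis using w(2)[of x] by simp
    qed
    then have "v = (\<lambda>x. \<Sum>g\<in>insert w B. c' g * g x)" by blast
    then show "v \<in> cspan (B \<union> W)"
      unfolding cspan_def using B(1) w by (intro CollectI exI[of _ "insert w B"] exI[of _ c']) auto
  qed
qed

lemma gens_iff:
  assumes V: "csub V" and W: "csub W"
  shows "gens V W k \<longleftrightarrow> (\<exists>B. finite B \<and> B \<subseteq> V \<and> card B \<le> k \<and> V \<subseteq> cspan (B \<union> W))"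
proof
  assume "gens V W k"
  then obtain u where u: "\<forall>i<k. u i \<in> V" "\<forall>v\<in>V. \<exists>c. (\<lambda>x. v x - (\<Sum>i<k. c i * u i x)) \<in> W" by (auto simp: gens_def)
  let ?B = "u ` {..<k}"
  have "\<forall>v\<in>V. \<exists>c. (\<lambda>x. v x - (\<Sum>b\<in>?B. c b * b x)) \<in> W"
  proof
    fix v assume "v \<in> V"
    then obtain c where c: "(\<lambda>x. v x - (\<Sum>i<k. c i * u i x)) \<in> W" using u by blast
    have "(\<Sum>i<k. c i * u i x) = (\<Sum>b\<in>?B. (\<Sum>i\<in>{i\<in>{..<k}. u i = b}. c i) * b x)" for x
    proof -
      have "(\<Sum>i<k. c i * u i x) = (\<Sum>b\<in>?B. \<Sum>i\<in>{i\<in>{..<k}. u i = b}. c i * u i x)"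
        by (rule sum.image_gen) simp
      then show ?thesis by (simp add: sum_distrib_right)
    qed
    then show "\<exists>c. (\<lambda>x. v x - (\<Sum>b\<in>?B. c b * b x)) \<in> W" using c by auto
  qed
  then have "V \<subseteq> cspan (?B \<union> W)" using u by (subst gens_set[OF V W]) auto
  moreover have "card ?B \<le> k" using card_image_le[of "{..<k}" u] by simp
  ultimately show "\<exists>B. finite B \<and> B \<subseteq> V \<and> card B \<le> k \<and> V \<subseteq> cspan (B \<union> W)"
    using u by (intro exI[of _ ?B]) auto
next
  assume "\<exists>B. finite B \<and> B \<subseteq> V \<and> card B \<le> k \<and> V \<subseteq> cspan (B \<union> W)"
  then obtain B where B: "finite B" "B \<subseteq> V" "card B \<le> k" "V \<subseteq> cspan (B \<union> W)" by blast
  obtain u where u: "bij_betw u {..<card B} B" using ex_bij_betw_nat_finite[OF B(1)] by (auto simp: atLeast0LessThan)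
  have "gens V W (card B)"
    unfolding gens_def
  proof (intro exI[of _ u] conjI allI ballI impI)
    show "u i \<in> V" if "i < card B" for i using that u B by (auto simp: bij_betw_def)
    fix v assume "v \<in> V"
    then obtain c where c: "(\<lambda>x. v x - (\<Sum>b\<in>B. c b * b x)) \<in> W" using B gens_set[OF V W B(1,2)] by blast
    have "(\<Sum>b\<in>B. c b * b x) = (\<Sum>i<card B. c (u i) * u i x)" for x
      using sum.reindex_bij_betw[OF u, of "\<lambda>b. c b * b x"] by simp
    then show "\<exists>c. (\<lambda>x. v x - (\<Sum>i<card B. c i * u i x)) \<in> W" using c by (intro exI[of _ "\<lambda>i. c (u i)"]) simp
  qed
  then show "gens V W k" using gens_mono[OF V] B(3) by blast
qed

lemma qdim_le_iff:
  assumes V: "csub V" and W: "csub W"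
  shows "qdim V W \<le> enat k \<longleftrightarrow> gens V W k"
proof (cases "\<exists>B. finite B \<and> B \<subseteq> V \<and> V \<subseteq> cspan (B \<union> W)")
  case True
  let ?P = "\<lambda>k. \<exists>B. finite B \<and> B \<subseteq> V \<and> card B = k \<and> V \<subseteq> cspan (B \<union> W)"
  have ex: "\<exists>k. ?P k" using True by blast
  have "qdim V W = enat (Least ?P)" using True by (auto simp: qdim_def)
  moreover have "Least ?P \<le> k \<longleftrightarrow> gens V W k"
  proof
    assume "Least ?P \<le> k"
    then show "gens V W k" using LeastI_ex[OF ex] unfolding gens_iff[OF V W] by metis
  next
    assume "gens V W k"
    then obtain B where "finite B" "B \<subseteq> V" "card B \<le> k" "V \<subseteq> cspan (B \<union> W)" unfolding gens_iff[OF V W] by blast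
    then have "?P (card B)" by blast
    then have "Least ?P \<le> card B" by (rule Least_le)
    then show "Least ?P \<le> k" using \<open>card B \<le> k\<close> by simp
  qed
  ultimately show ?thesis by simp
next
  case False
  then show ?thesis unfolding gens_iff[OF V W] by (auto simp: qdim_def)
qed

lemma enat_eq_via_le: "(\<And>k. x \<le> enat k \<longleftrightarrow> y \<le> enat k) \<Longrightarrow> x = (y::enat)"
proof (rule antisym)
  assume a: "\<And>k. x \<le> enat k \<longleftrightarrow> y \<le> enat k"
  show "x \<le> y" using a by (cases y) auto
  show "y \<le> x" using a by (cases x) auto
qed

lemma gens_0: "gens V W 0 \<longleftrightarrow> V \<subseteq> W"
  by (auto simp: gens_def)

lemma qdim_eq_0_iff: "csub V \<Longrightarrow> csub W \<Longrightarrow> qdim V W = 0 \<longleftrightarrow> V \<subseteq> W"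
  using qdim_le_iff[of V W 0] by (simp add: gens_0 flip: zero_enat_def)

text \<open>A linear relation, total on both sides, that matches \<open>W\<close> with
  \<open>W'\<close>; it induces an isomorphism of the quotients. Relations are used because the
  comparisons below run through choices and zigzags that are not maps of cocycles.\<close>

definition lin_corr where
  "lin_corr V W V' W' R \<longleftrightarrow> csub V \<and> csub W \<and> csub V' \<and> csub W' \<and>
     (\<forall>x x'. R x x' \<longrightarrow> x \<in> V \<and> x' \<in> V' \<and> (x \<in> W \<longleftrightarrow> x' \<in> W')) \<and>
     (\<forall>x\<in>V. \<exists>x'. R x x') \<and> (\<forall>x'\<in>V'. \<exists>x. R x x') \<and>
     (\<forall>x x' y y' a b. R x x' \<longrightarrow> R y y' \<longrightarrow> R (\<lambda>t. a * x t + b * y t) (\<lambda>t. a * x' t + b * y' t))"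

lemma lin_corr_sym: "lin_corr V W V' W' R \<Longrightarrow> lin_corr V' W' V W (\<lambda>x y. R y x)"
  unfolding lin_corr_def by blast

lemma lin_corr_gens:
  assumes R: "lin_corr V W V' W' R" and g: "gens V W k"
  shows "gens V' W' k"
proof -
  have V: "csub V" "csub W" "csub V'" "csub W'"
    and R1: "\<And>x x'. R x x' \<Longrightarrow> x \<in> V \<and> x' \<in> V' \<and> (x \<in> W \<longleftrightarrow> x' \<in> W')"
    and R2: "\<And>x. x \<in> V \<Longrightarrow> \<exists>x'. R x x'" "\<And>x'. x' \<in> V' \<Longrightarrow> \<exists>x. R x x'"
    and R3: "\<And>x x' y y' a b. R x x' \<Longrightarrow> R y y' \<Longrightarrow> R (\<lambda>t. a * x t + b * y t) (\<lambda>t. a * x' t + b * y' t)"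
    using R unfolding lin_corr_def by blast+
  obtain u where u: "\<forall>i<k. u i \<in> V" "\<forall>v\<in>V. \<exists>c. (\<lambda>x. v x - (\<Sum>i<k. c i * u i x)) \<in> W" using g by (auto simp: gens_def)
  have "\<forall>i. \<exists>x'. i < k \<longrightarrow> R (u i) x'" using u(1) R2(1) by blast
  then obtain u' where u': "\<forall>i<k. R (u i) (u' i)" by metis
  have lin: "R (\<lambda>x. v x - (\<Sum>i<l. c i * u i x)) (\<lambda>x. v' x - (\<Sum>i<l. c i * u' i x))" if "R v v'" "l \<le> k" for v v' c l
    using that
  proof (induction l)
    case (Suc l)
    from R3[of _ _ "u l" "u' l" 1 "- c l", OF Suc.IH] u' Suc.prems show ?case by (simp add: algebra_simps)
  qed simp
  show ?thesis
    unfolding gens_def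
  proof (intro exI[of _ u'] conjI allI ballI impI)
    show "u' i \<in> V'" if "i < k" for i using that u' R1 by blast
    fix v' assume "v' \<in> V'"
    then obtain v where v: "R v v'" using R2 by blast
    then obtain c where "(\<lambda>x. v x - (\<Sum>i<k. c i * u i x)) \<in> W" using u R1 by blast
    then show "\<exists>c. (\<lambda>x. v' x - (\<Sum>i<k. c i * u' i x)) \<in> W'" using lin[OF v order_refl, of c] R1 by blast
  qed
qed

lemma lin_corr_qdim:
  assumes R: "lin_corr V W V' W' R"
  shows "qdim V W = qdim V' W'"
proof (rule enat_eq_via_le)
  fix k
  have c: "csub V" "csub W" "csub V'" "csub W'" using R by (auto simp: lin_corr_def)
  show "qdim V W \<le> enat k \<longleftrightarrow> qdim V' W' \<le> enat k"
    unfolding qdim_le_iff[OF c(1,2)] qdim_le_iff[OF c(3,4)]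
    using lin_corr_gens[OF R] lin_corr_gens[OF lin_corr_sym[OF R]] by blast
qed

lemma csub_Zc: "csub (Zc J lam S q)"
  unfolding csub_def
proof (intro conjI ballI allI Zc_linear)
  show "(\<lambda>_. 0) \<in> Zc J lam S q" by (simp add: Zc_def eqvt_def cobd_alt)
qed

lemma zero_Bc: "(\<lambda>_. 0) \<in> Bc J lam S q"
  unfolding Bc_def by (auto simp: eqvt_def cobd_alt intro!: exI[of _ "\<lambda>_. 0"])

lemma csub_Bc: "csub (Bc J lam S q)"
  unfolding csub_def using Bc_linear zero_Bc by blast

lemma van_iff_qdim: "van J f lam Y q \<longleftrightarrow> qdim (ZZ J f lam Y q) (BB J f lam Y q) = 0"
  by (simp add: van_def qdim_eq_0_iff csub_Zc csub_Bc)

lemma small_deck_iff: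
  assumes "\<And>U. U \<in> \<U> \<Longrightarrow> deck_inv J U" "g \<in> Gam J" "singular_simplex q euclidean \<sigma>"
  shows "simplex_map q (deck g) \<sigma> \<in> small \<U> q \<longleftrightarrow> \<sigma> \<in> small \<U> q"
  using sys_of_deck_iff[OF assms(1) assms(2,3)] by (auto simp: small_def)

text \<open>Restriction identifies the quotients: \<open>small_cocycle_extends\<close> yields
  surjectivity, and \<open>small_vanishing_cocycle\<close> yields injectivity once a primitive on
  small simplices has been extended by zero.\<close>

lemma qdim_small:
  assumes AU: "A = \<Union>\<U>" and opn: "\<And>U. U \<in> \<U> \<Longrightarrow> openin (top_of_set A) U" and inv: "\<And>U. U \<in> \<U> \<Longrightarrow> deck_inv J U"
  shows "qdim (Zc J lam (sys_of A) q) (Bc J lam (sys_of A) q) = qdim (Zc J lam (small \<U>) q) (Bc J lam (small \<U>) q)"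
proof (rule lin_corr_qdim)
  define R where "R = (\<lambda>\<phi> \<psi>. \<phi> \<in> Zc J lam (sys_of A) q \<and> \<psi> \<in> Zc J lam (small \<U>) q \<and> (\<forall>\<sigma>\<in>small \<U> q. \<phi> \<sigma> = \<psi> \<sigma>))"
  note sub = small_sub[OF AU opn inv]
  note iA = deck_inv_A[OF AU opn inv]
  have B: "\<phi> \<in> Bc J lam (sys_of A) q \<longleftrightarrow> \<psi> \<in> Bc J lam (small \<U>) q" if R: "R \<phi> \<psi>" for \<phi> \<psi>
  proof
    assume "\<phi> \<in> Bc J lam (sys_of A) q"
    then have "\<phi> \<in> Bc J lam (small \<U>) q" using sub by (rule Bc_mono)
    moreover have "\<And>\<sigma>. \<sigma> \<in> small \<U> q \<Longrightarrow> \<phi> \<sigma> = \<psi> \<sigma>" using R by (auto simp: R_def)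
    ultimately show "\<psi> \<in> Bc J lam (small \<U>) q" by (rule Bc_cong)
  next
    assume b: "\<psi> \<in> Bc J lam (small \<U>) q"
    have phi: "\<phi> \<in> Zc J lam (sys_of A) q" using R by (simp add: R_def)
    show "\<phi> \<in> Bc J lam (sys_of A) q"
    proof (cases q)
      case 0
      show ?thesis by (rule small_vanishing_cocycle[OF AU opn inv phi]) (use b R 0 in \<open>auto simp: Bc_def R_def\<close>)
    next
      case (Suc r)
      obtain u where u: "eqvt J lam (small \<U>) r u" "\<forall>\<sigma>\<in>small \<U> q. \<psi> \<sigma> = cobd r u \<sigma>" using b Suc by (auto simp: Bc_def)
      define u' where "u' = (\<lambda>\<sigma>. if \<sigma> \<in> small \<U> r then u \<sigma> else 0)"
      have e: "eqvt J lam (sys_of A) r u'"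
        unfolding eqvt_def
      proof (intro ballI)
        fix \<sigma> g assume s: "\<sigma> \<in> sys_of A r" and g: "g \<in> Gam J"
        have "simplex_map r (deck g) \<sigma> \<in> small \<U> r \<longleftrightarrow> \<sigma> \<in> small \<U> r"
          by (rule small_deck_iff[OF inv g]) (use s in \<open>auto simp: sys_of_iff\<close>)
        then show "u' (simplex_map r (deck g) \<sigma>) = chi J lam g * u' \<sigma>" using u(1) g by (auto simp: u'_def eqvt_def)
      qed
      have bb: "cobd r u' \<in> Bc J lam (sys_of A) q" using e Suc by (auto simp: Bc_def)
      have zz: "cobd r u' \<in> Zc J lam (sys_of A) q"
        proof -
        have "eqvt J lam (sys_of A) (Suc r) (cobd r u')" by (rule eqvt_cobd[OF e iA])
        then show ?thesis using Bc_sub_Zc[OF iA bb] Suc by simp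
      qed
      have "(\<lambda>\<sigma>. \<phi> \<sigma> - cobd r u' \<sigma>) \<in> Bc J lam (sys_of A) q"
      proof (rule small_vanishing_cocycle[OF AU opn inv Zc_diff[OF phi zz]])
        fix \<sigma> assume s: "\<sigma> \<in> small \<U> q"
        have "cobd r u' \<sigma> = cobd r u \<sigma>"
        proof (rule cobd_cong)
          fix k assume "k \<le> Suc r"
          then have "singular_face (Suc r) k \<sigma> \<in> small \<U> r"
            using s Suc ssys_small[OF AU opn inv] unfolding ssys_def by blast
          then show "u' (singular_face (Suc r) k \<sigma>) = u (singular_face (Suc r) k \<sigma>)" by (simp add: u'_def)
        qed
        then show "\<phi> \<sigma> - cobd r u' \<sigma> = 0" using s u R by (auto simp: R_def)
      qed
      from Bc_linear[OF this bb, of 1 1] show ?thesis by simp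
    qed
  qed
  show "lin_corr (Zc J lam (sys_of A) q) (Bc J lam (sys_of A) q) (Zc J lam (small \<U>) q) (Bc J lam (small \<U>) q) R"
    unfolding lin_corr_def
  proof (intro conjI allI ballI impI csub_Zc csub_Bc)
    show "\<exists>\<psi>. R \<phi> \<psi>" if "\<phi> \<in> Zc J lam (sys_of A) q" for \<phi>
      using that Zc_mono[OF that sub] by (auto simp: R_def)
    show "\<exists>\<phi>. R \<phi> \<psi>" if "\<psi> \<in> Zc J lam (small \<U>) q" for \<psi>
      using small_cocycle_extends[OF AU opn inv that] that unfolding R_def by metis
    show "R (\<lambda>t. a * x t + b * y t) (\<lambda>t. a * x' t + b * y' t)" if "R x x'" "R y y'" for x x' y y' a b
      using that by (auto simp: R_def Zc_linear)
  qed (use B in \<open>auto simp: R_def\<close>)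
qed

section \<open>The Leray theorem for finite covers\<close>

text \<open>The usual sign of the vertex \<open>i\<close> in the ordered simplex \<open>K\<close>:
  the parity of its position, counted from 0.\<close>

definition ksgn :: "nat set \<Rightarrow> nat \<Rightarrow> complex" where
  "ksgn K i = (-1) ^ card {k\<in>K. k < i}"

lemma ksgn_sq [simp]: "ksgn K i * ksgn K i = 1"
  by (simp add: ksgn_def flip: power_mult_distrib)

lemma ksgn_remove:
  assumes "finite K" "k \<in> K"
  shows "ksgn (K - {k}) i = (if k < i then - ksgn K i else ksgn K i)"
proof (cases "k < i")
  case True
  have e: "{l\<in>K - {k}. l < i} = {l\<in>K. l < i} - {k}" by auto
  have "card {l\<in>K. l < i} = Suc (card {l\<in>K - {k}. l < i})"
    unfolding e using assms True by (subst card_Suc_Diff1) auto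
  then show ?thesis using True by (simp add: ksgn_def)
next
  case False
  then have "{l\<in>K - {k}. l < i} = {l\<in>K. l < i}" by auto
  then show ?thesis using False by (simp add: ksgn_def)
qed

lemma ksgn_anti:
  assumes "finite K" "i \<in> K" "k \<in> K" "i \<noteq> k"
  shows "ksgn K i * ksgn (K - {i}) k = - (ksgn K k * ksgn (K - {k}) i)"
  using assms by (auto simp: ksgn_remove not_less)

text \<open>In \<open>cechD\<close> the argument \<open>e\<close> carries the transition factors.\<close>

definition cechD :: "(nat set \<Rightarrow> nat \<Rightarrow> complex) \<Rightarrow> (nat set \<Rightarrow> complex) \<Rightarrow> nat set \<Rightarrow> complex" where
  "cechD e \<Psi> K = (\<Sum>i\<in>K. ksgn K i * e K i * \<Psi> (K - {i}))"

text \<open>Removing \<open>i\<close> and then \<open>k\<close> carries the opposite sign of the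
  reverse order, and by \<open>e\<close> the factors agree. So the double sum equals its own
  negative.\<close>

lemma cechD_cechD:
  assumes K: "finite K" and e: "\<And>i k. i \<in> K \<Longrightarrow> k \<in> K \<Longrightarrow> i \<noteq> k \<Longrightarrow> e K i * e (K - {i}) k = e K k * e (K - {k}) i"
  shows "cechD e (cechD e \<Psi>) K = 0"
proof -
  define F where "F i k = ksgn K i * ksgn (K - {i}) k * (e K i * e (K - {i}) k) * \<Psi> (K - {i} - {k})" for i k
  have anti: "F i k = - F k i" if "i \<in> K" "k \<in> K" "i \<noteq> k" for i k
  proof -
    have "K - {i} - {k} = K - {k} - {i}" by auto
    then show ?thesis unfolding F_def using ksgn_anti[OF K that] e[OF that] by simp
  qed
  let ?P = "{(i,k). i \<in> K \<and> k \<in> K \<and> i \<noteq> k}"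
  have fin: "finite ?P" by (rule finite_subset[of _ "K \<times> K"]) (use K in auto)
  have sig: "?P = Sigma K (\<lambda>i. K - {i})" by auto
  have "cechD e (cechD e \<Psi>) K = (\<Sum>i\<in>K. \<Sum>k\<in>K - {i}. F i k)"
    unfolding cechD_def F_def by (simp add: sum_distrib_left algebra_simps)
  also have "\<dots> = (\<Sum>(i,k)\<in>?P. F i k)"
    unfolding sig using K by (subst sum.Sigma) auto
  finally have s: "cechD e (cechD e \<Psi>) K = (\<Sum>(i,k)\<in>?P. F i k)" .
  have "(\<Sum>(i,k)\<in>?P. F i k) = (\<Sum>(i,k)\<in>?P. F k i)"
    by (rule sum.reindex_bij_witness[of _ prod.swap prod.swap]) auto
  also have "\<dots> = (\<Sum>(i,k)\<in>?P. - F i k)"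
  proof (rule sum.cong[OF refl], clarify)
    fix i k assume "i \<in> K" "k \<in> K" "i \<noteq> k"
    then show "F k i = - F i k" using anti[of k i] by simp
  qed
  also have "\<dots> = - (\<Sum>(i,k)\<in>?P. F i k)" by (simp add: sum_negf case_prod_unfold)
  finally show ?thesis unfolding s by simp
qed

text \<open>Logarithms of different charts differ on overlaps by the constants
  \<open>c i k j\<close>. These do not involve the weights, and this makes the Cech matrices entire
  in \<open>lam\<close> later on.\<close>

locale leray =
  fixes J :: "nat set" and f :: "nat \<Rightarrow> 'a::topological_space \<Rightarrow> complex" and lam :: "nat \<Rightarrow> complex"
    and m :: nat and U :: "nat \<Rightarrow> 'a set"
    and s :: "nat \<Rightarrow> nat \<Rightarrow> 'a \<Rightarrow> complex" and c :: "nat \<Rightarrow> nat \<Rightarrow> nat \<Rightarrow> complex"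
  assumes finJ: "finite J"
    and opn: "\<And>i. i < m \<Longrightarrow> openin (top_of_set (\<Union>i<m. U i)) (U i)"
    and cont: "\<And>i j. i < m \<Longrightarrow> j \<in> J \<Longrightarrow> continuous_on (U i) (s i j)"
    and expo: "\<And>i j x. i < m \<Longrightarrow> j \<in> J \<Longrightarrow> x \<in> U i \<Longrightarrow> exp (s i j x) = f j x"
    and trans: "\<And>i k j x. i < m \<Longrightarrow> k < m \<Longrightarrow> j \<in> J \<Longrightarrow> x \<in> U i \<Longrightarrow> x \<in> U k \<Longrightarrow> s i j x - s k j x = c i k j"
    and contr: "\<And>K. K \<subseteq> {..<m} \<Longrightarrow> K \<noteq> {} \<Longrightarrow> (\<Inter>i\<in>K. U i) \<noteq> {} \<Longrightarrow>
      \<exists>x0 H. continuous_on ({0..1} \<times> (\<Inter>i\<in>K. U i)) (\<lambda>z. H (fst z) (snd z)) \<and>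
        (\<forall>t\<in>{0..1::real}. \<forall>x\<in>(\<Inter>i\<in>K. U i). H t x \<in> (\<Inter>i\<in>K. U i)) \<and> (\<forall>x\<in>(\<Inter>i\<in>K. U i). H 0 x = x \<and> H 1 x = x0)"
begin

abbreviation UK :: "nat set \<Rightarrow> 'a set" where "UK K \<equiv> (\<Inter>i\<in>K. U i)"
abbreviation Y :: "'a set" where "Y \<equiv> (\<Union>i<m. U i)"
abbreviation \<U> :: "'a cov set set" where "\<U> \<equiv> (\<lambda>i. cover J f (U i)) ` {..<m}"

text \<open>For empty \<open>K\<close> these are all small simplices. The empty index set thus
  provides the augmentation of the double complex, which is the complex to be computed.\<close>

definition SK :: "nat set \<Rightarrow> 'a cov ssys" where
  "SK K q = {\<sigma> \<in> small \<U> q. \<forall>i\<in>K. \<sigma> \<in> sys_of (cover J f (U i)) q}"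

definition Kset :: "nat \<Rightarrow> nat set set" where
  "Kset P = {K. K \<subseteq> {..<m} \<and> card K = P}"

lemma Kset_finite: "K \<in> Kset P \<Longrightarrow> finite K" using finite_subset by (auto simp: Kset_def)

lemma cover_U: "cover J f Y = \<Union>\<U>" by (auto simp: cover_def)

lemma openin_U: "V \<in> \<U> \<Longrightarrow> openin (top_of_set (cover J f Y)) V"
  by (auto intro!: openin_cover opn)

lemma deck_inv_U: "V \<in> \<U> \<Longrightarrow> deck_inv J V"
  by (auto simp: deck_inv_cover)

lemma SK_UK:
  assumes "K \<subseteq> {..<m}" "K \<noteq> {}"
  shows "SK K q = sys_of (cover J f (UK K)) q"
proof -
  have "cover J f (UK K) = (\<Inter>i\<in>K. cover J f (U i))" using assms by (auto simp: cover_def)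
  moreover have "sys_of (\<Inter>i\<in>K. cover J f (U i)) q = (\<Inter>i\<in>K. sys_of (cover J f (U i)) q)"
    using assms(2) by (auto simp: sys_of_iff image_subset_iff)
  ultimately show ?thesis using assms by (fastforce simp: SK_def small_def)
qed

lemma SK_empty: "SK {} = small \<U>" by (auto simp: SK_def fun_eq_iff)

lemma SK_mono: "K \<subseteq> L \<Longrightarrow> SK L q \<subseteq> SK K q" by (auto simp: SK_def)

lemma SK_deck_iff:
  assumes "g \<in> Gam J" "singular_simplex q euclidean \<sigma>"
  shows "simplex_map q (deck g) \<sigma> \<in> SK K q \<longleftrightarrow> \<sigma> \<in> SK K q"
  unfolding SK_def using small_deck_iff[OF deck_inv_U assms] sys_of_deck_iff[OF deck_inv_cover assms] by auto

lemma SK_sing: "\<sigma> \<in> SK K q \<Longrightarrow> singular_simplex q euclidean \<sigma>"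
  by (auto simp: SK_def small_def sys_of_iff)

lemma ssys_SK: "ssys J (SK K)"
  unfolding ssys_def
proof (intro conjI allI ballI impI)
  show "singular_simplex q euclidean \<sigma>" if "\<sigma> \<in> SK K q" for q \<sigma> using that SK_sing by blast
  show "singular_face (Suc q) k \<sigma> \<in> SK K q" if "\<sigma> \<in> SK K (Suc q)" "k \<le> Suc q" for q k \<sigma>
    using that sys_of_face by (fastforce simp: SK_def small_def)
  show "simplex_map q (deck g) \<sigma> \<in> SK K q" if "g \<in> Gam J" "\<sigma> \<in> SK K q" for q g \<sigma>
    using that SK_deck_iff SK_sing by blast
qed

section \<open>The double complex of a cover\<close>

type_synonym 'c dbl = "nat set \<times> ((nat \<Rightarrow> real) \<Rightarrow> 'c cov) \<Rightarrow> complex"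

text \<open>\<open>P\<close> counts indices, so the Cech degree is \<open>P - 1\<close>, and
  \<open>P = 0\<close> is the augmentation by cochains on small simplices.\<close>

definition EE :: "nat \<Rightarrow> nat \<Rightarrow> 'a dbl set" where
  "EE P Q = {\<Psi>. \<forall>K\<in>Kset P. eqvt J lam (SK K) Q (\<lambda>\<sigma>. \<Psi> (K, \<sigma>))}"

definition hD :: "'a dbl \<Rightarrow> 'a dbl" where
  "hD \<Psi> = (\<lambda>(K, \<sigma>). cechD (\<lambda>_ _. 1) (\<lambda>L. \<Psi> (L, \<sigma>)) K)"

definition vD :: "nat \<Rightarrow> 'a dbl \<Rightarrow> 'a dbl" where
  "vD Q \<Psi> = (\<lambda>(K, \<sigma>). cobd Q (\<lambda>\<tau>. \<Psi> (K, \<tau>)) \<sigma>)"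

definition eqE :: "nat \<Rightarrow> nat \<Rightarrow> 'a dbl \<Rightarrow> 'a dbl \<Rightarrow> bool" where
  "eqE P Q \<Psi> \<Phi> \<longleftrightarrow> (\<forall>K\<in>Kset P. \<forall>\<sigma>\<in>SK K Q. \<Psi> (K, \<sigma>) = \<Phi> (K, \<sigma>))"

lemma Kset_remove: "K \<in> Kset (Suc P) \<Longrightarrow> i \<in> K \<Longrightarrow> K - {i} \<in> Kset P"
  using finite_subset[of K "{..<m}"] by (auto simp: Kset_def)

lemma hD_linear: "hD (\<lambda>t. a * x t + b * y t) = (\<lambda>t. a * hD x t + b * hD y t)"
  by (auto simp: hD_def cechD_def fun_eq_iff sum.distrib sum_distrib_left algebra_simps)

lemma vD_linear: "vD Q (\<lambda>t. a * x t + b * y t) = (\<lambda>t. a * vD Q x t + b * vD Q y t)"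
  by (auto simp: vD_def fun_eq_iff cobd_linear)

lemma hD_diff: "hD (\<lambda>t. x t - y t) = (\<lambda>t. hD x t - hD y t)"
  using hD_linear[of 1 x "-1" y] by simp

lemma vD_diff: "vD Q (\<lambda>t. x t - y t) = (\<lambda>t. vD Q x t - vD Q y t)"
  using vD_linear[of Q 1 x "-1" y] by simp

lemma csub_EE: "csub (EE P Q)"
  unfolding csub_def
proof (intro conjI ballI allI)
  show "(\<lambda>_. 0) \<in> EE P Q" by (simp add: EE_def eqvt_def)
  show "(\<lambda>x. a * u x + b * v x) \<in> EE P Q" if "u \<in> EE P Q" "v \<in> EE P Q" for u v a b
    using that eqvt_linear[of J lam "SK _" Q "\<lambda>\<sigma>. u (_, \<sigma>)" "\<lambda>\<sigma>. v (_, \<sigma>)"] by (simp add: EE_def)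
qed

lemma hD_EE: "\<Psi> \<in> EE P Q \<Longrightarrow> hD \<Psi> \<in> EE (Suc P) Q"
  unfolding EE_def
proof (intro CollectI ballI)
  fix K assume a: "\<Psi> \<in> {\<Psi>. \<forall>K\<in>Kset P. eqvt J lam (SK K) Q (\<lambda>\<sigma>. \<Psi> (K, \<sigma>))}" and K: "K \<in> Kset (Suc P)"
  show "eqvt J lam (SK K) Q (\<lambda>\<sigma>. hD \<Psi> (K, \<sigma>))"
    unfolding eqvt_def
  proof (intro ballI)
    fix \<sigma> g assume s: "\<sigma> \<in> SK K Q" and g: "g \<in> Gam J"
    have "\<Psi> (K - {i}, simplex_map Q (deck g) \<sigma>) = chi J lam g * \<Psi> (K - {i}, \<sigma>)" if "i \<in> K" for i
      using a Kset_remove[OF K that] s g SK_mono[of "K - {i}" K] by (auto simp: eqvt_def)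
    then show "hD \<Psi> (K, simplex_map Q (deck g) \<sigma>) = chi J lam g * hD \<Psi> (K, \<sigma>)"
      by (simp add: hD_def cechD_def sum_distrib_left algebra_simps)
  qed
qed

lemma vD_EE: "\<Psi> \<in> EE P Q \<Longrightarrow> vD Q \<Psi> \<in> EE P (Suc Q)"
  unfolding EE_def
proof (intro CollectI ballI)
  fix K assume a: "\<Psi> \<in> {\<Psi>. \<forall>K\<in>Kset P. eqvt J lam (SK K) Q (\<lambda>\<sigma>. \<Psi> (K, \<sigma>))}" and K: "K \<in> Kset P"
  show "eqvt J lam (SK K) (Suc Q) (\<lambda>\<sigma>. vD Q \<Psi> (K, \<sigma>))"
    unfolding eqvt_def
  proof (intro ballI)
    fix \<sigma> g assume s: "\<sigma> \<in> SK K (Suc Q)" and g: "g \<in> Gam J"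
    have "chains_in (SK K) Q (chain_boundary (Suc Q) (frag_of \<sigma>))"
      using chains_in_boundary[OF ssys_SK] s by simp
    from cev_eqvt[OF _ this g, of lam "\<lambda>\<sigma>. \<Psi> (K, \<sigma>)"] a K
    show "vD Q \<Psi> (K, simplex_map (Suc Q) (deck g) \<sigma>) = chi J lam g * vD Q \<Psi> (K, \<sigma>)"
      using chain_boundary_chain_map[of "Suc Q" euclidean "frag_of \<sigma>" "deck g"] SK_sing[OF s]
      by (simp add: vD_def cobd_def singular_chain_of)
  qed
qed

lemma hD_cong: "eqE P Q \<Psi> \<Phi> \<Longrightarrow> eqE (Suc P) Q (hD \<Psi>) (hD \<Phi>)"
  unfolding eqE_def hD_def cechD_def
  using Kset_remove SK_mono[of "_ - {_}"] by (auto intro!: sum.cong) blast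

lemma vD_cong: "eqE P Q \<Psi> \<Phi> \<Longrightarrow> eqE P (Suc Q) (vD Q \<Psi>) (vD Q \<Phi>)"
  unfolding eqE_def vD_def using ssys_SK by (auto intro!: cobd_cong simp: ssys_def)

lemma hD_hD: "eqE (Suc (Suc P)) Q (hD (hD \<Psi>)) (\<lambda>_. 0)"
  unfolding eqE_def hD_def using cechD_cechD[of _ "\<lambda>_ _. 1"] Kset_finite by auto

lemma vD_vD: "eqE P (Suc (Suc Q)) (vD (Suc Q) (vD Q \<Psi>)) (\<lambda>_. 0)"
  unfolding eqE_def vD_def by (auto intro!: cobd_cobd SK_sing)

lemma hD_vD: "hD (vD Q \<Psi>) = vD Q (hD \<Psi>)"
proof (intro ext, clarify)
  fix K \<sigma>
  have "hD (vD Q \<Psi>) (K, \<sigma>) = (\<Sum>i\<in>K. \<Sum>k\<le>Suc Q. ksgn K i * ((-1) ^ k * \<Psi> (K - {i}, singular_face (Suc Q) k \<sigma>)))"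
    by (simp add: hD_def vD_def cechD_def cobd_alt sum_distrib_left del: sum.atMost_Suc)
  also have "\<dots> = (\<Sum>k\<le>Suc Q. \<Sum>i\<in>K. ksgn K i * ((-1) ^ k * \<Psi> (K - {i}, singular_face (Suc Q) k \<sigma>)))"
    by (rule sum.swap)
  also have "\<dots> = vD Q (hD \<Psi>) (K, \<sigma>)"
    by (simp add: hD_def vD_def cechD_def cobd_alt sum_distrib_left algebra_simps del: sum.atMost_Suc)
  finally show "hD (vD Q \<Psi>) (K, \<sigma>) = vD Q (hD \<Psi>) (K, \<sigma>)" .
qed

lemma row_inj:
  assumes "eqE 1 Q (hD \<Psi>) (\<lambda>_. 0)"
  shows "eqE 0 Q \<Psi> (\<lambda>_. 0)"
  unfolding eqE_def
proof (intro ballI)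
  fix K \<sigma> assume K: "K \<in> Kset 0" and s: "\<sigma> \<in> SK K Q"
  then have K0: "K = {}" using Kset_finite[OF K] by (auto simp: Kset_def)
  obtain i where i: "i < m" "\<sigma> \<in> sys_of (cover J f (U i)) Q" using s by (auto simp: K0 SK_def small_def)
  then have "{i} \<in> Kset 1" "\<sigma> \<in> SK {i} Q" using s by (auto simp: Kset_def SK_def)
  then have "hD \<Psi> ({i}, \<sigma>) = 0" using assms by (auto simp: eqE_def)
  then show "\<Psi> (K, \<sigma>) = 0" by (simp add: hD_def cechD_def ksgn_def K0)
qed

text \<open>Each small simplex lies in a member of the cover of least index \<open>ix\<close>, and
  inserting this index into \<open>K\<close> is a contracting homotopy of the row. The index is deck
  invariant, so the homotopy preserves equivariance.\<close>

lemma row_exact: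
  assumes psi: "\<Psi> \<in> EE (Suc P) Q" and z: "eqE (Suc (Suc P)) Q (hD \<Psi>) (\<lambda>_. 0)"
  obtains \<Theta> where "\<Theta> \<in> EE P Q" "eqE (Suc P) Q (hD \<Theta>) \<Psi>"
proof -
  define ix where "ix = (\<lambda>\<sigma>. LEAST i. i < m \<and> \<sigma> \<in> sys_of (cover J f (U i)) Q)"
  have ix: "ix \<sigma> < m \<and> \<sigma> \<in> sys_of (cover J f (U (ix \<sigma>))) Q" if "\<sigma> \<in> small \<U> Q" for \<sigma>
    unfolding ix_def by (rule LeastI_ex) (use that in \<open>auto simp: small_def\<close>)
  define \<Theta> :: "'a dbl" where "\<Theta> = (\<lambda>(K, \<sigma>). if ix \<sigma> \<in> K then 0 else ksgn (insert (ix \<sigma>) K) (ix \<sigma>) * \<Psi> (insert (ix \<sigma>) K, \<sigma>))"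
  have ins: "insert (ix \<sigma>) K \<in> Kset (Suc r)" "\<sigma> \<in> SK (insert (ix \<sigma>) K) Q" if "K \<in> Kset r" "\<sigma> \<in> SK K Q" "ix \<sigma> \<notin> K" for K \<sigma> r
    using that ix[of \<sigma>] Kset_finite[OF that(1)] by (auto simp: Kset_def SK_def)
  have "\<Theta> \<in> EE P Q"
    unfolding EE_def eqvt_def
  proof (intro CollectI ballI)
    fix K \<sigma> g assume a: "K \<in> Kset P" "\<sigma> \<in> SK K Q" "g \<in> Gam J"
    have "ix (simplex_map Q (deck g) \<sigma>) = ix \<sigma>"
      unfolding ix_def using sys_of_deck_iff[OF deck_inv_cover a(3) SK_sing[OF a(2)]] by auto
    then show "\<Theta> (K, simplex_map Q (deck g) \<sigma>) = chi J lam g * \<Theta> (K, \<sigma>)"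
      using psi a(3) ins[OF a(1,2)] by (auto simp: \<Theta>_def EE_def eqvt_def)
  qed
  moreover have "eqE (Suc P) Q (hD \<Theta>) \<Psi>"
    unfolding eqE_def
  proof (intro ballI)
    fix K \<sigma> assume K: "K \<in> Kset (Suc P)" and s: "\<sigma> \<in> SK K Q"
    note fK = Kset_finite[OF K]
    define i where "i = ix \<sigma>"
    show "hD \<Theta> (K, \<sigma>) = \<Psi> (K, \<sigma>)"
    proof (cases "i \<in> K")
      case True
      have "hD \<Theta> (K, \<sigma>) = (\<Sum>k\<in>K. if k = i then \<Psi> (K, \<sigma>) else 0)"
        unfolding hD_def cechD_def prod.case
      proof (rule sum.cong[OF refl])
        fix k assume k: "k \<in> K"
        show "ksgn K k * 1 * \<Theta> (K - {k}, \<sigma>) = (if k = i then \<Psi> (K, \<sigma>) else 0)"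
        proof (cases "k = i")
          case True
          then have "insert i (K - {k}) = K" using \<open>i \<in> K\<close> by auto
          then show ?thesis using True by (simp add: \<Theta>_def i_def[symmetric] mult.assoc[symmetric])
        qed (use True in \<open>simp add: \<Theta>_def i_def\<close>)
      qed
      then show ?thesis using True fK by simp
    next
      case False
      define L where "L = insert i K"
      have L: "L \<in> Kset (Suc (Suc P))" "\<sigma> \<in> SK L Q" using ins[OF K s] False by (auto simp: L_def i_def)
      have LK: "L - {i} = K" using False by (auto simp: L_def)
      have "0 = hD \<Psi> (L, \<sigma>)" using z L by (auto simp: eqE_def)
      also have "\<dots> = ksgn L i * \<Psi> (K, \<sigma>) + (\<Sum>k\<in>K. ksgn L k * \<Psi> (L - {k}, \<sigma>))"
        using fK False by (simp add: hD_def cechD_def L_def LK[unfolded L_def])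
      finally have e: "(\<Sum>k\<in>K. ksgn L k * \<Psi> (L - {k}, \<sigma>)) = - (ksgn L i * \<Psi> (K, \<sigma>))" by (simp add: eq_neg_iff_add_eq_0 add.commute)
      have "hD \<Theta> (K, \<sigma>) = (\<Sum>k\<in>K. - ksgn L i * (ksgn L k * \<Psi> (L - {k}, \<sigma>)))"
        unfolding hD_def cechD_def prod.case
      proof (rule sum.cong[OF refl])
        fix k assume k: "k \<in> K"
        then have ki: "k \<noteq> i" using False by auto
        have Lk: "insert i (K - {k}) = L - {k}" using ki by (auto simp: L_def)
        have fL: "finite L" using fK by (simp add: L_def)
        have "ksgn L i * ksgn (L - {i}) k = - (ksgn L k * ksgn (L - {k}) i)"
          by (rule ksgn_anti[OF fL]) (use ki k in \<open>auto simp: L_def\<close>)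
        then have a: "ksgn L i * ksgn K k = - (ksgn L k * ksgn (L - {k}) i)" by (simp add: LK)
        have "ksgn K k * ksgn (L - {k}) i = ksgn L i * (ksgn L i * ksgn K k) * ksgn (L - {k}) i"
          by (simp flip: mult.assoc)
        also have "\<dots> = - ksgn L i * ksgn L k * (ksgn (L - {k}) i * ksgn (L - {k}) i)"
          unfolding a by (simp only: mult.assoc mult_minus_left mult_minus_right)
        finally have "ksgn K k * ksgn (L - {k}) i = - ksgn L i * ksgn L k" by simp
        then show "ksgn K k * 1 * \<Theta> (K - {k}, \<sigma>) = - ksgn L i * (ksgn L k * \<Psi> (L - {k}, \<sigma>))"
          using False by (simp add: \<Theta>_def i_def[symmetric] Lk mult.assoc[symmetric])
      qed
      also have "\<dots> = - ksgn L i * (\<Sum>k\<in>K. ksgn L k * \<Psi> (L - {k}, \<sigma>))" by (simp add: sum_distrib_left)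
      also have "\<dots> = \<Psi> (K, \<sigma>)" unfolding e by (simp flip: mult.assoc)
      finally show ?thesis .
    qed
  qed
  ultimately show ?thesis by (rule that)
qed

text \<open>During the contraction the logarithms are read off in one chart containing the whole
  intersection, so the contraction lifts to the cover.\<close>

lemma contraction_hmor:
  assumes K: "K \<subseteq> {..<m}" "K \<noteq> {}" and ne: "UK K \<noteq> {}" and i: "i \<in> K"
  obtains x0 H G where "x0 \<in> UK K" "hmor J f (UK K) f (UK K) H G"
     "\<And>x. x \<in> UK K \<Longrightarrow> H 0 x = x" "\<And>x. x \<in> UK K \<Longrightarrow> H 1 x = x0"
     "\<And>t j x. G t j x = s i j (H t x) - s i j x"
proof -
  obtain x0 H where H: "continuous_on ({0..1} \<times> UK K) (\<lambda>z. H (fst z) (snd z))"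
     "\<forall>t\<in>{0..1::real}. \<forall>x\<in>UK K. H t x \<in> UK K" "\<forall>x\<in>UK K. H 0 x = x \<and> H 1 x = x0"
    using contr[OF K ne] by blast
  define G where "G = (\<lambda>t j x. s i j (H t x) - s i j x)"
  have im: "i < m" using i K by auto
  have "continuous_on ({0..1} \<times> UK K) (\<lambda>z. G (fst z) j (snd z))" if "j \<in> J" for j
    unfolding G_def
    by (intro continuous_on_diff continuous_on_compose2[OF cont[OF im that] H(1)]
         continuous_on_compose2[OF cont[OF im that]] continuous_on_snd continuous_on_id)
      (use H(2) i in auto)
  moreover have "f j (H t x) = f j x * exp (G t j x)" if "t \<in> {0..1}" "x \<in> UK K" "j \<in> J" for t x j
  proof -
    have "H t x \<in> U i" "x \<in> U i" using H(2) that i by blast+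
    then have e: "exp (s i j (H t x)) = f j (H t x)" "exp (s i j x) = f j x" using expo[OF im that(3)] by auto
    have "exp (G t j x) = f j (H t x) / f j x" unfolding G_def exp_diff e ..
    moreover have "f j x \<noteq> 0" using e(2) by (metis exp_not_eq_zero)
    ultimately show ?thesis by simp
  qed
  ultimately have "hmor J f (UK K) f (UK K) H G" using H by (auto simp: hmor_def)
  moreover have "x0 \<in> UK K"
  proof -
    obtain x where x: "x \<in> UK K" using ne by blast
    then have "H 1 x \<in> UK K" using H(2) by force
    then show ?thesis using H(3) x by metis
  qed
  ultimately show ?thesis using that H(3) by (simp add: G_def)
qed

lemma van_UK:
  assumes K: "K \<subseteq> {..<m}" "K \<noteq> {}" and q: "q > 0"
  shows "van J f lam (UK K) q"
proof (cases "UK K = {}")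
  case True then show ?thesis using van_empty by metis
next
  case False
  obtain i where i: "i \<in> K" using K by blast
  obtain x0 H G where H: "x0 \<in> UK K" "hmor J f (UK K) f (UK K) H G"
     "\<And>x. x \<in> UK K \<Longrightarrow> H 0 x = x" "\<And>x. x \<in> UK K \<Longrightarrow> H 1 x = x0"
     "\<And>t j x. G t j x = s i j (H t x) - s i j x"
    using contraction_hmor[OF K False i] by blast
  show ?thesis
    by (rule van_retract[OF H(2), of "{x0}"]) (use H van_point[OF q] in auto)
qed

lemma col_exact:
  assumes psi: "\<Psi> \<in> EE (Suc P) (Suc Q)" and z: "eqE (Suc P) (Suc (Suc Q)) (vD (Suc Q) \<Psi>) (\<lambda>_. 0)"
  obtains \<Theta> where "\<Theta> \<in> EE (Suc P) Q" "eqE (Suc P) (Suc Q) (vD Q \<Theta>) \<Psi>"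
proof -
  have "\<exists>\<psi>. eqvt J lam (SK K) Q \<psi> \<and> (\<forall>\<sigma>\<in>SK K (Suc Q). \<Psi> (K, \<sigma>) = cobd Q \<psi> \<sigma>)" if K: "K \<in> Kset (Suc P)" for K
  proof -
    have K': "K \<subseteq> {..<m}" "K \<noteq> {}" using K by (auto simp: Kset_def)
    note S = SK_UK[OF K']
    have Sf: "SK K = sys_of (cover J f (UK K))" using S by (intro ext) simp
    have "(\<lambda>\<sigma>. \<Psi> (K, \<sigma>)) \<in> ZZ J f lam (UK K) (Suc Q)"
      unfolding Zc_def using psi z K by (auto simp: EE_def eqE_def vD_def Sf)
    then have "(\<lambda>\<sigma>. \<Psi> (K, \<sigma>)) \<in> BB J f lam (UK K) (Suc Q)" using van_UK[OF K'] by (auto simp: van_def)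
    then show ?thesis by (auto simp: Bc_def Sf)
  qed
  then obtain th where th: "\<And>K. K \<in> Kset (Suc P) \<Longrightarrow> eqvt J lam (SK K) Q (th K) \<and> (\<forall>\<sigma>\<in>SK K (Suc Q). \<Psi> (K, \<sigma>) = cobd Q (th K) \<sigma>)"
    by metis
  show ?thesis
    by (rule that[of "\<lambda>(K, \<sigma>). th K \<sigma>"]) (use th in \<open>auto simp: EE_def eqE_def vD_def\<close>)
qed

end

text \<open>Sections over the intersection indexed by \<open>K\<close> are written in the chart
  \<open>Min K\<close>. The factor expresses the section of the chart of \<open>K - {i}\<close>
  through that of \<open>K\<close>.\<close>

definition ctrans :: "(nat \<Rightarrow> nat \<Rightarrow> nat \<Rightarrow> complex) \<Rightarrow> nat set \<Rightarrow> (nat \<Rightarrow> complex) \<Rightarrow> nat set \<Rightarrow> nat \<Rightarrow> complex" where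
  "ctrans c J lam K i = exp (- (\<Sum>j\<in>J. lam j * c (Min K) (Min (K - {i})) j))"

definition cechZ where
  "cechZ \<N> c J lam q = {\<psi>. \<forall>K\<in>\<N>. card K = Suc (Suc q) \<longrightarrow> cechD (ctrans c J lam) \<psi> K = 0}"

definition cechB where
  "cechB \<N> c J lam q = {\<psi>. if q = 0 then \<forall>K\<in>\<N>. card K = 1 \<longrightarrow> \<psi> K = 0
     else \<exists>\<theta>. \<forall>K\<in>\<N>. card K = Suc q \<longrightarrow> \<psi> K = cechD (ctrans c J lam) \<theta> K}"

lemma cechD_linear: "cechD e (\<lambda>t. a * x t + b * y t) K = a * cechD e x K + b * cechD e y K"
  by (simp add: cechD_def sum.distrib sum_distrib_left algebra_simps)

lemma csub_cechZ: "csub (cechZ \<N> c J lam q)"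
  by (auto simp: csub_def cechZ_def cechD_linear) (simp add: cechD_def)

lemma csub_cechB: "csub (cechB \<N> c J lam q)"
proof (cases "q = 0")
  case False
  show ?thesis
    unfolding csub_def
  proof (intro conjI ballI allI)
    show "(\<lambda>_. 0) \<in> cechB \<N> c J lam q"
      using False by (auto simp: cechB_def cechD_def intro!: exI[of _ "\<lambda>_. 0"])
    fix u v a b assume "u \<in> cechB \<N> c J lam q" "v \<in> cechB \<N> c J lam q"
    then obtain x y where "\<forall>K\<in>\<N>. card K = Suc q \<longrightarrow> u K = cechD (ctrans c J lam) x K" "\<forall>K\<in>\<N>. card K = Suc q \<longrightarrow> v K = cechD (ctrans c J lam) y K"
      using False by (auto simp: cechB_def)
    then show "(\<lambda>x. a * u x + b * v x) \<in> cechB \<N> c J lam q"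
      using False by (auto simp: cechB_def cechD_linear intro!: exI[of _ "\<lambda>t. a * x t + b * y t"])
  qed
qed (auto simp: csub_def cechB_def)

section \<open>The zigzag through the double complex\<close>

context leray
begin

definition NN :: "nat \<Rightarrow> nat \<Rightarrow> 'a dbl set" where
  "NN P Q = {\<Psi> \<in> EE P Q. eqE (Suc P) Q (hD \<Psi>) (\<lambda>_. 0) \<and> eqE P (Suc Q) (vD Q \<Psi>) (\<lambda>_. 0)}"

text \<open>Cochains closed in both directions (\<open>NN\<close>) modulo double coboundaries: these
  quotients agree along each antidiagonal and join the augmentation column to the bottom row. In the
  bottom row no lower row exists, so there \<open>BN\<close> consists of horizontal coboundaries of
  vertical cocycles, and of 0 if \<open>P = 1\<close>.\<close>

definition BN :: "nat \<Rightarrow> nat \<Rightarrow> 'a dbl set" where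
  "BN P Q = {\<Psi>. if Q = 0 then (if P = 1 then eqE P Q \<Psi> (\<lambda>_. 0)
        else \<exists>z\<in>EE (P - 1) 0. eqE (P - 1) 1 (vD 0 z) (\<lambda>_. 0) \<and> eqE P Q \<Psi> (hD z))
     else \<exists>z\<in>EE (P - 1) (Q - 1). eqE P Q \<Psi> (hD (vD (Q - 1) z))}"

lemma eqE_refl: "eqE P Q x x" by (simp add: eqE_def)
lemma eqE_sym: "eqE P Q x y \<Longrightarrow> eqE P Q y x" by (simp add: eqE_def)
lemma eqE_trans: "eqE P Q x y \<Longrightarrow> eqE P Q y z \<Longrightarrow> eqE P Q x z" by (simp add: eqE_def)
lemma eqE_diff: "eqE P Q (\<lambda>t. x t - y t) (\<lambda>_. 0) \<longleftrightarrow> eqE P Q x y" by (simp add: eqE_def)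
lemma eqE_lin: "eqE P Q x x' \<Longrightarrow> eqE P Q y y' \<Longrightarrow> eqE P Q (\<lambda>t. a * x t + b * y t) (\<lambda>t. a * x' t + b * y' t)" by (simp add: eqE_def)
lemma eqE_lin0: "eqE P Q x (\<lambda>_. 0) \<Longrightarrow> eqE P Q y (\<lambda>_. 0) \<Longrightarrow> eqE P Q (\<lambda>t. a * x t + b * y t) (\<lambda>_. 0)" by (simp add: eqE_def)

lemma hD_0: "hD (\<lambda>_. 0) = (\<lambda>_. 0)" by (auto simp: hD_def cechD_def)
lemma vD_0: "vD Q (\<lambda>_. 0) = (\<lambda>_. 0)" by (auto simp: vD_def cobd_alt)

lemma csub_NN: "csub (NN P Q)"
  unfolding csub_def NN_def
proof (intro conjI ballI allI CollectI; (elim CollectE conjE)?)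
  show "(\<lambda>_. 0) \<in> EE P Q" using csub_EE by (simp add: csub_def)
  fix u v a b assume a: "u \<in> EE P Q" "v \<in> EE P Q" "eqE (Suc P) Q (hD u) (\<lambda>_. 0)" "eqE P (Suc Q) (vD Q u) (\<lambda>_. 0)"
    "eqE (Suc P) Q (hD v) (\<lambda>_. 0)" "eqE P (Suc Q) (vD Q v) (\<lambda>_. 0)"
  show "(\<lambda>x. a * u x + b * v x) \<in> EE P Q" by (rule csubD[OF csub_EE a(1,2)])
  show "eqE (Suc P) Q (hD (\<lambda>x. a * u x + b * v x)) (\<lambda>_. 0)" unfolding hD_linear by (rule eqE_lin0) fact+
  show "eqE P (Suc Q) (vD Q (\<lambda>x. a * u x + b * v x)) (\<lambda>_. 0)" unfolding vD_linear by (rule eqE_lin0) fact+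
qed (simp_all add: hD_0 vD_0 eqE_refl)

lemma csub_BN: "csub (BN P Q)"
proof (cases "Q = 0")
  case True
  show ?thesis
  proof (cases "P = 1")
    case False
    have z: "(\<lambda>_. 0) \<in> EE (P - 1) 0" using csub_EE by (simp add: csub_def)
    show ?thesis
      unfolding csub_def
    proof (intro conjI ballI allI)
      show "(\<lambda>_. 0) \<in> BN P Q" unfolding BN_def using False True z by (auto intro!: bexI[of _ "\<lambda>_. 0"] simp: hD_0 vD_0 eqE_refl)
      fix u v a b assume "u \<in> BN P Q" "v \<in> BN P Q"
      then obtain x y where x: "x \<in> EE (P - 1) 0" "eqE (P - 1) 1 (vD 0 x) (\<lambda>_. 0)" "eqE P Q u (hD x)"
         and y: "y \<in> EE (P - 1) 0" "eqE (P - 1) 1 (vD 0 y) (\<lambda>_. 0)" "eqE P Q v (hD y)"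
        using False True by (auto simp: BN_def)
      have "(\<lambda>t. a * x t + b * y t) \<in> EE (P - 1) 0" by (rule csubD[OF csub_EE x(1) y(1)])
      moreover have "eqE (P - 1) 1 (vD 0 (\<lambda>t. a * x t + b * y t)) (\<lambda>_. 0)" unfolding vD_linear by (rule eqE_lin0[OF x(2) y(2)])
      moreover have "eqE P Q (\<lambda>t. a * u t + b * v t) (hD (\<lambda>t. a * x t + b * y t))" unfolding hD_linear by (rule eqE_lin[OF x(3) y(3)])
      ultimately show "(\<lambda>x. a * u x + b * v x) \<in> BN P Q" unfolding BN_def using False True by auto
    qed
  qed (use True in \<open>auto simp: csub_def BN_def eqE_def\<close>)
next
  case False
  have z: "(\<lambda>_. 0) \<in> EE (P - 1) (Q - 1)" using csub_EE by (simp add: csub_def)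
  show ?thesis
    unfolding csub_def
  proof (intro conjI ballI allI)
    show "(\<lambda>_. 0) \<in> BN P Q" unfolding BN_def using False z by (auto intro!: bexI[of _ "\<lambda>_. 0"] simp: hD_0 vD_0 eqE_refl)
    fix u v a b assume "u \<in> BN P Q" "v \<in> BN P Q"
    then obtain x y where x: "x \<in> EE (P - 1) (Q - 1)" "eqE P Q u (hD (vD (Q - 1) x))"
       and y: "y \<in> EE (P - 1) (Q - 1)" "eqE P Q v (hD (vD (Q - 1) y))"
      using False by (auto simp: BN_def)
    have "(\<lambda>t. a * x t + b * y t) \<in> EE (P - 1) (Q - 1)" by (rule csubD[OF csub_EE x(1) y(1)])
    moreover have "eqE P Q (\<lambda>t. a * u t + b * v t) (hD (vD (Q - 1) (\<lambda>t. a * x t + b * y t)))"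
      unfolding hD_linear vD_linear by (rule eqE_lin[OF x(2) y(2)])
    ultimately show "(\<lambda>x. a * u x + b * v x) \<in> BN P Q" unfolding BN_def using False by auto
  qed
qed

lemma Kset_0: "Kset 0 = {{}}"
  using finite_subset[of _ "{..<m}"] by (auto simp: Kset_def)

definition emb :: "(((nat \<Rightarrow> real) \<Rightarrow> 'a cov) \<Rightarrow> complex) \<Rightarrow> 'a dbl" where
  "emb \<phi> = (\<lambda>(K, \<sigma>). \<phi> \<sigma>)"

lemma emb_EE: "emb \<phi> \<in> EE 0 q \<longleftrightarrow> eqvt J lam (small \<U>) q \<phi>"
  by (simp add: EE_def Kset_0 emb_def SK_empty)

lemma emb_eqE: "eqE 0 q (emb \<phi>) \<Psi> \<longleftrightarrow> (\<forall>\<sigma>\<in>small \<U> q. \<phi> \<sigma> = \<Psi> ({}, \<sigma>))"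
  by (simp add: eqE_def Kset_0 emb_def SK_empty)

lemma vD_emb: "vD q (emb \<phi>) = emb (cobd q \<phi>)"
  by (auto simp: vD_def emb_def)

lemma qdim_step0:
  "qdim (Zc J lam (small \<U>) q) (Bc J lam (small \<U>) q) = qdim (NN 1 q) (BN 1 q)"
proof (rule lin_corr_qdim)
  define R where "R = (\<lambda>\<phi> \<Psi>. \<phi> \<in> Zc J lam (small \<U>) q \<and> \<Psi> \<in> NN 1 q \<and> eqE 1 q \<Psi> (hD (emb \<phi>)))"
  have inj: "eqE 0 q' x y" if "eqE 1 q' (hD x) (hD y)" for x y q'
  proof -
    have "eqE 1 q' (hD (\<lambda>t. x t - y t)) (\<lambda>_. 0)" unfolding hD_diff eqE_diff by (rule that)
    from row_inj[OF this] show ?thesis by (simp add: eqE_diff)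
  qed
  have W: "\<phi> \<in> Bc J lam (small \<U>) q \<longleftrightarrow> \<Psi> \<in> BN 1 q" if R: "R \<phi> \<Psi>" for \<phi> \<Psi>
  proof -
    have e: "eqE 1 q \<Psi> (hD (emb \<phi>))" using R by (simp add: R_def)
    show ?thesis
    proof (cases q)
      case 0
      have "\<phi> \<in> Bc J lam (small \<U>) q \<longleftrightarrow> eqE 0 q (emb \<phi>) (\<lambda>_. 0)" by (simp add: Bc_def 0 emb_eqE)
      also have "\<dots> \<longleftrightarrow> eqE 1 q (hD (emb \<phi>)) (\<lambda>_. 0)"
        using row_inj hD_cong[of 0 q "emb \<phi>" "\<lambda>_. 0"] by (auto simp: hD_0)
      also have "\<dots> \<longleftrightarrow> eqE 1 q \<Psi> (\<lambda>_. 0)" using e eqE_trans eqE_sym by blast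
      finally show ?thesis by (simp add: BN_def 0)
    next
      case (Suc r)
      show ?thesis
      proof
        assume "\<phi> \<in> Bc J lam (small \<U>) q"
        then obtain u where u: "eqvt J lam (small \<U>) r u" "\<forall>\<sigma>\<in>small \<U> q. \<phi> \<sigma> = cobd r u \<sigma>" by (auto simp: Bc_def Suc)
        then have "eqE 0 q (emb \<phi>) (vD r (emb u))" by (simp add: emb_eqE vD_emb) (simp add: emb_def)
        then have "eqE 1 q \<Psi> (hD (vD r (emb u)))" using hD_cong e eqE_trans by (metis One_nat_def)
        then show "\<Psi> \<in> BN 1 q" unfolding BN_def using u(1) by (auto simp: Suc emb_EE)
      next
        assume "\<Psi> \<in> BN 1 q"
        then obtain z where z: "z \<in> EE 0 r" "eqE 1 q \<Psi> (hD (vD r z))" by (auto simp: BN_def Suc)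
        then have "eqE 0 q (emb \<phi>) (vD r z)" using inj e eqE_trans eqE_sym by blast
        then have "\<forall>\<sigma>\<in>small \<U> q. \<phi> \<sigma> = cobd r (\<lambda>\<tau>. z ({}, \<tau>)) \<sigma>" by (simp add: emb_eqE vD_def)
        then show "\<phi> \<in> Bc J lam (small \<U>) q" unfolding Bc_def using z(1) by (auto simp: Suc EE_def Kset_0 SK_empty)
      qed
    qed
  qed
  show "lin_corr (Zc J lam (small \<U>) q) (Bc J lam (small \<U>) q) (NN 1 q) (BN 1 q) R"
    unfolding lin_corr_def
  proof (intro conjI allI ballI impI csub_Zc csub_Bc csub_NN csub_BN)
    fix \<phi> assume p: "\<phi> \<in> Zc J lam (small \<U>) q"
    have "hD (emb \<phi>) \<in> NN 1 q"
      unfolding NN_def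
    proof (intro CollectI conjI)
      show "hD (emb \<phi>) \<in> EE 1 q" using hD_EE[of "emb \<phi>" 0 q] p by (simp add: emb_EE Zc_def)
      show "eqE (Suc 1) q (hD (hD (emb \<phi>))) (\<lambda>_. 0)" using hD_hD[of 0] by simp
      have "eqE 0 (Suc q) (vD q (emb \<phi>)) (\<lambda>_. 0)" using p by (simp add: vD_emb emb_eqE Zc_def)
      from hD_cong[OF this] show "eqE 1 (Suc q) (vD q (hD (emb \<phi>))) (\<lambda>_. 0)" by (simp add: hD_0 hD_vD)
    qed
    then show "\<exists>\<Psi>. R \<phi> \<Psi>" using p eqE_refl by (auto simp: R_def)
  next
    fix \<Psi> assume n: "\<Psi> \<in> NN 1 q"
    then obtain \<Theta> where t: "\<Theta> \<in> EE 0 q" "eqE 1 q (hD \<Theta>) \<Psi>" using row_exact[of \<Psi> 0 q] by (auto simp: NN_def)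
    define \<phi> where "\<phi> = (\<lambda>\<sigma>. \<Theta> ({}, \<sigma>))"
    have et: "eqE 0 q (emb \<phi>) \<Theta>" by (simp add: emb_eqE \<phi>_def)
    have "eqE 1 (Suc q) (hD (vD q \<Theta>)) (\<lambda>_. 0)"
      unfolding hD_vD using vD_cong[OF t(2)] n eqE_trans by (auto simp: NN_def)
    from row_inj[OF this] have "eqE 0 (Suc q) (vD q \<Theta>) (\<lambda>_. 0)" .
    then have "\<phi> \<in> Zc J lam (small \<U>) q" using t(1)
      by (auto simp: Zc_def eqE_def Kset_0 SK_empty vD_def \<phi>_def EE_def)
    moreover have "eqE 1 q \<Psi> (hD (emb \<phi>))" using hD_cong[OF et] t(2) eqE_trans eqE_sym by (metis One_nat_def)
    ultimately show "\<exists>\<phi>. R \<phi> \<Psi>" using n by (auto simp: R_def)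
  next
    fix x x' y y' a b assume r: "R x x'" "R y y'"
    have "hD (emb (\<lambda>t. a * x t + b * y t)) = (\<lambda>t. a * hD (emb x) t + b * hD (emb y) t)"
      using hD_linear[of a "emb x" b "emb y"] by (simp add: emb_def case_prod_unfold)
    then show "R (\<lambda>t. a * x t + b * y t) (\<lambda>t. a * x' t + b * y' t)"
      using r csubD[OF csub_NN] by (auto simp: R_def Zc_linear eqE_lin)
  qed (use W in \<open>auto simp: R_def\<close>)
qed

text \<open>One stair of the zigzag: \<open>\<Psi>\<close> and \<open>\<Psi>'\<close> correspond if
  a common \<open>y\<close> has \<open>\<Psi>\<close> as its vertical and \<open>\<Psi>'\<close> as
  its horizontal coboundary. Exactness of columns finds \<open>y\<close> from \<open>\<Psi>\<close>,
  exactness of rows finds it from \<open>\<Psi>'\<close>.\<close>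

lemma qdim_step:
  assumes P: "P \<ge> 1"
  shows "qdim (NN P (Suc Q)) (BN P (Suc Q)) = qdim (NN (Suc P) Q) (BN (Suc P) Q)"
proof (rule lin_corr_qdim)
  obtain P' where P': "P = Suc P'" using P by (cases P) auto
  define R where "R = (\<lambda>\<Psi> \<Psi>'. \<Psi> \<in> NN P (Suc Q) \<and> \<Psi>' \<in> NN (Suc P) Q \<and>
     (\<exists>y\<in>EE P Q. eqE P (Suc Q) \<Psi> (vD Q y) \<and> eqE (Suc P) Q \<Psi>' (hD y)))"
  have W: "\<Psi> \<in> BN P (Suc Q) \<longleftrightarrow> \<Psi>' \<in> BN (Suc P) Q" if R: "R \<Psi> \<Psi>'" for \<Psi> \<Psi>'
  proof -
    obtain y where y: "y \<in> EE P Q" "eqE P (Suc Q) \<Psi> (vD Q y)" "eqE (Suc P) Q \<Psi>' (hD y)" using R by (auto simp: R_def)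
    have B1: "\<Psi> \<in> BN P (Suc Q) \<longleftrightarrow> (\<exists>th\<in>EE P' Q. eqE P (Suc Q) (vD Q y) (vD Q (hD th)))"
    proof -
      have "eqE P (Suc Q) \<Psi> w \<longleftrightarrow> eqE P (Suc Q) (vD Q y) w" for w using y(2) eqE_trans eqE_sym by blast
      then show ?thesis unfolding BN_def by (simp add: P' hD_vD)
    qed
    show ?thesis
    proof
      assume "\<Psi> \<in> BN P (Suc Q)"
      then obtain th where th: "th \<in> EE P' Q" "eqE P (Suc Q) (vD Q y) (vD Q (hD th))" using B1 by blast
      define w where "w = (\<lambda>t. y t - hD th t)"
      have hth: "hD th \<in> EE P Q" using hD_EE[OF th(1)] by (simp add: P')
      have w: "w \<in> EE P Q" unfolding w_def by (rule csub_diff[OF csub_EE y(1) hth])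
      have vw: "eqE P (Suc Q) (vD Q w) (\<lambda>_. 0)" unfolding w_def vD_diff eqE_diff by (rule th(2))
      have "eqE (Suc P) Q (hD (hD th)) (\<lambda>_. 0)" using hD_hD[of P'] by (simp add: P')
      then have hw: "eqE (Suc P) Q \<Psi>' (hD w)" unfolding w_def hD_diff using y(3) by (simp add: eqE_def)
      show "\<Psi>' \<in> BN (Suc P) Q"
      proof (cases Q)
        case 0
        then show ?thesis unfolding BN_def using w vw hw P by (auto simp: P')
      next
        case (Suc Q')
        obtain z where z: "z \<in> EE P Q'" "eqE P Q (vD Q' z) w" using col_exact[of w P' Q'] w vw by (auto simp: P' Suc)
        have "eqE (Suc P) Q \<Psi>' (hD (vD Q' z))" using hw hD_cong[OF z(2)] eqE_trans eqE_sym by blast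
        then show ?thesis unfolding BN_def using z(1) by (auto simp: Suc)
      qed
    next
      assume b: "\<Psi>' \<in> BN (Suc P) Q"
      obtain z where z: "z \<in> EE P Q" "eqE P (Suc Q) (vD Q z) (\<lambda>_. 0)" "eqE (Suc P) Q \<Psi>' (hD z)"
      proof (cases Q)
        case 0
        then show ?thesis using b P that by (auto simp: BN_def P')
      next
        case (Suc Q')
        then obtain z where "z \<in> EE P Q'" "eqE (Suc P) Q \<Psi>' (hD (vD Q' z))" using b by (auto simp: BN_def)
        then show ?thesis using that[of "vD Q' z"] vD_EE[of z P Q'] vD_vD[of P Q' z] by (simp add: Suc)
      qed
      have "eqE (Suc P) Q (hD (\<lambda>t. y t - z t)) (\<lambda>_. 0)" unfolding hD_diff eqE_diff using y(3) z(3) eqE_trans eqE_sym by blast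
      moreover have "(\<lambda>t. y t - z t) \<in> EE P Q" by (rule csub_diff[OF csub_EE y(1) z(1)])
      ultimately obtain th where th: "th \<in> EE P' Q" "eqE P Q (hD th) (\<lambda>t. y t - z t)" using row_exact[of "\<lambda>t. y t - z t" P' Q] by (auto simp: P')
      have "eqE P (Suc Q) (vD Q (hD th)) (vD Q y)"
        using vD_cong[OF th(2)] z(2) unfolding vD_diff by (simp add: eqE_def)
      then show "\<Psi> \<in> BN P (Suc Q)" unfolding B1 using th(1) eqE_sym by blast
    qed
  qed
  show "lin_corr (NN P (Suc Q)) (BN P (Suc Q)) (NN (Suc P) Q) (BN (Suc P) Q) R"
    unfolding lin_corr_def
  proof (intro conjI allI ballI impI csub_NN csub_BN)
    fix \<Psi> assume n: "\<Psi> \<in> NN P (Suc Q)"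
    then obtain y where y: "y \<in> EE P Q" "eqE P (Suc Q) (vD Q y) \<Psi>" using col_exact[of \<Psi> P' Q] by (auto simp: NN_def P')
    have "hD y \<in> NN (Suc P) Q"
      unfolding NN_def
    proof (intro CollectI conjI hD_EE y hD_hD)
      have "eqE (Suc P) (Suc Q) (hD (vD Q y)) (hD \<Psi>)" by (rule hD_cong[OF y(2)])
      then show "eqE (Suc P) (Suc Q) (vD Q (hD y)) (\<lambda>_. 0)" unfolding hD_vD using n eqE_trans by (auto simp: NN_def)
    qed
    then show "\<exists>\<Psi>'. R \<Psi> \<Psi>'" unfolding R_def using n y eqE_refl eqE_sym by blast
  next
    fix \<Psi>' assume n: "\<Psi>' \<in> NN (Suc P) Q"
    then obtain y where y: "y \<in> EE P Q" "eqE (Suc P) Q (hD y) \<Psi>'" using row_exact[of \<Psi>' P Q] by (auto simp: NN_def)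
    have "vD Q y \<in> NN P (Suc Q)"
      unfolding NN_def
    proof (intro CollectI conjI vD_EE y vD_vD)
      have "eqE (Suc P) (Suc Q) (vD Q (hD y)) (vD Q \<Psi>')" by (rule vD_cong[OF y(2)])
      then show "eqE (Suc P) (Suc Q) (hD (vD Q y)) (\<lambda>_. 0)" unfolding hD_vD using n eqE_trans by (auto simp: NN_def)
    qed
    then show "\<exists>\<Psi>. R \<Psi> \<Psi>'" unfolding R_def using n y eqE_refl eqE_sym by blast
  next
    fix x x' y y' a b assume r: "R x x'" "R y y'"
    then obtain u v where u: "u \<in> EE P Q" "eqE P (Suc Q) x (vD Q u)" "eqE (Suc P) Q x' (hD u)"
      and v: "v \<in> EE P Q" "eqE P (Suc Q) y (vD Q v)" "eqE (Suc P) Q y' (hD v)" unfolding R_def by blast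
    have "(\<lambda>t. a * u t + b * v t) \<in> EE P Q" by (rule csubD[OF csub_EE u(1) v(1)])
    moreover have "eqE P (Suc Q) (\<lambda>t. a * x t + b * y t) (vD Q (\<lambda>t. a * u t + b * v t))" unfolding vD_linear by (rule eqE_lin[OF u(2) v(2)])
    moreover have "eqE (Suc P) Q (\<lambda>t. a * x' t + b * y' t) (hD (\<lambda>t. a * u t + b * v t))" unfolding hD_linear by (rule eqE_lin[OF u(3) v(3)])
    ultimately show "R (\<lambda>t. a * x t + b * y t) (\<lambda>t. a * x' t + b * y' t)"
      using r csubD[OF csub_NN] unfolding R_def by blast
  qed (use W in \<open>auto simp: R_def\<close>)
qed

lemma qdim_steps: "P + Q = q \<Longrightarrow> qdim (NN (Suc P) Q) (BN (Suc P) Q) = qdim (NN (Suc q) 0) (BN (Suc q) 0)"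
proof (induction Q arbitrary: P)
  case (Suc Q)
  then show ?case using qdim_step[of "Suc P" Q] Suc.IH[of "Suc P"] by simp
qed simp

section \<open>The bottom row: flat sections over the intersections\<close>

definition nerve :: "nat set set" where
  "nerve = {K. K \<subseteq> {..<m} \<and> K \<noteq> {} \<and> UK K \<noteq> {}}"

abbreviation e0 :: "nat \<Rightarrow> real" where "e0 \<equiv> (\<lambda>j. if j = 0 then 1 else 0)"

text \<open>The value at the initial vertex of the flat section that is 1 where the lifted
  logarithms are those of the chart \<open>Min K\<close>.\<close>

definition tf :: "nat set \<Rightarrow> ((nat \<Rightarrow> real) \<Rightarrow> 'a cov) \<Rightarrow> complex" where
  "tf K \<sigma> = exp (- (\<Sum>j\<in>J. lam j * (snd (\<sigma> e0) j - s (Min K) j (fst (\<sigma> e0)))))"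

definition LL :: "(nat set \<Rightarrow> complex) \<Rightarrow> 'a dbl" where
  "LL \<psi> = (\<lambda>(K, \<sigma>). \<psi> K * tf K \<sigma>)"

lemma KsetS: "K \<in> Kset (Suc P) \<Longrightarrow> K \<subseteq> {..<m} \<and> K \<noteq> {} \<and> Min K \<in> K \<and> Min K < m"
proof -
  assume K: "K \<in> Kset (Suc P)"
  then have "K \<noteq> {}" "K \<subseteq> {..<m}" by (auto simp: Kset_def)
  then show ?thesis using Min_in[OF Kset_finite[OF K]] by auto
qed

lemma SK_point: "K \<in> Kset (Suc P) \<Longrightarrow> \<sigma> \<in> SK K q \<Longrightarrow> x \<in> standard_simplex q \<Longrightarrow> \<sigma> x \<in> cover J f (UK K)"
  using SK_UK[of K q] KsetS[of K P] by (auto simp: sys_of_iff)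

lemma e0_in [simp]: "e0 \<in> standard_simplex q" by simp

lemma LL_EE: "LL \<psi> \<in> EE P 0"
  unfolding EE_def eqvt_def
proof (intro CollectI ballI)
  fix K \<sigma> g assume "\<sigma> \<in> SK K 0" "g \<in> Gam J"
  have "tf K (simplex_map 0 (deck g) \<sigma>) = chi J lam g * tf K \<sigma>"
    unfolding tf_def chi_def simplex_map_def
    by (simp add: deck_def standard_simplex_0 exp_add[symmetric] algebra_simps sum.distrib sum_subtractf)
  then show "LL \<psi> (K, simplex_map 0 (deck g) \<sigma>) = chi J lam g * LL \<psi> (K, \<sigma>)" by (simp add: LL_def)
qed

text \<open>Along an edge the lifted logarithms and the chart logarithms differ by a constant, so
  \<open>tf\<close> takes the same value at both ends.\<close>

lemma LL_vD: "eqE (Suc P) 1 (vD 0 (LL \<psi>)) (\<lambda>_. 0)"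
  unfolding eqE_def
proof (intro ballI)
  fix K \<sigma> assume K: "K \<in> Kset (Suc P)" and sg: "\<sigma> \<in> SK K 1"
  note K' = KsetS[OF K]
  have s1: "\<sigma> \<in> sys_of (cover J f (UK K)) 1" using sg SK_UK[of K 1] K' by blast
  have eq: "snd (\<sigma> x) j - s (Min K) j (fst (\<sigma> x)) = snd (\<sigma> y) j - s (Min K) j (fst (\<sigma> y))"
    if xy: "x \<in> standard_simplex 1" "y \<in> standard_simplex 1" and j: "j \<in> J" for x y j
  proof -
    let ?d = "\<lambda>x. snd (\<sigma> x) j - s (Min K) j (fst (\<sigma> x))"
    have pt: "\<sigma> x \<in> cover J f (UK K)" if "x \<in> standard_simplex 1" for x using SK_point[OF K sg that] .
    have c1: "continuous_on (standard_simplex 1) (\<lambda>z. snd (\<sigma> z) j)"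
      by (rule continuous_on_product_then_coordinatewise, rule continuous_on_snd, rule sys_of_continuous[OF s1])
    have c2: "continuous_on (standard_simplex 1) (\<lambda>z. s (Min K) j (fst (\<sigma> z)))"
      by (rule continuous_on_compose2[OF cont[of "Min K" j]])
        (use K' j pt continuous_on_fst[OF sys_of_continuous[OF s1]] in \<open>auto simp: cover_def\<close>)
    have "exp (?d x) = 1" if "x \<in> standard_simplex 1" for x
    proof -
      have "fst (\<sigma> x) \<in> U (Min K)" using pt[OF that] K' by (auto simp: cover_def)
      then have "exp (s (Min K) j (fst (\<sigma> x))) = f j (fst (\<sigma> x))" using expo K' j by blast
      moreover have "exp (snd (\<sigma> x) j) = f j (fst (\<sigma> x))" using pt[OF that] j by (auto simp: cover_def)
      ultimately show ?thesis unfolding exp_diff by (metis divide_self exp_not_eq_zero)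
    qed
    then have "?d constant_on standard_simplex 1"
      by (intro constant_log connected_standard_simplex continuous_on_diff c1 c2)
    then obtain w where "\<And>z. z \<in> standard_simplex 1 \<Longrightarrow> ?d z = w" by (auto simp: constant_on_def)
    from this[OF xy(1)] this[OF xy(2)] show ?thesis by simp
  qed
  have mem: "simplical_face k e0 \<in> standard_simplex 1" if "k \<le> 1" for k
    using simplical_face_in_standard_simplex[of 1 k e0] that by simp
  have tf_face: "tf K (singular_face 1 k \<sigma>) = tf K \<sigma>" if "k \<le> 1" for k
    unfolding tf_def singular_face_def using eq[OF mem[OF that] e0_in] by simp
  show "vD 0 (LL \<psi>) (K, \<sigma>) = 0"
    using tf_face[of 0] tf_face[of 1] by (simp add: vD_def LL_def cobd_alt)
qed

text \<open>A cocycle of degree 0 does not change under the contraction to \<open>x0\<close>, which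
  carries every vertex to a deck translate of one fixed vertex. By equivariance a single value
  determines all others.\<close>

lemma LL_all:
  assumes psi: "\<Psi> \<in> EE (Suc P) 0" and v: "eqE (Suc P) 1 (vD 0 \<Psi>) (\<lambda>_. 0)"
  shows "\<exists>\<psi>. eqE (Suc P) 0 \<Psi> (LL \<psi>)"
proof -
  have "\<exists>w. \<forall>\<sigma>\<in>SK K 0. \<Psi> (K, \<sigma>) = w * tf K \<sigma>" if K: "K \<in> Kset (Suc P)" for K
  proof (cases "UK K = {}")
    case True
    then have "SK K 0 = {}" using SK_point[OF K _ e0_in, of _ 0] by (auto simp: cover_def)
    then show ?thesis by simp
  next
    case False
    note K' = KsetS[OF K]
    have Sf: "SK K = sys_of (cover J f (UK K))" using SK_UK[of K] K' by (intro ext) blast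
    obtain x0 H G where H: "x0 \<in> UK K" "hmor J f (UK K) f (UK K) H G"
     "\<And>x. x \<in> UK K \<Longrightarrow> H 0 x = x" "\<And>x. x \<in> UK K \<Longrightarrow> H 1 x = x0"
     "\<And>t j x. G t j x = s (Min K) j (H t x) - s (Min K) j x"
      by (rule contraction_hmor[of K "Min K"]) (use K' False in auto)
    let ?\<phi> = "\<lambda>\<sigma>. \<Psi> (K, \<sigma>)"
    have z: "?\<phi> \<in> ZZ J f lam (UK K) 0"
      using psi v K unfolding Zc_def by (auto simp: EE_def eqE_def vD_def Sf)
    define p0 where "p0 = (x0, \<lambda>j. if j \<in> J then s (Min K) j x0 else 0)"
    define \<sigma>0 where "\<sigma>0 = restrict (\<lambda>_. p0) (standard_simplex 0)"
    have p0: "p0 \<in> cover J f (UK K)"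
      using H(1) K' expo[of "Min K"] by (auto simp: p0_def cover_def)
    have s0: "\<sigma>0 \<in> SK K 0" unfolding Sf using p0 by (auto simp: \<sigma>0_def sys_of_iff singular_simplex_def)
    have "\<Psi> (K, \<sigma>) = \<Psi> (K, \<sigma>0) * tf K \<sigma>" if sg: "\<sigma> \<in> SK K 0" for \<sigma>
    proof -
      have sg': "\<sigma> \<in> sys_of (cover J f (UK K)) 0" using sg Sf by simp
      have pt: "\<sigma> e0 \<in> cover J f (UK K)" using SK_point[OF K sg] by simp
      have a: "\<Psi> (K, simplex_map 0 (lift J (H 1) (G 1)) \<sigma>) = \<Psi> (K, \<sigma>)"
        using hmor_BB[OF H(2) z] sg' lift_id[OF sg', of "H 0" "G 0"] H(3,5) by (auto simp: Bc_def)
      define d where "d j = snd (\<sigma> e0) j - s (Min K) j (fst (\<sigma> e0))" for j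
      have fs: "fst (\<sigma> e0) \<in> UK K" using pt by (auto simp: cover_def)
      have "\<exists>n::int. d j = 2 * complex_of_real pi * \<i> * of_int n" if "j \<in> J" for j
      proof -
        have "exp (snd (\<sigma> e0) j) = exp (s (Min K) j (fst (\<sigma> e0)))"
          using pt that fs K' expo[of "Min K" j] by (auto simp: cover_def)
        then obtain n :: int where "snd (\<sigma> e0) j = s (Min K) j (fst (\<sigma> e0)) + (of_int (2 * n) * pi) * \<i>" unfolding exp_eq by blast
        then show ?thesis by (intro exI[of _ n]) (simp add: d_def algebra_simps)
      qed
      then obtain n where n: "\<And>j. j \<in> J \<Longrightarrow> d j = 2 * complex_of_real pi * \<i> * of_int (n j)" by metis
      define g where "g j = (if j \<in> J then n j else 0)" for j
      have g: "g \<in> Gam J" by (simp add: Gam_def g_def)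
      have l: "lift J (H 1) (G 1) (\<sigma> e0) = deck g p0"
        using fs H(4) n by (auto simp: lift_def deck_def p0_def H(5) g_def fun_eq_iff d_def algebra_simps)
      have "simplex_map 0 (lift J (H 1) (G 1)) \<sigma> = simplex_map 0 (deck g) \<sigma>0"
        using l unfolding simplex_map_def \<sigma>0_def standard_simplex_0 by (intro restrict_ext) auto
      moreover have "\<Psi> (K, simplex_map 0 (deck g) \<sigma>0) = chi J lam g * \<Psi> (K, \<sigma>0)"
        using psi K s0 g by (auto simp: EE_def eqvt_def)
      moreover have "chi J lam g = tf K \<sigma>"
        unfolding chi_def tf_def d_def[symmetric] by (intro arg_cong[where f=exp] arg_cong[where f=uminus] sum.cong) (auto simp: g_def n)
      ultimately show ?thesis using a by (simp add: mult.commute)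
    qed
    then show ?thesis by blast
  qed
  then obtain \<psi> where "\<And>K. K \<in> Kset (Suc P) \<Longrightarrow> \<forall>\<sigma>\<in>SK K 0. \<Psi> (K, \<sigma>) = \<psi> K * tf K \<sigma>" by metis
  then show ?thesis by (auto simp: eqE_def LL_def)
qed

lemma LL_hD:
  "eqE (Suc (Suc P)) 0 (hD (LL \<psi>)) (LL (cechD (ctrans c J lam) \<psi>))"
  unfolding eqE_def
proof (intro ballI)
  fix K \<sigma> assume K: "K \<in> Kset (Suc (Suc P))" and sg: "\<sigma> \<in> SK K 0"
  note K' = KsetS[OF K]
  have x: "fst (\<sigma> e0) \<in> UK K" using SK_point[OF K sg, of e0] by (auto simp: cover_def)
  have "tf (K - {i}) \<sigma> = ctrans c J lam K i * tf K \<sigma>" if "i \<in> K" for i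
  proof -
    note Ki = KsetS[OF Kset_remove[OF K that]]
    have "s (Min K) j (fst (\<sigma> e0)) - s (Min (K - {i})) j (fst (\<sigma> e0)) = c (Min K) (Min (K - {i})) j" if "j \<in> J" for j
      using trans[of "Min K" "Min (K - {i})" j] x K' Ki that by blast
    then have "(\<Sum>j\<in>J. lam j * c (Min K) (Min (K - {i})) j) + (\<Sum>j\<in>J. lam j * (snd (\<sigma> e0) j - s (Min K) j (fst (\<sigma> e0))))
       = (\<Sum>j\<in>J. lam j * (snd (\<sigma> e0) j - s (Min (K - {i})) j (fst (\<sigma> e0))))"
      unfolding sum.distrib[symmetric] by (intro sum.cong refl) (simp add: algebra_simps)
    then show ?thesis unfolding tf_def ctrans_def exp_add[symmetric] by (simp only: minus_add_distrib[symmetric])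
  qed
  then show "hD (LL \<psi>) (K, \<sigma>) = LL (cechD (ctrans c J lam) \<psi>) (K, \<sigma>)"
    by (simp add: hD_def LL_def cechD_def sum_distrib_left mult_ac)
qed

lemma LL_eq: "eqE (Suc P) 0 (LL \<psi>) (LL \<psi>') \<longleftrightarrow> (\<forall>K\<in>nerve. card K = Suc P \<longrightarrow> \<psi> K = \<psi>' K)"
proof
  assume l: "eqE (Suc P) 0 (LL \<psi>) (LL \<psi>')"
  show "\<forall>K\<in>nerve. card K = Suc P \<longrightarrow> \<psi> K = \<psi>' K"
  proof (intro ballI impI)
    fix K assume K: "K \<in> nerve" "card K = Suc P"
    then have K2: "K \<in> Kset (Suc P)" by (auto simp: nerve_def Kset_def)
    note K' = KsetS[OF K2]
    obtain x where x: "x \<in> UK K" using K by (auto simp: nerve_def)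
    let ?p = "(x, \<lambda>j. if j \<in> J then s (Min K) j x else 0)"
    have "?p \<in> cover J f (UK K)" using x K' expo[of "Min K"] by (auto simp: cover_def)
    then have "restrict (\<lambda>_. ?p) (standard_simplex 0) \<in> SK K 0"
      using SK_UK[of K 0] K' by (auto simp: sys_of_iff singular_simplex_def)
    then have "LL \<psi> (K, restrict (\<lambda>_. ?p) (standard_simplex 0)) = LL \<psi>' (K, restrict (\<lambda>_. ?p) (standard_simplex 0))"
      using l K2 by (auto simp: eqE_def)
    then show "\<psi> K = \<psi>' K" by (simp add: LL_def tf_def)
  qed
next
  assume r: "\<forall>K\<in>nerve. card K = Suc P \<longrightarrow> \<psi> K = \<psi>' K"
  show "eqE (Suc P) 0 (LL \<psi>) (LL \<psi>')"
    unfolding eqE_def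
  proof (intro ballI)
    fix K \<sigma> assume K: "K \<in> Kset (Suc P)" and sg: "\<sigma> \<in> SK K 0"
    have "UK K \<noteq> {}" using SK_point[OF K sg, of e0] by (auto simp: cover_def)
    then have "K \<in> nerve" using KsetS[OF K] by (auto simp: nerve_def)
    then show "LL \<psi> (K, \<sigma>) = LL \<psi>' (K, \<sigma>)" using r K by (auto simp: LL_def Kset_def)
  qed
qed

lemma LL_linear: "LL (\<lambda>t. a * x t + b * y t) = (\<lambda>t. a * LL x t + b * LL y t)"
  by (auto simp: LL_def fun_eq_iff algebra_simps)

lemma LL_0: "LL (\<lambda>_. 0) = (\<lambda>_. 0)" by (auto simp: LL_def)

lemma qdim_final: "qdim (NN (Suc q) 0) (BN (Suc q) 0) = qdim (cechZ nerve c J lam q) (cechB nerve c J lam q)"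
proof (rule lin_corr_qdim)
  define R where "R = (\<lambda>\<Psi> \<psi>. \<Psi> \<in> NN (Suc q) 0 \<and> \<psi> \<in> cechZ nerve c J lam q \<and> eqE (Suc q) 0 \<Psi> (LL \<psi>))"
  have Z: "\<psi> \<in> cechZ nerve c J lam q \<longleftrightarrow> eqE (Suc (Suc q)) 0 (hD (LL \<psi>)) (\<lambda>_. 0)" for \<psi>
  proof -
    have "\<psi> \<in> cechZ nerve c J lam q \<longleftrightarrow> eqE (Suc (Suc q)) 0 (LL (cechD (ctrans c J lam) \<psi>)) (LL (\<lambda>_. 0))"
      unfolding LL_eq by (simp add: cechZ_def)
    then show ?thesis unfolding LL_0 using LL_hD[of q \<psi>] eqE_trans eqE_sym by blast
  qed
  have W: "\<Psi> \<in> BN (Suc q) 0 \<longleftrightarrow> \<psi> \<in> cechB nerve c J lam q" if R: "R \<Psi> \<psi>" for \<Psi> \<psi>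
  proof -
    have e: "eqE (Suc q) 0 \<Psi> (LL \<psi>)" using R by (simp add: R_def)
    show ?thesis
    proof (cases q)
      case 0
      have "\<psi> \<in> cechB nerve c J lam q \<longleftrightarrow> eqE (Suc q) 0 (LL \<psi>) (LL (\<lambda>_. 0))" unfolding LL_eq by (simp add: cechB_def 0)
      moreover have "\<Psi> \<in> BN (Suc q) 0 \<longleftrightarrow> eqE (Suc q) 0 \<Psi> (\<lambda>_. 0)" by (simp add: BN_def 0)
      ultimately show ?thesis using e eqE_trans eqE_sym unfolding LL_0 by blast
    next
      case (Suc r)
      show ?thesis
      proof
        assume "\<Psi> \<in> BN (Suc q) 0"
        then obtain z where z: "z \<in> EE q 0" "eqE q 1 (vD 0 z) (\<lambda>_. 0)" "eqE (Suc q) 0 \<Psi> (hD z)" by (auto simp: BN_def Suc)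
        then obtain th where th: "eqE q 0 z (LL th)" using LL_all[of z r] by (auto simp: Suc)
        have "eqE (Suc q) 0 (LL \<psi>) (LL (cechD (ctrans c J lam) th))"
          using e z(3) hD_cong[OF th] LL_hD[of r th] eqE_trans eqE_sym unfolding Suc by blast
        then have "\<forall>K\<in>nerve. card K = Suc q \<longrightarrow> \<psi> K = cechD (ctrans c J lam) th K" unfolding LL_eq .
        then show "\<psi> \<in> cechB nerve c J lam q" unfolding cechB_def by (auto simp: Suc)
      next
        assume "\<psi> \<in> cechB nerve c J lam q"
        then obtain th where "\<forall>K\<in>nerve. card K = Suc q \<longrightarrow> \<psi> K = cechD (ctrans c J lam) th K" by (auto simp: cechB_def Suc)
        then have "eqE (Suc q) 0 (LL \<psi>) (LL (cechD (ctrans c J lam) th))" unfolding LL_eq .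
        then have "eqE (Suc q) 0 \<Psi> (hD (LL th))" using e LL_hD[of r th] eqE_trans eqE_sym unfolding Suc by blast
        then show "\<Psi> \<in> BN (Suc q) 0" unfolding BN_def using LL_EE[of th q] LL_vD[of r th] by (auto simp: Suc)
      qed
    qed
  qed
  show "lin_corr (NN (Suc q) 0) (BN (Suc q) 0) (cechZ nerve c J lam q) (cechB nerve c J lam q) R"
    unfolding lin_corr_def
  proof (intro conjI allI ballI impI csub_NN csub_BN csub_cechZ csub_cechB)
    fix \<Psi> assume n: "\<Psi> \<in> NN (Suc q) 0"
    then obtain \<psi> where p: "eqE (Suc q) 0 \<Psi> (LL \<psi>)" using LL_all[of \<Psi> q] by (auto simp: NN_def)
    have "eqE (Suc (Suc q)) 0 (hD \<Psi>) (\<lambda>_. 0)" using n by (simp add: NN_def)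
    then have "\<psi> \<in> cechZ nerve c J lam q" unfolding Z by (rule eqE_trans[OF eqE_sym[OF hD_cong[OF p]]])
    then show "\<exists>\<psi>. R \<Psi> \<psi>" unfolding R_def using n p by blast
  next
    fix \<psi> assume p: "\<psi> \<in> cechZ nerve c J lam q"
    then have "LL \<psi> \<in> NN (Suc q) 0" unfolding NN_def using LL_EE[of \<psi> "Suc q"] LL_vD[of q \<psi>] Z by auto
    then show "\<exists>\<Psi>. R \<Psi> \<psi>" unfolding R_def using p eqE_refl by blast
  next
    fix x x' y y' a b assume "R x x'" "R y y'"
    then show "R (\<lambda>t. a * x t + b * y t) (\<lambda>t. a * x' t + b * y' t)"
      using csubD[OF csub_NN] csubD[OF csub_cechZ] by (auto simp: R_def LL_linear eqE_lin)
  qed (use W in \<open>auto simp: R_def\<close>)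
qed

theorem leray: "qdim (ZZ J f lam Y q) (BB J f lam Y q) = qdim (cechZ nerve c J lam q) (cechB nerve c J lam q)"
  using qdim_small[OF cover_U openin_U deck_inv_U] qdim_step0[of q] qdim_steps[of 0 q q] qdim_final[of q] by simp

end

section \<open>Finite complexes depending on the weights\<close>

interpretation fsp: vector_space "\<lambda>a (u::'b \<Rightarrow> complex) x. a * u x"
  by unfold_locales (auto simp: fun_eq_iff algebra_simps)

definition indep :: "nat \<Rightarrow> (nat \<Rightarrow> 'b \<Rightarrow> complex) \<Rightarrow> bool" where
  "indep r v \<longleftrightarrow> (\<forall>c. (\<forall>x. (\<Sum>i<r. c i * v i x) = 0) \<longrightarrow> (\<forall>i<r. c i = 0))"

lemma sum_fun_apply: "(\<Sum>i\<in>I. F i) x = (\<Sum>i\<in>I. F i x)"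
  by (induction I rule: infinite_finite_induct) auto

lemma indep_of_independent:
  assumes "fsp.independent B" "bij_betw v {..<r} B"
  shows "indep r v"
  unfolding indep_def
proof (intro allI impI)
  fix c i assume z: "\<forall>x. (\<Sum>i<r. c i * v i x) = 0" and i: "i < r"
  have fin: "finite B" using assms(2) bij_betw_finite by blast
  define d where "d b = c (the_inv_into {..<r} v b)" for b
  have inj: "inj_on v {..<r}" using assms(2) by (simp add: bij_betw_def)
  have d: "d (v i) = c i" if "i < r" for i using the_inv_into_f_f[OF inj, of i] that by (simp add: d_def)
  have "(\<Sum>b\<in>B. (\<lambda>x. d b * b x)) = 0"
  proof
    fix x
    have "(\<Sum>b\<in>B. (\<lambda>x. d b * b x)) x = (\<Sum>b\<in>B. d b * b x)" by (simp add: sum_fun_apply)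
    also have "\<dots> = (\<Sum>i<r. d (v i) * v i x)" using sum.reindex_bij_betw[OF assms(2), of "\<lambda>b. d b * b x"] by simp
    also have "\<dots> = (\<Sum>i<r. c i * v i x)" by (intro sum.cong refl) (simp add: d)
    finally show "(\<Sum>b\<in>B. (\<lambda>x. d b * b x)) x = 0 x" using z by simp
  qed
  then have "d (v i) = 0" using fsp.independentD[OF assms(1) fin order_refl] i assms(2) by (auto simp: bij_betw_def)
  then show "c i = 0" using d i by simp
qed

lemma independent_of_indep:
  assumes "indep r v"
  shows "inj_on v {..<r}" "fsp.independent (v ` {..<r})"
proof -
  show inj: "inj_on v {..<r}"
  proof (rule inj_onI, rule ccontr)
    fix i k assume a: "i \<in> {..<r}" "k \<in> {..<r}" "v i = v k" "i \<noteq> k"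
    define c where "c l = (if l = i then 1 else if l = k then -1 else 0 :: complex)" for l
    have "(\<Sum>l<r. c l * v l x) = 0" for x
    proof -
      have "(\<Sum>l<r. c l * v l x) = (\<Sum>l\<in>{i,k}. c l * v l x)"
        by (rule sum.mono_neutral_right) (use a in \<open>auto simp: c_def\<close>)
      also have "\<dots> = 0" using a by (simp add: c_def)
      finally show ?thesis .
    qed
    then have "c i = 0" using assms a by (auto simp: indep_def)
    then show False by (simp add: c_def)
  qed
  show "fsp.independent (v ` {..<r})"
  proof (subst fsp.independent_explicit_finite_subsets, intro allI impI ballI)
    fix S u b assume S: "S \<subseteq> v ` {..<r}" "finite S" and z: "(\<Sum>v\<in>S. (\<lambda>x. u v * v x)) = 0" and b: "b \<in> S"
    define c where "c i = (if v i \<in> S then u (v i) else 0)" for i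
    have "(\<Sum>i<r. c i * v i x) = 0" for x
    proof -
      have "(\<Sum>i<r. c i * v i x) = (\<Sum>i\<in>{i\<in>{..<r}. v i \<in> S}. u (v i) * v i x)"
        by (rule sum.mono_neutral_cong_right) (auto simp: c_def)
      also have "\<dots> = (\<Sum>b\<in>S. u b * b x)"
      proof -
        have "inj_on v {i\<in>{..<r}. v i \<in> S}" by (rule inj_on_subset[OF inj]) auto
        moreover have "v ` {i\<in>{..<r}. v i \<in> S} = S" using S by auto
        ultimately show ?thesis using sum.reindex[of v "{i\<in>{..<r}. v i \<in> S}" "\<lambda>b. u b * b x"] by simp
      qed
      also have "\<dots> = 0" using fun_cong[OF z, of x] by (simp add: sum_fun_apply)
      finally show ?thesis .
    qed
    then have "\<forall>i<r. c i = 0" using assms by (auto simp: indep_def)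
    moreover obtain i where "i < r" "b = v i" using S b by auto
    ultimately show "u b = 0" using b by (auto simp: c_def)
  qed
qed

definition findim :: "('b \<Rightarrow> complex) set \<Rightarrow> bool" where
  "findim V \<longleftrightarrow> (\<exists>S. finite S \<and> V \<subseteq> fsp.span S)"

lemma findim_mono: "findim V \<Longrightarrow> W \<subseteq> V \<Longrightarrow> findim W"
  unfolding findim_def by blast

lemma findim_independent: "findim V \<Longrightarrow> B \<subseteq> V \<Longrightarrow> fsp.independent B \<Longrightarrow> finite B"
proof -
  assume a: "findim V" "B \<subseteq> V" "fsp.independent B"
  then obtain S where "finite S" "V \<subseteq> fsp.span S" by (auto simp: findim_def)
  then show ?thesis using fsp.independent_span_bound[of S B] a by blast
qed

lemma indep_le_dim:
  assumes "findim V" "indep r v" "\<And>i. i < r \<Longrightarrow> v i \<in> V"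
  shows "r \<le> fsp.dim V"
proof -
  note i = independent_of_indep[OF assms(2)]
  obtain B where B: "B \<subseteq> V" "fsp.independent B" "V \<subseteq> fsp.span B" "card B = fsp.dim V" using fsp.basis_exists by blast
  have "finite B" using findim_independent[OF assms(1) B(1,2)] .
  moreover have "v ` {..<r} \<subseteq> fsp.span B" using assms(3) B(3) by auto
  ultimately have "card (v ` {..<r}) \<le> card B" using fsp.independent_span_bound i(2) by blast
  then show ?thesis using card_image[OF i(1)] B(4) by simp
qed

lemma dim_family:
  assumes "findim V"
  obtains v where "indep (fsp.dim V) v" "\<And>i. i < fsp.dim V \<Longrightarrow> v i \<in> V"
proof -
  obtain B where B: "B \<subseteq> V" "fsp.independent B" "V \<subseteq> fsp.span B" "card B = fsp.dim V" using fsp.basis_exists by blast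
  have "finite B" using findim_independent[OF assms B(1,2)] .
  then obtain v where v: "bij_betw v {..<fsp.dim V} B" using ex_bij_betw_nat_finite[of B] B(4) by (auto simp: atLeast0LessThan)
  show ?thesis by (rule that[OF indep_of_independent[OF B(2) v]]) (use v B(1) in \<open>auto simp: bij_betw_def\<close>)
qed

lemma fsp_span_sum: "(\<lambda>x. \<Sum>i<k. c i * u i x) \<in> fsp.span (u ` {..<k})"
proof -
  have "(\<Sum>i<k. (\<lambda>x. c i * u i x)) \<in> fsp.span (u ` {..<k})"
    by (intro fsp.span_sum fsp.span_scale fsp.span_base) auto
  moreover have "(\<Sum>i<k. (\<lambda>x. c i * u i x)) = (\<lambda>x. \<Sum>i<k. c i * u i x)" by (auto simp: sum_fun_apply)
  ultimately show ?thesis by simp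
qed

lemma qdim_eq_dim_diff:
  assumes V: "csub V" and W: "csub W" and sub: "W \<subseteq> V" and fin: "findim V"
  shows "qdim V W = enat (fsp.dim V - fsp.dim W)" "fsp.dim W \<le> fsp.dim V"
proof -
  obtain C where C: "C \<subseteq> W" "fsp.independent C" "W \<subseteq> fsp.span C" "card C = fsp.dim W" using fsp.basis_exists by blast
  have fC: "finite C" using findim_independent[OF findim_mono[OF fin sub] C(1,2)] .
  obtain B where B: "C \<subseteq> B" "B \<subseteq> V" "fsp.independent B" "V \<subseteq> fsp.span B"
    using fsp.maximal_independent_subset_extend[of C V] C sub by blast
  have fB: "finite B" using findim_independent[OF fin B(2,3)] .
  have dV: "card B = fsp.dim V" using fsp.basis_card_eq_dim[OF B(2,4,3)] .
  show le: "fsp.dim W \<le> fsp.dim V" using card_mono[OF fB B(1)] dV C(4) by simp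
  have "gens V W k \<longleftrightarrow> fsp.dim V - fsp.dim W \<le> k" for k
  proof
    assume "gens V W k"
    then obtain u where u: "\<forall>i<k. u i \<in> V" "\<forall>v\<in>V. \<exists>c. (\<lambda>x. v x - (\<Sum>i<k. c i * u i x)) \<in> W" by (auto simp: gens_def)
    let ?S = "u ` {..<k} \<union> C"
    have "V \<subseteq> fsp.span ?S"
    proof
      fix v assume "v \<in> V"
      then obtain c where c: "(\<lambda>x. v x - (\<Sum>i<k. c i * u i x)) \<in> W" using u by blast
      then have 1: "(\<lambda>x. v x - (\<Sum>i<k. c i * u i x)) \<in> fsp.span ?S" using C(3) fsp.span_mono[of C ?S] by blast
      have 2: "(\<lambda>x. \<Sum>i<k. c i * u i x) \<in> fsp.span ?S" using fsp_span_sum[where k=k and c=c and u=u] fsp.span_mono[of "u ` {..<k}" ?S] by blast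
      have "(\<lambda>x. v x - (\<Sum>i<k. c i * u i x)) + (\<lambda>x. \<Sum>i<k. c i * u i x) \<in> fsp.span ?S" by (rule fsp.span_add[OF 1 2])
      then show "v \<in> fsp.span ?S" by (simp add: plus_fun_def)
    qed
    then have "fsp.dim V \<le> card ?S" using fC by (intro fsp.dim_le_card) auto
    also have "\<dots> \<le> k + fsp.dim W" using card_Un_le[of "u ` {..<k}" C] card_image_le[of "{..<k}" u] C(4) by simp
    finally show "fsp.dim V - fsp.dim W \<le> k" by simp
  next
    assume k: "fsp.dim V - fsp.dim W \<le> k"
    have cd: "card (B - C) = fsp.dim V - fsp.dim W" using card_Diff_subset[OF fC B(1)] dV C(4) by simp
    have "\<forall>v\<in>V. \<exists>c. (\<lambda>x. v x - (\<Sum>b\<in>B - C. c b * b x)) \<in> W"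
    proof
      fix v assume "v \<in> V"
      then have "v \<in> fsp.span B" using B by blast
      then obtain c where c: "v = (\<Sum>b\<in>B. (\<lambda>x. c b * b x))" unfolding fsp.span_finite[OF fB] by auto
      have "v x - (\<Sum>b\<in>B - C. c b * b x) = (\<Sum>b\<in>C. c b * b x)" for x
        unfolding c sum_fun_apply using sum.subset_diff[OF B(1) fB, of "\<lambda>b. c b * b x"] by simp
      moreover have "(\<lambda>x. \<Sum>b\<in>C. c b * b x) \<in> W" using csub_sum[OF W fC, of "\<lambda>b. b" c] C(1) by auto
      ultimately show "\<exists>c. (\<lambda>x. v x - (\<Sum>b\<in>B - C. c b * b x)) \<in> W" by (intro exI[of _ c]) simp
    qed
    then have "V \<subseteq> cspan ((B - C) \<union> W)" using gens_set[OF V W, of "B - C"] fB B(2) by auto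
    then show "gens V W k" unfolding gens_iff[OF V W] using fB B(2) cd k by (intro exI[of _ "B - C"]) auto
  qed
  then show "qdim V W = enat (fsp.dim V - fsp.dim W)"
    by (intro enat_eq_via_le) (simp add: qdim_le_iff[OF V W])
qed

definition flin :: "(('b \<Rightarrow> complex) \<Rightarrow> ('d \<Rightarrow> complex)) \<Rightarrow> bool" where
  "flin F \<longleftrightarrow> (\<forall>a b u v. F (\<lambda>x. a * u x + b * v x) = (\<lambda>x. a * F u x + b * F v x))"

lemma flinD: "flin F \<Longrightarrow> F (\<lambda>x. a * u x + b * v x) = (\<lambda>x. a * F u x + b * F v x)"
  by (simp add: flin_def)

lemma flin_sum:
  assumes F: "flin F" and "finite I"
  shows "F (\<lambda>x. \<Sum>i\<in>I. c i * u i x) = (\<lambda>x. \<Sum>i\<in>I. c i * F (u i) x)"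
  using assms(2)
proof (induction I rule: finite_induct)
  case empty
  have "F (\<lambda>x. 0 * u undefined x + 0 * u undefined x) = (\<lambda>x. 0 * F (u undefined) x + 0 * F (u undefined) x)"
    by (rule flinD[OF F])
  then show ?case by simp
next
  case (insert i I)
  have "F (\<lambda>x. c i * u i x + 1 * (\<Sum>i\<in>I. c i * u i x)) = (\<lambda>x. c i * F (u i) x + 1 * F (\<lambda>x. \<Sum>i\<in>I. c i * u i x) x)"
    by (rule flinD[OF F])
  then show ?case using insert by simp
qed

lemma csub_image: "flin F \<Longrightarrow> csub V \<Longrightarrow> csub (F ` V)"
  unfolding csub_def
proof (intro conjI ballI allI)
  assume a: "flin F" "(\<lambda>_. 0) \<in> V \<and> (\<forall>u\<in>V. \<forall>v\<in>V. \<forall>a b. (\<lambda>x. a * u x + b * v x) \<in> V)"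
  show "(\<lambda>_. 0) \<in> F ` V" using flin_sum[OF a(1), of "{}"] a(2) by (auto simp: image_iff intro!: bexI[of _ "\<lambda>_. 0"])
  fix u v r t assume "u \<in> F ` V" "v \<in> F ` V"
  then obtain u' v' where "u = F u'" "v = F v'" "u' \<in> V" "v' \<in> V" by blast
  then show "(\<lambda>x. r * u x + t * v x) \<in> F ` V" using a unfolding flin_def by (intro image_eqI[of _ _ "\<lambda>x. r * u' x + t * v' x"]) auto
qed

lemma rank_nullity:
  assumes F: "flin F" and V: "csub V" and fin: "findim V"
  shows "fsp.dim V = fsp.dim {u\<in>V. F u = (\<lambda>_. 0)} + fsp.dim (F ` V)" "findim (F ` V)"
proof -
  let ?Z = "{u\<in>V. F u = (\<lambda>_. 0)}"
  have Z: "csub ?Z"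
    using V F unfolding csub_def flin_def using flin_sum[OF F, of "{}"] by auto
  obtain C where C: "C \<subseteq> ?Z" "fsp.independent C" "?Z \<subseteq> fsp.span C" "card C = fsp.dim ?Z" using fsp.basis_exists by blast
  have fC: "finite C" using findim_independent[OF findim_mono[OF fin] C(1,2)] by auto
  obtain B where B: "C \<subseteq> B" "B \<subseteq> V" "fsp.independent B" "V \<subseteq> fsp.span B"
    using fsp.maximal_independent_subset_extend[of C V] C by blast
  have fB: "finite B" using findim_independent[OF fin B(2,3)] .
  have dV: "card B = fsp.dim V" using fsp.basis_card_eq_dim[OF B(2,4,3)] .
  let ?k = "card (B - C)"
  obtain v where v: "bij_betw v {..<?k} (B - C)" using ex_bij_betw_nat_finite[of "B - C"] fB by (auto simp: atLeast0LessThan)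
  have vV: "v i \<in> V" if "i < ?k" for i using v that B(2) by (auto simp: bij_betw_def)
  have span: "F ` V \<subseteq> fsp.span ((\<lambda>i. F (v i)) ` {..<?k})"
  proof clarify
    fix u assume "u \<in> V"
    then have "u \<in> fsp.span B" using B by blast
    then obtain c where c: "u = (\<Sum>b\<in>B. (\<lambda>x. c b * b x))" unfolding fsp.span_finite[OF fB] by auto
    then have u: "u = (\<lambda>x. \<Sum>b\<in>B. c b * b x)" by (auto simp: sum_fun_apply)
    have "F u x = (\<Sum>i<?k. c (v i) * F (v i) x)" for x
    proof -
      have "F u x = (\<Sum>b\<in>B. c b * F b x)" unfolding u using flin_sum[OF F fB, of c "\<lambda>b. b"] by simp
      also have "\<dots> = (\<Sum>b\<in>B - C. c b * F b x) + (\<Sum>b\<in>C. c b * F b x)" by (rule sum.subset_diff[OF B(1) fB])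
      also have "(\<Sum>b\<in>C. c b * F b x) = 0" using C(1) by (intro sum.neutral) auto
      also have "(\<Sum>b\<in>B - C. c b * F b x) = (\<Sum>i<?k. c (v i) * F (v i) x)"
        using sum.reindex_bij_betw[OF v, of "\<lambda>b. c b * F b x"] by simp
      finally show ?thesis by simp
    qed
    then have "F u = (\<lambda>x. \<Sum>i<?k. c (v i) * F (v i) x)" by blast
    then show "F u \<in> fsp.span ((\<lambda>i. F (v i)) ` {..<?k})" using fsp_span_sum[where k="?k" and c="\<lambda>i. c (v i)" and u="\<lambda>i. F (v i)"] by simp
  qed
  then show fi: "findim (F ` V)" unfolding findim_def by (intro exI[of _ "(\<lambda>i. F (v i)) ` {..<?k}"]) auto
  have "indep ?k (\<lambda>i. F (v i))"
    unfolding indep_def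
  proof (intro allI impI)
    fix c i assume z: "\<forall>x. (\<Sum>i<?k. c i * F (v i) x) = 0" and i: "i < ?k"
    let ?w = "\<lambda>x. \<Sum>i<?k. c i * v i x"
    have "F ?w = (\<lambda>_. 0)" using flin_sum[OF F, of "{..<?k}" c v] z by auto
    moreover have "?w \<in> V" using csub_sum[OF V, of "{..<?k}" v c] vV by auto
    ultimately have "?w \<in> fsp.span C" using C(3) by blast
    then obtain d where d: "?w = (\<Sum>b\<in>C. (\<lambda>x. d b * b x))" unfolding fsp.span_finite[OF fC] by auto
    define e where "e b = (if b \<in> C then - d b else c (the_inv_into {..<?k} v b))" for b
    have inj: "inj_on v {..<?k}" using v by (simp add: bij_betw_def)
    have ev: "e (v i) = c i" if "i < ?k" for i
      using that v the_inv_into_f_f[OF inj, of i] by (auto simp: e_def bij_betw_def)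
    have "(\<Sum>b\<in>B. (\<lambda>x. e b * b x)) = 0"
    proof
      fix x
      have "(\<Sum>b\<in>B. (\<lambda>x. e b * b x)) x = (\<Sum>b\<in>B - C. e b * b x) + (\<Sum>b\<in>C. e b * b x)"
        unfolding sum_fun_apply by (rule sum.subset_diff[OF B(1) fB])
      also have "(\<Sum>b\<in>B - C. e b * b x) = (\<Sum>i<?k. e (v i) * v i x)" using sum.reindex_bij_betw[OF v, of "\<lambda>b. e b * b x"] by simp
      also have "\<dots> = ?w x" by (intro sum.cong refl) (simp add: ev)
      also have "\<dots> = (\<Sum>b\<in>C. d b * b x)" using fun_cong[OF d, of x] by (simp add: sum_fun_apply)
      also have "(\<Sum>b\<in>C. e b * b x) = - (\<Sum>b\<in>C. d b * b x)" by (simp add: e_def sum_negf)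
      finally show "(\<Sum>b\<in>B. (\<lambda>x. e b * b x)) x = 0 x" by simp
    qed
    then have "e (v i) = 0" using fsp.independentD[OF B(3) fB order_refl] i v by (auto simp: bij_betw_def)
    then show "c i = 0" using ev i by simp
  qed
  then have "?k \<le> fsp.dim (F ` V)" by (rule indep_le_dim[OF fi]) (use vV in auto)
  moreover have "fsp.dim (F ` V) \<le> card ((\<lambda>i. F (v i)) ` {..<?k})" by (rule fsp.dim_le_card[OF span]) simp
  moreover have "card ((\<lambda>i. F (v i)) ` {..<?k}) \<le> ?k" using card_image_le[of "{..<?k}"] by simp
  moreover have "?k = card B - card C" using card_Diff_subset[OF fC B(1)] .
  moreover have "card C \<le> card B" using card_mono[OF fB B(1)] .
  ultimately show "fsp.dim V = fsp.dim ?Z + fsp.dim (F ` V)" using dV C(4) by linarith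
qed

definition fsupp :: "'b set \<Rightarrow> ('b \<Rightarrow> complex) set" where
  "fsupp I = {u. \<forall>x. x \<notin> I \<longrightarrow> u x = 0}"

lemma csub_fsupp: "csub (fsupp I)" by (simp add: csub_def fsupp_def)

lemma fsupp_dim:
  fixes I :: "'b set"
  assumes "finite I"
  shows "findim (fsupp I)" "fsp.dim (fsupp I) = card I"
proof -
  define v where "v i = (\<lambda>x. if x = i then 1 else 0 :: complex)" for i :: 'b
  obtain w where w: "bij_betw w {..<card I} I" using ex_bij_betw_nat_finite[OF assms] by (auto simp: atLeast0LessThan)
  have inj: "inj_on w {..<card I}" using w by (simp add: bij_betw_def)
  have span: "fsupp I \<subseteq> fsp.span ((\<lambda>i. v (w i)) ` {..<card I})"
  proof
    fix u assume u: "u \<in> fsupp I"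
    have "u x = (\<Sum>i<card I. u (w i) * v (w i) x)" for x
    proof -
      have "(\<Sum>i<card I. u (w i) * v (w i) x) = (\<Sum>i\<in>I. u i * v i x)" using sum.reindex_bij_betw[OF w, of "\<lambda>i. u i * v i x"] .
      also have "\<dots> = (\<Sum>i\<in>I. if i = x then u x else 0)" by (intro sum.cong) (auto simp: v_def)
      also have "\<dots> = u x" using u assms by (auto simp: fsupp_def)
      finally show ?thesis by simp
    qed
    then have "u = (\<lambda>x. \<Sum>i<card I. u (w i) * v (w i) x)" by blast
    then show "u \<in> fsp.span ((\<lambda>i. v (w i)) ` {..<card I})" using fsp_span_sum[where k="card I" and c="\<lambda>i. u (w i)" and u="\<lambda>i. v (w i)"] by metis
  qed
  then show f: "findim (fsupp I)" unfolding findim_def by (intro exI[of _ "(\<lambda>i. v (w i)) ` {..<card I}"]) auto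
  have "indep (card I) (\<lambda>i. v (w i))"
    unfolding indep_def
  proof (intro allI impI)
    fix c i assume z: "\<forall>x. (\<Sum>i<card I. c i * v (w i) x) = 0" and i: "i < card I"
    have "(\<Sum>k<card I. c k * v (w k) (w i)) = (\<Sum>k<card I. if k = i then c i else 0)"
      using inj i by (intro sum.cong) (auto simp: v_def inj_on_def)
    then show "c i = 0" using z i by simp
  qed
  then have "card I \<le> fsp.dim (fsupp I)" by (rule indep_le_dim[OF f]) (use w in \<open>auto simp: v_def fsupp_def bij_betw_def\<close>)
  moreover have "fsp.dim (fsupp I) \<le> card ((\<lambda>i. v (w i)) ` {..<card I})" by (rule fsp.dim_le_card[OF span]) simp
  moreover have "card ((\<lambda>i. v (w i)) ` {..<card I}) \<le> card I" using card_image_le[of "{..<card I}"] by simp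
  ultimately show "fsp.dim (fsupp I) = card I" by linarith
qed

section \<open>Functions of the weights that are entire along complex lines\<close>

definition line_entire :: "((nat \<Rightarrow> complex) \<Rightarrow> complex) \<Rightarrow> bool" where
  "line_entire \<Phi> \<longleftrightarrow> (\<forall>l m. (\<lambda>s. \<Phi> (\<lambda>j. l j + s * m j)) holomorphic_on UNIV)"

lemma line_entire_const [simp]: "line_entire (\<lambda>_. a)"
  and line_entire_coord: "line_entire (\<lambda>l. l j)"
  by (auto simp: line_entire_def intro!: holomorphic_intros)

lemma line_entire_mult: "line_entire A \<Longrightarrow> line_entire B \<Longrightarrow> line_entire (\<lambda>l. A l * B l)"
  and line_entire_add: "line_entire A \<Longrightarrow> line_entire B \<Longrightarrow> line_entire (\<lambda>l. A l + B l)"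
  and line_entire_diff: "line_entire A \<Longrightarrow> line_entire B \<Longrightarrow> line_entire (\<lambda>l. A l - B l)"
  and line_entire_minus: "line_entire A \<Longrightarrow> line_entire (\<lambda>l. - A l)"
  and line_entire_exp: "line_entire A \<Longrightarrow> line_entire (\<lambda>l. exp (A l))"
  by (auto simp: line_entire_def intro!: holomorphic_intros holomorphic_on_exp[THEN holomorphic_on_compose[unfolded comp_def], rotated])

lemma line_entire_sum: "(\<And>i. i \<in> I \<Longrightarrow> line_entire (A i)) \<Longrightarrow> line_entire (\<lambda>l. \<Sum>i\<in>I. A i l)"
  by (induction I rule: infinite_finite_induct) (auto intro: line_entire_add)

text \<open>The identity theorem on the line from \<open>l1\<close> to \<open>l2\<close>: near
  \<open>l1\<close> the factor \<open>A\<close> does not vanish, so otherwise \<open>B\<close> would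
  vanish there and then on the entire line. Holomorphy along lines thus suffices to combine generic
  conditions, although weights are arbitrary sequences.\<close>

lemma line_entire_common:
  assumes A: "line_entire A" "A l1 \<noteq> 0" and B: "line_entire B" "B l2 \<noteq> 0"
  shows "\<exists>l. A l * B l \<noteq> 0"
proof (rule ccontr)
  assume n: "\<not> (\<exists>l. A l * B l \<noteq> 0)"
  let ?L = "\<lambda>s j. l1 j + s * (l2 j - l1 j)"
  have hA: "(\<lambda>s. A (?L s)) holomorphic_on UNIV" and hB: "(\<lambda>s. B (?L s)) holomorphic_on UNIV"
    using A B by (auto simp: line_entire_def)
  have "?L 0 = l1" "?L 1 = l2" by auto
  have z: "A (?L s) = 0 \<or> B (?L s) = 0" for s using n by auto
  have A0: "A (?L 0) \<noteq> 0" using A \<open>?L 0 = l1\<close> by metis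
  have B1: "B (?L 1) \<noteq> 0" using B \<open>?L 1 = l2\<close> by metis
  have "continuous_on UNIV (\<lambda>s. A (?L s))" by (rule holomorphic_on_imp_continuous_on[OF hA])
  then have "open {s. A (?L s) \<noteq> 0}" by (intro open_Collect_neq) auto
  moreover have "0 \<in> {s. A (?L s) \<noteq> 0}" using A0 by simp
  ultimately obtain e where e: "e > 0" "ball 0 e \<subseteq> {s. A (?L s) \<noteq> 0}" using open_contains_ball by blast
  have "B (?L 1) = 0"
  proof (rule analytic_continuation[where f="\<lambda>s. B (?L s)" and S=UNIV and U="ball 0 e" and \<xi>=0])
    show "(0::complex) islimpt ball 0 e" using e by (simp add: islimpt_ball)
    show "B (?L s) = 0" if "s \<in> ball 0 e" for s using that e z by blast
  qed (use hB in auto)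
  then show False using B1 by simp
qed

text \<open>In place of a minor, \<open>\<Phi>\<close> is a product of pivots of a Gaussian
  elimination whose pivot positions are chosen at \<open>l0\<close>. Wherever these pivots stay
  nonzero the elimination succeeds and shows independence.\<close>

lemma indep_generic:
  assumes "\<And>i x. i < r \<Longrightarrow> line_entire (\<lambda>l. v i l x)" "indep r (\<lambda>i. v i l0)"
  shows "\<exists>\<Phi>. line_entire \<Phi> \<and> \<Phi> l0 \<noteq> 0 \<and> (\<forall>l. \<Phi> l \<noteq> 0 \<longrightarrow> indep r (\<lambda>i. v i l))"
  using assms
proof (induction r arbitrary: v)
  case 0
  show ?case by (intro exI[of _ "\<lambda>_. 1"]) (auto simp: indep_def)
next
  case (Suc r)
  have "\<exists>x. v r l0 x \<noteq> 0"
  proof (rule ccontr)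
    assume n: "\<nexists>x. v r l0 x \<noteq> 0"
    have "(\<Sum>i<Suc r. (if i = r then 1 else 0) * v i l0 x) = 0" for x using n by simp
    then have "(if r = r then 1 else 0 :: complex) = 0" using Suc.prems(2)[unfolded indep_def, rule_format, of "\<lambda>i. if i = r then 1 else 0" r] by blast
    then show False by simp
  qed
  then obtain x where x: "v r l0 x \<noteq> 0" by blast
  \<comment> \<open>Coordinate \<open>x\<close> is eliminated by cross multiplication instead of
    division, which keeps the entries entire along lines.\<close>
  define w where "w i l = (\<lambda>y. v r l x * v i l y - v i l x * v r l y)" for i l
  have key: "indep (Suc r) (\<lambda>i. v i l) \<longleftrightarrow> indep r (\<lambda>i. w i l)" if nz: "v r l x \<noteq> 0" for l
  proof
    assume a: "indep (Suc r) (\<lambda>i. v i l)"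
    show "indep r (\<lambda>i. w i l)"
      unfolding indep_def
    proof (intro allI impI)
      fix c i assume z: "\<forall>y. (\<Sum>i<r. c i * w i l y) = 0" and i: "i < r"
      define d where "d k = (if k < r then v r l x * c k else - (\<Sum>i<r. c i * v i l x))" for k
      have "(\<Sum>k<Suc r. d k * v k l y) = (\<Sum>i<r. c i * w i l y)" for y
        by (simp add: d_def w_def algebra_simps sum_subtractf sum_distrib_left sum_distrib_right)
      then have "d i = 0" using a z i unfolding indep_def by (metis less_Suc_eq)
      then show "c i = 0" using i nz by (simp add: d_def)
    qed
  next
    assume a: "indep r (\<lambda>i. w i l)"
    show "indep (Suc r) (\<lambda>i. v i l)"
      unfolding indep_def
    proof (intro allI impI)
      fix c i assume z: "\<forall>y. (\<Sum>i<Suc r. c i * v i l y) = 0" and i: "i < Suc r"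
      have "(\<Sum>i<r. c i * w i l y) = v r l x * (\<Sum>i<Suc r. c i * v i l y) - (\<Sum>i<Suc r. c i * v i l x) * v r l y" for y
        by (simp add: w_def algebra_simps sum_subtractf sum_distrib_left sum_distrib_right)
      then have c: "\<forall>i<r. c i = 0" using a z unfolding indep_def by simp
      then have "(\<Sum>i<r. c i * v i l x) = 0" by simp
      then have "c r * v r l x = 0" using z[rule_format, of x] by simp
      then show "c i = 0" using nz c i by (auto simp: less_Suc_eq)
    qed
  qed
  have "\<And>i x. i < r \<Longrightarrow> line_entire (\<lambda>l. w i l x)"
    unfolding w_def using Suc.prems(1) by (intro line_entire_diff line_entire_mult) auto
  then obtain \<Phi> where P: "line_entire \<Phi>" "\<Phi> l0 \<noteq> 0" "\<forall>l. \<Phi> l \<noteq> 0 \<longrightarrow> indep r (\<lambda>i. w i l)"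
    using Suc.IH[of w] key[OF x] Suc.prems(2) by blast
  have "line_entire (\<lambda>l. \<Phi> l * v r l x)" using P Suc.prems(1) by (intro line_entire_mult) auto
  then show ?case using P x key by (intro exI[of _ "\<lambda>l. \<Phi> l * v r l x"]) auto
qed

section \<open>The Cech complex of a nerve and the ranks of its differentials\<close>

locale cech_data =
  fixes \<N> :: "nat set set" and c :: "nat \<Rightarrow> nat \<Rightarrow> nat \<Rightarrow> complex" and J :: "nat set"
  assumes finN: "finite \<N>" and finK: "\<And>K. K \<in> \<N> \<Longrightarrow> finite K"
    and down: "\<And>K L. K \<in> \<N> \<Longrightarrow> L \<subseteq> K \<Longrightarrow> L \<noteq> {} \<Longrightarrow> L \<in> \<N>"
    and coc: "\<And>K i k j. K \<in> \<N> \<Longrightarrow> i \<in> K \<Longrightarrow> k \<in> K \<Longrightarrow> i \<noteq> k \<Longrightarrow> K - {i} - {k} \<noteq> {} \<Longrightarrow> j \<in> J \<Longrightarrow>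
       c (Min K) (Min (K - {i})) j + c (Min (K - {i})) (Min (K - {i} - {k})) j
     = c (Min K) (Min (K - {k})) j + c (Min (K - {k})) (Min (K - {i} - {k})) j"
begin

definition I :: "nat \<Rightarrow> nat set set" where "I q = {K \<in> \<N>. card K = Suc q}"

text \<open>Cut off outside the nerve, the differential becomes a linear map between the finite
  dimensional spaces \<open>fsupp (I q)\<close>, so that it has a rank.\<close>

definition Dn :: "(nat \<Rightarrow> complex) \<Rightarrow> nat \<Rightarrow> (nat set \<Rightarrow> complex) \<Rightarrow> nat set \<Rightarrow> complex" where
  "Dn lam q \<psi> K = (if K \<in> I (Suc q) then cechD (ctrans c J lam) \<psi> K else 0)"

definition Rk :: "(nat \<Rightarrow> complex) \<Rightarrow> nat \<Rightarrow> nat" where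
  "Rk lam q = fsp.dim (Dn lam q ` fsupp (I q))"

lemma finI: "finite (I q)" unfolding I_def using finN by simp

lemma flin_Dn: "flin (Dn lam q)"
  by (auto simp: flin_def Dn_def cechD_linear fun_eq_iff)

lemma I_remove: "K \<in> I (Suc q) \<Longrightarrow> i \<in> K \<Longrightarrow> K - {i} \<in> I q"
proof -
  assume a: "K \<in> I (Suc q)" "i \<in> K"
  then have f: "finite K" and c: "card (K - {i}) = Suc q" using finK by (auto simp: I_def)
  then have "K - {i} \<noteq> {}" by (metis card.empty nat.distinct(1))
  then show ?thesis using a c down[of K "K - {i}"] by (auto simp: I_def)
qed

lemma Dn_cong:
  assumes "\<And>K. K \<in> I q \<Longrightarrow> \<psi> K = \<psi>' K"
  shows "Dn lam q \<psi> = Dn lam q \<psi>'"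
  using assms I_remove by (auto simp: Dn_def cechD_def fun_eq_iff intro!: sum.cong)

lemma Dn_Dn: "Dn lam (Suc q) (Dn lam q \<psi>) = (\<lambda>_. 0)"
proof
  fix K
  show "Dn lam (Suc q) (Dn lam q \<psi>) K = 0"
  proof (cases "K \<in> I (Suc (Suc q))")
    case True
    have KN: "K \<in> \<N>" "finite K" using True finK by (auto simp: I_def)
    have "cechD (ctrans c J lam) (Dn lam q \<psi>) K = cechD (ctrans c J lam) (cechD (ctrans c J lam) \<psi>) K"
      unfolding cechD_def[of _ _ K] using I_remove[OF True] by (intro sum.cong) (auto simp: Dn_def)
    also have "\<dots> = 0"
    proof (rule cechD_cechD[OF KN(2)])
      fix i k assume ik: "i \<in> K" "k \<in> K" "i \<noteq> k"
      have "K - {i} - {k} \<in> I q" using I_remove[OF I_remove[OF True ik(1)], of k] ik by auto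
      then have ne: "K - {i} - {k} \<noteq> {}" using I_def[of q] by (cases "K - {i} - {k} = {}") simp_all
      have sw: "K - {k} - {i} = K - {i} - {k}" by auto
      have "(\<Sum>j\<in>J. lam j * c (Min K) (Min (K - {i})) j) + (\<Sum>j\<in>J. lam j * c (Min (K - {i})) (Min (K - {i} - {k})) j)
          = (\<Sum>j\<in>J. lam j * c (Min K) (Min (K - {k})) j) + (\<Sum>j\<in>J. lam j * c (Min (K - {k})) (Min (K - {i} - {k})) j)"
        unfolding sum.distrib[symmetric] distrib_left[symmetric] using coc[OF KN(1) ik ne] by (intro sum.cong) auto
      then show "ctrans c J lam K i * ctrans c J lam (K - {i}) k = ctrans c J lam K k * ctrans c J lam (K - {k}) i"
        unfolding ctrans_def exp_add[symmetric] sw minus_add_distrib[symmetric] by simp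
    qed
    finally show ?thesis by (simp add: Dn_def True)
  qed (simp add: Dn_def)
qed

lemma Dn_fsupp: "Dn lam q \<psi> \<in> fsupp (I (Suc q))" by (simp add: fsupp_def Dn_def)

definition Zn where "Zn lam q = {u\<in>fsupp (I q). Dn lam q u = (\<lambda>_. 0)}"
definition Bn where "Bn lam q = (if q = 0 then {\<lambda>_. 0} else Dn lam (q - 1) ` fsupp (I (q - 1)))"

lemma csub_Zn: "csub (Zn lam q)"
  unfolding csub_def Zn_def using csub_fsupp[of "I q"] flinD[OF flin_Dn] flin_sum[OF flin_Dn, of "{}"] by (auto simp: csub_def)

lemma csub_Bn: "csub (Bn lam q)"
  unfolding Bn_def using csub_image[OF flin_Dn csub_fsupp] by (auto simp: csub_def)

lemma Bn_Zn: "Bn lam q \<subseteq> Zn lam q"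
proof (cases q)
  case 0
  then show ?thesis using csub_Zn by (auto simp: Bn_def csub_def)
next
  case (Suc r)
  then show ?thesis using Dn_Dn Dn_fsupp by (auto simp: Bn_def Zn_def)
qed

text \<open>The conditions in \<open>cechZ\<close> and \<open>cechB\<close> leave values outside
  \<open>I q\<close> free; setting them to 0 picks a representative.\<close>

lemma cech_normalize: "qdim (cechZ \<N> c J lam q) (cechB \<N> c J lam q) = qdim (Zn lam q) (Bn lam q)"
proof (rule lin_corr_qdim)
  define R where "R = (\<lambda>\<psi> \<psi>'. \<psi> \<in> cechZ \<N> c J lam q \<and> \<psi>' \<in> Zn lam q \<and> (\<forall>K\<in>I q. \<psi> K = \<psi>' K))"
  have Z: "\<psi> \<in> cechZ \<N> c J lam q \<longleftrightarrow> Dn lam q \<psi> = (\<lambda>_. 0)" for \<psi>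
    by (auto simp: cechZ_def Dn_def I_def fun_eq_iff)
  have W: "\<psi> \<in> cechB \<N> c J lam q \<longleftrightarrow> \<psi>' \<in> Bn lam q" if R: "R \<psi> \<psi>'" for \<psi> \<psi>'
  proof -
    have e: "\<And>K. K \<in> I q \<Longrightarrow> \<psi> K = \<psi>' K" and s: "\<psi>' \<in> fsupp (I q)" using R by (auto simp: R_def Zn_def)
    show ?thesis
    proof (cases q)
      case 0
      show ?thesis using e s by (auto simp: cechB_def Bn_def 0 I_def fsupp_def fun_eq_iff)
    next
      case (Suc r)
      show ?thesis
      proof
        assume "\<psi> \<in> cechB \<N> c J lam q"
        then obtain th where th: "\<forall>K\<in>I q. \<psi> K = cechD (ctrans c J lam) th K" by (auto simp: cechB_def Suc I_def)
        define th' where "th' K = (if K \<in> I r then th K else 0)" for K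
        have "Dn lam r th' = Dn lam r th" by (rule Dn_cong) (simp add: th'_def)
        moreover have "\<psi>' = Dn lam r th" using th e s by (auto simp: fun_eq_iff Dn_def fsupp_def Suc)
        moreover have "th' \<in> fsupp (I r)" by (simp add: th'_def fsupp_def)
        ultimately show "\<psi>' \<in> Bn lam q" unfolding Bn_def Suc by (metis diff_Suc_1 image_eqI nat.distinct(1))
      next
        assume "\<psi>' \<in> Bn lam q"
        then obtain th where "\<psi>' = Dn lam r th" by (auto simp: Bn_def Suc)
        then have "\<forall>K\<in>\<N>. card K = Suc q \<longrightarrow> \<psi> K = cechD (ctrans c J lam) th K" using e by (auto simp: I_def Dn_def Suc)
        then show "\<psi> \<in> cechB \<N> c J lam q" by (auto simp: cechB_def Suc)
      qed
    qed
  qed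
  show "lin_corr (cechZ \<N> c J lam q) (cechB \<N> c J lam q) (Zn lam q) (Bn lam q) R"
    unfolding lin_corr_def
  proof (intro conjI allI ballI impI csub_cechZ csub_cechB csub_Zn csub_Bn)
    fix \<psi> assume z: "\<psi> \<in> cechZ \<N> c J lam q"
    define \<psi>' where "\<psi>' K = (if K \<in> I q then \<psi> K else 0)" for K
    have "Dn lam q \<psi>' = Dn lam q \<psi>" by (rule Dn_cong) (simp add: \<psi>'_def)
    then have "\<psi>' \<in> Zn lam q" using z by (simp add: Z Zn_def fsupp_def \<psi>'_def)
    then show "\<exists>\<psi>'. R \<psi> \<psi>'" unfolding R_def using z by (auto simp: \<psi>'_def intro!: exI[of _ \<psi>'])
  next
    fix \<psi>' assume "\<psi>' \<in> Zn lam q"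
    then show "\<exists>\<psi>. R \<psi> \<psi>'" unfolding R_def using Z by (auto simp: Zn_def intro!: exI[of _ \<psi>'])
  next
    fix x x' y y' a b assume "R x x'" "R y y'"
    then show "R (\<lambda>t. a * x t + b * y t) (\<lambda>t. a * x' t + b * y' t)"
      unfolding R_def using csubD[OF csub_cechZ] csubD[OF csub_Zn] by auto
  qed (use W in \<open>auto simp: R_def\<close>)
qed

definition Rm :: "(nat \<Rightarrow> complex) \<Rightarrow> nat \<Rightarrow> nat" where
  "Rm lam q = (if q = 0 then 0 else Rk lam (q - 1))"

lemma cech_dim:
  "qdim (cechZ \<N> c J lam q) (cechB \<N> c J lam q) = enat (card (I q) - Rk lam q - Rm lam q)"
  "Rk lam q + Rm lam q \<le> card (I q)"
proof -
  note fi = fsupp_dim[OF finI[of q]]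
  have fZ: "findim (Zn lam q)" by (rule findim_mono[OF fi(1)]) (auto simp: Zn_def)
  have "card (I q) = fsp.dim (Zn lam q) + Rk lam q"
    using rank_nullity(1)[OF flin_Dn csub_fsupp fi(1)] fi(2) by (simp add: Zn_def Rk_def)
  moreover have "fsp.dim (Bn lam q) = Rm lam q"
  proof (cases q)
    case 0
    have "fsp.dim {\<lambda>_::nat set. 0 :: complex} \<le> card ({} :: (nat set \<Rightarrow> complex) set)"
      by (rule fsp.dim_le_card) (auto simp: zero_fun_def)
    then show ?thesis using 0 by (simp add: Bn_def Rm_def)
  qed (simp add: Bn_def Rm_def Rk_def)
  moreover note qdim_eq_dim_diff[OF csub_Zn csub_Bn Bn_Zn fZ]
  ultimately show "qdim (cechZ \<N> c J lam q) (cechB \<N> c J lam q) = enat (card (I q) - Rk lam q - Rm lam q)"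
    "Rk lam q + Rm lam q \<le> card (I q)" unfolding cech_normalize by simp_all
qed

text \<open>Fix vectors, as many as the rank at \<open>l0\<close>, with independent images there.
  Their images at other weights have entries entire along lines, so they stay independent
  generically.\<close>

lemma Rk_generic: "\<exists>\<Phi>. line_entire \<Phi> \<and> \<Phi> l0 \<noteq> 0 \<and> (\<forall>l. \<Phi> l \<noteq> 0 \<longrightarrow> Rk l0 q \<le> Rk l q)"
proof -
  note fi = fsupp_dim[OF finI[of q]]
  have fR: "findim (Dn l q ` fsupp (I q))" for l by (rule rank_nullity(2)[OF flin_Dn csub_fsupp fi(1)])
  obtain v where v: "indep (Rk l0 q) v" "\<And>i. i < Rk l0 q \<Longrightarrow> v i \<in> Dn l0 q ` fsupp (I q)"
    using dim_family[OF fR[of l0]] unfolding Rk_def by metis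
  have "\<forall>i. \<exists>u. i < Rk l0 q \<longrightarrow> u \<in> fsupp (I q) \<and> v i = Dn l0 q u" using v(2) by blast
  then obtain u where u: "\<And>i. i < Rk l0 q \<Longrightarrow> u i \<in> fsupp (I q) \<and> v i = Dn l0 q (u i)" by metis
  have le: "line_entire (\<lambda>l. Dn l q (u i) K)" for i K
  proof (cases "K \<in> I (Suc q)")
    case True
    have "line_entire (\<lambda>l. ctrans c J l K k)" for k
      unfolding ctrans_def by (intro line_entire_exp line_entire_minus line_entire_sum line_entire_mult line_entire_coord line_entire_const)
    then show ?thesis using True unfolding Dn_def cechD_def by (simp, intro line_entire_sum line_entire_mult line_entire_const)
  qed (simp add: Dn_def)
  have "indep (Rk l0 q) (\<lambda>i. Dn l0 q (u i))"
    using v(1) u unfolding indep_def by simp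
  from indep_generic[OF le this] obtain \<Phi> where P: "line_entire \<Phi>" "\<Phi> l0 \<noteq> 0" "\<forall>l. \<Phi> l \<noteq> 0 \<longrightarrow> indep (Rk l0 q) (\<lambda>i. Dn l q (u i))" by blast
  moreover have "Rk l0 q \<le> Rk l q" if "\<Phi> l \<noteq> 0" for l
    unfolding Rk_def[of l]
  proof (rule indep_le_dim[OF fR])
    show "indep (Rk l0 q) (\<lambda>i. Dn l q (u i))" using P that by blast
    show "Dn l q (u i) \<in> Dn l q ` fsupp (I q)" if "i < Rk l0 q" for i using u[OF that] by blast
  qed
  ultimately show ?thesis by blast
qed

text \<open>By \<open>cech_dim\<close> the dimension is a number of simplices minus two ranks, and
  ranks generically do not drop below their value at \<open>l0\<close>.\<close>

lemma cech_usc: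
  "\<exists>\<Phi>. line_entire \<Phi> \<and> \<Phi> l0 \<noteq> 0 \<and> (\<forall>l. \<Phi> l \<noteq> 0 \<longrightarrow>
     qdim (cechZ \<N> c J l q) (cechB \<N> c J l q) \<le> qdim (cechZ \<N> c J l0 q) (cechB \<N> c J l0 q))"
proof -
  obtain A where A: "line_entire A" "A l0 \<noteq> 0" "\<forall>l. A l \<noteq> 0 \<longrightarrow> Rk l0 q \<le> Rk l q" using Rk_generic by blast
  obtain B where B: "line_entire B" "B l0 \<noteq> 0" "\<forall>l. B l \<noteq> 0 \<longrightarrow> Rk l0 (q - 1) \<le> Rk l (q - 1)" using Rk_generic by blast
  show ?thesis
    by (intro exI[of _ "\<lambda>l. A l * B l"] conjI line_entire_mult A B allI impI)
       (use A B in \<open>auto simp: cech_dim(1) Rm_def intro!: diff_le_mono2 add_mono\<close>)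
qed

text \<open>In the alternating sum each rank occurs twice with opposite signs, leaving only numbers
  of simplices, which do not involve the weights.\<close>

lemma cech_euler:
  obtains N ec where "\<And>lam q. q \<ge> N \<Longrightarrow> qdim (cechZ \<N> c J lam q) (cechB \<N> c J lam q) = 0"
    "\<And>lam. (\<Sum>q<N. (-1) ^ q * int (the_enat (qdim (cechZ \<N> c J lam q) (cechB \<N> c J lam q)))) = ec"
proof -
  obtain N where N: "\<And>K. K \<in> \<N> \<Longrightarrow> card K < N"
    using finite_imageI[OF finN, of card] by (metis finite_nat_set_iff_bounded imageI)
  have I0: "I q = {}" if "q \<ge> N" for q using N that by (force simp: I_def)
  have tel: "(\<Sum>q<n. (-1) ^ q * (int (card (I q)) - int (Rk lam q) - int (Rm lam q)))
      = (\<Sum>q<n. (-1) ^ q * int (card (I q))) - (if n = 0 then 0 else (-1) ^ (n - 1) * int (Rk lam (n - 1)))" for lam n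
  proof (induction n)
    case (Suc n)
    then show ?case by (cases n) (auto simp: Rm_def algebra_simps)
  qed simp
  show ?thesis
  proof (rule that[of "Suc N" "\<Sum>q<Suc N. (-1) ^ q * int (card (I q))"])
    show "qdim (cechZ \<N> c J lam q) (cechB \<N> c J lam q) = 0" if "Suc N \<le> q" for lam q
      using I0[of q] that by (simp add: cech_dim(1) zero_enat_def)
    fix lam
    \<comment> \<open>The sum is taken one degree further than the dimension bound: the rank left
      over by telescoping is the one in degree \<open>N\<close>, where there are no
      simplices.\<close>
    have "Rk lam N = 0" using cech_dim(2)[of lam N] I0[of N] by simp
    moreover have "(-1) ^ q * int (the_enat (qdim (cechZ \<N> c J lam q) (cechB \<N> c J lam q)))
        = (-1) ^ q * (int (card (I q)) - int (Rk lam q) - int (Rm lam q))" for q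
      using cech_dim(2)[of lam q] by (simp add: cech_dim(1) of_nat_diff)
    ultimately show "(\<Sum>q<Suc N. (-1) ^ q * int (the_enat (qdim (cechZ \<N> c J lam q) (cechB \<N> c J lam q)))) = (\<Sum>q<Suc N. (-1) ^ q * int (card (I q)))"
      using tel[of lam "Suc N"] by simp
  qed
qed

end

lemma (in leray) cech_data_nerve: "cech_data nerve c J"
proof
  show "finite nerve" by (rule finite_subset[of _ "Pow {..<m}"]) (auto simp: nerve_def)
  show "finite K" if "K \<in> nerve" for K using that finite_subset[of K "{..<m}"] by (auto simp: nerve_def)
  show "L \<in> nerve" if "K \<in> nerve" "L \<subseteq> K" "L \<noteq> {}" for K L using that by (fastforce simp: nerve_def)
  fix K i k j assume a: "K \<in> nerve" "i \<in> K" "k \<in> K" "i \<noteq> k" "K - {i} - {k} \<noteq> {}" "j \<in> J"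
  obtain x where x: "x \<in> UK K" using a by (auto simp: nerve_def)
  have K: "K \<subseteq> {..<m}" "finite K" using a finite_subset[of K "{..<m}"] by (auto simp: nerve_def)
  have M: "Min L < m \<and> x \<in> U (Min L)" if "L \<subseteq> K" "L \<noteq> {}" for L
  proof -
    have "Min L \<in> L" using Min_in[OF finite_subset[OF that(1) K(2)] that(2)] .
    then show ?thesis using that K x by auto
  qed
  have t: "c (Min L) (Min L') j = s (Min L) j x - s (Min L') j x" if "L \<subseteq> K" "L \<noteq> {}" "L' \<subseteq> K" "L' \<noteq> {}" for L L'
    using trans[of "Min L" "Min L'" j x] M[of L] M[of L'] that a(6) by simp
  show "c (Min K) (Min (K - {i})) j + c (Min (K - {i})) (Min (K - {i} - {k})) j
     = c (Min K) (Min (K - {k})) j + c (Min (K - {k})) (Min (K - {i} - {k})) j"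
  proof -
    have n: "K \<noteq> {}" "K - {i} \<noteq> {}" "K - {k} \<noteq> {}" using a(2-5) by auto
    have ss: "K - {i} \<subseteq> K" "K - {k} \<subseteq> K" "K - {i} - {k} \<subseteq> K" by auto
    show ?thesis
      unfolding t[OF order_refl n(1) ss(1) n(2)] t[OF ss(1) n(2) ss(3) a(5)] t[OF order_refl n(1) ss(2) n(3)] t[OF ss(2) n(3) ss(3) a(5)]
      by simp
  qed
qed

section \<open>Twisted cochains and the logarithmic cover\<close>

definition gen_transport :: "nat set \<Rightarrow> (nat \<Rightarrow> 'a \<Rightarrow> complex) \<Rightarrow> (nat \<Rightarrow> complex) \<Rightarrow> ((nat \<Rightarrow> real) \<Rightarrow> 'a) \<Rightarrow> complex" where
  "gen_transport J f lam \<sigma> = exp (\<Sum>j\<in>J. lam j * log_change (\<lambda>s. f j (edge10 \<sigma> s)))"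

lemma log_change_eq:
  assumes h: "continuous_on {0..1} h" "\<And>s. s \<in> {0..1} \<Longrightarrow> exp (h s) = \<gamma> s"
  shows "log_change \<gamma> = h 1 - h 0"
  unfolding log_change_def
proof (rule the_equality)
  show "\<exists>h'. continuous_on {0..1} h' \<and> (\<forall>s\<in>{0..1}. exp (h' s) = \<gamma> s) \<and> h 1 - h 0 = h' 1 - h' 0"
    using h by blast
  fix d assume "\<exists>h'. continuous_on {0..1} h' \<and> (\<forall>s\<in>{0..1}. exp (h' s) = \<gamma> s) \<and> d = h' 1 - h' 0"
  then obtain h' where h': "continuous_on {0..1} h'" "\<forall>s\<in>{0..1}. exp (h' s) = \<gamma> s" "d = h' 1 - h' 0" by blast
  have "(\<lambda>s. h' s - h s) constant_on {0..1}"
  proof (rule constant_log)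
    show "exp (h' s - h s) = 1" if "s \<in> {0..1}" for s
      using that h' h(2) exp_not_eq_zero[of "h s"] by (simp add: exp_diff)
  qed (auto intro: continuous_on_diff h h')
  then obtain k where "\<And>s. s \<in> {0..1} \<Longrightarrow> h' s - h s = k" by (auto simp: constant_on_def)
  from this[of 0] this[of 1] show "d = h 1 - h 0" using h'(3) by (auto simp: algebra_simps)
qed

text \<open>Compare \<open>F\<close> at \<open>N\<close> steps along the segment from vertex 0 to
  the point. By compactness \<open>N\<close> can be so large that consecutive quotients have
  positive real part; their principal logarithms are continuous and add up to a logarithm of
  \<open>F\<close>.\<close>

lemma continuous_log_simplex:
  fixes F :: "(nat \<Rightarrow> real) \<Rightarrow> complex"
  assumes F: "continuous_on (standard_simplex q) F" and nz: "\<And>x. x \<in> standard_simplex q \<Longrightarrow> F x \<noteq> 0"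
  obtains w where "continuous_on (standard_simplex q) w" "\<And>x. x \<in> standard_simplex q \<Longrightarrow> exp (w x) = F x"
proof -
  let ?D = "standard_simplex q" and ?e = "\<lambda>j::nat. if j = 0 then 1 else (0::real)"
  have comp: "compact ?D" using compactin_standard_simplex[of q] unfolding euclidean_product_topology by simp
  define P where "P = (\<lambda>z::real \<times> (nat \<Rightarrow> real). \<lambda>i. (1 - fst z) * ?e i + fst z * snd z i)"
  have Pc: "continuous_on ({0..1} \<times> ?D) P"
    unfolding P_def
  proof (rule continuous_on_coordinatewise_then_product)
    fix i
    have "continuous_on ({0..1} \<times> ?D) (\<lambda>z. snd z i)"
      by (rule continuous_on_product_then_coordinatewise) (intro continuous_on_snd continuous_on_id)
    then show "continuous_on ({0..1} \<times> ?D) (\<lambda>z. (1 - fst z) * ?e i + fst z * snd z i)"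
      by (intro continuous_intros)
  qed
  have Pm: "P z \<in> ?D" if "z \<in> {0..1} \<times> ?D" for z
    using that convex_standard_simplex[of ?e q "snd z" "fst z"] by (auto simp: P_def)
  have FP: "continuous_on ({0..1} \<times> ?D) (\<lambda>z. F (P z))"
    by (rule continuous_on_compose2[OF F Pc]) (use Pm in auto)
  have cK: "compact ({0..1::real} \<times> ?D)" by (intro compact_Times comp) simp
  have "uniformly_continuous_on ({0..1} \<times> ?D) (\<lambda>z. F (P z))" by (rule compact_uniformly_continuous[OF FP cK])
  moreover have "\<exists>r>0. \<forall>x\<in>?D. r \<le> cmod (F x)"
  proof -
    have ne: "?D \<noteq> {}" by (rule nonempty_standard_simplex)
    have "continuous_on ?D (\<lambda>x. cmod (F x))" by (intro continuous_on_norm F)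
    then obtain x where "x \<in> ?D" "\<forall>y\<in>?D. cmod (F x) \<le> cmod (F y)" using continuous_attains_inf[OF comp ne] by blast
    then show ?thesis using nz by (intro exI[of _ "cmod (F x)"]) auto
  qed
  then obtain r where r: "r > 0" "\<And>x. x \<in> ?D \<Longrightarrow> r \<le> cmod (F x)" by blast
  ultimately obtain d where d: "d > 0" "\<And>x y. x \<in> {0..1} \<times> ?D \<Longrightarrow> y \<in> {0..1} \<times> ?D \<Longrightarrow> dist y x < d \<Longrightarrow> dist (F (P y)) (F (P x)) < r"
    unfolding uniformly_continuous_on_def by metis
  obtain N :: nat where N: "N > 0" "1 / real N < d"
    using reals_Archimedean[OF d(1)] by (metis inverse_eq_divide zero_less_Suc)
  define Q where "Q k x = F (P (real k / real N, x))" for k x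
  have Qm: "(real k / real N, x) \<in> {0..1} \<times> ?D" if "k \<le> N" "x \<in> ?D" for k x using that N by auto
  have Qnz: "Q k x \<noteq> 0" "r \<le> cmod (Q k x)" if "k \<le> N" "x \<in> ?D" for k x
    unfolding Q_def using nz r Pm[OF Qm[OF that]] by auto
  have step: "Re (Q (Suc k) x / Q k x) > 0" if "k < N" "x \<in> ?D" for k x
  proof -
    have k: "k \<le> N" "Suc k \<le> N" using that by auto
    have "dist (real (Suc k) / real N, x) (real k / real N, x) = 1 / real N"
      using N by (simp add: dist_Pair_Pair dist_real_def diff_divide_distrib[symmetric])
    then have "cmod (Q (Suc k) x - Q k x) < r"
      using d(2)[OF Qm[OF k(1) that(2)] Qm[OF k(2) that(2)]] N by (simp add: Q_def dist_norm)
    also have "r \<le> cmod (Q k x)" using Qnz k that by blast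
    finally have "cmod ((Q (Suc k) x - Q k x) / Q k x) < 1"
      using Qnz(1)[OF k(1) that(2)] by (simp add: norm_divide field_simps)
    moreover have "(Q (Suc k) x - Q k x) / Q k x = Q (Suc k) x / Q k x - 1" using Qnz(1)[OF k(1) that(2)] by (simp add: field_simps)
    ultimately have "cmod (Q (Suc k) x / Q k x - 1) < 1" by simp
    then have "\<bar>Re (Q (Suc k) x / Q k x - 1)\<bar> < 1" using abs_Re_le_cmod order_le_less_trans by blast
    then show ?thesis by simp
  qed
  have Qc: "continuous_on ?D (Q k)" if "k \<le> N" for k
    unfolding Q_def
    by (rule continuous_on_compose2[OF FP, of _ "\<lambda>x. (real k / real N, x)"])
       (use Qm[OF that] in \<open>auto intro!: continuous_on_Pair continuous_on_const continuous_on_id\<close>)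
  define w where "w n x = Ln (F ?e) + (\<Sum>k<n. Ln (Q (Suc k) x / Q k x))" for n x
  have wc: "continuous_on ?D (w n)" if "n \<le> N" for n
    unfolding w_def
  proof (intro continuous_on_add continuous_on_const continuous_on_sum)
    fix k assume "k \<in> {..<n}"
    then have k: "k < N" "k \<le> N" "Suc k \<le> N" using that by auto
    have "continuous_on ?D (\<lambda>x. Q (Suc k) x / Q k x)"
      by (intro continuous_on_divide Qc k) (use Qnz k in auto)
    then show "continuous_on ?D (\<lambda>x. Ln (Q (Suc k) x / Q k x))"
      by (rule continuous_on_Ln') (use step[OF k(1)] in \<open>fastforce simp: complex_nonpos_Reals_iff\<close>)
  qed
  have we: "exp (w n x) = Q n x" if "n \<le> N" "x \<in> ?D" for n x
    using that(1)
  proof (induction n)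
    case 0
    have "P (0, x) = ?e" by (simp add: P_def)
    then show ?case using nz[of ?e] by (simp add: w_def Q_def)
  next
    case (Suc n)
    have "exp (w (Suc n) x) = exp (w n x) * exp (Ln (Q (Suc n) x / Q n x))" by (simp add: w_def exp_add algebra_simps)
    then show ?case using Suc Qnz[of n x] Qnz[of "Suc n" x] that(2) by simp
  qed
  have "Q N x = F x" for x using N by (simp add: Q_def P_def)
  then show ?thesis using that[OF wc[of N]] we[of N] by simp
qed

lemma lift_exists:
  fixes \<sigma> :: "(nat \<Rightarrow> real) \<Rightarrow> 'a::topological_space"
  assumes s: "singular_simplex q (top_of_set Y) \<sigma>"
    and fc: "\<And>j. j \<in> J \<Longrightarrow> continuous_on Y (f j)" and nz: "\<And>j x. j \<in> J \<Longrightarrow> x \<in> Y \<Longrightarrow> f j x \<noteq> 0"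
  obtains \<tau> where "\<tau> \<in> sys_of (cover J f Y) q" "simplex_map q fst \<tau> = \<sigma>"
proof -
  let ?D = "standard_simplex q"
  have sc: "continuous_on ?D \<sigma>" and sY: "\<And>x. x \<in> ?D \<Longrightarrow> \<sigma> x \<in> Y" and se: "\<sigma> \<in> extensional ?D"
    using s by (auto simp: singular_simplex_def euclidean_product_topology Pi_iff)
  have "\<exists>w. continuous_on ?D w \<and> (\<forall>x\<in>?D. exp (w x) = f j (\<sigma> x))" if "j \<in> J" for j
  proof -
    have "continuous_on ?D (\<lambda>x. f j (\<sigma> x))" by (rule continuous_on_compose2[OF fc[OF that] sc]) (use sY in auto)
    then show ?thesis using continuous_log_simplex[of q "\<lambda>x. f j (\<sigma> x)"] nz[OF that sY] by metis
  qed
  then obtain w where w: "\<And>j. j \<in> J \<Longrightarrow> continuous_on ?D (w j) \<and> (\<forall>x\<in>?D. exp (w j x) = f j (\<sigma> x))" by metis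
  define \<tau> where "\<tau> = restrict (\<lambda>x. (\<sigma> x, \<lambda>j. if j \<in> J then w j x else 0)) ?D"
  have "continuous_on ?D (\<lambda>x. (\<sigma> x, \<lambda>j. if j \<in> J then w j x else 0))"
  proof (intro continuous_on_Pair sc continuous_on_coordinatewise_then_product)
    show "continuous_on ?D (\<lambda>x. if j \<in> J then w j x else 0)" for j using w by (cases "j \<in> J") auto
  qed
  then have "continuous_on ?D \<tau>" by (rule continuous_on_eq) (simp add: \<tau>_def)
  then have "\<tau> \<in> sys_of (cover J f Y) q"
    using w sY by (auto simp: sys_of_iff singular_simplex_def euclidean_product_topology \<tau>_def cover_def)
  moreover have "simplex_map q fst \<tau> = \<sigma>"
    using se by (auto simp: simplex_map_def \<tau>_def restrict_def extensional_def fun_eq_iff)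
  ultimately show ?thesis by (rule that)
qed

lemma lift_unique:
  assumes t: "\<tau> \<in> sys_of (cover J f Y) q" "\<tau>' \<in> sys_of (cover J f Y) q" and e: "simplex_map q fst \<tau> = simplex_map q fst \<tau>'"
  obtains g where "g \<in> Gam J" "\<tau>' = simplex_map q (deck g) \<tau>"
proof -
  let ?D = "standard_simplex q" and ?e = "\<lambda>j::nat. if j = 0 then 1 else (0::real)"
  have fs: "fst (\<tau> x) = fst (\<tau>' x)" if "x \<in> ?D" for x using fun_cong[OF e, of x] that by (simp add: simplex_map_def)
  have m: "\<tau> x \<in> cover J f Y" "\<tau>' x \<in> cover J f Y" if "x \<in> ?D" for x using t that by (auto simp: sys_of_iff)
  have ev: "\<tau> \<in> extensional ?D" "\<tau>' \<in> extensional ?D" using t by (auto simp: sys_of_iff singular_simplex_def)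
  have "\<exists>n::int. \<forall>x\<in>?D. snd (\<tau>' x) j = snd (\<tau> x) j + 2 * complex_of_real pi * \<i> * of_int n" if j: "j \<in> J" for j
  proof -
    have c: "continuous_on ?D (\<lambda>z. snd (\<rho> z) j)" if "\<rho> \<in> sys_of (cover J f Y) q" for \<rho>
      by (rule continuous_on_product_then_coordinatewise, rule continuous_on_snd, rule sys_of_continuous[OF that])
    have ex: "exp (snd (\<tau>' x) j) = exp (snd (\<tau> x) j)" if "x \<in> ?D" for x
      using m[OF that] j fs[OF that] by (simp add: cover_def)
    have "(\<lambda>x. snd (\<tau>' x) j - snd (\<tau> x) j) constant_on ?D"
      by (rule constant_log[OF connected_standard_simplex continuous_on_diff[OF c[OF t(2)] c[OF t(1)]]]) (simp add: exp_diff ex)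
    then obtain k where k: "\<And>x. x \<in> ?D \<Longrightarrow> snd (\<tau>' x) j - snd (\<tau> x) j = k" by (auto simp: constant_on_def)
    have "?e \<in> ?D" by simp
    from ex[OF this] obtain n :: int where "snd (\<tau>' ?e) j = snd (\<tau> ?e) j + (of_int (2 * n) * pi) * \<i>" unfolding exp_eq by blast
    then have "k = 2 * complex_of_real pi * \<i> * of_int n" using k[of ?e] by (simp add: algebra_simps)
    then show ?thesis using k by (intro exI[of _ n]) (auto simp: algebra_simps)
  qed
  then obtain n where n: "\<And>j x. j \<in> J \<Longrightarrow> x \<in> ?D \<Longrightarrow> snd (\<tau>' x) j = snd (\<tau> x) j + 2 * complex_of_real pi * \<i> * of_int (n j)" by metis
  define g where "g j = (if j \<in> J then n j else 0)" for j
  have "\<tau>' x = simplex_map q (deck g) \<tau> x" for x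
  proof (cases "x \<in> ?D")
    case True
    have "snd (\<tau>' x) j = snd (deck g (\<tau> x)) j" for j
      using n[of j x] True m[OF True] by (cases "j \<in> J") (auto simp: deck_def g_def cover_def)
    then show ?thesis using True fs[OF True] by (auto simp: simplex_map_def prod_eq_iff deck_def)
  qed (use ev in \<open>auto simp: simplex_map_def extensional_def\<close>)
  then show ?thesis by (intro that[of g]) (auto simp: Gam_def g_def)
qed

text \<open>The multivalued function prod f_j^(- lam_j), made single valued on the cover and taken
  at vertex 0. Multiplication by it identifies twisted cochains with equivariant ones.\<close>

definition wt :: "nat set \<Rightarrow> (nat \<Rightarrow> complex) \<Rightarrow> ((nat \<Rightarrow> real) \<Rightarrow> 'a cov) \<Rightarrow> complex" where
  "wt J lam \<tau> = exp (- (\<Sum>j\<in>J. lam j * snd (\<tau> (\<lambda>j. if j = 0 then 1 else 0)) j))"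

lemma wt_nz [simp]: "wt J lam \<tau> \<noteq> 0" by (simp add: wt_def)

lemma wt_deck: "wt J lam (simplex_map q (deck g) \<tau>) = chi J lam g * wt J lam \<tau>"
  by (simp add: wt_def chi_def simplex_map_def deck_def exp_add[symmetric] algebra_simps sum.distrib)

text \<open>The face opposite vertex 0 starts at vertex 1. The lift provides continuous logarithms
  along the edge from vertex 1 to vertex 0, so the transport is the quotient of the two weights; the
  other faces keep vertex 0 (\<open>wt_face\<close>).\<close>

lemma gen_transport_wt:
  assumes t: "\<tau> \<in> sys_of (cover J f Y) (Suc q)"
  shows "gen_transport J f lam (simplex_map (Suc q) fst \<tau>) * wt J lam \<tau> = wt J lam (singular_face (Suc q) 0 \<tau>)"
proof -
  let ?D = "standard_simplex (Suc q)"
  let ?p = "\<lambda>s i. (1 - s) * std_vertex 1 i + s * std_vertex 0 i"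
  have v: "std_vertex 1 \<in> ?D" "std_vertex 0 \<in> ?D" by (auto simp: std_vertex_def eq_commute)
  have pm: "?p s \<in> ?D" if "s \<in> {0..1}" for s
    using convex_standard_simplex[OF v, of s] that by simp
  have pc: "continuous_on {0..1} ?p" by (intro continuous_on_coordinatewise_then_product continuous_intros)
  have p01: "?p 0 = std_vertex 1" "?p 1 = std_vertex 0" by auto
  have lc: "log_change (\<lambda>s. f j (edge10 (simplex_map (Suc q) fst \<tau>) s)) = snd (\<tau> (std_vertex 0)) j - snd (\<tau> (std_vertex 1)) j" if j: "j \<in> J" for j
  proof -
    let ?h = "\<lambda>s. snd (\<tau> (?p s)) j"
    have "log_change (\<lambda>s. f j (edge10 (simplex_map (Suc q) fst \<tau>) s)) = ?h 1 - ?h 0"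
    proof (rule log_change_eq)
      have "continuous_on ?D (\<lambda>z. snd (\<tau> z) j)"
        by (rule continuous_on_product_then_coordinatewise, rule continuous_on_snd, rule sys_of_continuous[OF t])
      then show "continuous_on {0..1} ?h" by (rule continuous_on_compose2[OF _ pc]) (use pm in auto)
      fix s :: real assume s: "s \<in> {0..1}"
      then have "\<tau> (?p s) \<in> cover J f Y" using t pm by (auto simp: sys_of_iff)
      then show "exp (?h s) = f j (edge10 (simplex_map (Suc q) fst \<tau>) s)"
        using j pm[OF s] by (simp add: edge10_def simplex_map_def cover_def)
    qed
    then show ?thesis unfolding p01 .
  qed
  have e0: "(\<lambda>j. if j = 0 then 1 else 0) = std_vertex 0" by (auto simp: std_vertex_def)
  have "simplical_face 0 (std_vertex 0) = std_vertex 1" by (auto simp: simplical_face_def std_vertex_def fun_eq_iff)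
  then have f0: "singular_face (Suc q) 0 \<tau> (std_vertex 0) = \<tau> (std_vertex 1)"
    by (simp add: singular_face_def std_vertex_def eq_commute)
  have "(\<Sum>j\<in>J. lam j * log_change (\<lambda>s. f j (edge10 (simplex_map (Suc q) fst \<tau>) s)))
     = (\<Sum>j\<in>J. lam j * snd (\<tau> (std_vertex 0)) j) - (\<Sum>j\<in>J. lam j * snd (\<tau> (std_vertex 1)) j)"
    unfolding sum_subtractf[symmetric] by (intro sum.cong refl) (simp add: lc algebra_simps)
  then show ?thesis unfolding gen_transport_def wt_def e0 f0 exp_add[symmetric] by simp
qed

lemma wt_face:
  assumes "k \<in> {1..Suc q}"
  shows "wt J lam (singular_face (Suc q) k \<tau>) = wt J lam \<tau>"
proof -
  let ?e = "\<lambda>j::nat. if j = 0 then 1 else (0::real)"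
  have "simplical_face k ?e = ?e" using assms by (auto simp: simplical_face_def fun_eq_iff)
  then have "singular_face (Suc q) k \<tau> ?e = \<tau> ?e" by (simp add: singular_face_def)
  then show ?thesis unfolding wt_def by metis
qed

text \<open>Twisted cochains on \<open>Y\<close> are the equivariant cochains on the abelian cover on which all \<open>log f\<^sub>j\<close> are defined.\<close>

theorem tw_cohom_dim_cover:
  fixes f :: "nat \<Rightarrow> 'a::topological_space \<Rightarrow> complex"
  assumes fc: "\<And>j. j \<in> J \<Longrightarrow> continuous_on Y (f j)" and nz: "\<And>j x. j \<in> J \<Longrightarrow> x \<in> Y \<Longrightarrow> f j x \<noteq> 0"
  shows "tw_cohom_dim (top_of_set Y) (gen_transport J f lam) q = qdim (ZZ J f lam Y q) (BB J f lam Y q)"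
proof -
  let ?X = "top_of_set Y" and ?T = "gen_transport J f lam" and ?S = "sys_of (cover J f Y)"
  define rel where "rel q \<phi> \<Phi> \<longleftrightarrow> (\<forall>\<tau>\<in>?S q. \<Phi> \<tau> = wt J lam \<tau> * \<phi> (simplex_map q fst \<tau>))" for q \<phi> \<Phi>
  have sm: "singular_simplex q ?X (simplex_map q fst \<tau>)" if "\<tau> \<in> ?S q" for q \<tau>
  proof -
    have "continuous_map (top_of_set (cover J f Y)) ?X fst" by (auto simp: continuous_map_in_subtopology cover_def intro: continuous_on_fst continuous_on_id)
    from singular_simplex_simplex_map[OF _ this] show ?thesis using that by (simp add: sys_of_def)
  qed
  have lift: "\<exists>\<tau>\<in>?S q. simplex_map q fst \<tau> = \<sigma>" if "singular_simplex q ?X \<sigma>" for q \<sigma>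
    using lift_exists[of q Y \<sigma> J f, OF that fc nz] by blast
  have fstdeck: "simplex_map q fst (simplex_map q (deck g) \<tau>) = simplex_map q fst \<tau>" for q g and \<tau> :: "(nat \<Rightarrow> real) \<Rightarrow> 'a cov"
    by (auto simp: simplex_map_def deck_def)
  have r_eqvt: "eqvt J lam ?S q \<Phi>" if "rel q \<phi> \<Phi>" for q \<phi> \<Phi>
    unfolding eqvt_def
  proof (intro ballI)
    fix \<tau> g assume "\<tau> \<in> ?S q" "g \<in> Gam J"
    moreover from this have "simplex_map q (deck g) \<tau> \<in> ?S q" using ssys_sys_of[OF deck_inv_cover[of J f Y]] by (auto simp: ssys_def)
    ultimately show "\<Phi> (simplex_map q (deck g) \<tau>) = chi J lam g * \<Phi> \<tau>" using that by (simp add: rel_def wt_deck fstdeck)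
  qed
  have r_cobd: "cobd q \<Phi> \<tau> = wt J lam \<tau> * tw_coboundary ?X ?T q \<phi> (simplex_map (Suc q) fst \<tau>)" if r: "rel q \<phi> \<Phi>" and t: "\<tau> \<in> ?S (Suc q)" for q \<phi> \<Phi> \<tau>
  proof -
    let ?\<sigma> = "simplex_map (Suc q) fst \<tau>"
    have P: "\<Phi> (singular_face (Suc q) k \<tau>) = wt J lam (singular_face (Suc q) k \<tau>) * \<phi> (singular_face (Suc q) k ?\<sigma>)" if "k \<le> Suc q" for k
      using r sys_of_face[OF t that] by (simp add: rel_def singular_face_simplex_map_deck[OF that])
    have "{..Suc q} = insert 0 {1..Suc q}" by auto
    then have "cobd q \<Phi> \<tau> = \<Phi> (singular_face (Suc q) 0 \<tau>) + (\<Sum>k\<in>{1..Suc q}. (-1) ^ k * \<Phi> (singular_face (Suc q) k \<tau>))"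
      unfolding cobd_alt by simp
    also have "\<Phi> (singular_face (Suc q) 0 \<tau>) = wt J lam \<tau> * (?T ?\<sigma> * \<phi> (singular_face (Suc q) 0 ?\<sigma>))"
      using P[of 0] gen_transport_wt[OF t, of lam] by (simp add: mult_ac)
    also have "(\<Sum>k\<in>{1..Suc q}. (-1) ^ k * \<Phi> (singular_face (Suc q) k \<tau>)) = wt J lam \<tau> * (\<Sum>k\<in>{1..Suc q}. (-1) ^ k * \<phi> (singular_face (Suc q) k ?\<sigma>))"
      unfolding sum_distrib_left by (intro sum.cong refl) (simp add: P wt_face)
    finally show ?thesis using sm[OF t] by (simp add: tw_coboundary_def distrib_left)
  qed
  have down: "\<exists>\<phi>\<in>tw_cochains ?X q. rel q \<phi> \<Phi>" if e: "eqvt J lam ?S q \<Phi>" for q \<Phi>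
  proof -
    \<comment> \<open>Any lift will do: another one differs by a deck transformation, which
      multiplies \<open>\<Phi>\<close> and \<open>wt\<close> by the same character.\<close>
    define pick where "pick \<sigma> = (SOME \<tau>. \<tau> \<in> ?S q \<and> simplex_map q fst \<tau> = \<sigma>)" for \<sigma>
    have pick: "pick \<sigma> \<in> ?S q \<and> simplex_map q fst (pick \<sigma>) = \<sigma>" if "singular_simplex q ?X \<sigma>" for \<sigma>
      using someI_ex[of "\<lambda>\<tau>. \<tau> \<in> ?S q \<and> simplex_map q fst \<tau> = \<sigma>"] lift[OF that] unfolding pick_def by blast
    define \<phi> where "\<phi> \<sigma> = (if singular_simplex q ?X \<sigma> then \<Phi> (pick \<sigma>) / wt J lam (pick \<sigma>) else 0)" for \<sigma>
    have "rel q \<phi> \<Phi>"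
      unfolding rel_def
    proof
      fix \<tau> assume t: "\<tau> \<in> ?S q"
      let ?\<sigma> = "simplex_map q fst \<tau>"
      note p = pick[OF sm[OF t]]
      obtain g where g: "g \<in> Gam J" "\<tau> = simplex_map q (deck g) (pick ?\<sigma>)" using lift_unique[OF conjunct1[OF p] t conjunct2[OF p]] by blast
      have "\<Phi> \<tau> = chi J lam g * \<Phi> (pick ?\<sigma>)" "wt J lam \<tau> = chi J lam g * wt J lam (pick ?\<sigma>)"
        using e g p wt_deck[of J lam q g "pick ?\<sigma>"] by (auto simp: eqvt_def) (metis g(2))+
      then show "\<Phi> \<tau> = wt J lam \<tau> * \<phi> ?\<sigma>" using sm[OF t] by (simp add: \<phi>_def)
    qed
    then show ?thesis by (intro bexI[of _ \<phi>]) (auto simp: tw_cochains_def \<phi>_def)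
  qed
  have up: "rel q \<phi> (\<lambda>\<tau>. wt J lam \<tau> * \<phi> (simplex_map q fst \<tau>))" for q \<phi> by (simp add: rel_def)
  have cz: "tw_coboundary ?X ?T q \<phi> = (\<lambda>_. 0) \<longleftrightarrow> (\<forall>\<tau>\<in>?S (Suc q). cobd q \<Phi> \<tau> = 0)" if r: "rel q \<phi> \<Phi>" for q \<phi> \<Phi>
  proof
    assume "\<forall>\<tau>\<in>?S (Suc q). cobd q \<Phi> \<tau> = 0"
    then have "tw_coboundary ?X ?T q \<phi> \<sigma> = 0" if "singular_simplex (Suc q) ?X \<sigma>" for \<sigma>
      using lift[OF that] r_cobd[OF r] by auto
    then show "tw_coboundary ?X ?T q \<phi> = (\<lambda>_. 0)" by (auto simp: tw_coboundary_def fun_eq_iff)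
  qed (simp add: r_cobd[OF r])
  have lin: "tw_coboundary ?X ?T q (\<lambda>t. a * x t + b * y t) = (\<lambda>t. a * tw_coboundary ?X ?T q x t + b * tw_coboundary ?X ?T q y t)" for q a b x y
    by (auto simp: tw_coboundary_def fun_eq_iff sum.distrib sum_distrib_left algebra_simps)
  have zero: "tw_coboundary ?X ?T q (\<lambda>_. 0) = (\<lambda>_. 0)" for q by (auto simp: tw_coboundary_def)
  have cC: "csub (tw_cochains ?X q)" for q by (auto simp: csub_def tw_cochains_def)
  have cZ: "csub (tw_cocycles ?X ?T q)"
    unfolding tw_cocycles_def using cC[of q] by (auto simp: csub_def lin zero)
  have cB: "csub (tw_coboundaries ?X ?T q)"
  proof (cases "q = 0")
    case False
    have "flin (tw_coboundary ?X ?T (q - 1))" by (simp add: flin_def lin)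
    from csub_image[OF this cC] show ?thesis using False by (simp add: tw_coboundaries_def)
  qed (auto simp: tw_coboundaries_def csub_def)
  define R where "R = (\<lambda>\<phi> \<Phi>. \<phi> \<in> tw_cocycles ?X ?T q \<and> \<Phi> \<in> ZZ J f lam Y q \<and> rel q \<phi> \<Phi>)"
  have W: "\<phi> \<in> tw_coboundaries ?X ?T q \<longleftrightarrow> \<Phi> \<in> BB J f lam Y q" if R: "R \<phi> \<Phi>" for \<phi> \<Phi>
  proof -
    have r: "rel q \<phi> \<Phi>" and c: "\<phi> \<in> tw_cochains ?X q" using R by (auto simp: R_def tw_cocycles_def)
    show ?thesis
    proof (cases q)
      case 0
      have "\<phi> = (\<lambda>_. 0) \<longleftrightarrow> (\<forall>\<tau>\<in>?S q. \<Phi> \<tau> = 0)"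
      proof
        assume z: "\<forall>\<tau>\<in>?S q. \<Phi> \<tau> = 0"
        have "\<phi> \<sigma> = 0" for \<sigma>
        proof (cases "singular_simplex q ?X \<sigma>")
          case True
          obtain \<tau> where "\<tau> \<in> ?S q" "simplex_map q fst \<tau> = \<sigma>" using lift[OF True] by blast
          then show ?thesis using z r by (auto simp: rel_def)
        qed (use c in \<open>simp add: tw_cochains_def\<close>)
        then show "\<phi> = (\<lambda>_. 0)" by auto
      qed (use r in \<open>simp add: rel_def\<close>)
      then show ?thesis by (simp add: tw_coboundaries_def Bc_def 0)
    next
      case (Suc p)
      show ?thesis
      proof
        assume "\<phi> \<in> tw_coboundaries ?X ?T q"
        then obtain u where u: "\<phi> = tw_coboundary ?X ?T p u" by (auto simp: tw_coboundaries_def Suc)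
        let ?u = "\<lambda>\<tau>. wt J lam \<tau> * u (simplex_map p fst \<tau>)"
        have "\<forall>\<tau>\<in>?S q. \<Phi> \<tau> = cobd p ?u \<tau>" using r r_cobd[OF up] by (auto simp: rel_def u Suc)
        then show "\<Phi> \<in> BB J f lam Y q" using r_eqvt[OF up, of p u] by (auto simp: Bc_def Suc)
      next
        assume "\<Phi> \<in> BB J f lam Y q"
        then obtain U where U: "eqvt J lam ?S p U" "\<forall>\<tau>\<in>?S q. \<Phi> \<tau> = cobd p U \<tau>" by (auto simp: Bc_def Suc)
        obtain u where u: "u \<in> tw_cochains ?X p" "rel p u U" using down[OF U(1)] by blast
        have "\<phi> \<sigma> = tw_coboundary ?X ?T p u \<sigma>" for \<sigma>
        proof (cases "singular_simplex q ?X \<sigma>")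
          case True
          obtain \<tau> where "\<tau> \<in> ?S q" "simplex_map q fst \<tau> = \<sigma>" using lift[OF True] by blast
          then show ?thesis using r U(2) r_cobd[OF u(2), of \<tau>] by (auto simp: rel_def Suc)
        qed (use c in \<open>simp add: tw_cochains_def tw_coboundary_def Suc\<close>)
        then show "\<phi> \<in> tw_coboundaries ?X ?T q" using u(1) by (auto simp: tw_coboundaries_def Suc)
      qed
    qed
  qed
  have "lin_corr (tw_cocycles ?X ?T q) (tw_coboundaries ?X ?T q) (ZZ J f lam Y q) (BB J f lam Y q) R"
    unfolding lin_corr_def
  proof (intro conjI allI ballI impI cZ cB csub_Zc csub_Bc)
    fix \<phi> assume p: "\<phi> \<in> tw_cocycles ?X ?T q"
    show "\<exists>\<Phi>. R \<phi> \<Phi>"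
      by (intro exI[of _ "\<lambda>\<tau>. wt J lam \<tau> * \<phi> (simplex_map q fst \<tau>)"])
         (use p cz[OF up] r_eqvt[OF up] in \<open>auto simp: R_def up Zc_def tw_cocycles_def\<close>)
  next
    fix \<Phi> assume P: "\<Phi> \<in> ZZ J f lam Y q"
    then have "eqvt J lam ?S q \<Phi>" by (simp add: Zc_def)
    from down[OF this] obtain \<phi> where "\<phi> \<in> tw_cochains ?X q" "rel q \<phi> \<Phi>" by blast
    then show "\<exists>\<phi>. R \<phi> \<Phi>" using P cz by (auto simp: R_def tw_cocycles_def Zc_def)
  next
    fix x x' y y' a b assume "R x x'" "R y y'"
    then show "R (\<lambda>t. a * x t + b * y t) (\<lambda>t. a * x' t + b * y' t)"
      using csubD[OF cZ] by (auto simp: R_def Zc_linear rel_def algebra_simps)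
  qed (use W in \<open>auto simp: R_def\<close>)
  from lin_corr_qdim[OF this] show ?thesis by (simp add: tw_cohom_dim_def)
qed

section \<open>Complements of hyperplanes in convex sets\<close>

text \<open>Three open half planes cover the punctured plane and have no common point; all of their
  nonempty intersections are convex cones carrying a logarithm.\<close>
definition uw :: "nat \<Rightarrow> complex" where
  "uw k = (if k = 0 then 1 else if k = 1 then Complex (- 1 / 2) (- sqrt 3 / 2) else Complex (- 1 / 2) (sqrt 3 / 2))"

definition hpl :: "nat \<Rightarrow> complex set" where
  "hpl k = {z. Re (z * uw k) > 0}"

definition hlog :: "nat \<Rightarrow> complex \<Rightarrow> complex" where
  "hlog k z = Ln (z * uw k) - Ln (uw k)"

lemma uw_nz: "uw k \<noteq> 0" by (simp add: uw_def complex_eq_iff)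

lemma uw_sum: "z * uw 0 + z * uw 1 + z * uw 2 = 0"
  by (simp add: uw_def complex_eq_iff algebra_simps)

lemma hpl_cover: assumes "z \<noteq> 0" shows "\<exists>k<3. z \<in> hpl k"
proof (rule ccontr)
  assume "\<not> (\<exists>k<3. z \<in> hpl k)"
  then have "Re (z * uw k) \<le> 0" if "k < 3" for k using that by (force simp: hpl_def)
  from this[of 0] this[of 1] this[of 2]
  have a: "Re (z * uw 0) \<le> 0" "Re (z * uw 1) \<le> 0" "Re (z * uw 2) \<le> 0" by simp_all
  have "Re (z * uw 0) + Re (z * uw 1) + Re (z * uw 2) = 0" using arg_cong[OF uw_sum[of z], of Re] by simp
  then have "Re (z * uw 0) = 0" "Re (z * uw 1) = 0" using a by linarith+
  then have "Re z = 0" "Im z = 0" by (auto simp: uw_def)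
  then show False using assms by (simp add: complex_eq_iff)
qed

lemma hpl_triple: "hpl 0 \<inter> hpl 1 \<inter> hpl 2 = {}"
proof -
  have False if "z \<in> hpl 0" "z \<in> hpl 1" "z \<in> hpl 2" for z
    using that arg_cong[OF uw_sum[of z], of Re] by (simp add: hpl_def)
  then show ?thesis by blast
qed

lemma open_hpl: "open (hpl k)"
  unfolding hpl_def by (intro open_Collect_less continuous_intros)

lemma hpl_comb:
  assumes "z \<in> hpl k" "w \<in> hpl k" "0 \<le> s" "0 \<le> t" "s + t > 0"
  shows "complex_of_real s * z + complex_of_real t * w \<in> hpl k"
proof -
  have "Re ((complex_of_real s * z + complex_of_real t * w) * uw k) = s * Re (z * uw k) + t * Re (w * uw k)"
    by (simp add: algebra_simps)
  moreover have "s * Re (z * uw k) + t * Re (w * uw k) > 0"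
  proof (cases "s > 0")
    case True
    then have "s * Re (z * uw k) > 0" "t * Re (w * uw k) \<ge> 0" using assms by (simp_all add: hpl_def)
    then show ?thesis by linarith
  next
    case False
    then have "s = 0" "t > 0" using assms by auto
    then show ?thesis using assms by (simp add: hpl_def)
  qed
  ultimately show ?thesis by (simp add: hpl_def)
qed

lemma hpl_scale: "z \<in> hpl k \<Longrightarrow> s > 0 \<Longrightarrow> complex_of_real s * z \<in> hpl k"
  using hpl_comb[of z k z s 0] by simp

lemma convex_hpl: "convex (hpl k)"
  unfolding convex_def
proof (intro ballI allI impI)
  fix x y and u v :: real assume "x \<in> hpl k" "y \<in> hpl k" "0 \<le> u" "0 \<le> v" "u + v = 1"
  then show "u *\<^sub>R x + v *\<^sub>R y \<in> hpl k" using hpl_comb[of x k y u v] by (simp add: scaleR_conv_of_real)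
qed

lemma hpl_nonzero: "z \<in> hpl k \<Longrightarrow> z \<noteq> 0" by (auto simp: hpl_def)

lemma exp_hlog: "z \<in> hpl k \<Longrightarrow> exp (hlog k z) = z"
  using uw_nz[of k] hpl_nonzero[of z k] by (simp add: hlog_def exp_diff)

lemma continuous_hlog: "continuous_on (hpl k) (hlog k)"
  unfolding hlog_def
proof (intro continuous_on_diff continuous_on_const continuous_on_Ln' continuous_intros)
  show "z * uw k \<notin> \<real>\<^sub>\<le>\<^sub>0" if "z \<in> hpl k" for z
    using that by (auto simp: hpl_def complex_nonpos_Reals_iff)
qed

text \<open>The intersection of two half planes is convex, hence connected, so two logarithms on it
  differ by a constant. The choice is made once and is independent of forms and regions.\<close>

definition hcst :: "nat \<Rightarrow> nat \<Rightarrow> complex" where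
  "hcst k l = (SOME d. \<forall>z\<in>hpl k \<inter> hpl l. hlog k z - hlog l z = d)"

lemma hcst: assumes "z \<in> hpl k" "z \<in> hpl l" shows "hlog k z - hlog l z = hcst k l"
proof -
  have "(\<lambda>z. hlog k z - hlog l z) constant_on (hpl k \<inter> hpl l)"
  proof (rule constant_log)
    show "connected (hpl k \<inter> hpl l)" by (intro convex_connected convex_Int convex_hpl)
    show "continuous_on (hpl k \<inter> hpl l) (\<lambda>z. hlog k z - hlog l z)"
      by (intro continuous_on_diff continuous_on_subset[OF continuous_hlog]) auto
    show "exp (hlog k z - hlog l z) = 1" if "z \<in> hpl k \<inter> hpl l" for z
      using that exp_hlog[of z k] exp_hlog[of z l] hpl_nonzero[of z k] by (simp add: exp_diff)
  qed
  then have "\<exists>d. \<forall>z\<in>hpl k \<inter> hpl l. hlog k z - hlog l z = d" by (auto simp: constant_on_def)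
  from someI_ex[OF this] show ?thesis using assms unfolding hcst_def by blast
qed

definition ncell :: "nat set \<Rightarrow> nat" where "ncell J = card (PiE J (\<lambda>_. {..<3::nat}))"

text \<open>Charts in \<open>leray\<close> are numbered, so the choices of one half plane for every
  form are enumerated.\<close>

definition cidx :: "nat set \<Rightarrow> nat \<Rightarrow> nat \<Rightarrow> nat" where
  "cidx J = (SOME u. bij_betw u {..<ncell J} (PiE J (\<lambda>_. {..<3})))"

definition ccst :: "nat set \<Rightarrow> nat \<Rightarrow> nat \<Rightarrow> nat \<Rightarrow> complex" where
  "ccst J i k j = hcst (cidx J i j) (cidx J k j)"

lemma cidx: "finite J \<Longrightarrow> bij_betw (cidx J) {..<ncell J} (PiE J (\<lambda>_. {..<3}))"
  using someI_ex[OF ex_bij_betw_nat_finite[of "PiE J (\<lambda>_. {..<3::nat})"]] finite_PiE[of J "\<lambda>_. {..<3::nat}"]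
  by (simp add: cidx_def ncell_def atLeast0LessThan)

definition cell :: "nat set \<Rightarrow> (nat \<Rightarrow> 'a \<Rightarrow> complex) \<Rightarrow> 'a set \<Rightarrow> nat \<Rightarrow> 'a set" where
  "cell J f V i = {x\<in>V. \<forall>j\<in>J. f j x \<in> hpl (cidx J i j)}"

text \<open>The nerve of the cover by cells. Together with \<open>ccst\<close>, which does not
  depend on \<open>V\<close>, it determines the cohomology dimensions for convex \<open>V\<close>
  (\<open>hd_dim_cells\<close>). Convex regions with the same nerve are therefore interchangeable,
  which is how unbounded or shrinking regions are handled below.\<close>

definition cells :: "nat set \<Rightarrow> (nat \<Rightarrow> 'a \<Rightarrow> complex) \<Rightarrow> 'a set \<Rightarrow> nat set set" where
  "cells J f V = {K. K \<subseteq> {..<ncell J} \<and> K \<noteq> {} \<and> (\<Inter>i\<in>K. cell J f V i) \<noteq> {}}"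

definition Mset :: "nat set \<Rightarrow> (nat \<Rightarrow> 'a \<Rightarrow> complex) \<Rightarrow> 'a set \<Rightarrow> 'a set" where
  "Mset J f V = {x\<in>V. \<forall>j\<in>J. f j x \<noteq> 0}"

definition affc :: "('a::real_normed_vector \<Rightarrow> complex) \<Rightarrow> bool" where
  "affc f \<longleftrightarrow> continuous_on UNIV f \<and> (\<forall>x y t. f ((1 - t) *\<^sub>R x + t *\<^sub>R y) = complex_of_real (1 - t) * f x + complex_of_real t * f y)"

lemma cell_Union: "finite J \<Longrightarrow> (\<Union>i<ncell J. cell J f V i) = Mset J f V"
proof
  assume fin: "finite J"
  note b = cidx[OF fin]
  show "Mset J f V \<subseteq> (\<Union>i<ncell J. cell J f V i)"
  proof
    fix x assume x: "x \<in> Mset J f V"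
    then have "\<forall>j\<in>J. \<exists>k<3. f j x \<in> hpl k" using hpl_cover by (auto simp: Mset_def)
    then obtain k where k: "\<forall>j\<in>J. k j < 3 \<and> f j x \<in> hpl (k j)" by metis
    then have "restrict k J \<in> PiE J (\<lambda>_. {..<3})" by auto
    then have "restrict k J \<in> cidx J ` {..<ncell J}" using b by (simp add: bij_betw_def)
    then obtain i where "i < ncell J" "cidx J i = restrict k J" by force
    then show "x \<in> (\<Union>i<ncell J. cell J f V i)" using x k by (intro UN_I[of i]) (auto simp: cell_def Mset_def)
  qed
  show "(\<Union>i<ncell J. cell J f V i) \<subseteq> Mset J f V" using hpl_nonzero by (fastforce simp: cell_def Mset_def)
qed

text \<open>Cells are preimages of half planes under affine maps, intersected with \<open>V\<close>;
  they and their intersections are convex, and straight segments contract them.\<close>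

lemma convex_leray:
  fixes f :: "nat \<Rightarrow> 'a::real_normed_vector \<Rightarrow> complex"
  assumes fin: "finite J" and V: "convex V" and f: "\<And>j. j \<in> J \<Longrightarrow> affc (f j)"
  shows "leray J f (ncell J) (cell J f V) (\<lambda>i j x. hlog (cidx J i j) (f j x)) (ccst J)"
proof
  let ?Y = "\<Union>i<ncell J. cell J f V i"
  have fc: "continuous_on A (f j)" if "j \<in> J" for A j using f[OF that] by (auto simp: affc_def intro: continuous_on_subset)
  show "finite J" by fact
  show "openin (top_of_set ?Y) (cell J f V i)" if "i < ncell J" for i
  proof -
    have "openin (top_of_set ?Y) (?Y \<inter> (\<Inter>j\<in>J. f j -` hpl (cidx J i j)))"
    proof (cases "J = {}")
      case False
      have "openin (top_of_set ?Y) (?Y \<inter> f j -` hpl (cidx J i j))" if "j \<in> J" for j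
        by (rule continuous_openin_preimage_gen[OF fc[OF that] open_hpl])
      then have "openin (top_of_set ?Y) (\<Inter>j\<in>J. ?Y \<inter> f j -` hpl (cidx J i j))" using fin False by (intro openin_Inter) auto
      moreover have "(\<Inter>j\<in>J. ?Y \<inter> f j -` hpl (cidx J i j)) = ?Y \<inter> (\<Inter>j\<in>J. f j -` hpl (cidx J i j))" using False by auto
      ultimately show ?thesis by simp
    qed simp
    moreover have "?Y \<inter> (\<Inter>j\<in>J. f j -` hpl (cidx J i j)) = cell J f V i" using that by (auto simp: cell_def)
    ultimately show ?thesis by simp
  qed
  show "continuous_on (cell J f V i) (\<lambda>x. hlog (cidx J i j) (f j x))" if "i < ncell J" "j \<in> J" for i j
    by (rule continuous_on_compose2[OF continuous_hlog fc]) (use that in \<open>auto simp: cell_def\<close>)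
  show "exp (hlog (cidx J i j) (f j x)) = f j x" if "i < ncell J" "j \<in> J" "x \<in> cell J f V i" for i j x
    using that by (intro exp_hlog) (auto simp: cell_def)
  show "hlog (cidx J i j) (f j x) - hlog (cidx J k j) (f j x) = ccst J i k j"
    if "i < ncell J" "k < ncell J" "j \<in> J" "x \<in> cell J f V i" "x \<in> cell J f V k" for i k j x
    unfolding ccst_def using that by (intro hcst) (auto simp: cell_def)
  fix K assume K: "K \<subseteq> {..<ncell J}" "K \<noteq> {}" and "(\<Inter>i\<in>K. cell J f V i) \<noteq> {}"
  then obtain x0 where x0: "x0 \<in> (\<Inter>i\<in>K. cell J f V i)" by blast
  define H where "H = (\<lambda>t::real. \<lambda>x. (1 - t) *\<^sub>R x + t *\<^sub>R x0)"
  have "H t x \<in> (\<Inter>i\<in>K. cell J f V i)" if t: "t \<in> {0..1}" and x: "x \<in> (\<Inter>i\<in>K. cell J f V i)" for t x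
  proof
    fix i assume i: "i \<in> K"
    have "H t x \<in> V" unfolding H_def using V x0 x i t by (intro convexD[OF V]) (auto simp: cell_def)
    moreover have "f j (H t x) \<in> hpl (cidx J i j)" if "j \<in> J" for j
    proof -
      have "f j (H t x) = complex_of_real (1 - t) * f j x + complex_of_real t * f j x0" using f[OF that] by (simp add: affc_def H_def)
      also have "\<dots> \<in> hpl (cidx J i j)" using x x0 i that t by (intro hpl_comb) (auto simp: cell_def)
      finally show ?thesis .
    qed
    ultimately show "H t x \<in> cell J f V i" by (simp add: cell_def)
  qed
  moreover have "continuous_on ({0..1} \<times> (\<Inter>i\<in>K. cell J f V i)) (\<lambda>z. H (fst z) (snd z))"
    unfolding H_def by (intro continuous_intros)
  moreover have "H 0 x = x" "H 1 x = x0" for x by (simp_all add: H_def)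
  ultimately show "\<exists>x0 H. continuous_on ({0..1} \<times> (\<Inter>i\<in>K. cell J f V i)) (\<lambda>z. H (fst z) (snd z)) \<and>
        (\<forall>t\<in>{0..1::real}. \<forall>x\<in>(\<Inter>i\<in>K. cell J f V i). H t x \<in> (\<Inter>i\<in>K. cell J f V i)) \<and> (\<forall>x\<in>(\<Inter>i\<in>K. cell J f V i). H 0 x = x \<and> H 1 x = x0)"
    by (intro exI[of _ x0] exI[of _ H]) auto
qed

definition hd_dim :: "nat set \<Rightarrow> (nat \<Rightarrow> 'a::topological_space \<Rightarrow> complex) \<Rightarrow> (nat \<Rightarrow> complex) \<Rightarrow> 'a set \<Rightarrow> nat \<Rightarrow> enat" where
  "hd_dim J f lam Y q = qdim (ZZ J f lam Y q) (BB J f lam Y q)"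

lemma van_hd_dim: "van J f lam Y q \<longleftrightarrow> hd_dim J f lam Y q = 0"
  by (simp add: van_iff_qdim hd_dim_def)

context
  fixes J :: "nat set" and f :: "nat \<Rightarrow> 'a::real_normed_vector \<Rightarrow> complex"
  assumes fin: "finite J" and aff: "\<And>j. j \<in> J \<Longrightarrow> affc (f j)"
begin

lemma hd_dim_cells:
  assumes "convex V"
  shows "hd_dim J f lam (Mset J f V) q = qdim (cechZ (cells J f V) (ccst J) J lam q) (cechB (cells J f V) (ccst J) J lam q)"
proof -
  interpret leray J f lam "ncell J" "cell J f V" "\<lambda>i j x. hlog (cidx J i j) (f j x)" "ccst J"
    by (rule convex_leray[OF fin assms aff])
  have "nerve = cells J f V" by (auto simp: nerve_def cells_def)
  then show ?thesis using leray[of q] cell_Union[OF fin, of f V] by (simp add: hd_dim_def)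
qed

lemma van_same_cells:
  assumes "convex V" "convex V'" "cells J f V = cells J f V'" "van J f lam (Mset J f V) q"
  shows "van J f lam (Mset J f V') q"
  using assms by (simp add: van_hd_dim hd_dim_cells)

lemma cech_data_cells:
  assumes "convex V"
  shows "cech_data (cells J f V) (ccst J) J"
proof -
  interpret leray J f "\<lambda>_. 0" "ncell J" "cell J f V" "\<lambda>i j x. hlog (cidx J i j) (f j x)" "ccst J"
    by (rule convex_leray[OF fin assms aff])
  have "nerve = cells J f V" by (auto simp: nerve_def cells_def)
  then show ?thesis using cech_data_nerve by simp
qed

lemma hd_dim_usc:
  assumes V: "convex V"
  shows "\<exists>\<Phi>. line_entire \<Phi> \<and> \<Phi> l0 \<noteq> 0 \<and> (\<forall>l. \<Phi> l \<noteq> 0 \<longrightarrow> hd_dim J f l (Mset J f V) q \<le> hd_dim J f l0 (Mset J f V) q)"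
  unfolding hd_dim_cells[OF V] by (rule cech_data.cech_usc[OF cech_data_cells[OF V]])

lemma hd_dim_finite:
  assumes V: "convex V"
  shows "hd_dim J f lam (Mset J f V) q \<noteq> \<infinity>"
  unfolding hd_dim_cells[OF V] cech_data.cech_dim(1)[OF cech_data_cells[OF V]] by simp

lemma hd_dim_euler:
  assumes V: "convex V"
  obtains N ec where "\<And>lam q. q \<ge> N \<Longrightarrow> hd_dim J f lam (Mset J f V) q = 0"
    "\<And>lam. (\<Sum>q<N. (-1) ^ q * int (the_enat (hd_dim J f lam (Mset J f V) q))) = ec"
proof (rule cech_data.cech_euler[OF cech_data_cells[OF V]])
  fix N ec
  assume "\<And>lam q. q \<ge> N \<Longrightarrow> qdim (cechZ (cells J f V) (ccst J) J lam q) (cechB (cells J f V) (ccst J) J lam q) = 0"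
    "\<And>lam. (\<Sum>q<N. (-1) ^ q * int (the_enat (qdim (cechZ (cells J f V) (ccst J) J lam q) (cechB (cells J f V) (ccst J) J lam q)))) = ec"
  then show thesis by (intro that[of N ec]) (simp_all add: hd_dim_cells[OF V])
qed

end

lemma cells_point: "K \<in> cells J f V \<longleftrightarrow> K \<subseteq> {..<ncell J} \<and> K \<noteq> {} \<and> (\<exists>x\<in>V. \<forall>i\<in>K. \<forall>j\<in>J. f j x \<in> hpl (cidx J i j))"
  by (auto simp: cells_def cell_def)

lemma cells_mono: "V \<subseteq> V' \<Longrightarrow> cells J f V \<subseteq> cells J f V'"
proof
  fix K assume "V \<subseteq> V'" and K: "K \<in> cells J f V"
  then have "cell J f V i \<subseteq> cell J f V' i" for i by (auto simp: cell_def)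
  then have "(\<Inter>i\<in>K. cell J f V i) \<subseteq> (\<Inter>i\<in>K. cell J f V' i)" by (rule INF_mono') 
  then show "K \<in> cells J f V'" using K unfolding cells_def by auto
qed

lemma finite_cells: "finite (cells J f V)"
  by (rule finite_subset[of _ "Pow {..<ncell J}"]) (auto simp: cells_def)

section \<open>Cohomological dimension\<close>

text \<open>Bilinear, not Hermitian, so that \<open>bil u\<close> is the complex linear form with
  coefficient vector \<open>u\<close>.\<close>

definition bil :: "complex ^ 'l \<Rightarrow> complex ^ 'l \<Rightarrow> complex" where
  "bil u v = (\<Sum>i\<in>UNIV. u $ i * v $ i)"

lemma hyp_form_bil: "hyp_form a b j x = bil (a j) x - b j"
  by (simp add: hyp_form_def bil_def)

lemma bil_add: "bil u (v + w) = bil u v + bil u w"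
  and bil_diff: "bil u (v - w) = bil u v - bil u w"
  and bil_minus: "bil u (- v) = - bil u v"
  and bil_scale: "bil u (c *s v) = c * bil u v"
  and bil_scaleR: "bil u (t *\<^sub>R v) = complex_of_real t * bil u v"
  and bil_zero [simp]: "bil u 0 = 0" "bil 0 u = 0"
  by (simp_all add: bil_def algebra_simps sum.distrib sum_subtractf sum_distrib_left sum_negf scaleR_conv_of_real[where 'a = complex])

lemma bil_sum: "bil u (\<Sum>i\<in>I. g i) = (\<Sum>i\<in>I. bil u (g i))"
  by (induction I rule: infinite_finite_induct) (simp_all add: bil_add)

lemma continuous_on_bil [continuous_intros]: "continuous_on S g \<Longrightarrow> continuous_on S (\<lambda>x. bil u (g x))"
  unfolding bil_def by (intro continuous_on_sum continuous_on_mult continuous_on_const continuous_on_component)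

lemma continuous_on_hyp_form: "continuous_on S g \<Longrightarrow> continuous_on S (\<lambda>x. hyp_form a b j (g x))"
  unfolding hyp_form_bil by (intro continuous_intros)

lemma affc_hyp_form: "affc (hyp_form a b j)"
  unfolding affc_def
proof (intro conjI allI)
  show "continuous_on UNIV (hyp_form a b j)" using continuous_on_hyp_form[OF continuous_on_id] by simp
  fix x y t show "hyp_form a b j ((1 - t) *\<^sub>R x + t *\<^sub>R y) = complex_of_real (1 - t) * hyp_form a b j x + complex_of_real t * hyp_form a b j y"
    unfolding hyp_form_bil bil_add bil_scaleR by (simp add: algebra_simps)
qed

lemma vec_scaleR: "t *\<^sub>R (v :: complex ^ 'l) = complex_of_real t *s v"
  by (simp add: vec_eq_iff scaleR_conv_of_real[where 'a = complex])

lemma hyp_form_add: "hyp_form a b j (x + v) = hyp_form a b j x + bil (a j) v"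
  by (simp add: hyp_form_bil bil_add)

lemma continuous_on_vscale [continuous_intros]:
  fixes g :: "'a::topological_space \<Rightarrow> complex ^ 'l"
  shows "continuous_on S c \<Longrightarrow> continuous_on S g \<Longrightarrow> continuous_on S (\<lambda>x. c x *s g x)"
  unfolding vector_scalar_mult_def
  by (intro continuous_on_vec_lambda continuous_on_mult continuous_on_component)

lemma ratio_not_nonpos:
  fixes z w :: complex assumes "cmod (z - w) < cmod w"
  shows "z / w \<notin> \<real>\<^sub>\<le>\<^sub>0" "w \<noteq> 0" "z \<noteq> 0"
proof -
  show w: "w \<noteq> 0" using assms by auto
  show "z \<noteq> 0" using assms by auto
  have "z / w = 1 + (z - w) / w" using w by (simp add: field_simps)
  moreover have "cmod ((z - w) / w) < 1" using assms w by (simp add: norm_divide)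
  then have "\<bar>Re ((z - w) / w)\<bar> < 1" using abs_Re_le_cmod[of "(z - w) / w"] by linarith
  ultimately have "Re (z / w) > 0" by simp
  then show "z / w \<notin> \<real>\<^sub>\<le>\<^sub>0" by (auto simp: complex_nonpos_Reals_iff)
qed

text \<open>A displacement whose effect on each form is smaller than that form does not change the
  logarithms of the forms beyond the principal branch.\<close>
lemma flow_retract:
  fixes W :: "complex ^ 'l \<Rightarrow> complex ^ 'l" and a b
  defines "f \<equiv> hyp_form a b"
  assumes W: "continuous_on (Mset J f V) W"
    and V: "\<And>x t. x \<in> Mset J f V \<Longrightarrow> 0 \<le> t \<Longrightarrow> t \<le> 1 \<Longrightarrow> x + t *\<^sub>R W x \<in> V"
    and s: "\<And>x j. x \<in> Mset J f V \<Longrightarrow> j \<in> J \<Longrightarrow> cmod (bil (a j) (W x)) < cmod (f j x)"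
    and V': "V' \<subseteq> V" "\<And>x. x \<in> Mset J f V \<Longrightarrow> x + W x \<in> V'"
    and v: "van J f lam (Mset J f V') q"
  shows "van J f lam (Mset J f V) q"
proof -
  let ?Y = "Mset J f V"
  define H where "H = (\<lambda>t::real. \<lambda>x. x + t *\<^sub>R W x)"
  define G where "G = (\<lambda>t j x. Ln (f j (H t x) / f j x))"
  have fH: "f j (H t x) - f j x = complex_of_real t * bil (a j) (W x)" for t j x
    by (simp add: f_def H_def hyp_form_add bil_scaleR)
  have sm: "cmod (f j (H t x) - f j x) < cmod (f j x)" if "x \<in> ?Y" "j \<in> J" "t \<in> {0..1}" for t j x
  proof -
    have "cmod (f j (H t x) - f j x) \<le> 1 * cmod (bil (a j) (W x))"
      unfolding fH norm_mult using that by (intro mult_right_mono) auto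
    then show ?thesis using s[OF that(1,2)] by simp
  qed
  have cH: "continuous_on ({0..1} \<times> ?Y) (\<lambda>z. H (fst z) (snd z))"
    unfolding H_def
    by (intro continuous_intros continuous_on_compose2[OF W]) auto
  have cf: "continuous_on S g \<Longrightarrow> continuous_on S (\<lambda>x. f j (g x))" for S j and g :: "real \<times> (complex^'l) \<Rightarrow> complex^'l"
    unfolding f_def by (rule continuous_on_hyp_form)
  have "hmor J f ?Y f ?Y H G"
    unfolding hmor_def
  proof (intro conjI ballI)
    show "continuous_on ({0..1} \<times> ?Y) (\<lambda>z. G (fst z) j (snd z))" if "j \<in> J" for j
      unfolding G_def
    proof (intro continuous_on_Ln' continuous_on_divide cf cH continuous_on_snd continuous_on_id)
      fix z :: "real \<times> (complex ^ 'l)" assume "z \<in> {0..1} \<times> ?Y"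
      then show "f j (H (fst z) (snd z)) / f j (snd z) \<notin> \<real>\<^sub>\<le>\<^sub>0"
        using ratio_not_nonpos[OF sm[of "snd z" j "fst z"]] that by auto
    qed (use that in \<open>auto simp: Mset_def\<close>)
    fix t :: real and x assume t: "t \<in> {0..1}" and x: "x \<in> ?Y"
    note r = ratio_not_nonpos[OF sm[OF x _ t]]
    show "H t x \<in> ?Y" using V[OF x, of t] t r(3) by (auto simp: Mset_def H_def)
    show "f j (H t x) = f j x * exp (G t j x)" if "j \<in> J" for j
      using r[OF that] by (simp add: G_def)
  qed (rule cH)
  moreover have "G 0 j x = 0" if "x \<in> ?Y" "j \<in> J" for x j
    using that by (simp add: G_def H_def Mset_def)
  moreover have "H 1 x \<in> Mset J f V'" if x: "x \<in> ?Y" for x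
    using V'(2)[OF x] ratio_not_nonpos(3)[OF sm[OF x]] by (auto simp: Mset_def H_def) (metis atLeastAtMost_iff order_refl scaleR_one zero_le_one)
  ultimately show ?thesis
    using V'(1) v by (intro van_retract[of J f ?Y H G "Mset J f V'"]) (auto simp: H_def Mset_def)
qed

text \<open>Induction on the number of forms: on the kernel of one of them the others suffice, and a
  vector of \<open>D\<close> outside this kernel fixes the missing coefficient.\<close>

lemma functional_duality:
  fixes D :: "(complex ^ 'l) set" and g :: "'i \<Rightarrow> complex ^ 'l"
  assumes "finite I" "vec.subspace D" "\<And>v. v \<in> D \<Longrightarrow> (\<And>i. i \<in> I \<Longrightarrow> bil (g i) v = 0) \<Longrightarrow> bil y v = 0"
  shows "\<exists>c. \<forall>v\<in>D. bil y v = (\<Sum>i\<in>I. c i * bil (g i) v)"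
  using assms
proof (induction I arbitrary: D rule: finite_induct)
  case (insert i0 I)
  let ?D = "{v\<in>D. bil (g i0) v = 0}"
  have sD: "vec.subspace ?D"
    using insert.prems(1) by (auto simp: vec.subspace_def bil_add bil_scale)
  have "\<exists>c. \<forall>v\<in>?D. bil y v = (\<Sum>i\<in>I. c i * bil (g i) v)"
    by (rule insert.IH[OF sD]) (use insert.prems(2) in auto)
  then obtain c where c: "\<And>v. v \<in> D \<Longrightarrow> bil (g i0) v = 0 \<Longrightarrow> bil y v = (\<Sum>i\<in>I. c i * bil (g i) v)" by auto
  have upd: "(\<Sum>i\<in>insert i0 I. (c(i0 := e)) i * bil (g i) v) = e * bil (g i0) v + (\<Sum>i\<in>I. c i * bil (g i) v)" for e v
  proof -
    have "(\<Sum>i\<in>I. (c(i0 := e)) i * bil (g i) v) = (\<Sum>i\<in>I. c i * bil (g i) v)"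
      using insert.hyps by (intro sum.cong) auto
    then show ?thesis using insert.hyps by simp
  qed
  show ?case
  proof (cases "\<exists>v0\<in>D. bil (g i0) v0 \<noteq> 0")
    case True
    then obtain v0 where v0: "v0 \<in> D" "bil (g i0) v0 \<noteq> 0" by blast
    define e where "e = (bil y v0 - (\<Sum>i\<in>I. c i * bil (g i) v0)) / bil (g i0) v0"
    have "bil y v = e * bil (g i0) v + (\<Sum>i\<in>I. c i * bil (g i) v)" if "v \<in> D" for v
    proof -
      let ?t = "bil (g i0) v / bil (g i0) v0"
      have "v - ?t *s v0 \<in> D" using that v0 insert.prems(1) by (intro vec.subspace_diff vec.subspace_scale)
      moreover have "bil (g i0) (v - ?t *s v0) = 0" using v0 by (simp add: bil_diff bil_scale)
      ultimately have "bil y (v - ?t *s v0) = (\<Sum>i\<in>I. c i * bil (g i) (v - ?t *s v0))" by (rule c)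
      then have "bil y v = ?t * (bil y v0 - (\<Sum>i\<in>I. c i * bil (g i) v0)) + (\<Sum>i\<in>I. c i * bil (g i) v)"
        by (simp add: bil_diff bil_scale algebra_simps sum_subtractf sum_distrib_left)
      then show ?thesis using v0 by (simp add: e_def)
    qed
    then show ?thesis using upd[of e] by (intro exI[of _ "c(i0 := e)"]) simp
  next
    case False
    then show ?thesis using c upd[of 0] by (intro exI[of _ "c(i0 := 0)"]) simp
  qed
qed simp

text \<open>Fields inside the coset that move \<open>y\<close> with unit speed and leave the forms
  of \<open>Z\<close> unchanged. Their effect on every form is at most \<open>B\<close> times the
  value of that form, as long as \<open>y\<close> stays at distance \<open>\<delta>\<close> from
  \<open>Crit\<close> and the tube is thinner than \<open>r1\<close>. The field, \<open>B\<close>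
  and \<open>r1\<close> may depend on \<open>\<delta>\<close>.\<close>

definition vfields :: "complex ^ 'l \<Rightarrow> (complex ^ 'l) set \<Rightarrow> (complex ^ 'l) set \<Rightarrow> nat set \<Rightarrow> (nat \<Rightarrow> complex ^ 'l) \<Rightarrow> (nat \<Rightarrow> complex)
    \<Rightarrow> complex ^ 'l \<Rightarrow> complex set \<Rightarrow> bool" where
  "vfields p D Z J a b y Crit \<longleftrightarrow> (\<forall>\<delta>>0. \<exists>r1>0. \<exists>B>0. \<exists>v. continuous_on {x. \<forall>j\<in>J. hyp_form a b j x \<noteq> 0} v \<and>
       (\<forall>x. (\<forall>j\<in>J. hyp_form a b j x \<noteq> 0) \<longrightarrow> v x \<in> D \<and> (\<forall>z\<in>Z. bil z (v x) = 0) \<and> bil y (v x) = 1 \<and>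
         (x - p \<in> D \<and> (\<forall>z\<in>Z. cmod (bil z (x - p)) < r1) \<and> (\<forall>\<kappa>\<in>Crit. \<delta> \<le> cmod (bil y x - \<kappa>)) \<longrightarrow>
            (\<forall>j\<in>J. cmod (bil (a j) (v x)) \<le> B * cmod (hyp_form a b j x)))))"

lemma vfieldsE:
  assumes "vfields p D Z J a b y Crit" "\<delta> > 0"
  obtains r1 B v where "r1 > 0" "B > 0" "continuous_on {x. \<forall>j\<in>J. hyp_form a b j x \<noteq> 0} v"
    "\<And>x. (\<forall>j\<in>J. hyp_form a b j x \<noteq> 0) \<Longrightarrow> v x \<in> D \<and> (\<forall>z\<in>Z. bil z (v x) = 0) \<and> bil y (v x) = 1"
    "\<And>x j. (\<forall>j\<in>J. hyp_form a b j x \<noteq> 0) \<Longrightarrow> x - p \<in> D \<Longrightarrow> (\<forall>z\<in>Z. cmod (bil z (x - p)) < r1) \<Longrightarrow>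
        (\<forall>\<kappa>\<in>Crit. \<delta> \<le> cmod (bil y x - \<kappa>)) \<Longrightarrow> j \<in> J \<Longrightarrow> cmod (bil (a j) (v x)) \<le> B * cmod (hyp_form a b j x)"
proof -
  have "\<exists>r1>0. \<exists>B>0. \<exists>v. continuous_on {x. \<forall>j\<in>J. hyp_form a b j x \<noteq> 0} v \<and>
       (\<forall>x. (\<forall>j\<in>J. hyp_form a b j x \<noteq> 0) \<longrightarrow> v x \<in> D \<and> (\<forall>z\<in>Z. bil z (v x) = 0) \<and> bil y (v x) = 1 \<and>
         (x - p \<in> D \<and> (\<forall>z\<in>Z. cmod (bil z (x - p)) < r1) \<and> (\<forall>\<kappa>\<in>Crit. \<delta> \<le> cmod (bil y x - \<kappa>)) \<longrightarrow>
            (\<forall>j\<in>J. cmod (bil (a j) (v x)) \<le> B * cmod (hyp_form a b j x))))"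
    using assms unfolding vfields_def by blast
  then show ?thesis
  proof (elim exE conjE)
    fix r1 B v assume "r1 > 0" "B > 0" "continuous_on {x. \<forall>j\<in>J. hyp_form a b j x \<noteq> 0} v"
      and "\<forall>x. (\<forall>j\<in>J. hyp_form a b j x \<noteq> 0) \<longrightarrow> v x \<in> D \<and> (\<forall>z\<in>Z. bil z (v x) = 0) \<and> bil y (v x) = 1 \<and>
         (x - p \<in> D \<and> (\<forall>z\<in>Z. cmod (bil z (x - p)) < r1) \<and> (\<forall>\<kappa>\<in>Crit. \<delta> \<le> cmod (bil y x - \<kappa>)) \<longrightarrow>
            (\<forall>j\<in>J. cmod (bil (a j) (v x)) \<le> B * cmod (hyp_form a b j x)))"
    then show thesis by (intro that[of r1 B v]) simp_all
  qed
qed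

text \<open>The field averages directions \<open>v\<^sub>J\<close> annihilated by the forms in \<open>J\<close>, with weights that
  vanish where a form outside \<open>J\<close> vanishes. Where \<open>y\<close> stays away from the critical values, the set
  of all small forms admits such a direction, because otherwise \<open>y\<close> would be, up to a constant, a
  combination of small forms.\<close>
lemma critical_values:
  fixes p :: "complex ^ 'l" and Z :: "(complex ^ 'l) set"
  assumes fin: "finite J" "finite Z" and D: "vec.subspace D"
    and w: "w0 \<in> D" "\<And>z. z \<in> Z \<Longrightarrow> bil z w0 = 0" "bil y w0 = 1"
  obtains Crit where "finite Crit" "vfields p D Z J a b y Crit"
proof -
  let ?f = "hyp_form a b"
  define gv where "gv J' v \<longleftrightarrow> v \<in> D \<and> (\<forall>z\<in>Z. bil z v = 0) \<and> (\<forall>j\<in>J'. bil (a j) v = 0) \<and> bil y v = 1" for J' v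
  define GG where "GG = {J'. J' \<subseteq> J \<and> (\<exists>v. gv J' v)}"
  define BD where "BD = Pow J - GG"
  have finG: "finite GG" "finite BD" using fin by (auto simp: GG_def BD_def)
  \<comment> \<open>If no direction of \<open>D\<close> with \<open>y\<close>-speed 1 is annihilated
    by \<open>Z\<close> and by the forms in \<open>J'\<close>, then on \<open>D\<close> the form
    \<open>y\<close> is a combination of these. So \<open>y\<close> is close to one value
    \<open>\<kappa>\<close> wherever all of them are small, and this is the critical value of
    \<open>J'\<close>.\<close>
  have "\<exists>\<kappa> C. C > 0 \<and> (\<forall>x. x - p \<in> D \<longrightarrow> cmod (bil y x - \<kappa>) \<le> C * ((\<Sum>z\<in>Z. cmod (bil z (x - p))) + (\<Sum>j\<in>J'. cmod (?f j x))))"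
    if J': "J' \<in> BD" for J'
  proof -
    have finJ': "finite J'" using J' fin by (auto simp: BD_def intro: finite_subset)
    have bad: "\<not> gv J' v" for v using J' by (auto simp: BD_def GG_def)
    let ?g = "case_sum (\<lambda>z. z) a"
    have "\<exists>c. \<forall>v\<in>D. bil y v = (\<Sum>i\<in>Z <+> J'. c i * bil (?g i) v)"
    proof (rule functional_duality[OF _ D])
      show "finite (Z <+> J')" using fin finJ' by simp
      fix v assume v: "v \<in> D" "\<And>i. i \<in> Z <+> J' \<Longrightarrow> bil (?g i) v = 0"
      have "bil z v = 0" if "z \<in> Z" for z using v(2)[OF InlI[OF that]] by simp
      moreover have "bil (a j) v = 0" if "j \<in> J'" for j using v(2)[OF InrI[OF that]] by simp
      ultimately have "gv J' ((1 / bil y v) *s v)" if "bil y v \<noteq> 0"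
        unfolding gv_def using that v(1) D by (auto simp: bil_scale intro: vec.subspace_scale)
      then show "bil y v = 0" using bad by blast
    qed
    then obtain c where "\<forall>v\<in>D. bil y v = (\<Sum>i\<in>Z <+> J'. c i * bil (?g i) v)" by blast
    then have c: "bil y v = (\<Sum>z\<in>Z. c (Inl z) * bil z v) + (\<Sum>j\<in>J'. c (Inr j) * bil (a j) v)" if "v \<in> D" for v
      using that fin finJ' by (simp add: sum.Plus)
    define C where "C = 1 + (\<Sum>z\<in>Z. cmod (c (Inl z))) + (\<Sum>j\<in>J'. cmod (c (Inr j)))"
    define \<kappa> where "\<kappa> = bil y p - (\<Sum>j\<in>J'. c (Inr j) * ?f j p)"
    have nn: "(\<Sum>z\<in>Z. cmod (c (Inl z))) \<ge> 0" "(\<Sum>j\<in>J'. cmod (c (Inr j))) \<ge> 0" by (simp_all add: sum_nonneg)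
    have Cz: "cmod (c (Inl z)) \<le> C" if "z \<in> Z" for z
      using member_le_sum[OF that, of "\<lambda>z. cmod (c (Inl z))"] fin nn by (simp add: C_def)
    have Cj: "cmod (c (Inr j)) \<le> C" if "j \<in> J'" for j
      using member_le_sum[OF that, of "\<lambda>j. cmod (c (Inr j))"] finJ' nn by (simp add: C_def)
    have "cmod (bil y x - \<kappa>) \<le> C * ((\<Sum>z\<in>Z. cmod (bil z (x - p))) + (\<Sum>j\<in>J'. cmod (?f j x)))" if x: "x - p \<in> D" for x
    proof -
      have "?f j x = ?f j p + bil (a j) (x - p)" for j by (simp add: hyp_form_bil bil_diff)
      then have "(\<Sum>j\<in>J'. c (Inr j) * ?f j x) = (\<Sum>j\<in>J'. c (Inr j) * ?f j p) + (\<Sum>j\<in>J'. c (Inr j) * bil (a j) (x - p))"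
        by (simp only: distrib_left sum.distrib)
      then have "bil y x - \<kappa> = (\<Sum>z\<in>Z. c (Inl z) * bil z (x - p)) + (\<Sum>j\<in>J'. c (Inr j) * ?f j x)"
        using c[OF x] by (simp add: \<kappa>_def bil_diff[of y])
      also have "cmod \<dots> \<le> (\<Sum>z\<in>Z. cmod (c (Inl z) * bil z (x - p))) + (\<Sum>j\<in>J'. cmod (c (Inr j) * ?f j x))"
        by (intro norm_triangle_le add_mono norm_sum)
      also have "\<dots> \<le> (\<Sum>z\<in>Z. C * cmod (bil z (x - p))) + (\<Sum>j\<in>J'. C * cmod (?f j x))"
        unfolding norm_mult by (intro add_mono sum_mono mult_right_mono Cz Cj) auto
      finally show ?thesis by (simp add: sum_distrib_left distrib_left)
    qed
    moreover have "C > 0" using nn by (simp add: C_def)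
    ultimately show ?thesis by blast
  qed
  then have "\<forall>J'\<in>BD. \<exists>\<kappa> C. C > 0 \<and> (\<forall>x. x - p \<in> D \<longrightarrow> cmod (bil y x - \<kappa>) \<le> C * ((\<Sum>z\<in>Z. cmod (bil z (x - p))) + (\<Sum>j\<in>J'. cmod (?f j x))))" by blast
  from bchoice[OF this] obtain \<kappa> where "\<forall>J'\<in>BD. \<exists>C. C > 0 \<and> (\<forall>x. x - p \<in> D \<longrightarrow> cmod (bil y x - \<kappa> J') \<le> C * ((\<Sum>z\<in>Z. cmod (bil z (x - p))) + (\<Sum>j\<in>J'. cmod (?f j x))))" by blast
  from bchoice[OF this] obtain C where C: "\<And>J'. J' \<in> BD \<Longrightarrow> C J' > 0"
    "\<And>J' x. J' \<in> BD \<Longrightarrow> x - p \<in> D \<Longrightarrow> cmod (bil y x - \<kappa> J') \<le> C J' * ((\<Sum>z\<in>Z. cmod (bil z (x - p))) + (\<Sum>j\<in>J'. cmod (?f j x)))" by blast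
  have "\<forall>J'\<in>GG. \<exists>v. gv J' v" by (auto simp: GG_def)
  from bchoice[OF this] obtain vv where vv: "\<And>J'. J' \<in> GG \<Longrightarrow> gv J' (vv J')" by blast
  have G0: "{} \<in> GG" unfolding GG_def gv_def using w by auto
  show ?thesis
  proof (rule that[of "\<kappa> ` BD"])
    show "finite (\<kappa> ` BD)" using finG by simp
    show "vfields p D Z J a b y (\<kappa> ` BD)"
      unfolding vfields_def
    proof (intro allI impI)
    fix \<delta> :: real assume "\<delta> > 0"
    define CC where "CC = 1 + (\<Sum>J'\<in>BD. C J')"
    have CCsum: "(\<Sum>J'\<in>BD. C J') \<ge> 0" by (rule sum_nonneg) (use C(1) in \<open>auto intro: less_imp_le\<close>)
    then have CC: "CC > 0" by (simp add: CC_def)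
    have CCle: "C J' \<le> CC" if "J' \<in> BD" for J'
      using member_le_sum[OF that, of C] C(1) finG by (force simp: CC_def intro: less_imp_le)
    \<comment> \<open>Small enough that tube forms and forms of a bad set, all at most
      \<open>\<epsilon>\<close>, would bring \<open>y\<close> within less than
      \<open>\<delta>\<close> of a critical value (\<open>small\<close>).\<close>
    define \<epsilon> where "\<epsilon> = \<delta> / (CC * (card Z + card J + 1))"
    have eps: "\<epsilon> > 0" using \<open>\<delta> > 0\<close> CC by (simp add: \<epsilon>_def add_nonneg_pos)
    have small: "CC * (card Z * \<epsilon> + card J * \<epsilon>) < \<delta>"
    proof -
      have "CC * (card Z * \<epsilon> + card J * \<epsilon>) < CC * (card Z + card J + 1) * \<epsilon>" using CC eps by (simp add: algebra_simps)
      also have "\<dots> = \<delta>" using CC by (simp add: \<epsilon>_def)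
      finally show ?thesis .
    qed
    \<comment> \<open>The weight of the direction for \<open>J'\<close> is at most |f_j| /
      \<open>\<epsilon>\<close> for every \<open>j\<close> outside \<open>J'\<close>, and the forms
      inside \<open>J'\<close> are annihilated by that direction. Either way form \<open>j\<close>
      is moved by at most a multiple of its value.\<close>
    define \<rho> where "\<rho> J' x = (\<Prod>j\<in>J - J'. min 1 (cmod (?f j x) / \<epsilon>))" for J' x
    define S where "S x = (\<Sum>J'\<in>GG. \<rho> J' x)" for x
    define v where "v x = (\<Sum>J'\<in>GG. complex_of_real (\<rho> J' x / S x) *s vv J')" for x
    define B where "B = 1 + (\<Sum>J'\<in>GG. \<Sum>j\<in>J. cmod (bil (a j) (vv J'))) / \<epsilon>"
    have B: "B > 0" using eps by (simp add: B_def add_pos_nonneg sum_nonneg)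
    have rho0: "\<rho> J' x \<ge> 0" for J' x unfolding \<rho>_def using eps by (intro prod_nonneg) auto
    have rho1: "\<rho> J' x \<le> cmod (?f j x) / \<epsilon>" if "j \<in> J" "j \<notin> J'" for J' x j
    proof -
      have "\<rho> J' x = min 1 (cmod (?f j x) / \<epsilon>) * (\<Prod>j\<in>J - J' - {j}. min 1 (cmod (?f j x) / \<epsilon>))"
        unfolding \<rho>_def using that fin by (intro prod.remove) auto
      also have "\<dots> \<le> (cmod (?f j x) / \<epsilon>) * 1"
        using eps by (intro mult_mono prod_le_1 prod_nonneg) auto
      finally show ?thesis by simp
    qed
    have Spos: "S x > 0" if x: "\<forall>j\<in>J. ?f j x \<noteq> 0" for x
    proof -
      have "\<rho> {} x > 0" unfolding \<rho>_def using x eps by (intro prod_pos) auto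
      then show ?thesis unfolding S_def using G0 finG rho0 by (intro sum_pos2[of _ "{}"]) auto
    qed
    have lin: "bil u (v x) = (\<Sum>J'\<in>GG. complex_of_real (\<rho> J' x / S x) * bil u (vv J'))" for u x
      by (simp only: v_def bil_sum bil_scale)
    have crho: "continuous_on A (\<lambda>x. \<rho> J' x)" for A J'
      unfolding \<rho>_def using eps by (intro continuous_intros continuous_on_hyp_form) auto
    have "continuous_on {x. \<forall>j\<in>J. ?f j x \<noteq> 0} v"
      unfolding v_def S_def using Spos unfolding S_def
      by (intro continuous_on_sum continuous_on_vscale continuous_on_of_real continuous_on_divide crho continuous_on_const) force
    moreover have "v x \<in> D \<and> (\<forall>z\<in>Z. bil z (v x) = 0) \<and> bil y (v x) = 1 \<and>
         (x - p \<in> D \<and> (\<forall>z\<in>Z. cmod (bil z (x - p)) < \<epsilon>) \<and> (\<forall>\<kappa>\<in>\<kappa> ` BD. \<delta> \<le> cmod (bil y x - \<kappa>)) \<longrightarrow>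
            (\<forall>j\<in>J. cmod (bil (a j) (v x)) \<le> B * cmod (?f j x)))" if x: "\<forall>j\<in>J. ?f j x \<noteq> 0" for x
    proof (intro conjI impI ballI)
      show "v x \<in> D" unfolding v_def using vv D by (intro vec.subspace_sum vec.subspace_scale) (auto simp: gv_def)
      show "bil z (v x) = 0" if "z \<in> Z" for z unfolding lin using vv that by (intro sum.neutral) (auto simp: gv_def)
      have "bil y (v x) = (\<Sum>J'\<in>GG. complex_of_real (\<rho> J' x / S x))" unfolding lin
        using vv by (intro sum.cong) (auto simp: gv_def)
      also have "\<dots> = complex_of_real ((\<Sum>J'\<in>GG. \<rho> J' x) / S x)" by (simp add: sum_divide_distrib)
      finally show "bil y (v x) = 1" using Spos[OF x] by (simp add: S_def)
      fix j assume a: "x - p \<in> D \<and> (\<forall>z\<in>Z. cmod (bil z (x - p)) < \<epsilon>) \<and> (\<forall>\<kappa>\<in>\<kappa> ` BD. \<delta> \<le> cmod (bil y x - \<kappa>))" and j: "j \<in> J"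
      \<comment> \<open>The set of small forms at \<open>x\<close> is good by the choice of
        \<open>\<epsilon>\<close>, and its weight is 1. Hence the normalising sum \<open>S x\<close>
        is at least 1 and division by it does no harm to the bounds.\<close>
      define J0 where "J0 = {j\<in>J. cmod (?f j x) < \<epsilon>}"
      have "J0 \<in> GG"
      proof (rule ccontr)
        assume "J0 \<notin> GG"
        then have J0: "J0 \<in> BD" by (auto simp: BD_def J0_def)
        have finJ0: "finite J0" "card J0 \<le> card J" using fin by (auto simp: J0_def intro: card_mono)
        have "(\<Sum>z\<in>Z. cmod (bil z (x - p))) \<le> card Z * \<epsilon>"
          using a by (intro sum_bounded_above) (auto intro: less_imp_le)
        moreover have "(\<Sum>j\<in>J0. cmod (?f j x)) \<le> card J0 * \<epsilon>"
          by (intro sum_bounded_above) (auto simp: J0_def)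
        moreover have "card J0 * \<epsilon> \<le> card J * \<epsilon>" using finJ0 eps by (intro mult_right_mono) auto
        ultimately have le: "(\<Sum>z\<in>Z. cmod (bil z (x - p))) + (\<Sum>j\<in>J0. cmod (?f j x)) \<le> card Z * \<epsilon> + card J * \<epsilon>" by linarith
        have "\<delta> \<le> cmod (bil y x - \<kappa> J0)" using a J0 by auto
        also have "\<dots> \<le> C J0 * ((\<Sum>z\<in>Z. cmod (bil z (x - p))) + (\<Sum>j\<in>J0. cmod (?f j x)))" using C(2)[OF J0] a by blast
        also have "\<dots> \<le> CC * (card Z * \<epsilon> + card J * \<epsilon>)"
          using CCle[OF J0] le CC by (intro mult_mono) (auto intro!: add_nonneg_nonneg sum_nonneg)
        finally show False using small by linarith
      qed
      moreover have "\<rho> J0 x = 1" unfolding \<rho>_def using eps by (intro prod.neutral) (auto simp: J0_def min_def divide_simps split: if_splits)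
      ultimately have S1: "S x \<ge> 1" using member_le_sum[of J0 GG "\<lambda>J'. \<rho> J' x"] rho0 finG by (simp add: S_def)
      have "cmod (bil (a j) (v x)) \<le> (\<Sum>J'\<in>GG. cmod (?f j x) / \<epsilon> * cmod (bil (a j) (vv J')))"
        unfolding lin
      proof (rule sum_norm_le)
        fix J' assume J': "J' \<in> GG"
        show "cmod (complex_of_real (\<rho> J' x / S x) * bil (a j) (vv J')) \<le> cmod (?f j x) / \<epsilon> * cmod (bil (a j) (vv J'))"
        proof (cases "j \<in> J'")
          case True then show ?thesis using vv[OF J'] by (simp add: gv_def)
        next
          case False
          have "\<rho> J' x / S x \<le> \<rho> J' x / 1" using S1 rho0 by (intro divide_left_mono) auto
          also have "\<dots> \<le> cmod (?f j x) / \<epsilon>" using rho1[OF j False] by simp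
          finally have "\<rho> J' x / S x \<le> cmod (?f j x) / \<epsilon>" .
          moreover have "\<rho> J' x / S x \<ge> 0" using rho0[of J' x] S1 by simp
          ultimately show ?thesis unfolding norm_mult norm_of_real by (intro mult_right_mono) auto
        qed
      qed
      also have "\<dots> = cmod (?f j x) / \<epsilon> * (\<Sum>J'\<in>GG. cmod (bil (a j) (vv J')))" by (simp add: sum_distrib_left)
      also have "\<dots> \<le> cmod (?f j x) / \<epsilon> * (\<Sum>J'\<in>GG. \<Sum>j\<in>J. cmod (bil (a j) (vv J')))"
        using eps j fin member_le_sum[OF j, of "\<lambda>j. cmod (bil (a j) (vv J'))" for J'] by (intro mult_left_mono sum_mono) auto
      also have "\<dots> \<le> B * cmod (?f j x)" by (simp add: B_def algebra_simps)
      finally show "cmod (bil (a j) (v x)) \<le> B * cmod (?f j x)" .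
    qed
    ultimately show "\<exists>r1>0. \<exists>B>0. \<exists>v. continuous_on {x. \<forall>j\<in>J. ?f j x \<noteq> 0} v \<and>
       (\<forall>x. (\<forall>j\<in>J. ?f j x \<noteq> 0) \<longrightarrow> v x \<in> D \<and> (\<forall>z\<in>Z. bil z (v x) = 0) \<and> bil y (v x) = 1 \<and>
         (x - p \<in> D \<and> (\<forall>z\<in>Z. cmod (bil z (x - p)) < r1) \<and> (\<forall>\<kappa>\<in>\<kappa> ` BD. \<delta> \<le> cmod (bil y x - \<kappa>)) \<longrightarrow>
            (\<forall>j\<in>J. cmod (bil (a j) (v x)) \<le> B * cmod (?f j x))))"
      using eps B by blast
    qed
  qed
qed

definition polytube :: "complex ^ 'l \<Rightarrow> (complex ^ 'l) set \<Rightarrow> (complex ^ 'l) set \<Rightarrow> real \<Rightarrow> (complex ^ 'l) set" where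
  "polytube p D Z r = {x. x - p \<in> D \<and> (\<forall>z\<in>Z. cmod (bil z (x - p)) < r)}"

text \<open>Radii are only required to be small, since how small depends on the position of the
  hyperplanes relative to \<open>p\<close>. With empty \<open>Z\<close> the tube is the full coset
  and the radius disappears (\<open>tube_cd_empty\<close>).\<close>

definition tube_cd :: "complex ^ 'l \<Rightarrow> (complex ^ 'l) set \<Rightarrow> (complex ^ 'l) set \<Rightarrow> nat set \<Rightarrow> (nat \<Rightarrow> complex ^ 'l) \<Rightarrow> (nat \<Rightarrow> complex) \<Rightarrow> bool" where
  "tube_cd p D Z J a b \<longleftrightarrow> (\<forall>\<^sub>F r in at_right 0. \<forall>lam q. vec.dim D < q \<longrightarrow>
     van J (hyp_form a b) lam (Mset J (hyp_form a b) (polytube p D Z r)) q)"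

lemma convex_comb_diff:
  fixes x y p :: "'a::real_vector"
  shows "u + v = (1::real) \<Longrightarrow> (u *\<^sub>R x + v *\<^sub>R y) - p = u *\<^sub>R (x - p) + v *\<^sub>R (y - p)"
  by (simp add: algebra_simps) (metis scaleR_add_left scaleR_one)

lemma convex_bil_preimage:
  assumes "convex Q" shows "convex {x. bil y (x - p) \<in> Q}"
proof (rule convexI)
  fix x x' and u v :: real assume "x \<in> {x. bil y (x - p) \<in> Q}" "x' \<in> {x. bil y (x - p) \<in> Q}" and uv: "0 \<le> u" "0 \<le> v" "u + v = 1"
  then have "u *\<^sub>R bil y (x - p) + v *\<^sub>R bil y (x' - p) \<in> Q" by (intro convexD[OF assms]) auto
  then show "u *\<^sub>R x + v *\<^sub>R x' \<in> {x. bil y (x - p) \<in> Q}"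
    unfolding mem_Collect_eq convex_comb_diff[OF uv(3)] by (simp add: bil_add bil_scaleR scaleR_conv_of_real[where 'a = complex])
qed

lemma subspace_scaleR: "vec.subspace D \<Longrightarrow> (v :: complex ^ 'l) \<in> D \<Longrightarrow> t *\<^sub>R v \<in> D"
  by (simp add: vec_scaleR vec.subspace_scale)

lemma convex_coset: "vec.subspace D \<Longrightarrow> convex {x :: complex ^ 'l. x - p \<in> D}"
proof (rule convexI)
  fix x y :: "complex ^ 'l" and u v :: real
  assume D: "vec.subspace D" and xy: "x \<in> {x. x - p \<in> D}" "y \<in> {x. x - p \<in> D}" and uv: "0 \<le> u" "0 \<le> v" "u + v = 1"
  have "u *\<^sub>R (x - p) + v *\<^sub>R (y - p) \<in> D" using D xy by (intro vec.subspace_add subspace_scaleR) auto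
  then show "u *\<^sub>R x + v *\<^sub>R y \<in> {x. x - p \<in> D}" unfolding mem_Collect_eq convex_comb_diff[OF uv(3)] .
qed

lemma convex_polytube:
  fixes p :: "complex ^ 'l"
  assumes D: "vec.subspace D" shows "convex (polytube p D Z r)"
proof -
  have "convex {x. bil z (x - p) \<in> ball 0 r}" for z :: "complex ^ 'l" by (intro convex_bil_preimage convex_ball)
  then have "convex ({x. x - p \<in> D} \<inter> (\<Inter>z\<in>Z. {x. bil z (x - p) \<in> ball 0 r}))"
    by (intro convex_Int convex_INT convex_coset D)
  moreover have "{x. x - p \<in> D} \<inter> (\<Inter>z\<in>Z. {x. bil z (x - p) \<in> ball 0 r}) = polytube p D Z r"
    by (auto simp: polytube_def)
  ultimately show ?thesis by simp
qed

lemma subspace_kernel: "vec.subspace D \<Longrightarrow> vec.subspace {v\<in>D. bil y v = 0}"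
  by (auto simp: vec.subspace_def bil_add bil_scale)

lemma dim_kernel_less:
  assumes "vec.subspace D" "w \<in> D" "bil y w \<noteq> 0"
  shows "vec.dim {v\<in>D. bil y v = 0} < vec.dim D"
proof (rule vec.dim_psubset)
  have sp: "vec.span {v\<in>D. bil y v = 0} = {v\<in>D. bil y v = 0}" "vec.span D = D"
    using assms by (simp_all add: vec.span_eq_iff subspace_kernel)
  show "vec.span {v\<in>D. bil y v = 0} \<subset> vec.span D" unfolding sp using assms(2,3) by auto
qed

section \<open>Slabs: the part of a tube where \<open>y\<close> takes values in a convex set\<close>

context
  fixes p :: "complex ^ 'l" and D Z :: "(complex ^ 'l) set" and J :: "nat set"
    and a :: "nat \<Rightarrow> complex ^ 'l" and b :: "nat \<Rightarrow> complex" and y w :: "complex ^ 'l"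
  assumes fin: "finite J" "finite Z" and D: "vec.subspace D"
    and w: "w \<in> D" "\<And>z. z \<in> Z \<Longrightarrow> bil z w = 0" "bil y w = 1"
begin

private abbreviation (input) "f \<equiv> hyp_form a b"

definition slab :: "real \<Rightarrow> complex set \<Rightarrow> (complex ^ 'l) set" where
  "slab r Q = {x\<in>polytube p D Z r. bil y x \<in> Q}"

lemma convex_slab: assumes "convex Q" shows "convex (slab r Q)"
proof -
  have "slab r Q = polytube p D Z r \<inter> {x. bil y (x - 0) \<in> Q}" by (auto simp: slab_def)
  then show ?thesis using convex_Int[OF convex_polytube[OF D, of p Z r] convex_bil_preimage[OF assms, of y 0]] by simp
qed

text \<open>There are finitely many intersections of cells, and each has a witness with some finite
  value of \<open>y\<close>; a large ball keeps them all.\<close>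

lemma slab_truncate:
  "\<exists>R0. \<forall>R\<ge>R0. cells J f (slab r (Q \<inter> ball c R)) = cells J f (slab r Q)"
proof -
  have "\<forall>\<^sub>F R in at_top. K \<in> cells J f (slab r (Q \<inter> ball c R))" if K: "K \<in> cells J f (slab r Q)" for K
  proof -
    from K obtain x where x: "x \<in> slab r Q" "\<forall>i\<in>K. \<forall>j\<in>J. f j x \<in> hpl (cidx J i j)" by (auto simp: cells_point)
    have "\<forall>\<^sub>F R in at_top. dist c (bil y x) < R" by (rule eventually_gt_at_top)
    then show ?thesis
    proof eventually_elim
      case (elim R)
      then have "x \<in> slab r (Q \<inter> ball c R)" using x(1) by (simp add: slab_def)
      then show ?case using x(2) K unfolding cells_point by blast
    qed
  qed
  then have "\<forall>\<^sub>F R in at_top. \<forall>K\<in>cells J f (slab r Q). K \<in> cells J f (slab r (Q \<inter> ball c R))"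
    by (intro eventually_ball_finite finite_cells) auto
  then obtain R0 where "\<forall>R\<ge>R0. cells J f (slab r Q) \<subseteq> cells J f (slab r (Q \<inter> ball c R))"
    by (auto simp: eventually_at_top_linorder subset_eq)
  moreover have "cells J f (slab r (Q \<inter> ball c R)) \<subseteq> cells J f (slab r Q)" for R
    by (rule cells_mono) (auto simp: slab_def)
  ultimately show ?thesis by blast
qed

text \<open>Move along the field so that \<open>y - c\<close> is multiplied by 1 -
  \<open>\<tau>\<close> \<open>\<phi>\<close>. Form \<open>j\<close> changes by at most
  \<open>B * \<tau> * R\<close> times its value, which is less than the value itself, as
  \<open>flow_retract\<close> demands. The cutoff \<open>\<phi>\<close> allows the field to be
  uncontrolled where \<open>\<phi>\<close> vanishes.\<close>

lemma slab_shift: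
  assumes Q: "convex Q" "c \<in> Q" and v: "continuous_on {x. \<forall>j\<in>J. f j x \<noteq> 0} v"
    and vD: "\<And>x. (\<forall>j\<in>J. f j x \<noteq> 0) \<Longrightarrow> v x \<in> D \<and> (\<forall>z\<in>Z. bil z (v x) = 0) \<and> bil y (v x) = 1"
    and \<phi>: "continuous_on UNIV \<phi>" "\<And>s. 0 \<le> \<phi> s \<and> \<phi> s \<le> (1::real)"
    and bd: "\<And>x j. x \<in> slab r (Q \<inter> ball c R) \<Longrightarrow> (\<forall>j\<in>J. f j x \<noteq> 0) \<Longrightarrow> j \<in> J \<Longrightarrow> \<phi> (cmod (bil y x - c)) * cmod (bil (a j) (v x)) \<le> B * cmod (f j x)"
    and \<tau>: "0 \<le> \<tau>" "\<tau> \<le> 1" "B * \<tau> * R < 1" "B \<ge> 0"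
    and Q': "Q' \<subseteq> Q \<inter> ball c R" "\<And>z. z \<in> Q \<inter> ball c R \<Longrightarrow> z - (\<tau> * \<phi> (cmod (z - c))) *\<^sub>R (z - c) \<in> Q'"
    and van: "van J f lam (Mset J f (slab r Q')) q"
  shows "van J f lam (Mset J f (slab r (Q \<inter> ball c R))) q"
proof -
  define s where "s x = \<tau> * \<phi> (cmod (bil y x - c))" for x
  define W where "W x = (- (complex_of_real (s x) * (bil y x - c))) *s v x" for x
  let ?Y = "Mset J f (slab r (Q \<inter> ball c R))"
  have Y: "x \<in> slab r (Q \<inter> ball c R)" "\<forall>j\<in>J. f j x \<noteq> 0" if "x \<in> ?Y" for x using that by (auto simp: Mset_def)
  have s: "0 \<le> s x" "s x \<le> 1" for x using \<tau> \<phi>(2)[of "cmod (bil y x - c)"] mult_le_one[of \<tau>] by (auto simp: s_def)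
  have yW: "bil y (x + t *\<^sub>R W x) = bil y x - (t * s x) *\<^sub>R (bil y x - c)" if "x \<in> ?Y" for x t
    unfolding bil_add bil_scaleR W_def bil_scale using vD[OF Y(2)[OF that]] by (simp add: scaleR_conv_of_real[where 'a = complex])
  have tube: "x + t *\<^sub>R W x \<in> polytube p D Z r" if x: "x \<in> ?Y" for x t
  proof -
    have "x \<in> polytube p D Z r" using Y(1)[OF x] by (simp add: slab_def)
    moreover have e: "x + t *\<^sub>R W x - p = (x - p) + t *\<^sub>R W x" by simp
    moreover have "t *\<^sub>R W x \<in> D" unfolding W_def using vD[OF Y(2)[OF x]] D by (intro subspace_scaleR vec.subspace_scale) auto
    moreover have "bil z (t *\<^sub>R W x) = 0" if "z \<in> Z" for z unfolding W_def bil_scaleR bil_scale using vD[OF Y(2)[OF x]] that by simp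
    ultimately show ?thesis using D unfolding polytube_def mem_Collect_eq e by (auto simp: bil_add intro: vec.subspace_add)
  qed
  show ?thesis
  proof (rule flow_retract[of J a b _ W, OF _ _ _ _ _ van])
    have "continuous_on ?Y v" by (rule continuous_on_subset[OF v]) (auto simp: Mset_def)
    moreover have "continuous_on ?Y (\<lambda>x. \<phi> (cmod (bil y x - c)))"
      by (rule continuous_on_compose2[OF \<phi>(1)]) (auto intro!: continuous_intros)
    ultimately show "continuous_on ?Y W"
      unfolding W_def s_def by (intro continuous_intros)
  next
    fix x and t :: real assume x: "x \<in> ?Y" and t: "0 \<le> t" "t \<le> 1"
    have u: "0 \<le> t * s x" "t * s x \<le> 1" using s[of x] t by (auto intro: mult_le_one)
    have xQ: "bil y x \<in> Q" "cmod (bil y x - c) < R" using Y(1)[OF x] by (auto simp: slab_def dist_norm norm_minus_commute)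
    have "bil y x - (t * s x) *\<^sub>R (bil y x - c) = (1 - t * s x) *\<^sub>R bil y x + (t * s x) *\<^sub>R c" by (simp add: algebra_simps)
    also have "\<dots> \<in> Q" using u xQ Q by (intro convexD[OF Q(1)]) auto
    finally have 1: "bil y x - (t * s x) *\<^sub>R (bil y x - c) \<in> Q" .
    have "bil y x - (t * s x) *\<^sub>R (bil y x - c) - c = (1 - t * s x) *\<^sub>R (bil y x - c)" by (simp add: algebra_simps)
    then have "cmod (bil y x - (t * s x) *\<^sub>R (bil y x - c) - c) \<le> 1 * cmod (bil y x - c)"
      using u by (simp add: mult_left_le_one_le)
    then have "bil y x - (t * s x) *\<^sub>R (bil y x - c) \<in> Q \<inter> ball c R" using 1 xQ by (simp add: dist_norm norm_minus_commute)
    then show "x + t *\<^sub>R W x \<in> slab r (Q \<inter> ball c R)" using tube[OF x, of t] by (simp add: slab_def yW[OF x])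
  next
    fix x j assume x: "x \<in> ?Y" and j: "j \<in> J"
    have xQ: "cmod (bil y x - c) < R" using Y(1)[OF x] by (auto simp: slab_def dist_norm norm_minus_commute)
    have f0: "cmod (f j x) > 0" using Y(2)[OF x] j by simp
    have "cmod (bil (a j) (W x)) = \<tau> * cmod (bil y x - c) * (\<phi> (cmod (bil y x - c)) * cmod (bil (a j) (v x)))"
      using \<tau> \<phi>(2)[of "cmod (bil y x - c)"] unfolding W_def bil_scale s_def by (simp add: norm_mult)
    also have "\<dots> \<le> \<tau> * R * (B * cmod (f j x))"
    proof (rule mult_mono[OF _ bd[OF Y[OF x] j]])
      show "\<tau> * cmod (bil y x - c) \<le> \<tau> * R" using \<tau> xQ by (intro mult_left_mono) auto
      show "0 \<le> \<tau> * R" using \<tau> xQ by (intro mult_nonneg_nonneg) (auto intro: order_trans[OF norm_ge_zero less_imp_le])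
      show "0 \<le> \<phi> (cmod (bil y x - c)) * cmod (bil (a j) (v x))" using \<phi>(2) by simp
    qed
    also have "\<dots> = (B * \<tau> * R) * cmod (f j x)" by (simp add: algebra_simps)
    also have "\<dots> < 1 * cmod (f j x)" using \<tau>(3) f0 by (intro mult_strict_right_mono)
    finally show "cmod (bil (a j) (W x)) < cmod (f j x)" by simp
  next
    show "slab r Q' \<subseteq> slab r (Q \<inter> ball c R)" using Q'(1) by (auto simp: slab_def)
    fix x assume x: "x \<in> ?Y"
    have "bil y x \<in> Q \<inter> ball c R" using Y(1)[OF x] by (auto simp: slab_def)
    from Q'(2)[OF this] show "x + W x \<in> slab r Q'"
      using tube[OF x, of 1] yW[OF x, of 1] by (simp add: slab_def s_def)
  qed
qed

text \<open>A single admissible move shrinks the radius only by a factor 1 - \<open>\<tau>\<close>,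
  where \<open>\<tau>\<close> is limited by the current radius. Truncation first makes the radius
  finite without changing the nerve, and then finitely many moves with one common
  \<open>\<tau>\<close> lead down to \<open>R0\<close>.\<close>

lemma slab_shrink:
  assumes Q: "convex Q" "c \<in> Q" and v: "continuous_on {x. \<forall>j\<in>J. f j x \<noteq> 0} v"
    and vD: "\<And>x. (\<forall>j\<in>J. f j x \<noteq> 0) \<Longrightarrow> v x \<in> D \<and> (\<forall>z\<in>Z. bil z (v x) = 0) \<and> bil y (v x) = 1"
    and \<phi>: "continuous_on UNIV \<phi>" "\<And>s. 0 \<le> \<phi> s \<and> \<phi> s \<le> (1::real)" "\<And>s. R0 \<le> s \<Longrightarrow> \<phi> s = 1"
    and bd: "\<And>x j. x \<in> slab r Q \<Longrightarrow> (\<forall>j\<in>J. f j x \<noteq> 0) \<Longrightarrow> j \<in> J \<Longrightarrow> \<phi> (cmod (bil y x - c)) * cmod (bil (a j) (v x)) \<le> B * cmod (f j x)"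
    and B: "B > 0" and R0: "R0 > 0"
    and van: "van J f lam (Mset J f (slab r (Q \<inter> ball c R0))) q"
  shows "van J f lam (Mset J f (slab r Q)) q"
proof -
  obtain R1 where R1: "\<forall>R\<ge>R1. cells J f (slab r (Q \<inter> ball c R)) = cells J f (slab r Q)" using slab_truncate by blast
  define Rm where "Rm = max R0 R1"
  \<comment> \<open>The second bound gives \<open>B * \<tau> * Rm\<close> at most 1/2; the bound 1/2
    keeps the factor 1 - \<open>\<tau>\<close> positive.\<close>
  define \<tau> where "\<tau> = min (1/2) (1 / (2 * B * Rm))"
  have Rm: "Rm > 0" using R0 by (simp add: Rm_def)
  have t: "0 < \<tau>" "\<tau> \<le> 1/2" using B Rm by (auto simp: \<tau>_def)
  have tB: "B * \<tau> * Rm < 1"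
  proof -
    have "B * \<tau> * Rm \<le> B * (1 / (2 * B * Rm)) * Rm" using B Rm by (intro mult_right_mono mult_left_mono) (auto simp: \<tau>_def)
    also have "\<dots> < 1" using B Rm by simp
    finally show ?thesis .
  qed
  have step: "van J f lam (Mset J f (slab r (Q \<inter> ball c R))) q"
    if R: "R0 \<le> R" "R \<le> Rm" "R * (1 - \<tau>) ^ N \<le> R0" for N R
    using R
  proof (induction N arbitrary: R)
    case 0
    then have "R = R0" by simp
    then show ?case using van by simp
  next
    case (Suc N)
    define R' where "R' = max R0 (R * (1 - \<tau>))"
    have R'le: "R' \<le> R" using Suc.prems t R0 by (auto simp: R'_def mult_left_le)
    have v': "van J f lam (Mset J f (slab r (Q \<inter> ball c R'))) q"
    proof (cases "R * (1 - \<tau>) \<le> R0")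
      case True then show ?thesis using van by (simp add: R'_def)
    next
      case False
      then show ?thesis using Suc.prems R'le by (intro Suc.IH) (auto simp: R'_def mult_ac)
    qed
    show ?case
    proof (rule slab_shift[OF Q v vD \<phi>(1,2) _ _ _ _ _ _ _ v'])
      fix x j assume "x \<in> slab r (Q \<inter> ball c R)" "\<forall>j\<in>J. f j x \<noteq> 0" "j \<in> J"
      then show "\<phi> (cmod (bil y x - c)) * cmod (bil (a j) (v x)) \<le> B * cmod (f j x)"
        by (intro bd) (auto simp: slab_def)
    next
      have "B * \<tau> * R \<le> B * \<tau> * Rm" using Suc.prems B t by (intro mult_left_mono) auto
      then show "B * \<tau> * R < 1" using tB by linarith
      show "Q \<inter> ball c R' \<subseteq> Q \<inter> ball c R" using R'le by auto
    next
      fix z assume z: "z \<in> Q \<inter> ball c R"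
      let ?s = "\<tau> * \<phi> (cmod (z - c))"
      have s: "0 \<le> ?s" "?s \<le> 1" using \<phi>(2)[of "cmod (z - c)"] t mult_le_one[of \<tau> "\<phi> (cmod (z - c))"] by auto
      have "z - ?s *\<^sub>R (z - c) = (1 - ?s) *\<^sub>R z + ?s *\<^sub>R c" by (simp add: algebra_simps)
      also have "\<dots> \<in> Q" using s z Q by (intro convexD[OF Q(1)]) auto
      finally have 1: "z - ?s *\<^sub>R (z - c) \<in> Q" .
      have "z - ?s *\<^sub>R (z - c) - c = (1 - ?s) *\<^sub>R (z - c)" by (simp add: algebra_simps)
      then have n: "cmod (z - ?s *\<^sub>R (z - c) - c) = (1 - ?s) * cmod (z - c)" using s by simp
      have "(1 - ?s) * cmod (z - c) < R'"
      proof (cases "R0 \<le> cmod (z - c)")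
        case True
        then have "(1 - ?s) * cmod (z - c) < (1 - \<tau>) * R"
          using \<phi>(3) z t by (auto simp: dist_norm norm_minus_commute)
        then show ?thesis by (simp add: R'_def mult.commute)
      next
        case False
        have "(1 - ?s) * cmod (z - c) \<le> cmod (z - c)" using s by (intro mult_left_le_one_le) auto
        then show ?thesis using False by (simp add: R'_def)
      qed
      then show "z - ?s *\<^sub>R (z - c) \<in> Q \<inter> ball c R'" using 1 n by (simp add: dist_norm norm_minus_commute)
    qed (use t B in auto)
  qed
  have "\<exists>N. (1 - \<tau>) ^ N < R0 / Rm" using t R0 Rm by (intro real_arch_pow_inv) auto
  then obtain N where "(1 - \<tau>) ^ N < R0 / Rm" by blast
  then have "Rm * (1 - \<tau>) ^ N \<le> R0" using Rm by (simp add: field_simps)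
  then have "van J f lam (Mset J f (slab r (Q \<inter> ball c Rm))) q" by (intro step[of _ N]) (auto simp: Rm_def)
  moreover have "cells J f (slab r (Q \<inter> ball c Rm)) = cells J f (slab r Q)" using R1 by (simp add: Rm_def)
  ultimately show ?thesis
    using van_same_cells[where f = f, OF fin(1) affc_hyp_form convex_slab[OF convex_Int[OF Q(1) convex_ball]] convex_slab[OF Q(1)]] by blast
qed

lemma slab_fibre: "slab r {c} = polytube (p + (c - bil y p) *s w) {v\<in>D. bil y v = 0} Z r"
proof -
  define u where "u = (c - bil y p) *s w"
  have u: "u \<in> D" unfolding u_def by (intro vec.subspace_scale[OF D] w(1))
  have e: "x - (p + u) = (x - p) - u" for x by simp
  have m: "x - (p + u) \<in> D \<longleftrightarrow> x - p \<in> D" for x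
    using vec.subspace_diff[OF D _ u, of "x - p"] vec.subspace_add[OF D _ u, of "x - p - u"] by (auto simp: e)
  have bu: "bil z u = 0" if "z \<in> Z" for z using w(2)[OF that] unfolding u_def bil_scale by simp
  have bw: "bil y u = c - bil y p" using w(3) unfolding u_def bil_scale by simp
  show ?thesis
    unfolding slab_def polytube_def u_def[symmetric] using m
    by (auto simp: e bil_diff bu bw)
qed

lemma slab_ball: "slab r (ball c r) = polytube (p + (c - bil y p) *s w) D (insert y Z) r"
proof -
  define u where "u = (c - bil y p) *s w"
  have u: "u \<in> D" unfolding u_def by (intro vec.subspace_scale[OF D] w(1))
  have e: "x - (p + u) = (x - p) - u" for x by simp
  have m: "x - (p + u) \<in> D \<longleftrightarrow> x - p \<in> D" for x
    using vec.subspace_diff[OF D _ u, of "x - p"] vec.subspace_add[OF D _ u, of "x - p - u"] by (auto simp: e)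
  have bu: "bil z u = 0" if "z \<in> Z" for z using w(2)[OF that] unfolding u_def bil_scale by simp
  have bw: "bil y u = c - bil y p" using w(3) unfolding u_def bil_scale by simp
  show ?thesis
    unfolding slab_def polytube_def u_def[symmetric] using m
    by (auto simp: e bil_diff bu bw dist_norm norm_minus_commute)
qed

text \<open>With no critical value in the closure the field is controlled everywhere, so the slab
  retracts into the fibre over \<open>c\<close>. The fibre has smaller dimension, so vanishing
  starts already in degree \<open>vec.dim D\<close>; Mayer-Vietoris in \<open>slab_cd\<close> needs
  this extra degree on overlaps.\<close>

lemma slab_regular:
  assumes vf: "vfields p D Z J a b y Crit"
    and Q: "convex Q" and Cr: "Crit \<inter> closure Q = {}" "finite Crit"
    and IH: "\<And>p'. tube_cd p' {v\<in>D. bil y v = 0} Z J a b"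
  shows "\<forall>\<^sub>F r in at_right 0. \<forall>lam q. vec.dim D \<le> q \<longrightarrow> van J f lam (Mset J f (slab r Q)) q"
proof (cases "Q = {}")
  case True
  then show ?thesis by (simp add: slab_def Mset_def van_empty)
next
  case False
  then obtain c where c: "c \<in> Q" by blast
  have "\<forall>\<kappa>\<in>Crit. \<forall>\<^sub>F \<delta> in at_right 0. \<forall>z\<in>Q. \<delta> \<le> cmod (z - \<kappa>)"
  proof
    fix \<kappa> assume "\<kappa> \<in> Crit"
    then have "\<kappa> \<notin> closure Q" using Cr by auto
    then obtain e where "e > 0" "\<forall>z\<in>Q. e \<le> dist z \<kappa>" by (force simp: closure_approachable not_less)
    then show "\<forall>\<^sub>F \<delta> in at_right 0. \<forall>z\<in>Q. \<delta> \<le> cmod (z - \<kappa>)"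
      unfolding eventually_at_right_field by (intro exI[of _ e]) (force simp: dist_norm)
  qed
  then have "\<forall>\<^sub>F \<delta> in at_right 0. \<forall>\<kappa>\<in>Crit. \<forall>z\<in>Q. \<delta> \<le> cmod (z - \<kappa>)"
    by (intro eventually_ball_finite Cr)
  then obtain e where e: "e > 0" "\<And>\<delta>. 0 < \<delta> \<Longrightarrow> \<delta> < e \<Longrightarrow> \<forall>\<kappa>\<in>Crit. \<forall>z\<in>Q. \<delta> \<le> cmod (z - \<kappa>)" by (auto simp: eventually_at_right_field)
  have d: "\<forall>\<kappa>\<in>Crit. \<forall>z\<in>Q. e / 2 \<le> cmod (z - \<kappa>)" using e(1) e(2)[of "e/2"] by auto
  have d0: "e / 2 > 0" using e(1) by simp
  obtain r1 B v where r1: "r1 > 0" and B: "B > 0" and v: "continuous_on {x. \<forall>j\<in>J. f j x \<noteq> 0} v"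
    and vD: "\<And>x. (\<forall>j\<in>J. f j x \<noteq> 0) \<Longrightarrow> v x \<in> D \<and> (\<forall>z\<in>Z. bil z (v x) = 0) \<and> bil y (v x) = 1"
    and bd: "\<And>x j. (\<forall>j\<in>J. f j x \<noteq> 0) \<Longrightarrow> x - p \<in> D \<Longrightarrow> (\<forall>z\<in>Z. cmod (bil z (x - p)) < r1) \<Longrightarrow> (\<forall>\<kappa>\<in>Crit. e / 2 \<le> cmod (bil y x - \<kappa>)) \<Longrightarrow>
            j \<in> J \<Longrightarrow> cmod (bil (a j) (v x)) \<le> B * cmod (f j x)"
    by (rule vfieldsE[OF vf d0]) (rule that[rotated 2])
  have ev: "\<forall>\<^sub>F r in at_right 0. r < r1" using r1 by (auto simp: eventually_at_right_field)
  show ?thesis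
    using ev IH[of "p + (c - bil y p) *s w", unfolded tube_cd_def]
  proof eventually_elim
    case (elim r)
    show ?case
    proof (intro allI impI)
      fix lam q assume q: "vec.dim D \<le> q"
      have "vec.dim {v\<in>D. bil y v = 0} < q" using dim_kernel_less[OF D w(1), of y] w(3) q by simp
      then have fib: "van J f lam (Mset J f (slab r {c})) q" using elim(2) by (simp add: slab_fibre)
      have bd': "1 * cmod (bil (a j) (v x)) \<le> B * cmod (f j x)" if "x \<in> slab r Q" "\<forall>j\<in>J. f j x \<noteq> 0" "j \<in> J" for x j
        using bd[of x j] that elim(1) d by (force simp: slab_def polytube_def)
      \<comment> \<open>At this radius \<open>B * R0\<close> is 1/2, so one move with
        \<open>\<tau> = 1\<close> reaches the fibre.\<close>
      define R0 where "R0 = 1 / (2 * B)"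
      have R0: "R0 > 0" "B * R0 < 1" using B by (auto simp: R0_def)
      have "van J f lam (Mset J f (slab r (Q \<inter> ball c R0))) q"
        by (rule slab_shift[OF Q c v vD _ _ _ _ _ _ _ _ _ fib, where \<phi> = "\<lambda>_. 1" and \<tau> = 1 and B = B])
           (use R0 B c bd' in \<open>auto simp: slab_def\<close>)
      then show "van J f lam (Mset J f (slab r Q)) q"
        by (intro slab_shrink[OF Q c v vD _ _ _ _ B R0(1), where \<phi> = "\<lambda>_. 1"]) (use bd' in auto)
    qed
  qed
qed

text \<open>Near the critical value \<open>c\<close> the field is switched off, so the slab is
  pushed only into the part where \<open>y\<close> is within \<open>2 * \<delta>\<close> of
  \<open>c\<close>. That part has the nerve of a tube with \<open>y\<close> added to
  \<open>Z\<close>, to which \<open>IH\<close> applies.\<close>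

lemma slab_critical:
  assumes vf: "vfields p D Z J a b y Crit"
    and Q: "convex Q" "open Q" and c: "c \<in> Q" and Cr: "Crit \<inter> closure Q \<subseteq> {c}" "finite Crit"
    and IH: "\<And>p'. tube_cd p' D (insert y Z) J a b"
  shows "\<forall>\<^sub>F r in at_right 0. \<forall>lam q. vec.dim D < q \<longrightarrow> van J f lam (Mset J f (slab r Q)) q"
proof -
  have "\<forall>\<kappa>\<in>Crit. \<forall>\<^sub>F \<delta> in at_right 0. \<forall>z\<in>Q. \<kappa> \<noteq> c \<longrightarrow> \<delta> \<le> cmod (z - \<kappa>)"
  proof
    fix \<kappa> assume k: "\<kappa> \<in> Crit"
    show "\<forall>\<^sub>F \<delta> in at_right 0. \<forall>z\<in>Q. \<kappa> \<noteq> c \<longrightarrow> \<delta> \<le> cmod (z - \<kappa>)"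
    proof (cases "\<kappa> = c")
      case False
      then have "\<kappa> \<notin> closure Q" using Cr k by auto
      then obtain e where "e > 0" "\<forall>z\<in>Q. e \<le> dist z \<kappa>" by (force simp: closure_approachable not_less)
      then show ?thesis
        unfolding eventually_at_right_field by (intro exI[of _ e]) (force simp: dist_norm)
    qed simp
  qed
  then have e1: "\<forall>\<^sub>F \<delta> in at_right 0. \<forall>\<kappa>\<in>Crit. \<forall>z\<in>Q. \<kappa> \<noteq> c \<longrightarrow> \<delta> \<le> cmod (z - \<kappa>)"
    by (intro eventually_ball_finite Cr)
  obtain e0 where "e0 > 0" "ball c e0 \<subseteq> Q" using Q(2) c by (meson open_contains_ball)
  then have e2: "\<forall>\<^sub>F \<delta> in at_right 0. ball c (2 * \<delta>) \<subseteq> Q"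
    unfolding eventually_at_right_field by (intro exI[of _ "e0/2"]) (auto simp: subset_eq)
  let ?T = "\<lambda>\<rho>. slab \<rho> (ball c \<rho>)"
  \<comment> \<open>The nerve of the tube around \<open>c\<close>. As the radius decreases the
    nerves decrease, and being finite they become stationary with value \<open>S\<close>.\<close>
  define S where "S = (\<Inter>\<rho>\<in>{0<..}. cells J f (?T \<rho>))"
  have mono: "?T \<rho> \<subseteq> ?T \<rho>'" if "\<rho> \<le> \<rho>'" for \<rho> \<rho>' using that by (force simp: slab_def polytube_def)
  have "\<forall>\<^sub>F \<rho> in at_right 0. K \<in> cells J f (?T \<rho>) \<longrightarrow> K \<in> S" for K
  proof (cases "K \<in> S")
    case False
    then obtain \<rho>0 where "\<rho>0 > 0" "K \<notin> cells J f (?T \<rho>0)" by (auto simp: S_def)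
    then have "K \<notin> cells J f (?T \<rho>)" if "\<rho> < \<rho>0" for \<rho> using cells_mono[OF mono[of \<rho> \<rho>0], of J f] that by auto
    then show ?thesis unfolding eventually_at_right_field using \<open>\<rho>0 > 0\<close> by blast
  qed simp
  then have "\<forall>\<^sub>F \<rho> in at_right 0. \<forall>K\<in>Pow {..<ncell J}. K \<in> cells J f (?T \<rho>) \<longrightarrow> K \<in> S"
    by (intro eventually_ball_finite) auto
  then have st: "\<forall>\<^sub>F \<rho> in at_right 0. cells J f (?T \<rho>) = S"
    using eventually_at_right_less[of "0::real"]
  proof eventually_elim
    case (elim \<rho>)
    then show ?case by (auto simp: S_def cells_def)
  qed
  have "\<forall>\<^sub>F \<rho> in at_right 0. \<forall>lam q. vec.dim D < q \<longrightarrow> van J f lam (Mset J f (?T \<rho>)) q"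
    using IH[of "p + (c - bil y p) *s w"] by (simp add: tube_cd_def slab_ball)
  then have "\<forall>\<^sub>F \<rho> in at_right 0. cells J f (?T \<rho>) = S \<and> (\<forall>lam q. vec.dim D < q \<longrightarrow> van J f lam (Mset J f (?T \<rho>)) q)"
    using st by (simp add: eventually_conj_iff)
  then obtain \<rho>1 where "\<rho>1 > 0" and r: "\<forall>\<rho>>0. \<rho> < \<rho>1 \<longrightarrow> cells J f (?T \<rho>) = S \<and> (\<forall>lam q. vec.dim D < q \<longrightarrow> van J f lam (Mset J f (?T \<rho>)) q)"
    unfolding eventually_at_right_field by (elim exE conjE)
  have \<rho>1: "\<And>\<rho>. 0 < \<rho> \<Longrightarrow> \<rho> < \<rho>1 \<Longrightarrow> cells J f (?T \<rho>) = S"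
      "\<And>\<rho> lam q. 0 < \<rho> \<Longrightarrow> \<rho> < \<rho>1 \<Longrightarrow> vec.dim D < q \<Longrightarrow> van J f lam (Mset J f (?T \<rho>)) q"
    using r by simp_all
  have e3: "\<forall>\<^sub>F \<delta> in at_right 0. 2 * \<delta> < \<rho>1" using \<open>\<rho>1 > 0\<close> unfolding eventually_at_right_field by (intro exI[of _ "\<rho>1/2"]) auto
  have "\<forall>\<^sub>F \<delta> in at_right 0. 0 < \<delta> \<and> (\<forall>\<kappa>\<in>Crit. \<forall>z\<in>Q. \<kappa> \<noteq> c \<longrightarrow> \<delta> \<le> cmod (z - \<kappa>)) \<and> ball c (2 * \<delta>) \<subseteq> Q \<and> 2 * \<delta> < \<rho>1"
    using eventually_at_right_less[of "0::real"] e1 e2 e3 by eventually_elim auto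
  then obtain \<delta> where \<delta>: "0 < \<delta>" "\<forall>\<kappa>\<in>Crit. \<forall>z\<in>Q. \<kappa> \<noteq> c \<longrightarrow> \<delta> \<le> cmod (z - \<kappa>)" "ball c (2 * \<delta>) \<subseteq> Q" "2 * \<delta> < \<rho>1"
    using eventually_happens'[OF trivial_limit_at_right_real] by blast
  have d0: "\<delta> > 0" using \<delta>(1) by simp
  obtain r1 B v where r1: "r1 > 0" and B: "B > 0" and v: "continuous_on {x. \<forall>j\<in>J. f j x \<noteq> 0} v"
    and vD: "\<And>x. (\<forall>j\<in>J. f j x \<noteq> 0) \<Longrightarrow> v x \<in> D \<and> (\<forall>z\<in>Z. bil z (v x) = 0) \<and> bil y (v x) = 1"
    and bd: "\<And>x j. (\<forall>j\<in>J. f j x \<noteq> 0) \<Longrightarrow> x - p \<in> D \<Longrightarrow> (\<forall>z\<in>Z. cmod (bil z (x - p)) < r1) \<Longrightarrow> (\<forall>\<kappa>\<in>Crit. \<delta> \<le> cmod (bil y x - \<kappa>)) \<Longrightarrow>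
            j \<in> J \<Longrightarrow> cmod (bil (a j) (v x)) \<le> B * cmod (f j x)"
    by (rule vfieldsE[OF vf d0]) (rule that[rotated 2])
  have ev: "\<forall>\<^sub>F r in at_right 0. 0 < r \<and> r < min r1 \<rho>1" using r1 \<open>\<rho>1 > 0\<close> unfolding eventually_at_right_field by (intro exI[of _ "min r1 \<rho>1"]) auto
  show ?thesis
    using ev
  proof eventually_elim
    case (elim r)
    \<comment> \<open>The radius \<open>r\<close> cannot simply be set to
      \<open>2 * \<delta>\<close>, because the bound \<open>r1\<close> on it depends on
      \<open>\<delta>\<close>. But the slab lies between the tubes of radii \<open>m\<close> and
      \<open>M\<close>, whose nerves coincide, so its nerve is the same.\<close>
    define m M where "m = min r (2 * \<delta>)" and "M = max r (2 * \<delta>)"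
    have mM: "0 < m" "m < \<rho>1" "0 < M" "M < \<rho>1" using elim \<delta> by (auto simp: m_def M_def)
    have QB: "Q \<inter> ball c (2 * \<delta>) = ball c (2 * \<delta>)" using \<delta>(3) by auto
    have "?T m \<subseteq> slab r (ball c (2 * \<delta>))" "slab r (ball c (2 * \<delta>)) \<subseteq> ?T M"
      by (force simp: slab_def polytube_def m_def M_def)+
    from cells_mono[OF this(1), of J f] cells_mono[OF this(2), of J f]
    have ce: "cells J f (?T m) = cells J f (slab r (ball c (2 * \<delta>)))" using \<rho>1(1) mM by auto
    define \<phi> where "\<phi> s = max 0 (min 1 ((s - \<delta>) / \<delta>))" for s
    have cphi: "continuous_on UNIV \<phi>" unfolding \<phi>_def using \<delta> by (intro continuous_intros) auto
    have phi: "0 \<le> \<phi> s \<and> \<phi> s \<le> 1" "2 * \<delta> \<le> s \<Longrightarrow> \<phi> s = 1" "s \<le> \<delta> \<Longrightarrow> \<phi> s = 0" for s using \<delta>(1) by (auto simp: \<phi>_def field_simps)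
    show ?case
    proof (intro allI impI)
      fix lam q assume q: "vec.dim D < q"
      have "van J f lam (Mset J f (slab r (ball c (2 * \<delta>)))) q"
        by (rule van_same_cells[where f = f, OF fin(1) affc_hyp_form convex_slab[OF convex_ball] convex_slab[OF convex_ball] ce \<rho>1(2)[OF mM(1,2) q]])
      then have vn: "van J f lam (Mset J f (slab r (Q \<inter> ball c (2 * \<delta>)))) q" by (simp add: QB)
      show "van J f lam (Mset J f (slab r Q)) q"
      proof (rule slab_shrink[OF Q(1) c v vD cphi phi(1,2) _ B _ vn])
        fix x j assume x: "x \<in> slab r Q" "\<forall>j\<in>J. f j x \<noteq> 0" "j \<in> J"
        show "\<phi> (cmod (bil y x - c)) * cmod (bil (a j) (v x)) \<le> B * cmod (f j x)"
        proof (cases "cmod (bil y x - c) \<le> \<delta>")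
          case True then show ?thesis using phi(3) B by simp
        next
          case False
          then have "\<forall>\<kappa>\<in>Crit. \<delta> \<le> cmod (bil y x - \<kappa>)" using x(1) \<delta>(2) by (force simp: slab_def)
          then have "cmod (bil (a j) (v x)) \<le> B * cmod (f j x)" using x elim by (intro bd) (auto simp: slab_def polytube_def)
          moreover have "\<phi> (cmod (bil y x - c)) * cmod (bil (a j) (v x)) \<le> cmod (bil (a j) (v x))"
            using phi(1) by (intro mult_left_le_one_le) auto
          ultimately show ?thesis by linarith
        qed
      qed (use \<delta> in auto)
    qed
  qed
qed

lemma openin_slab:
  assumes "open Q" "Q \<subseteq> Q'"
  shows "openin (top_of_set (Mset J f (slab r Q'))) (Mset J f (slab r Q))"
proof -
  have "Mset J f (slab r Q) = Mset J f (slab r Q') \<inter> (\<lambda>x. bil y x) -` Q" using assms(2) by (auto simp: Mset_def slab_def)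
  then show ?thesis using continuous_openin_preimage_gen[OF _ assms(1), of "Mset J f (slab r Q')" "\<lambda>x. bil y x"]
    by (simp add: continuous_on_bil continuous_on_id)
qed

text \<open>Induction on the number of critical values in \<open>Q\<close>. A set with several is
  cut by a linear functional into two overlapping convex pieces with fewer, and the overlap, a strip
  without critical values, is covered by \<open>slab_regular\<close>.\<close>

lemma slab_cd:
  assumes vf: "vfields p D Z J a b y Crit"
    and Cr: "finite Crit"
    and IH1: "\<And>p'. tube_cd p' {v\<in>D. bil y v = 0} Z J a b"
    and IH2: "\<And>p'. tube_cd p' D (insert y Z) J a b"
    and Q: "convex Q" "open Q" "Crit \<inter> closure Q \<subseteq> Q"
  shows "\<forall>\<^sub>F r in at_right 0. \<forall>lam q. vec.dim D < q \<longrightarrow> van J f lam (Mset J f (slab r Q)) q"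
  using Q
proof (induction "card (Crit \<inter> Q)" arbitrary: Q rule: less_induct)
  case less
  note Q = less.prems
  consider "Crit \<inter> Q = {}" | c where "Crit \<inter> Q = {c}" | k1 k2 where "k1 \<in> Crit" "k1 \<in> Q" "k2 \<in> Crit" "k2 \<in> Q" "k1 \<noteq> k2"
    by (metis Int_iff insertI1 is_singletonI' is_singleton_def)
  then show ?case
  proof cases
    case 1
    then have "Crit \<inter> closure Q = {}" using Q by auto
    from slab_regular[OF vf Q(1) this Cr IH1] show ?thesis by eventually_elim auto
  next
    case 2
    then have "c \<in> Q" "Crit \<inter> closure Q \<subseteq> {c}" using Q by auto
    from slab_critical[OF vf Q(1,2) this Cr IH2] show ?thesis .
  next
    case 3
    \<comment> \<open>The real linear functional in the direction from \<open>k1\<close> to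
      \<open>k2\<close>, which separates these two.\<close>
    define g where "g z = Re (cnj (k2 - k1) * z)" for z
    have "g k2 - g k1 = (cmod (k2 - k1))\<^sup>2"
      unfolding g_def cmod_power2 by (simp add: power2_eq_square algebra_simps)
    then have g12: "g k1 < g k2" using 3 by (smt (verit) zero_less_power2 norm_eq_zero right_minus_eq)
    \<comment> \<open>The next level above \<open>g k1\<close> that \<open>g\<close> attains on
      \<open>Crit\<close>. No critical value lies strictly between these levels, so the strip from
      \<open>\<alpha>\<close> to \<open>\<beta>\<close>, the middle third, has closure free of
      them.\<close>
    define m where "m = Min {t\<in>g ` Crit. g k1 < t}"
    have finm: "finite {t\<in>g ` Crit. g k1 < t}" "{t\<in>g ` Crit. g k1 < t} \<noteq> {}" using Cr 3 g12 by auto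
    have m: "g k1 < m" "m \<le> g k2" using Min_in[OF finm] Min_le[OF finm(1), of "g k2"] 3 g12 by (auto simp: m_def)
    have gap: "g k \<le> g k1 \<or> m \<le> g k" if "k \<in> Crit" for k using Min_le[OF finm(1), of "g k"] that by (force simp: m_def)
    define \<alpha> \<beta> where "\<alpha> = (2 * g k1 + m) / 3" and "\<beta> = (g k1 + 2 * m) / 3"
    have ab: "g k1 < \<alpha>" "\<alpha> < \<beta>" "\<beta> < m" using m by (auto simp: \<alpha>_def \<beta>_def)
    define Q1 Q2 where "Q1 = Q \<inter> {z. g z < \<beta>}" and "Q2 = Q \<inter> {z. \<alpha> < g z}"
    have g_inner: "g z = (k2 - k1) \<bullet> z" for z by (simp add: g_def inner_complex_def algebra_simps)
    have cvx: "convex {z. g z < \<beta>}" "convex {z. \<alpha> < g z}" unfolding g_inner using convex_halfspace_lt[of "k2 - k1" \<beta>] convex_halfspace_gt[of \<alpha> "k2 - k1"] by auto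
    have opn: "open {z. g z < \<beta>}" "open {z. \<alpha> < g z}" unfolding g_def by (intro open_Collect_less continuous_intros)+
    have cl: "closed {z. g z \<le> \<beta>}" "closed {z. \<alpha> \<le> g z}" unfolding g_def by (intro closed_Collect_le continuous_intros)+
    have c1: "closure Q1 \<subseteq> closure Q \<inter> {z. g z \<le> \<beta>}" and c2: "closure Q2 \<subseteq> closure Q \<inter> {z. \<alpha> \<le> g z}"
      unfolding Q1_def Q2_def by (intro closure_minimal closed_Int closed_closure cl; use closure_subset[of Q] in auto)+
    have q1: "Crit \<inter> closure Q1 \<subseteq> Q1" using c1 Q(3) gap ab by (force simp: Q1_def)
    have q2: "Crit \<inter> closure Q2 \<subseteq> Q2" using c2 Q(3) gap ab by (force simp: Q2_def)
    have c12: "closure (Q1 \<inter> Q2) \<subseteq> closure Q1 \<inter> closure Q2" by (simp add: closure_mono)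
    have q12: "Crit \<inter> closure (Q1 \<inter> Q2) = {}" using c12 c1 c2 gap ab by force
    have f: "finite (Crit \<inter> Q)" using Cr by simp
    have "k2 \<notin> Q1" using ab m by (auto simp: Q1_def)
    then have "Crit \<inter> Q1 \<subset> Crit \<inter> Q" using 3 by (auto simp: Q1_def)
    then have e1: "\<forall>\<^sub>F r in at_right 0. \<forall>lam q. vec.dim D < q \<longrightarrow> van J f lam (Mset J f (slab r Q1)) q"
      using Q cvx opn q1 by (intro less.hyps psubset_card_mono f) (auto simp: Q1_def intro: convex_Int)
    have "k1 \<notin> Q2" using ab m by (auto simp: Q2_def)
    then have "Crit \<inter> Q2 \<subset> Crit \<inter> Q" using 3 by (auto simp: Q2_def)
    then have e2: "\<forall>\<^sub>F r in at_right 0. \<forall>lam q. vec.dim D < q \<longrightarrow> van J f lam (Mset J f (slab r Q2)) q"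
      using Q cvx opn q2 by (intro less.hyps psubset_card_mono f) (auto simp: Q2_def intro: convex_Int)
    have "convex (Q1 \<inter> Q2)" using Q cvx by (auto simp: Q1_def Q2_def intro: convex_Int)
    note e12 = slab_regular[OF vf this q12 Cr IH1]
    have un: "Mset J f (slab r Q) = Mset J f (slab r Q1) \<union> Mset J f (slab r Q2)" for r
      using ab by (auto simp: Mset_def slab_def Q1_def Q2_def)
    have int: "Mset J f (slab r Q1) \<inter> Mset J f (slab r Q2) = Mset J f (slab r (Q1 \<inter> Q2))" for r
      by (auto simp: Mset_def slab_def)
    have o: "openin (top_of_set (Mset J f (slab r Q))) (Mset J f (slab r Q1))" "openin (top_of_set (Mset J f (slab r Q))) (Mset J f (slab r Q2))" for r
      using Q opn by (auto simp: Q1_def Q2_def intro!: openin_slab)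
    show ?thesis using e1 e2 e12
    proof eventually_elim
      case (elim r)
      show ?case
      proof (intro allI impI)
        fix lam q assume q: "vec.dim D < q"
        show "van J f lam (Mset J f (slab r Q)) q"
          unfolding un using elim q o[of r, unfolded un] by (intro van_mv) (auto simp: int)
      qed
    qed
  qed
qed

end

section \<open>Central arrangements and the induction over tubes\<close>

lemma tube_cd_empty: "tube_cd p D {} J a b \<longleftrightarrow> (\<forall>lam q. vec.dim D < q \<longrightarrow> van J (hyp_form a b) lam (Mset J (hyp_form a b) {x. x - p \<in> D}) q)"
  by (simp add: tube_cd_def polytube_def eventually_const)

lemma coset_shift: 
  fixes D :: "(complex ^ 'l) set"
  assumes D: "vec.subspace D" and u: "u \<in> D"
  shows "x - (p + u) \<in> D \<longleftrightarrow> x - p \<in> D"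
proof -
  have e: "x - (p + u) = x - p - u" by simp
  show ?thesis unfolding e using vec.subspace_diff[OF D _ u, of "x - p"] vec.subspace_add[OF D _ u, of "x - p - u"] by auto
qed

text \<open>Rescaling from \<open>p\<close> by \<open>n t x\<close> divided by form
  \<open>j0\<close> moves the sector onto the affine section where that form equals
  \<open>s0\<close>. All forms vanishing at \<open>p\<close> are multiplied by the same factor,
  whose logarithm is supplied by \<open>hlog k\<close>; the section has smaller dimension.\<close>

lemma van_sector:
  fixes p :: "complex ^ 'l"
  assumes D: "vec.subspace D" and central: "\<And>j. j \<in> J \<Longrightarrow> hyp_form a b j p = 0 \<or> a j = 0"
    and j0: "j0 \<in> J" "hyp_form a b j0 p = 0" and v0: "v0 \<in> D" "bil (a j0) v0 = 1"
    and S: "convex S" "S \<subseteq> hpl k" "s0 \<in> S"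
    and IH: "\<And>p' D'. vec.subspace D' \<Longrightarrow> vec.dim D' < vec.dim D \<Longrightarrow> tube_cd p' D' {} J a b"
    and q: "vec.dim D \<le> q"
  shows "van J (hyp_form a b) lam (Mset J (hyp_form a b) {x. x - p \<in> D \<and> hyp_form a b j0 x \<in> S}) q"
proof -
  let ?f = "hyp_form a b" and ?D' = "{v\<in>D. bil (a j0) v = 0}"
  let ?Y = "Mset J ?f {x. x - p \<in> D \<and> ?f j0 x \<in> S}" and ?Y' = "Mset J ?f {x. x - p \<in> D \<and> ?f j0 x = s0}"
  have u: "s0 *s v0 \<in> D" by (intro vec.subspace_scale D v0)
  have f0: "?f j0 x = bil (a j0) (x - p)" for x using j0(2) by (simp add: hyp_form_bil bil_diff)
  have "{x. x - p \<in> D \<and> ?f j0 x = s0} = {x. x - (p + s0 *s v0) \<in> ?D'}"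
    using coset_shift[OF D u] v0(2) unfolding f0 by (auto simp: bil_diff bil_add bil_scale)
  moreover have "vec.dim ?D' < vec.dim D" by (rule dim_kernel_less[OF D v0(1)]) (simp add: v0)
  ultimately have v': "van J ?f lam ?Y' q" using IH[OF subspace_kernel[OF D], of "a j0"] q by (simp add: tube_cd_empty)
  define n where "n = (\<lambda>t::real. \<lambda>x. complex_of_real (1 - t) * ?f j0 x + complex_of_real t * s0)"
  define H where "H = (\<lambda>t x. p + (n t x / ?f j0 x) *s (x - p))"
  define G where "G = (\<lambda>t j x. if ?f j p = 0 then hlog k (n t x) - hlog k (?f j0 x) else 0)"
  have nS: "n t x \<in> S" if "x \<in> ?Y" "t \<in> {0..1}" for t x
    using that convexD[OF S(1), of "?f j0 x" s0 "1 - t" t] S(3) by (simp add: Mset_def n_def scaleR_conv_of_real)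
  have nz: "?f j0 x \<noteq> 0" if "x \<in> ?Y" for x using that S(2) hpl_nonzero by (auto simp: Mset_def)
  have fH: "?f j (H t x) = (if ?f j p = 0 then n t x / ?f j0 x * ?f j x else ?f j x)" if "j \<in> J" for j t x
  proof (cases "?f j p = 0")
    case True
    then have "?f j x = bil (a j) (x - p)" by (simp add: hyp_form_bil bil_diff)
    then show ?thesis using True unfolding H_def hyp_form_add bil_scale by simp
  next
    case False
    then have "a j = 0" using central[OF that] by simp
    then show ?thesis using False by (simp add: hyp_form_bil)
  qed
  have fH0: "?f j0 (H t x) = n t x" if "x \<in> ?Y" for t x using fH[OF j0(1)] j0(2) nz[OF that] by simp
  have HY: "H t x \<in> ?Y" if x: "x \<in> ?Y" and t: "t \<in> {0..1}" for t x
  proof -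
    have "x - p \<in> D" using x by (simp add: Mset_def)
    then have "H t x - p \<in> D" unfolding H_def add_diff_cancel_left' by (rule vec.subspace_scale[OF D])
    moreover have "?f j (H t x) \<noteq> 0" if "j \<in> J" for j
      using fH[OF that, of t x] x that nz[OF x] nS[OF x t] S(2) hpl_nonzero by (auto simp: Mset_def)
    ultimately show ?thesis using fH0[OF x] nS[OF x t] by (simp add: Mset_def)
  qed
  let ?C = "{0..1::real} \<times> ?Y"
  have cf: "continuous_on ?C (\<lambda>z. ?f j0 (snd z))" by (intro continuous_on_hyp_form continuous_intros)
  have cn: "continuous_on ?C (\<lambda>z. n (fst z) (snd z))" unfolding n_def by (intro continuous_intros cf)
  have "hmor J ?f ?Y ?f ?Y H G"
    unfolding hmor_def
  proof (intro conjI ballI)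
    show "continuous_on ?C (\<lambda>z. H (fst z) (snd z))"
      unfolding H_def by (intro continuous_intros cn cf) (use nz in auto)
    show "continuous_on ?C (\<lambda>z. G (fst z) j (snd z))" if "j \<in> J" for j
    proof (cases "?f j p = 0")
      case True
      have "continuous_on ?C (\<lambda>z. hlog k (n (fst z) (snd z)) - hlog k (?f j0 (snd z)))"
        by (intro continuous_on_diff continuous_on_compose2[OF continuous_hlog cn] continuous_on_compose2[OF continuous_hlog cf])
          (use nS S(2) in \<open>auto simp: Mset_def\<close>)
      then show ?thesis using True by (simp add: G_def)
    qed (simp add: G_def)
    fix t :: real and x assume t: "t \<in> {0..1}" and x: "x \<in> ?Y"
    show "H t x \<in> ?Y" by (rule HY[OF x t])
    have "n t x \<in> hpl k" "?f j0 x \<in> hpl k" using nS[OF x t] x S(2) by (auto simp: Mset_def)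
    then show "?f j (H t x) = ?f j x * exp (G t j x)" if "j \<in> J" for j
      using fH[OF that] by (simp add: G_def exp_diff exp_hlog)
  qed
  moreover have "H 0 x = x" if "x \<in> ?Y" for x using nz[OF that] by (simp add: H_def n_def)
  moreover have "G 0 j x = 0" for j x by (simp add: G_def n_def)
  moreover have "H 1 x \<in> ?Y'" if x: "x \<in> ?Y" for x
    using HY[OF x, of 1] fH0[OF x, of 1] by (simp add: Mset_def n_def)
  ultimately show ?thesis using v' S(3) by (intro van_retract[of J ?f ?Y H G ?Y']) (auto simp: Mset_def)
qed

text \<open>The values of a nonconstant form are covered by three sectors. Sectors and double
  overlaps vanish from degree \<open>vec.dim D\<close> on and the triple overlap is empty, so
  Mayer-Vietoris loses one degree. If instead some form vanishes on the whole coset the complement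
  is empty, and if none vanishes at \<open>p\<close> all are constant and the coset
  contracts.\<close>

lemma central_cd:
  fixes p :: "complex ^ 'l"
  assumes D: "vec.subspace D" and central: "\<And>j. j \<in> J \<Longrightarrow> hyp_form a b j p = 0 \<or> a j = 0"
    and IH: "\<And>p' D'. vec.subspace D' \<Longrightarrow> vec.dim D' < vec.dim D \<Longrightarrow> tube_cd p' D' {} J a b"
    and q: "vec.dim D < q"
  shows "van J (hyp_form a b) lam (Mset J (hyp_form a b) {x. x - p \<in> D}) q"
proof -
  let ?f = "hyp_form a b"
  consider j0 where "j0 \<in> J" "?f j0 p = 0" "\<exists>v\<in>D. bil (a j0) v \<noteq> 0" | j0 where "j0 \<in> J" "?f j0 p = 0" "\<forall>v\<in>D. bil (a j0) v = 0"
    | "\<forall>j\<in>J. ?f j p \<noteq> 0" by blast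
  then show ?thesis
  proof cases
    case 1
    then obtain v1 where v1: "v1 \<in> D" "bil (a j0) v1 \<noteq> 0" by blast
    define v0 where "v0 = (1 / bil (a j0) v1) *s v1"
    have v0: "v0 \<in> D" "bil (a j0) v0 = 1" using v1 D by (auto simp: v0_def bil_scale intro: vec.subspace_scale)
    define Y where "Y S = Mset J ?f {x. x - p \<in> D \<and> ?f j0 x \<in> S}" for S
    have vS: "van J ?f lam (Y S) q'" if "convex S" "S \<subseteq> hpl k" "z \<in> S" "vec.dim D \<le> q'" for S k z q'
      unfolding Y_def by (rule van_sector[OF D central 1(1,2) v0 that(1-3) IH that(4)])
    have op: "openin (top_of_set (Y T)) (Y S)" if "open S" "S \<subseteq> T" for S T
    proof -
      have "Y S = Y T \<inter> ?f j0 -` S" using that(2) by (auto simp: Y_def Mset_def)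
      then show ?thesis using continuous_openin_preimage_gen[OF _ that(1), of "Y T" "?f j0"] continuous_on_hyp_form[OF continuous_on_id, of "Y T" a b j0] by simp
    qed
    have YU: "Y S \<union> Y T = Y (S \<union> T)" and YI: "Y S \<inter> Y T = Y (S \<inter> T)" for S T by (auto simp: Y_def Mset_def)
    \<comment> \<open>Points of the three double overlaps; they are the values at which the sectors
      and overlaps are cut by sections.\<close>
    have w: "Complex 1 1 \<in> hpl 0 \<inter> hpl 1" "Complex 1 (- 1) \<in> hpl 0 \<inter> hpl 2" "-1 \<in> hpl 1 \<inter> hpl 2"
      by (auto simp: hpl_def uw_def real_less_rsqrt)
    have o3: "open (hpl 0)" "open (hpl 1)" "open (hpl 2)" by (rule open_hpl)+
    have h: "van J ?f lam (Y (hpl 0)) q'" "van J ?f lam (Y (hpl 1)) q'" "van J ?f lam (Y (hpl 2)) q'"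
      "van J ?f lam (Y (hpl 0 \<inter> hpl 1)) q'" "van J ?f lam (Y (hpl 0 \<inter> hpl 2)) q'" "van J ?f lam (Y (hpl 1 \<inter> hpl 2)) q'"
      if "vec.dim D \<le> q'" for q'
      by (rule vS[where k = 0 and z = "Complex 1 1"] vS[where k = 1 and z = "Complex 1 1"] vS[where k = 2 and z = "-1"]
            vS[where k = 0 and z = "Complex 1 (-1)"] vS[where k = 1 and z = "-1"]; use w that in \<open>auto intro!: convex_hpl convex_Int\<close>; fail)+
    have i2: "van J ?f lam (Y ((hpl 0 \<inter> hpl 2) \<union> (hpl 1 \<inter> hpl 2))) q'" if "vec.dim D \<le> q'" for q'
      unfolding YU[symmetric]
    proof (rule van_mv)
      have "Y (hpl 0 \<inter> hpl 2) \<inter> Y (hpl 1 \<inter> hpl 2) = {}" unfolding YI using hpl_triple by (auto simp: Y_def Mset_def)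
      then show "van J ?f lam (Y (hpl 0 \<inter> hpl 2) \<inter> Y (hpl 1 \<inter> hpl 2)) (q' - 1)" by (simp add: van_empty)
    qed (use that h in \<open>auto simp: YU intro!: op open_hpl\<close>)
    have "van J ?f lam (Y (hpl 0) \<union> Y (hpl 1)) q"
      by (rule van_mv) (use q h in \<open>auto simp: YU YI intro!: op open_hpl\<close>)
    then have "van J ?f lam (Y (hpl 0 \<union> hpl 1) \<union> Y (hpl 2)) q"
    proof (intro van_mv)
      have "(hpl 0 \<union> hpl 1) \<inter> hpl 2 = (hpl 0 \<inter> hpl 2) \<union> (hpl 1 \<inter> hpl 2)" by blast
      then show "van J ?f lam (Y (hpl 0 \<union> hpl 1) \<inter> Y (hpl 2)) (q - 1)" using i2[of "q - 1"] q by (simp add: YI)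
    qed (use q h in \<open>auto simp: YU intro!: op open_hpl open_Un\<close>)
    moreover have "z \<in> hpl 0 \<union> hpl 1 \<union> hpl 2" if "z \<noteq> 0" for z
      using hpl_cover[OF that] by (auto simp: numeral_3_eq_3 less_Suc_eq numeral_2_eq_2)
    then have "Y (hpl 0 \<union> hpl 1) \<union> Y (hpl 2) = Mset J ?f {x. x - p \<in> D}" using 1(1) unfolding YU by (auto simp: Y_def Mset_def)
    ultimately show ?thesis by simp
  next
    case 2
    then have "?f j0 x = 0" if "x - p \<in> D" for x using that by (auto simp: hyp_form_bil bil_diff)
    then have "Mset J ?f {x. x - p \<in> D} = {}" using 2(1) by (auto simp: Mset_def)
    then show ?thesis by (simp add: van_empty)
  next
    case 3
    have a0: "a j = 0" if "j \<in> J" for j using central[OF that] 3 that by auto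
    have M: "Mset J ?f {x. x - p \<in> D} = {x. x - p \<in> D}" using 3 a0 by (auto simp: Mset_def hyp_form_bil)
    have fc: "?f j x = - b j" if "j \<in> J" for j x using a0[OF that] by (simp add: hyp_form_bil)
    have D0: "0 \<in> D" using D by (rule vec.subspace_0)
    show ?thesis unfolding M
    proof (rule van_retract[where H = "\<lambda>t x. (1 - t) *\<^sub>R x + t *\<^sub>R p" and G = "\<lambda>_ _ _. 0" and Y' = "{p}"])
      show "hmor J ?f {x. x - p \<in> D} ?f {x. x - p \<in> D} (\<lambda>t x. (1 - t) *\<^sub>R x + t *\<^sub>R p) (\<lambda>_ _ _. 0)"
        unfolding hmor_def
      proof (intro conjI ballI)
        fix t :: real and x assume t: "t \<in> {0..1}" and x: "x \<in> {x. x - p \<in> D}"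
        show "(1 - t) *\<^sub>R x + t *\<^sub>R p \<in> {x. x - p \<in> D}" using x t D0 by (intro convexD[OF convex_coset[OF D]]) auto
      qed (auto intro!: continuous_intros simp: fc)
    qed (use q D0 in \<open>auto simp: van_point\<close>)
  qed
qed

text \<open>Here \<open>Z\<close> confines the tube to a small neighbourhood of \<open>p\<close>, on
  which forms not vanishing at \<open>p\<close> are nearly constant. Replacing them by their values
  at \<open>p\<close> makes the arrangement central, and scaling towards \<open>p\<close> shows that
  the tube has the same nerve as the full coset.\<close>

lemma tube_cd_point:
  fixes p :: "complex ^ 'l"
  assumes fin: "finite J" "finite Z" and D: "vec.subspace D" and F: "\<And>v. v \<in> D \<Longrightarrow> (\<forall>z\<in>Z. bil z v = 0) \<Longrightarrow> v = 0"
    and IH: "\<And>(p' :: complex ^ 'l) D' a b. vec.subspace D' \<Longrightarrow> vec.dim D' < vec.dim D \<Longrightarrow> tube_cd p' D' {} J a b"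
  shows "tube_cd p D Z J a b"
proof -
  let ?f = "hyp_form a b"
  define a' where "a' j = (if ?f j p = 0 then a j else 0)" for j
  define b' where "b' j = (if ?f j p = 0 then b j else - ?f j p)" for j
  let ?f' = "hyp_form a' b'" and ?X = "{x. x - p \<in> D}"
  have f': "?f' j x = (if ?f j p = 0 then ?f j x else ?f j p)" for j x by (simp add: a'_def b'_def hyp_form_bil)
  have vX: "van J ?f' lam (Mset J ?f' ?X) q" if "vec.dim D < q" for lam q
    by (rule central_cd[OF D]) (use that IH in \<open>auto simp: f' a'_def\<close>)
  have "\<forall>\<^sub>F r in at_right 0. \<forall>x\<in>polytube p D Z r. ?f j p \<noteq> 0 \<longrightarrow> cmod (?f j x - ?f j p) < cmod (?f j p)" if "j \<in> J" for j
  proof (cases "?f j p = 0")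
    case False
    have "\<exists>c. \<forall>v\<in>D. bil (a j) v = (\<Sum>z\<in>Z. c z * bil ((\<lambda>z. z) z) v)"
    proof (rule functional_duality[OF fin(2) D])
      fix v assume "v \<in> D" "\<And>z. z \<in> Z \<Longrightarrow> bil z v = 0"
      then have "v = 0" using F by blast
      then show "bil (a j) v = 0" by simp
    qed
    then obtain c where c: "\<And>v. v \<in> D \<Longrightarrow> bil (a j) v = (\<Sum>z\<in>Z. c z * bil z v)" by auto
    define C where "C = (\<Sum>z\<in>Z. cmod (c z)) + 1"
    have C: "C > 0" unfolding C_def by (simp add: add_nonneg_pos sum_nonneg)
    have "cmod (?f j x - ?f j p) < cmod (?f j p)" if r: "0 < r" "r < cmod (?f j p) / C" and x: "x \<in> polytube p D Z r" for r x
    proof -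
      have "?f j x - ?f j p = (\<Sum>z\<in>Z. c z * bil z (x - p))" using c[of "x - p"] x by (simp add: polytube_def hyp_form_bil bil_diff)
      also have "cmod \<dots> \<le> (\<Sum>z\<in>Z. cmod (c z) * r)"
        using x by (intro sum_norm_le) (auto simp: norm_mult polytube_def intro!: mult_left_mono intro: less_imp_le)
      also have "\<dots> \<le> C * r" using r by (simp add: C_def sum_distrib_right distrib_right)
      also have "\<dots> < cmod (?f j p)" using r C by (simp add: field_simps)
      finally show ?thesis .
    qed
    then show ?thesis unfolding eventually_at_right_field using False C by (intro exI[of _ "cmod (?f j p) / C"]) auto
  qed simp
  then have "\<forall>\<^sub>F r in at_right 0. \<forall>j\<in>J. \<forall>x\<in>polytube p D Z r. ?f j p \<noteq> 0 \<longrightarrow> cmod (?f j x - ?f j p) < cmod (?f j p)"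
    by (intro eventually_ball_finite fin) auto
  then show ?thesis
    unfolding tube_cd_def using eventually_at_right_less[of "0::real"]
  proof eventually_elim
    case (elim r)
    let ?V = "polytube p D Z r"
    have "cells J ?f' ?X \<subseteq> cells J ?f' ?V"
    proof
      fix K assume K: "K \<in> cells J ?f' ?X"
      then obtain x where x: "x - p \<in> D" "\<forall>i\<in>K. \<forall>j\<in>J. ?f' j x \<in> hpl (cidx J i j)" by (auto simp: cells_point)
      have "\<forall>z\<in>Z. \<forall>\<^sub>F t in at_right 0. t * cmod (bil z (x - p)) < r"
      proof
        fix z assume "z \<in> Z"
        have "((\<lambda>t. t * cmod (bil z (x - p))) \<longlongrightarrow> 0 * cmod (bil z (x - p))) (at_right 0)" by (intro tendsto_intros)
        then show "\<forall>\<^sub>F t in at_right 0. t * cmod (bil z (x - p)) < r" using elim(2) by (intro order_tendstoD) auto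
      qed
      then have "\<forall>\<^sub>F t in at_right 0. 0 < t \<and> (\<forall>z\<in>Z. t * cmod (bil z (x - p)) < r)"
        by (intro eventually_conj eventually_at_right_less eventually_ball_finite fin)
      then obtain t where t: "0 < t" "\<forall>z\<in>Z. t * cmod (bil z (x - p)) < r"
        using eventually_happens'[OF trivial_limit_at_right_real] by blast
      \<comment> \<open>Scaling by a positive factor keeps the values of the central forms in their
        half planes, so every cell intersection of the coset has a witness inside the tube.\<close>
      let ?x = "p + t *\<^sub>R (x - p)"
      have "?x \<in> ?V" using t x(1) D by (auto simp: polytube_def bil_scaleR norm_mult intro: subspace_scaleR)
      moreover have "?f' j ?x \<in> hpl (cidx J i j)" if ij: "i \<in> K" "j \<in> J" for i j
      proof (cases "?f j p = 0")
        case True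
        have "?f j x = bil (a j) (x - p)" using True by (simp add: hyp_form_bil bil_diff)
        then have "?f j ?x = complex_of_real t * ?f j x" using True unfolding hyp_form_add bil_scaleR by simp
        moreover have "?f j x \<in> hpl (cidx J i j)" using bspec[OF bspec[OF x(2) ij(1)] ij(2)] True by (simp add: f')
        ultimately show ?thesis using True t hpl_scale by (simp add: f')
      next
        case False
        then show ?thesis using bspec[OF bspec[OF x(2) ij(1)] ij(2)] by (simp add: f')
      qed
      ultimately show "K \<in> cells J ?f' ?V" using K unfolding cells_point by blast
    qed
    moreover have "cells J ?f' ?V \<subseteq> cells J ?f' ?X" by (rule cells_mono) (auto simp: polytube_def)
    ultimately have ce: "cells J ?f' ?X = cells J ?f' ?V" by blast
    have MM: "Mset J ?f' ?V = Mset J ?f ?V"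
      using elim(1) by (auto simp: Mset_def f' split: if_splits) (metis norm_zero diff_0 norm_minus_cancel less_irrefl)
    show ?case
    proof (intro allI impI)
      fix lam q assume q: "vec.dim D < q"
      have v': "van J ?f' lam (Mset J ?f ?V) q"
        using van_same_cells[where f = ?f', OF fin(1) affc_hyp_form convex_coset[OF D] convex_polytube[OF D] ce vX[OF q]] by (simp add: MM)
      \<comment> \<open>Logarithm of the ratio between the constant and the original form. It exists
        on the tube because the form stays closer to its value at \<open>p\<close> than that value
        is to 0.\<close>
      define g where "g j x = (if ?f j p = 0 then 0 else - Ln (?f j x / ?f j p))" for j x
      have r: "?f j x / ?f j p \<notin> \<real>\<^sub>\<le>\<^sub>0" "?f j x \<noteq> 0" if "j \<in> J" "?f j p \<noteq> 0" "x \<in> Mset J ?f ?V" for j x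
        using that elim(1) by (auto simp: Mset_def intro!: ratio_not_nonpos)
      have cg: "continuous_on (Mset J ?f ?V) (g j)" if j: "j \<in> J" for j
      proof (cases "?f j p = 0")
        case False
        have "continuous_on (Mset J ?f ?V) (\<lambda>x. - Ln (?f j x / ?f j p))"
          by (intro continuous_on_minus continuous_on_Ln' continuous_on_divide continuous_on_hyp_form continuous_on_id continuous_on_const)
             (use False r[OF j] in auto)
        then show ?thesis using False by (simp add: g_def)
      qed (simp add: g_def)
      have eg: "?f' j x = ?f j x * exp (g j x)" if "j \<in> J" "x \<in> Mset J ?f ?V" for j x
        using r[OF that(1) _ that(2)] by (simp add: f' g_def exp_minus)
      have eg': "?f j x = ?f' j x * exp (- g j x)" if "j \<in> J" "x \<in> Mset J ?f ?V" for j x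
        using eg[OF that] by (simp add: exp_minus)
      show "van J ?f lam (Mset J ?f ?V) q"
      proof (rule van_factor[OF _ _ _ _ _ _ _ v'])
        show "hmor J ?f (Mset J ?f ?V) ?f (Mset J ?f ?V) (\<lambda>t x. x) (\<lambda>t j x. 0)"
          by (auto simp: hmor_def intro!: continuous_intros)
        show "mor J ?f (Mset J ?f ?V) ?f' (Mset J ?f ?V) (\<lambda>x. x) g"
          using cg eg by (auto simp: mor_def continuous_on_id)
        show "mor J ?f' (Mset J ?f ?V) ?f (Mset J ?f ?V) (\<lambda>x. x) (\<lambda>j x. - g j x)"
          using cg eg' by (auto simp: mor_def continuous_on_id intro!: continuous_on_minus)
      qed auto
    qed
  qed
qed

text \<open>Induction on the dimension of \<open>D\<close>, and inside it on the dimension of the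
  common kernel of \<open>Z\<close> in \<open>D\<close>. A form \<open>y\<close> that is nonzero on
  this kernel makes progress in both: its fibres lower the first dimension, adding it to
  \<open>Z\<close> lowers the second.\<close>

theorem tube_cohomological_dimension:
  fixes p :: "complex ^ 'l"
  assumes "finite J" "finite Z" "vec.subspace D"
  shows "tube_cd p D Z J a b"
  using assms
proof (induction "vec.dim D" arbitrary: D Z p a b rule: less_induct)
  case (less D Z p a b)
  note outer = less.hyps and J = less.prems(1) and D = less.prems(3)
  show ?case using less.prems(2)
  proof (induction "vec.dim {v\<in>D. \<forall>z\<in>Z. bil z v = 0}" arbitrary: Z p rule: less_induct)
    case (less Z p)
    note Z = less.prems
    let ?F = "{v\<in>D. \<forall>z\<in>Z. bil z v = 0}"
    have sF: "vec.subspace ?F" using D by (auto simp: vec.subspace_def bil_add bil_scale)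
    show ?case
    proof (cases "\<forall>v\<in>?F. v = 0")
      case True
      then show ?thesis by (intro tube_cd_point[OF J Z D] outer[OF _ J finite.emptyI]) auto
    next
      case False
      then obtain w0 where w0: "w0 \<in> ?F" "w0 \<noteq> 0" by blast
      then obtain i where i: "w0 $ i \<noteq> 0" by (auto simp: vec_eq_iff)
      \<comment> \<open>A coordinate on which \<open>w0\<close> is nonzero, normalised to take the
        value 1 there.\<close>
      define y :: "complex ^ 'l" where "y = axis i (1 / w0 $ i)"
      have yw: "bil y w0 = 1"
      proof -
        have "bil y w0 = (\<Sum>k\<in>UNIV. if k = i then 1 / w0 $ i * w0 $ k else 0)"
          unfolding bil_def y_def by (intro sum.cong) (auto simp: axis_def)
        then show ?thesis using i by simp
      qed
      have w: "w0 \<in> D" "\<And>z. z \<in> Z \<Longrightarrow> bil z w0 = 0" using w0 by auto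
      obtain Crit where Crit: "finite Crit" "vfields p D Z J a b y Crit"
        using critical_values[OF J Z D w yw] by metis
      have IH1: "tube_cd p' {v\<in>D. bil y v = 0} Z J a b" for p'
        using dim_kernel_less[OF D w(1), of y] yw by (intro outer J Z subspace_kernel D) simp
      have "{v\<in>D. \<forall>z\<in>insert y Z. bil z v = 0} = {v\<in>?F. bil y v = 0}" by auto
      then have IH2: "tube_cd p' D (insert y Z) J a b" for p'
        using dim_kernel_less[OF sF w0(1), of y] yw Z by (intro less.hyps) auto
      have "slab p D Z y r UNIV = polytube p D Z r" for r by (simp add: slab_def[OF J Z D w yw])
      then show ?thesis
        using slab_cd[OF J Z D w yw Crit(2,1) IH1 IH2 convex_UNIV open_UNIV] by (simp add: tube_cd_def)
    qed
  qed
qed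

corollary cohomological_dimension:
  assumes "finite J" "vec.subspace D" "vec.dim D < q"
  shows "van J (hyp_form a b) lam (Mset J (hyp_form a b) {x. x - p \<in> D}) q"
  using tube_cohomological_dimension[OF assms(1) finite.emptyI assms(2), of p a b] assms(3) by (simp add: tube_cd_empty)

section \<open>Removing a hyperplane of weight zero\<close>

lemma ZZ_glue:
  assumes o: "openin (top_of_set (Y1 \<union> Y2)) Y1" "openin (top_of_set (Y1 \<union> Y2)) Y2"
    and z: "\<phi>1 \<in> ZZ J f lam Y1 q" "\<phi>2 \<in> ZZ J f lam Y2 q" "(\<lambda>\<sigma>. \<phi>1 \<sigma> - \<phi>2 \<sigma>) \<in> BB J f lam (Y1 \<inter> Y2) q"
  obtains \<phi> where "\<phi> \<in> ZZ J f lam (Y1 \<union> Y2) q" "(\<lambda>\<sigma>. \<phi> \<sigma> - \<phi>1 \<sigma>) \<in> BB J f lam Y1 q"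
proof -
  have o': "openin (top_of_set (cover J f Y1 \<union> cover J f Y2)) (cover J f Y1)"
      "openin (top_of_set (cover J f Y1 \<union> cover J f Y2)) (cover J f Y2)"
    using openin_cover[OF o(1)] openin_cover[OF o(2)] by (auto simp flip: cover_Un)
  have z3: "(\<lambda>\<sigma>. \<phi>1 \<sigma> - \<phi>2 \<sigma>) \<in> Bc J lam (sys_of (cover J f Y1 \<inter> cover J f Y2)) q" using z(3) by (simp add: cover_Int)
  show ?thesis
    by (rule MV_glue[OF o' deck_inv_cover deck_inv_cover z(1,2) z3]) (rule that, simp_all add: cover_Un)
qed

context
  fixes p :: "complex ^ 'l" and D :: "(complex ^ 'l) set" and J :: "nat set"
    and a :: "nat \<Rightarrow> complex ^ 'l" and b :: "nat \<Rightarrow> complex" and k :: nat and v :: "complex ^ 'l"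
  assumes fin: "finite J" and D: "vec.subspace D" and v: "v \<in> D" "bil (a k) v = 1"
begin

private abbreviation (input) "lf \<equiv> hyp_form a b"

text \<open>The projection along \<open>v\<close> onto the hyperplane \<open>k\<close>; form
  \<open>k\<close> is the coordinate of the fibres.\<close>

definition tbase :: "complex ^ 'l \<Rightarrow> complex ^ 'l" where "tbase x = x - lf k x *s v"

text \<open>A radius at which moving along \<^term>\<open>v\<close> cannot reach any of the other hyperplanes.\<close>
definition trad :: "complex ^ 'l \<Rightarrow> real" where
  "trad y = 1 / (1 + (\<Sum>j\<in>J. 2 * (1 + cmod (bil (a j) v)) / cmod (lf j y)))"

text \<open>A tubular neighbourhood of the part of hyperplane \<open>k\<close> outside the others.
  \<open>S\<close> restricts the value of form \<open>k\<close>: \<open>UNIV\<close> is the full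
  tube, \<open>- {0}\<close> the punctured one, and half planes give sectors.\<close>

definition tube :: "complex set \<Rightarrow> (complex ^ 'l) set" where
  "tube S = {x. x - p \<in> D \<and> (\<forall>j\<in>J. lf j (tbase x) \<noteq> 0) \<and> cmod (lf k x) < trad (tbase x) \<and> lf k x \<in> S}"

lemma trad_pos: "trad y > 0"
  unfolding trad_def by (intro divide_pos_pos add_pos_nonneg sum_nonneg) auto

lemma trad_bound:
  assumes j: "j \<in> J" and nz: "lf j y \<noteq> 0" and z: "cmod z < trad y"
  shows "cmod (lf j (y + z *s v) - lf j y) < cmod (lf j y)"
proof -
  let ?c = "2 * (1 + cmod (bil (a j) v))"
  have c: "?c > 0" by (simp add: add_pos_nonneg)
  have "?c / cmod (lf j y) \<le> (\<Sum>j\<in>J. 2 * (1 + cmod (bil (a j) v)) / cmod (lf j y))"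
    by (rule member_le_sum[OF j, of "\<lambda>j. 2 * (1 + cmod (bil (a j) v)) / cmod (lf j y)"]) (use fin in auto)
  then have "trad y \<le> 1 / (?c / cmod (lf j y))"
    unfolding trad_def using nz c by (intro divide_left_mono mult_pos_pos add_pos_nonneg sum_nonneg) (auto intro: divide_pos_pos)
  then have "cmod z < cmod (lf j y) / ?c" using z by simp
  then have "cmod z * ?c < cmod (lf j y)" using c by (simp add: field_simps)
  moreover have "cmod z * cmod (bil (a j) v) \<le> cmod z * ?c" by (intro mult_left_mono) auto
  moreover have "lf j (y + z *s v) - lf j y = z * bil (a j) v" by (simp add: hyp_form_add bil_scale)
  ultimately show ?thesis by (simp add: norm_mult)
qed

lemma tbase_add: "tbase (x + z *s v) = tbase x"
  unfolding tbase_def hyp_form_add bil_scale using v(2) by (simp add: vec.scale_left_distrib)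

lemma tbase_self: "x = tbase x + lf k x *s v" by (simp add: tbase_def)

lemma tbase_kernel: "lf k (tbase x) = 0"
  using v(2) by (simp add: tbase_def hyp_form_bil bil_diff bil_scale)

lemma tbase_in: "x - p \<in> D \<Longrightarrow> tbase x - p \<in> D"
proof -
  have e: "tbase x - p = (x - p) - lf k x *s v" by (simp add: tbase_def)
  show "x - p \<in> D \<Longrightarrow> tbase x - p \<in> D" unfolding e by (rule vec.subspace_diff[OF D _ vec.subspace_scale[OF D v(1)]])
qed

lemma tube_mem:
  assumes "y - p \<in> D" "lf k y = 0" "\<forall>j\<in>J. lf j y \<noteq> 0" "cmod z < trad y" "z \<in> S"
  shows "y + z *s v \<in> tube S" "tbase (y + z *s v) = y"
proof -
  have t: "tbase y = y" using assms(2) by (simp add: tbase_def)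
  then show "tbase (y + z *s v) = y" by (simp add: tbase_add)
  have e: "y + z *s v - p = (y - p) + z *s v" by simp
  have "y + z *s v - p \<in> D" unfolding e by (intro vec.subspace_add[OF D] vec.subspace_scale[OF D] v(1) assms(1))
  then show "y + z *s v \<in> tube S" using assms v(2) t by (simp add: tube_def tbase_add hyp_form_add bil_scale)
qed

lemma tube_bound:
  assumes "x \<in> tube S" "j \<in> J"
  shows "cmod (lf j x - lf j (tbase x)) < cmod (lf j (tbase x))"
  using trad_bound[OF assms(2), of "tbase x" "lf k x"] assms tbase_self[of x] by (auto simp: tube_def)

lemma tube_nonzero: "x \<in> tube S \<Longrightarrow> j \<in> J \<Longrightarrow> lf j x \<noteq> 0"
  using ratio_not_nonpos(3)[OF tube_bound] by blast

lemma continuous_tbase: "continuous_on A g \<Longrightarrow> continuous_on A (\<lambda>x. tbase (g x))"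
  unfolding tbase_def by (intro continuous_intros continuous_on_hyp_form)

lemma continuous_trad:
  assumes "continuous_on A g" "\<And>x j. x \<in> A \<Longrightarrow> j \<in> J \<Longrightarrow> lf j (g x) \<noteq> 0"
  shows "continuous_on A (\<lambda>x. trad (g x))"
proof -
  have "1 + (\<Sum>j\<in>J. 2 * (1 + cmod (bil (a j) v)) / cmod (lf j (g x))) > 0" for x
    by (intro add_pos_nonneg sum_nonneg) auto
  then have nz: "1 + (\<Sum>j\<in>J. 2 * (1 + cmod (bil (a j) v)) / cmod (lf j (g x))) \<noteq> 0" for x by (metis less_irrefl)
  have "continuous_on A (\<lambda>x. 1 + (\<Sum>j\<in>J. 2 * (1 + cmod (bil (a j) v)) / cmod (lf j (g x))))"
    by (intro continuous_on_divide continuous_on_add continuous_on_sum continuous_on_const continuous_on_norm continuous_on_hyp_form assms(1))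
      (simp add: assms(2))
  from continuous_on_divide[OF continuous_on_const this] show ?thesis unfolding trad_def using nz by blast
qed

text \<open>Within each fibre of the projection, form \<open>k\<close> is moved straight to
  \<open>w\<close> times the radius. For this the modulus of \<open>w\<close> must be less than 1,
  and its positive multiples must lie in the sector.\<close>

definition thom :: "complex \<Rightarrow> real \<Rightarrow> complex ^ 'l \<Rightarrow> complex ^ 'l" where
  "thom w t x = tbase x + (complex_of_real (1 - t) * lf k x + complex_of_real (t * trad (tbase x)) * w) *s v"

definition tlog :: "complex \<Rightarrow> real \<Rightarrow> nat \<Rightarrow> complex ^ 'l \<Rightarrow> complex" where
  "tlog w t j x = Ln (lf j (thom w t x) / lf j (tbase x)) - Ln (lf j x / lf j (tbase x))"

lemma thom_tube:
  assumes S: "convex S" "\<forall>t>0. complex_of_real t * w \<in> S" and w: "cmod w < 1"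
    and x: "x \<in> tube S" and t: "t \<in> {0..1}"
  shows "thom w t x \<in> tube S" "tbase (thom w t x) = tbase x"
proof -
  let ?m = "trad (tbase x)" and ?z = "complex_of_real (1 - t) * lf k x + complex_of_real (t * trad (tbase x)) * w"
  have m: "?m > 0" by (rule trad_pos)
  have xk: "cmod (lf k x) < ?m" "lf k x \<in> S" using x by (auto simp: tube_def)
  have "cmod ?z \<le> cmod (complex_of_real (1 - t) * lf k x) + cmod (complex_of_real (t * ?m) * w)" by (rule norm_triangle_ineq)
  also have "\<dots> = (1 - t) * cmod (lf k x) + t * (?m * cmod w)" unfolding norm_mult norm_of_real using t m by simp
  also have "\<dots> < ?m"
  proof -
    have "?m * cmod w < ?m" using m w by simp
    then have "(1 - t) * cmod (lf k x) + t * (?m * cmod w) < ?m" using t xk(1) by (intro convex_bound_lt) auto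
    then show ?thesis .
  qed
  finally have z1: "cmod ?z < ?m" .
  have "?z = (1 - t) *\<^sub>R lf k x + t *\<^sub>R (complex_of_real ?m * w)" by (simp add: scaleR_conv_of_real)
  also have "\<dots> \<in> S" using t m xk(2) S(2) by (intro convexD[OF S(1)]) auto
  finally have z2: "?z \<in> S" .
  have xb: "tbase x - p \<in> D" "\<forall>j\<in>J. lf j (tbase x) \<noteq> 0" using x tbase_in by (auto simp: tube_def)
  show "thom w t x \<in> tube S" "tbase (thom w t x) = tbase x"
    using tube_mem[OF xb(1) tbase_kernel xb(2) z1 z2] by (simp_all only: thom_def)
qed

lemma tube_hmor:
  assumes S: "convex S" "\<forall>t>0. complex_of_real t * w \<in> S" and w: "cmod w < 1"
  shows "hmor J lf (tube S) lf (tube S) (thom w) (tlog w)"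
  unfolding hmor_def
proof (intro conjI ballI)
  let ?C = "{0..1::real} \<times> tube S"
  note th = thom_tube[OF S w]
  have bz: "lf j (tbase x) \<noteq> 0" if "x \<in> tube S" "j \<in> J" for x j using that by (auto simp: tube_def)
  have cb: "continuous_on ?C (\<lambda>z. tbase (snd z))" by (intro continuous_tbase continuous_intros)
  have ct: "continuous_on ?C (\<lambda>z. trad (tbase (snd z)))" by (intro continuous_trad cb) (use bz in auto)
  show cH: "continuous_on ?C (\<lambda>z. thom w (fst z) (snd z))"
    unfolding thom_def by (intro continuous_intros cb ct continuous_on_hyp_form)
  have r: "lf j x / lf j (tbase x) \<notin> \<real>\<^sub>\<le>\<^sub>0" if "x \<in> tube S" "j \<in> J" for x j
    by (rule ratio_not_nonpos[OF tube_bound[OF that]])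
  have rH: "lf j (thom w t x) / lf j (tbase x) \<notin> \<real>\<^sub>\<le>\<^sub>0" if "x \<in> tube S" "j \<in> J" "t \<in> {0..1}" for x j t
    using r[OF th(1)[OF that(1,3)] that(2)] th(2)[OF that(1,3)] by simp
  show "continuous_on ?C (\<lambda>z. tlog w (fst z) j (snd z))" if j: "j \<in> J" for j
    unfolding tlog_def
    by (intro continuous_on_diff continuous_on_Ln' continuous_on_divide continuous_on_hyp_form cH cb continuous_on_snd continuous_on_id)
       (use j r rH bz in auto)
  fix t :: real and x assume t: "t \<in> {0..1}" and x: "x \<in> tube S"
  show "thom w t x \<in> tube S" by (rule th[OF x t])
  show "lf j (thom w t x) = lf j x * exp (tlog w t j x)" if j: "j \<in> J" for j
    using bz[OF x j] tube_nonzero[OF x j] tube_nonzero[OF th(1)[OF x t] j] by (simp add: tlog_def exp_diff)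
qed

lemma thom_0: "thom w 0 x = x" and tlog_0: "tlog w 0 j x = 0"
  using tbase_self[of x] by (simp_all add: thom_def tlog_def)

lemma tube_deform:
  assumes S: "convex S" "convex S1" "S1 \<subseteq> S" "\<forall>t>0. complex_of_real t * w \<in> S1" and w: "cmod w < 1"
  shows "deform J lf (tube S) (tube S1)"
proof -
  have h: "hmor J lf (tube S) lf (tube S) (thom w) (tlog w)" using S by (intro tube_hmor w) auto
  have h1: "hmor J lf (tube S1) lf (tube S1) (thom w) (tlog w)" using S by (intro tube_hmor w) auto
  have "thom w 1 x \<in> tube S1" if x: "x \<in> tube S" for x
  proof -
    have "thom w 1 x \<in> tube S" using S by (intro thom_tube(1)[OF S(1) _ w x]) auto
    moreover have "lf k (thom w 1 x) = complex_of_real (trad (tbase x)) * w"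
      using v(2) tbase_kernel[of x] by (simp add: thom_def hyp_form_add bil_scale)
    ultimately show ?thesis using S(4) trad_pos by (simp add: tube_def)
  qed
  then show ?thesis unfolding deform_def using h h1 S(3) by (intro conjI exI[of _ "thom w"] exI[of _ "tlog w"]) (auto simp: thom_0 tlog_0 tube_def)
qed

text \<open>A sector of the tube is equivalent to its base. The logarithms of the other forms change
  by principal logarithms of their ratios to the values at the base, which \<open>tube_bound\<close>
  keeps off the negative axis.\<close>

lemma tube_van:
  assumes S: "convex S" "\<forall>t>0. complex_of_real t * w \<in> S" and w: "cmod w < 1"
    and van: "van J lf lam (Mset J lf {x. x - p \<in> D \<and> lf k x = 0}) q"
  shows "van J lf lam (tube S) q"
proof -
  let ?M = "Mset J lf {x. x - p \<in> D \<and> lf k x = 0}"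
  define h2 where "h2 y = y + (complex_of_real (trad y) * w) *s v" for y
  define g2 where "g2 j y = Ln (lf j (h2 y) / lf j y)" for j y
  have bz: "lf j (tbase x) \<noteq> 0" if "x \<in> tube S" "j \<in> J" for x j using that by (auto simp: tube_def)
  have r: "lf j x / lf j (tbase x) \<notin> \<real>\<^sub>\<le>\<^sub>0" if "x \<in> tube S" "j \<in> J" for x j
    by (rule ratio_not_nonpos[OF tube_bound[OF that]])
  have h2: "h2 y \<in> tube S" "tbase (h2 y) = y" if y: "y \<in> ?M" for y
  proof -
    have "cmod (complex_of_real (trad y) * w) < trad y" using w trad_pos[of y] by (simp add: norm_mult)
    from tube_mem[OF _ _ _ this S(2)[rule_format, OF trad_pos]] y show "h2 y \<in> tube S" "tbase (h2 y) = y" by (auto simp: Mset_def h2_def)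
  qed
  have cM: "continuous_on ?M (lf j)" for j using continuous_on_hyp_form[OF continuous_on_id] by simp
  have ch2: "continuous_on ?M h2" unfolding h2_def
    by (intro continuous_intros continuous_trad) (auto simp: Mset_def)
  show ?thesis
  proof (rule van_factor[where H = "thom w" and G = "tlog w" and ?h1.0 = tbase and ?g1.0 = "\<lambda>j x. - Ln (lf j x / lf j (tbase x))" and ?h2.0 = h2 and ?g2.0 = g2, OF tube_hmor[OF S w] _ _ _ _ _ _ van])
    show "mor J lf (tube S) lf ?M tbase (\<lambda>j x. - Ln (lf j x / lf j (tbase x)))"
      unfolding mor_def
    proof (intro conjI ballI)
      show "continuous_on (tube S) tbase" using continuous_tbase[OF continuous_on_id] by simp
      show "continuous_on (tube S) (\<lambda>x. - Ln (lf j x / lf j (tbase x)))" if "j \<in> J" for j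
        by (intro continuous_on_minus continuous_on_Ln' continuous_on_divide continuous_on_hyp_form continuous_tbase continuous_on_id)
          (use that r bz in auto)
      fix x assume x: "x \<in> tube S"
      show "tbase x \<in> ?M" using x tbase_in tbase_kernel by (auto simp: Mset_def tube_def)
      show "lf j (tbase x) = lf j x * exp (- Ln (lf j x / lf j (tbase x)))" if "j \<in> J" for j
        using bz[OF x that] tube_nonzero[OF x that] by (simp add: exp_minus)
    qed
    show "mor J lf ?M lf (tube S) h2 g2"
      unfolding mor_def
    proof (intro conjI ballI ch2)
      have rr: "lf j (h2 y) / lf j y \<notin> \<real>\<^sub>\<le>\<^sub>0" if "y \<in> ?M" "j \<in> J" for j y using r[OF h2(1)[OF that(1)] that(2)] h2(2)[OF that(1)] by simp
      show "continuous_on ?M (g2 j)" if "j \<in> J" for j unfolding g2_def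
        by (intro continuous_on_Ln' continuous_on_divide continuous_on_hyp_form ch2 cM) (use that rr in \<open>auto simp: Mset_def\<close>)
      fix y assume y: "y \<in> ?M"
      show "h2 y \<in> tube S" by (rule h2[OF y])
      show "lf j (h2 y) = lf j y * exp (g2 j y)" if "j \<in> J" for j
        using tube_nonzero[OF h2(1)[OF y] that] y that by (auto simp: g2_def Mset_def)
    qed
    show "thom w 1 x = h2 (tbase x)" for x by (simp add: thom_def h2_def)
    then show "tlog w 1 j x = - Ln (lf j x / lf j (tbase x)) + g2 j (tbase x)" for j x by (simp add: tlog_def g2_def)
  qed (simp_all add: thom_0 tlog_0)
qed

lemma openin_tube: "open S \<Longrightarrow> S \<subseteq> T \<Longrightarrow> openin (top_of_set (tube T)) (tube S)"
proof -
  assume "open S" "S \<subseteq> T"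
  then have "tube S = tube T \<inter> lf k -` S" by (auto simp: tube_def)
  then show ?thesis using continuous_openin_preimage_gen[OF _ \<open>open S\<close>, of "tube T" "lf k"] continuous_on_hyp_form[OF continuous_on_id, of "tube T" a b k] by simp
qed

text \<open>Since \<open>J\<close> indexes the logarithms, a cover over \<open>J\<close> does not
  see hyperplane \<open>k\<close>, and the local system extends over it. A class on the complement
  of \<open>k\<close> is extended over the tube: its restriction to one sector continues to the full
  tube, and the discrepancy on the punctured tube is exact. The glued class lives where
  \<open>v1\<close> applies. Only the vanishing in degree \<open>q - 1\<close> on the hyperplane
  enters, for the overlaps of sectors.\<close>

theorem gysin_vanishing:
  assumes v1: "van J lf lam (Mset J lf {x. x - p \<in> D}) q"
    and v2: "q \<noteq> 0 \<Longrightarrow> van J lf lam (Mset J lf {x. x - p \<in> D \<and> lf k x = 0}) (q - 1)"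
  shows "van J lf lam (Mset J lf {x. x - p \<in> D \<and> lf k x \<noteq> 0}) q"
  unfolding van_def
proof
  let ?M = "Mset J lf {x. x - p \<in> D}" and ?M' = "Mset J lf {x. x - p \<in> D \<and> lf k x \<noteq> 0}"
  fix \<phi> assume phi: "\<phi> \<in> ZZ J lf lam ?M' q"
  \<comment> \<open>Directions in the double overlaps of the half planes, with modulus below 1 as
    \<open>thom\<close> requires.\<close>
  define w01 w02 w12 where "w01 = Complex (1/2) (1/2)" and "w02 = Complex (1/2) (- 1/2)" and "w12 = (- 1/2 :: complex)"
  have wn: "cmod w01 < 1" "cmod w02 < 1" "cmod w12 < 1" by (auto simp: w01_def w02_def w12_def cmod_def power2_eq_square norm_divide intro!: real_less_lsqrt)
  have w: "w01 \<in> hpl 0 \<inter> hpl 1" "w02 \<in> hpl 0 \<inter> hpl 2" "w12 \<in> hpl 1 \<inter> hpl 2"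
    by (auto simp: hpl_def uw_def w01_def w02_def w12_def real_less_rsqrt)
  have w': "complex_of_real t * w01 \<in> hpl 0 \<inter> hpl 1" "complex_of_real t * w02 \<in> hpl 0 \<inter> hpl 2" "complex_of_real t * w12 \<in> hpl 1 \<inter> hpl 2" if "t > 0" for t
    using w hpl_scale that by auto
  have cv: "convex (hpl i \<inter> hpl j)" for i j by (intro convex_Int convex_hpl)
  have TU: "tube S \<union> tube T = tube (S \<union> T)" and TI: "tube S \<inter> tube T = tube (S \<inter> T)" for S T by (auto simp: tube_def)
  have TM: "tube S \<subseteq> ?M" for S using tube_nonzero by (auto simp: Mset_def tube_def)
  have un: "hpl 0 \<union> hpl 1 \<union> hpl 2 = - {0}"
  proof -
    have "z \<in> hpl 0 \<union> hpl 1 \<union> hpl 2" if "z \<noteq> 0" for z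
      using hpl_cover[OF that] by (auto simp: numeral_3_eq_3 less_Suc_eq numeral_2_eq_2)
    then show ?thesis using hpl_nonzero by blast
  qed
  have TM': "tube (- {0}) \<subseteq> ?M'" using TM[of "- {0}"] by (auto simp: Mset_def tube_def)
  have "deform J lf (tube UNIV) (tube (hpl 0))" by (rule tube_deform[of _ _ w01]) (use wn w' in \<open>auto intro: convex_hpl\<close>)
  moreover have "\<phi> \<in> ZZ J lf lam (tube (hpl 0)) q" by (rule ZZ_mono[OF phi]) (use TM' un in \<open>auto simp: tube_def\<close>)
  ultimately obtain \<theta> where th: "\<theta> \<in> ZZ J lf lam (tube UNIV) q" and th0: "(\<lambda>\<sigma>. \<theta> \<sigma> - \<phi> \<sigma>) \<in> BB J lf lam (tube (hpl 0)) q" by (rule deform_surj)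
  \<comment> \<open>The discrepancy is exact on sector 0. The other two sectors deform into their
    overlaps with sector 0, so it is exact on them as well; it then glues to an exact cocycle
    because the overlaps have no cohomology in degree \<open>q - 1\<close>.\<close>
  define \<psi> where "\<psi> = (\<lambda>\<sigma>. \<theta> \<sigma> - \<phi> \<sigma>)"
  have psi: "\<psi> \<in> ZZ J lf lam (tube (- {0})) q" unfolding \<psi>_def
    by (intro Zc_diff ZZ_mono[OF th] ZZ_mono[OF phi] TM') (auto simp: tube_def)
  have psiS: "\<psi> \<in> ZZ J lf lam (tube S) q" if "S \<subseteq> - {0}" for S by (rule ZZ_mono[OF psi]) (use that in \<open>auto simp: tube_def\<close>)
  have b0: "\<psi> \<in> BB J lf lam (tube (hpl 0)) q" using th0 by (simp add: \<psi>_def)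
  have b0': "\<psi> \<in> BB J lf lam (tube (hpl 0 \<inter> S)) q" for S by (rule BB_mono[OF b0]) (auto simp: tube_def)
  have "deform J lf (tube (hpl 1)) (tube (hpl 0 \<inter> hpl 1))" by (rule tube_deform[of _ _ w01]) (use wn w' cv in \<open>auto intro: convex_hpl\<close>)
  from deform_inj[OF this psiS b0'] have b1: "\<psi> \<in> BB J lf lam (tube (hpl 1)) q" using un by blast
  have "deform J lf (tube (hpl 2)) (tube (hpl 0 \<inter> hpl 2))" by (rule tube_deform[of _ _ w02]) (use wn w' cv in \<open>auto intro: convex_hpl\<close>)
  from deform_inj[OF this psiS b0'] have b2: "\<psi> \<in> BB J lf lam (tube (hpl 2)) q" using un by blast
  have vv: "van J lf lam (tube (hpl 0 \<inter> hpl 1)) (q - 1)" "van J lf lam (tube (hpl 0 \<inter> hpl 2)) (q - 1)" "van J lf lam (tube (hpl 1 \<inter> hpl 2)) (q - 1)" if "q \<noteq> 0"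
    using tube_van[OF cv _ wn(1) v2[OF that]] tube_van[OF cv _ wn(2) v2[OF that]] tube_van[OF cv _ wn(3) v2[OF that]] w' by blast+
  have "\<psi> \<in> BB J lf lam (tube (hpl 0) \<union> tube (hpl 1)) q"
    by (rule BB_mv) (use b0 b1 vv psiS un in \<open>auto simp: TU TI intro!: openin_tube open_hpl\<close>)
  then have "\<psi> \<in> BB J lf lam (tube (hpl 0 \<union> hpl 1) \<union> tube (hpl 2)) q"
  proof (intro BB_mv)
    assume q: "q \<noteq> 0"
    have "(hpl 0 \<union> hpl 1) \<inter> hpl 2 = (hpl 0 \<inter> hpl 2) \<union> (hpl 1 \<inter> hpl 2)" by blast
    then have "tube (hpl 0 \<union> hpl 1) \<inter> tube (hpl 2) = tube (hpl 0 \<inter> hpl 2) \<union> tube (hpl 1 \<inter> hpl 2)" by (simp add: TI TU)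
    moreover have "van J lf lam (tube (hpl 0 \<inter> hpl 2) \<union> tube (hpl 1 \<inter> hpl 2)) (q - 1)"
    proof (rule van_mv)
      have "tube (hpl 0 \<inter> hpl 2) \<inter> tube (hpl 1 \<inter> hpl 2) = {}" using hpl_triple by (auto simp: tube_def)
      then show "van J lf lam (tube (hpl 0 \<inter> hpl 2) \<inter> tube (hpl 1 \<inter> hpl 2)) (q - 1 - 1)" by (simp add: van_empty)
    qed (use vv[OF q] in \<open>auto simp: TU intro!: openin_tube open_hpl\<close>)
    ultimately show "van J lf lam (tube (hpl 0 \<union> hpl 1) \<inter> tube (hpl 2)) (q - 1)" by simp
  qed (use b2 psiS un in \<open>auto simp: TU intro!: openin_tube open_hpl open_Un\<close>)
  then have psiB: "\<psi> \<in> BB J lf lam (tube (- {0})) q" by (simp only: TU un)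
  have U: "?M' \<union> tube UNIV = ?M"
  proof -
    have "x \<in> tube UNIV" if "x \<in> ?M" "lf k x = 0" for x
      using that trad_pos[of x] by (auto simp: tube_def tbase_def Mset_def)
    then show ?thesis using TM[of UNIV] by (auto simp: Mset_def)
  qed
  have I: "?M' \<inter> tube UNIV = tube (- {0})" using TM' by (auto simp: tube_def Mset_def)
  have o1: "openin (top_of_set ?M) ?M'"
  proof -
    have "?M' = ?M \<inter> lf k -` (- {0})" by (auto simp: Mset_def)
    then show ?thesis using continuous_openin_preimage_gen[of ?M "lf k" "- {0}"] continuous_on_hyp_form[OF continuous_on_id, of ?M a b k] by (simp add: open_Compl)
  qed
  have o2: "openin (top_of_set ?M) (tube UNIV)"
  proof -
    let ?B = "{x\<in>?M. \<forall>j\<in>J. lf j (tbase x) \<noteq> 0}"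
    have oB: "openin (top_of_set ?M) ?B"
    proof (cases "J = {}")
      case False
      have "openin (top_of_set ?M) (?M \<inter> (\<lambda>x. lf j (tbase x)) -` (- {0}))" for j
        by (rule continuous_openin_preimage_gen) (auto intro!: continuous_on_hyp_form continuous_tbase continuous_on_id)
      then have "openin (top_of_set ?M) (\<Inter>j\<in>J. ?M \<inter> (\<lambda>x. lf j (tbase x)) -` (- {0}))" using fin False by (intro openin_Inter) auto
      moreover have "(\<Inter>j\<in>J. ?M \<inter> (\<lambda>x. lf j (tbase x)) -` (- {0})) = ?B" using False by auto
      ultimately show ?thesis by simp
    qed simp
    have "continuous_on ?B (\<lambda>x. trad (tbase x) - cmod (lf k x))"
      by (intro continuous_intros continuous_trad continuous_tbase continuous_on_hyp_form) auto
    then have "openin (top_of_set ?B) (?B \<inter> (\<lambda>x. trad (tbase x) - cmod (lf k x)) -` {0<..})"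
      by (rule continuous_openin_preimage_gen) simp
    moreover have "?B \<inter> (\<lambda>x. trad (tbase x) - cmod (lf k x)) -` {0<..} = tube UNIV"
      using TM[of UNIV] by (auto simp: tube_def Mset_def)
    ultimately have "openin (top_of_set ?B) (tube UNIV)" by simp
    then show ?thesis by (rule openin_trans[OF _ oB])
  qed
  have "(\<lambda>\<sigma>. 0 * \<psi> \<sigma> + (- 1) * \<psi> \<sigma>) \<in> BB J lf lam (tube (- {0})) q" by (rule Bc_linear[OF psiB psiB])
  then have "(\<lambda>\<sigma>. \<phi> \<sigma> - \<theta> \<sigma>) \<in> BB J lf lam (?M' \<inter> tube UNIV) q" by (simp add: I \<psi>_def)
  from ZZ_glue[OF _ _ phi th this, unfolded U, OF o1 o2]
  obtain \<Phi> where P: "\<Phi> \<in> ZZ J lf lam ?M q" "(\<lambda>\<sigma>. \<Phi> \<sigma> - \<phi> \<sigma>) \<in> BB J lf lam ?M' q" .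
  have "\<Phi> \<in> BB J lf lam ?M q" using P(1) v1 by (auto simp: van_def)
  then have "\<Phi> \<in> BB J lf lam ?M' q" by (rule BB_mono) (auto simp: Mset_def)
  from Bc_diff[OF this P(2)] show "\<phi> \<in> BB J lf lam ?M' q" by simp
qed

end

section \<open>Generic weights\<close>

text \<open>Validity off the zero set of a function that is entire along lines and not identically
  zero. By \<open>line_entire_common\<close> finitely many such conditions can be imposed
  together.\<close>

definition generically :: "((nat \<Rightarrow> complex) \<Rightarrow> bool) \<Rightarrow> bool" where
  "generically P \<longleftrightarrow> (\<exists>\<Phi>. line_entire \<Phi> \<and> (\<exists>l. \<Phi> l \<noteq> 0) \<and> (\<forall>l. \<Phi> l \<noteq> 0 \<longrightarrow> P l))"

lemma generically_mono: "generically P \<Longrightarrow> (\<And>l. P l \<Longrightarrow> Q l) \<Longrightarrow> generically Q"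
  unfolding generically_def by blast

lemma generically_all: "(\<And>l. P l) \<Longrightarrow> generically P"
  unfolding generically_def by (intro exI[of _ "\<lambda>_. 1"]) simp

lemma generically_ex: "generically P \<Longrightarrow> \<exists>l. P l"
  unfolding generically_def by blast

lemma generically_conj:
  assumes "generically P" "generically Q" shows "generically (\<lambda>l. P l \<and> Q l)"
proof -
  obtain A l1 where A: "line_entire A" "A l1 \<noteq> 0" "\<forall>l. A l \<noteq> 0 \<longrightarrow> P l" using assms(1) unfolding generically_def by blast
  obtain B l2 where B: "line_entire B" "B l2 \<noteq> 0" "\<forall>l. B l \<noteq> 0 \<longrightarrow> Q l" using assms(2) unfolding generically_def by blast
  show ?thesis unfolding generically_def
    using line_entire_mult[OF A(1) B(1)] line_entire_common[OF A(1,2) B(1,2)] A(3) B(3)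
    by (intro exI[of _ "\<lambda>l. A l * B l"]) simp
qed

lemma generically_ball:
  assumes "finite I" "\<And>i. i \<in> I \<Longrightarrow> generically (P i)" shows "generically (\<lambda>l. \<forall>i\<in>I. P i l)"
  using assms
proof (induction I rule: finite_induct)
  case (insert i I)
  then show ?case using generically_conj[of "P i" "\<lambda>l. \<forall>i\<in>I. P i l"] by simp
qed (simp add: generically_all)

text \<open>Hyperplanes of weight zero may be dropped from the logarithmic cover: the transport ignores them.\<close>
lemma van_index:
  fixes f :: "nat \<Rightarrow> 'a::topological_space \<Rightarrow> complex"
  assumes fin: "finite J'" and sub: "J \<subseteq> J'" and lam: "\<And>j. j \<in> J \<Longrightarrow> lam j = lam' j" "\<And>j. j \<in> J' - J \<Longrightarrow> lam' j = 0"
    and fc: "\<And>j. j \<in> J' \<Longrightarrow> continuous_on Y (f j)" and nz: "\<And>j x. j \<in> J' \<Longrightarrow> x \<in> Y \<Longrightarrow> f j x \<noteq> 0"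
    and v: "van J f lam Y q"
  shows "van J' f lam' Y q"
proof -
  have "(\<Sum>j\<in>J. lam j * log_change (\<lambda>s. f j (edge10 \<sigma> s))) = (\<Sum>j\<in>J'. lam' j * log_change (\<lambda>s. f j (edge10 \<sigma> s)))" for \<sigma>
    using lam by (intro sum.mono_neutral_cong_left[OF fin sub]) auto
  then have "gen_transport J f lam = gen_transport J' f lam'" by (auto simp: gen_transport_def)
  moreover have "tw_cohom_dim (top_of_set Y) (gen_transport J f lam) q = qdim (ZZ J f lam Y q) (BB J f lam Y q)"
    by (rule tw_cohom_dim_cover) (use sub fc nz in auto)
  moreover have "tw_cohom_dim (top_of_set Y) (gen_transport J' f lam') q = qdim (ZZ J' f lam' Y q) (BB J' f lam' Y q)"
    by (rule tw_cohom_dim_cover) (use fc nz in auto)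
  ultimately show ?thesis using v by (simp add: van_iff_qdim)
qed

lemma dim_kernel_ge:
  assumes D: "vec.subspace (D :: (complex ^ 'l) set)"
  shows "vec.dim D \<le> vec.dim {v\<in>D. bil y v = 0} + 1"
proof (cases "\<exists>w\<in>D. bil y w \<noteq> 0")
  case True
  then obtain w where w: "w \<in> D" "bil y w \<noteq> 0" by blast
  let ?K = "{v\<in>D. bil y v = 0}"
  have "D \<subseteq> vec.span (insert w ?K)"
  proof
    fix v assume v: "v \<in> D"
    let ?t = "bil y v / bil y w"
    have "v - ?t *s w \<in> ?K" using v w by (auto simp: bil_diff bil_scale intro: vec.subspace_diff[OF D] vec.subspace_scale[OF D])
    then have "(v - ?t *s w) + ?t *s w \<in> vec.span (insert w ?K)"
      by (intro vec.span_add vec.span_scale vec.span_base) auto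
    then show "v \<in> vec.span (insert w ?K)" by simp
  qed
  then have "vec.dim D \<le> vec.dim (vec.span (insert w ?K))" by (rule vec.dim_subset)
  also have "\<dots> = vec.dim (insert w ?K)" by (rule vec.dim_span)
  also have "\<dots> \<le> vec.dim ?K + 1" by (simp add: vec.dim_insert)
  finally show ?thesis .
next
  case False
  then have "{v\<in>D. bil y v = 0} = D" by auto
  then show ?thesis by simp
qed

context
  fixes a :: "nat \<Rightarrow> complex ^ 'l" and b :: "nat \<Rightarrow> complex"
begin

private abbreviation (input) "af \<equiv> hyp_form a b"

definition flat :: "complex ^ 'l \<Rightarrow> (complex ^ 'l) set \<Rightarrow> nat set \<Rightarrow> (complex ^ 'l) set" where
  "flat p D Z = {x. x - p \<in> D \<and> (\<forall>j\<in>Z. af j x = 0)}"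

definition dirs :: "(complex ^ 'l) set \<Rightarrow> nat set \<Rightarrow> (complex ^ 'l) set" where
  "dirs D Z = {v\<in>D. \<forall>j\<in>Z. bil (a j) v = 0}"

lemma subspace_dirs: "vec.subspace D \<Longrightarrow> vec.subspace (dirs D Z)"
  by (auto simp: vec.subspace_def dirs_def bil_add bil_scale)

lemma dim_dirs: "finite Z \<Longrightarrow> vec.subspace D \<Longrightarrow> vec.dim D \<le> vec.dim (dirs D Z) + card Z"
proof (induction Z rule: finite_induct)
  case (insert j Z)
  have "dirs D (insert j Z) = {v\<in>dirs D Z. bil (a j) v = 0}" by (auto simp: dirs_def)
  then show ?case using dim_kernel_ge[OF subspace_dirs[OF insert.prems], of Z "a j"] insert by simp
qed (simp add: dirs_def)

lemma flat_coset:
  assumes D: "vec.subspace D" and x0: "x0 \<in> flat p D Z"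
  shows "flat p D Z = {x. x - x0 \<in> dirs D Z}"
proof -
  have "x - p \<in> D \<longleftrightarrow> x - x0 \<in> D" for x
  proof -
    have "x0 - p \<in> D" using x0 by (simp add: flat_def)
    from coset_shift[OF D this, of x p] show ?thesis by simp
  qed
  moreover have "af j x = 0 \<longleftrightarrow> bil (a j) (x - x0) = 0" if "j \<in> Z" for j x
    using x0 that by (auto simp: flat_def hyp_form_bil bil_diff)
  ultimately show ?thesis by (auto simp: flat_def dirs_def)
qed

lemma cont_f: "continuous_on A (af j)" using continuous_on_hyp_form[OF continuous_on_id] by simp

text \<open>The hyperplanes in \<open>C\<close> are added one at a time by
  \<open>gysin_vanishing\<close>. Adding \<open>k\<close> on the flat of \<open>Z\<close> needs
  degree \<open>q\<close> on that flat and degree \<open>q - 1\<close> on its intersection with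
  \<open>k\<close>, so \<open>q + card Z\<close> does not grow. Hence the claim must be made for all
  flats at once.\<close>

lemma add_hyperplanes:
  assumes fin: "finite B" "finite C" and D: "vec.subspace D" and lam0: "\<And>j. j \<in> C - B \<Longrightarrow> lam j = 0"
    and base: "\<And>Z q. Z \<subseteq> C \<Longrightarrow> q + card Z < vec.dim D \<Longrightarrow> van B af lam (Mset B af (flat p D Z)) q"
    and Z: "Z \<subseteq> C" "q + card Z < vec.dim D"
  shows "van (B \<union> C) af lam (Mset (B \<union> C) af (flat p D Z)) q"
proof -
  have "van (B \<union> C') af lam (Mset (B \<union> C') af (flat p D Z)) q"
    if "finite C'" "C' \<subseteq> C" "Z \<subseteq> C" "q + card Z < vec.dim D" for C' Z q
    using that
  proof (induction C' arbitrary: Z q rule: finite_induct)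
    case empty
    then show ?case using base by simp
  next
    case (insert k C')
    let ?J = "B \<union> C'" and ?F = "flat p D Z"
    have k: "k \<in> C" and finJ: "finite ?J" using insert.prems insert.hyps fin by auto
    have IH1: "van ?J af lam (Mset ?J af ?F) q" using insert by simp
    have up: "van (B \<union> insert k C') af lam (Mset (B \<union> insert k C') af ?F) q" if "van ?J af lam (Mset (B \<union> insert k C') af ?F) q"
    proof (rule van_index[OF _ _ _ _ cont_f _ that])
      show "lam j = 0" if "j \<in> B \<union> insert k C' - (B \<union> C')" for j using that lam0[of j] k by auto
    qed (use finJ in \<open>auto simp: Mset_def\<close>)
    show ?case
    proof (cases "?F = {}")
      case True
      then show ?thesis by (simp add: Mset_def van_empty)
    next
      case False
      then obtain x0 where x0: "x0 \<in> ?F" by blast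
      note F = flat_coset[OF D x0]
      show ?thesis
      proof (cases "\<exists>v\<in>dirs D Z. bil (a k) v \<noteq> 0")
        case True
        then obtain v1 where v1: "v1 \<in> dirs D Z" "bil (a k) v1 \<noteq> 0" by blast
        define v where "v = (1 / bil (a k) v1) *s v1"
        have v: "v \<in> dirs D Z" "bil (a k) v = 1" using v1 vec.subspace_scale[OF subspace_dirs[OF D]] by (auto simp: v_def bil_scale)
        have "van ?J af lam (Mset ?J af {x. x - x0 \<in> dirs D Z \<and> af k x \<noteq> 0}) q"
        proof (rule gysin_vanishing[where a = a and k = k, OF finJ subspace_dirs[OF D] v])
          show "van ?J af lam (Mset ?J af {x. x - x0 \<in> dirs D Z}) q" using IH1 by (simp add: F)
          assume q: "q \<noteq> 0"
          have "{x. x - x0 \<in> dirs D Z \<and> af k x = 0} = flat p D (insert k Z)"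
            using F by (auto simp: flat_def)
          moreover have "van ?J af lam (Mset ?J af (flat p D (insert k Z))) (q - 1)"
          proof (rule insert.IH)
            have "card (insert k Z) \<le> Suc (card Z)" using insert.prems(2) fin(2) finite_subset[of Z C] by (simp add: card_insert_if)
            then show "q - 1 + card (insert k Z) < vec.dim D" using q insert.prems(3) by linarith
          qed (use insert.prems k in auto)
          ultimately show "van ?J af lam (Mset ?J af {x. x - x0 \<in> dirs D Z \<and> af k x = 0}) (q - 1)" by simp
        qed
        moreover have "Mset ?J af {x. x - x0 \<in> dirs D Z \<and> af k x \<noteq> 0} = Mset (B \<union> insert k C') af ?F" by (auto simp: F Mset_def)
        ultimately show ?thesis using up by simp
      next
        case False
        \<comment> \<open>Without a transversal direction form \<open>k\<close> is constant on the
          flat: it removes either everything or nothing.\<close>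
        then have c: "af k x = af k x0" if "x \<in> ?F" for x using that by (auto simp: F hyp_form_bil bil_diff)
        show ?thesis
        proof (cases "af k x0 = 0")
          case True
          then have "Mset (B \<union> insert k C') af ?F = {}" using c by (auto simp: Mset_def)
          then show ?thesis by (simp add: van_empty)
        next
          case False
          then have "Mset (B \<union> insert k C') af ?F = Mset ?J af ?F" using c by (auto simp: Mset_def)
          then show ?thesis using up IH1 by simp
        qed
      qed
    qed
  qed
  then show ?thesis using fin Z by blast
qed

definition ess :: "(complex ^ 'l) set \<Rightarrow> nat set \<Rightarrow> bool" where
  "ess D J \<longleftrightarrow> (\<forall>v\<in>D. (\<forall>j\<in>J. bil (a j) v = 0) \<longrightarrow> v = 0)"

text \<open>Rotating along \<open>v\<close> multiplies form \<open>k\<close> by a unit complex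
  number and fixes every other form in \<open>J\<close>. One full turn lifts to the generator of the
  deck group for \<open>k\<close>, whose character is exp(- 2 pi i l_k); it is 1 only for integral
  weight.\<close>

lemma rotation_generic:
  assumes fin: "finite J" and D: "vec.subspace D" and k: "k \<in> J" and v: "v \<in> D" "bil (a k) v = 1" "\<And>j. j \<in> J \<Longrightarrow> j \<noteq> k \<Longrightarrow> bil (a j) v = 0"
  shows "generically (\<lambda>l. \<forall>q. van J af l (Mset J af {x. x - p \<in> D}) q)"
proof -
  let ?Y = "Mset J af {x. x - p \<in> D}"
  define g :: "nat \<Rightarrow> int" where "g j = (if j = k then 1 else 0)" for j
  define c where "c s = 2 * complex_of_real pi * \<i> * complex_of_real s" for s
  define H where "H s x = x + ((exp (c s) - 1) * af k x) *s v" for s x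
  define G where "G s j x = (if j = k then c s else 0)" for s j and x :: "complex ^ 'l"
  have g: "g \<in> Gam J" using k by (auto simp: Gam_def g_def)
  have chi: "chi J l g = exp (- (2 * complex_of_real pi * \<i> * l k))" for l
  proof -
    have "(\<Sum>j\<in>J. l j * (2 * pi * \<i> * of_int (g j))) = (\<Sum>j\<in>J. if j = k then 2 * complex_of_real pi * \<i> * l k else 0)"
      by (intro sum.cong) (auto simp: g_def)
    then show ?thesis using fin k by (simp add: chi_def)
  qed
  have fH: "af j (H s x) = af j x * exp (G s j x)" if "j \<in> J" for s j x
  proof (cases "j = k")
    case True
    then show ?thesis unfolding H_def hyp_form_add bil_scale by (simp add: v(2) G_def algebra_simps)
  next
    case False
    then show ?thesis unfolding H_def hyp_form_add bil_scale by (simp add: v(3)[OF that] G_def)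
  qed
  have HY: "H s x \<in> ?Y" if "x \<in> ?Y" for s x
  proof -
    have e: "H s x - p = (x - p) + ((exp (c s) - 1) * af k x) *s v" by (simp add: H_def)
    have "x - p \<in> D" using that by (simp add: Mset_def)
    then have "H s x - p \<in> D" unfolding e by (rule vec.subspace_add[OF D _ vec.subspace_scale[OF D v(1)]])
    then show ?thesis using that fH by (auto simp: Mset_def)
  qed
  have h: "hmor J af ?Y af ?Y H G"
    unfolding hmor_def
  proof (intro conjI ballI)
    show "continuous_on ({0..1} \<times> ?Y) (\<lambda>z. H (fst z) (snd z))"
      unfolding H_def c_def by (intro continuous_intros continuous_on_hyp_form)
    show "continuous_on ({0..1} \<times> ?Y) (\<lambda>z. G (fst z) j (snd z))" for j
      unfolding G_def c_def by (cases "j = k") (auto intro!: continuous_intros)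
  qed (use HY fH in auto)
  have H1: "H 1 x = x" for x using exp_2pi_int[of 1] by (simp add: H_def c_def)
  have vn: "van J af l ?Y q" if "exp (- (2 * complex_of_real pi * \<i> * l k)) \<noteq> 1" for l q
    by (rule van_rotation[OF h _ _ _ _ g]) (use that H1 in \<open>auto simp: chi H_def G_def c_def g_def\<close>)
  define \<Phi> where "\<Phi> l = exp (- (2 * complex_of_real pi * \<i> * l k)) - 1" for l :: "nat \<Rightarrow> complex"
  have "line_entire \<Phi>" unfolding \<Phi>_def line_entire_def by (auto intro!: holomorphic_intros)
  \<comment> \<open>At weight 1/2 the character is -1, so \<open>\<Phi>\<close> is not identically
    zero.\<close>
  moreover have "\<Phi> (\<lambda>_. 1/2) \<noteq> 0"
  proof -
    have "exp (- (2 * complex_of_real pi * \<i> * (1/2))) = inverse (exp (\<i> * complex_of_real pi))" by (simp add: exp_minus mult_ac)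
    then show ?thesis by (simp add: \<Phi>_def)
  qed
  ultimately show ?thesis unfolding generically_def
    by (intro exI[of _ \<Phi>] conjI exI[of _ "\<lambda>_. 1/2"] allI impI vn) (simp_all add: \<Phi>_def)
qed

text \<open>An essential subset \<open>B\<close> of least size is a basis of forms on
  \<open>D\<close>. If it is everything, rotations apply. Otherwise the smaller arrangement
  \<open>B\<close> is handled on all flats by induction, the rest is added with weight zero, and
  semicontinuity spreads vanishing below degree \<open>vec.dim D\<close> from this one weight to
  generic ones.\<close>

theorem generic_vanishing:
  assumes "finite J" "vec.subspace D" "ess D J"
  shows "generically (\<lambda>l. \<forall>q. q \<noteq> vec.dim D \<longrightarrow> van J af l (Mset J af {x. x - p \<in> D}) q)"
  using assms
proof (induction "card J" arbitrary: J D p rule: less_induct)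
  case (less J D p)
  note fin = less.prems(1) and D = less.prems(2)
  define B where "B = arg_min card (\<lambda>B. B \<subseteq> J \<and> ess D B)"
  have "B \<subseteq> J \<and> ess D B" unfolding B_def by (rule arg_min_natI[of _ J]) (use less.prems in auto)
  then have B: "B \<subseteq> J" "ess D B" by auto
  have finB: "finite B" using B fin finite_subset by blast
  have Bmin: "\<not> ess D B'" if "B' \<subset> B" for B'
  proof
    assume "ess D B'"
    then have "card B \<le> card B'" unfolding B_def using that B by (intro arg_min_nat_le) auto
    then show False using psubset_card_mono[OF finB that] by simp
  qed
  have big: "van J af l (Mset J af {x. x - p \<in> D}) q" if "q > vec.dim D" for l q
    by (rule cohomological_dimension[OF fin D that])
  show ?case
  proof (cases "J = B")
    case True
    show ?thesis
    proof (cases "B = {}")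
      case True
      then have "D = {0}" using B(2) vec.subspace_0[OF D] by (auto simp: ess_def)
      then have d0: "vec.dim D = 0" by simp
      have "q > vec.dim D" if "q \<noteq> vec.dim D" for q using that unfolding d0 by simp
      then show ?thesis by (intro generically_all allI impI big)
    next
      case False
      then obtain k where k: "k \<in> B" by blast
      \<comment> \<open>By minimality some vector is killed by all forms of \<open>B\<close> except
        \<open>k\<close>; normalised, it is the dual vector along which to rotate.\<close>
      have "\<not> ess D (B - {k})" using k by (intro Bmin) auto
      then obtain v1 where v1: "v1 \<in> D" "\<forall>j\<in>B - {k}. bil (a j) v1 = 0" "v1 \<noteq> 0" by (auto simp: ess_def)
      have n: "bil (a k) v1 \<noteq> 0" using v1 B(2) unfolding ess_def by blast
      define v where "v = (1 / bil (a k) v1) *s v1"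
      have "generically (\<lambda>l. \<forall>q. van J af l (Mset J af {x. x - p \<in> D}) q)"
        by (rule rotation_generic[OF fin D, of k v])
           (use k v1 n True vec.subspace_scale[OF D] in \<open>auto simp: v_def bil_scale\<close>)
      then show ?thesis by (rule generically_mono) auto
    qed
  next
    case False
    define C where "C = J - B"
    have finC: "finite C" and JC: "J = B \<union> C" using fin B by (auto simp: C_def)
    have cB: "card B < card J" using False B fin by (intro psubset_card_mono) auto
    \<comment> \<open>\<open>B\<close> stays essential on the directions of a flat, and by
      \<open>dim_dirs\<close> a flat loses at most \<open>card Z\<close> dimensions, so these
      degrees are below its dimension.\<close>
    have "generically (\<lambda>l. \<forall>q. q + card Z < vec.dim D \<longrightarrow> van B af l (Mset B af (flat p D Z)) q)" if Z: "Z \<subseteq> C" for Z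
    proof (cases "flat p D Z = {}")
      case True
      then show ?thesis by (intro generically_all) (simp add: Mset_def van_empty)
    next
      case False
      then obtain x0 where x0: "x0 \<in> flat p D Z" by blast
      note F = flat_coset[OF D x0]
      have finZ: "finite Z" using Z finC finite_subset by blast
      have "generically (\<lambda>l. \<forall>q. q \<noteq> vec.dim (dirs D Z) \<longrightarrow> van B af l (Mset B af {x. x - x0 \<in> dirs D Z}) q)"
        by (rule less.hyps[OF cB finB subspace_dirs[OF D]]) (use B(2) in \<open>auto simp: ess_def dirs_def\<close>)
      then show ?thesis unfolding F[symmetric] by (rule generically_mono) (use dim_dirs[OF finZ D] in auto)
    qed
    then have "generically (\<lambda>l. \<forall>Z\<in>Pow C. \<forall>q. q + card Z < vec.dim D \<longrightarrow> van B af l (Mset B af (flat p D Z)) q)"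
      by (intro generically_ball) (use finC in auto)
    then obtain l where l: "\<And>Z q. Z \<subseteq> C \<Longrightarrow> q + card Z < vec.dim D \<Longrightarrow> van B af l (Mset B af (flat p D Z)) q"
      using generically_ex by blast
    \<comment> \<open>Weights off \<open>B\<close> are set to 0, which is what permits adding the
      remaining hyperplanes.\<close>
    define l' where "l' j = (if j \<in> B then l j else 0)" for j
    have l': "van B af l' (Mset B af (flat p D Z)) q" if "Z \<subseteq> C" "q + card Z < vec.dim D" for Z q
      by (rule van_index[OF finB subset_refl _ _ cont_f _ l[OF that]]) (auto simp: l'_def Mset_def)
    have low: "van J af l' (Mset J af {x. x - p \<in> D}) q" if "q < vec.dim D" for q
      using add_hyperplanes[OF finB finC D _ l', of "{}" q] that by (simp add: JC l'_def flat_def)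
    have cvx: "convex {x. x - p \<in> D}" by (rule convex_coset[OF D])
    have "generically (\<lambda>l. van J af l (Mset J af {x. x - p \<in> D}) q)" if q: "q < vec.dim D" for q
    proof -
      from hd_dim_usc[where f = af, OF fin affc_hyp_form cvx, of l' q] obtain \<Phi>
        where "line_entire \<Phi>" "\<Phi> l' \<noteq> 0" "\<forall>l. \<Phi> l \<noteq> 0 \<longrightarrow> hd_dim J af l (Mset J af {x. x - p \<in> D}) q \<le> hd_dim J af l' (Mset J af {x. x - p \<in> D}) q" by blast
      then show ?thesis using low[OF q] unfolding generically_def van_hd_dim by auto
    qed
    then have "generically (\<lambda>l. \<forall>q\<in>{..<vec.dim D}. van J af l (Mset J af {x. x - p \<in> D}) q)" by (intro generically_ball) auto
    then show ?thesis by (rule generically_mono) (use big in \<open>auto simp: neq_iff\<close>)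
  qed
qed

end

section \<open>Essential arrangements and the comparison of weights\<close>

text \<open>As many independent coefficient vectors as the dimension span the whole space. A vector
  killed by these forms is killed by every form, in particular by the coordinates.\<close>

lemma essential_kernel:
  fixes a :: "nat \<Rightarrow> complex ^ 'l"
  assumes "essential_arr n a"
  shows "ess a UNIV {..<n}"
  unfolding ess_def
proof (intro ballI impI)
  fix v :: "complex ^ 'l" assume v: "\<forall>j\<in>{..<n}. bil (a j) v = 0"
  obtain S where S: "S \<subseteq> {..<n}" "card S = CARD('l)" and ind: "\<And>c. (\<Sum>j\<in>S. c j *s a j) = 0 \<Longrightarrow> \<forall>j\<in>S. c j = 0"
    using assms by (auto simp: essential_arr_def)
  have fin: "finite S" using S(1) finite_subset by blast
  have inj: "inj_on a S"
  proof
    fix i j assume ij: "i \<in> S" "j \<in> S" "a i = a j"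
    show "i = j"
    proof (rule ccontr)
      assume "i \<noteq> j"
      define c where "c k = (if k = i then 1 else if k = j then - 1 else 0 :: complex)" for k
      have "(\<Sum>k\<in>S. c k *s a k) = (\<Sum>k\<in>{i, j}. c k *s a k)"
        using ij fin by (intro sum.mono_neutral_right) (auto simp: c_def)
      also have "\<dots> = 0" using ij \<open>i \<noteq> j\<close> by (simp add: c_def)
      finally have "c i = 0" using ind ij(1) by blast
      then show False by (simp add: c_def)
    qed
  qed
  have "vec.independent (a ` S)"
  proof (rule vec.independent_if_scalars_zero)
    show "finite (a ` S)" using fin by simp
    fix u x assume s: "(\<Sum>x\<in>a ` S. u x *s x) = 0" and x: "x \<in> a ` S"
    have "(\<Sum>j\<in>S. u (a j) *s a j) = 0" using s by (simp add: sum.reindex[OF inj])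
    from ind[OF this] show "u x = 0" using x by auto
  qed
  moreover have "card (a ` S) = vec.dim (UNIV :: (complex ^ 'l) set)" using card_image[OF inj] S(2) by (simp add: vec_dim_card del: vec.dim_UNIV)
  ultimately have sp: "UNIV \<subseteq> vec.span (a ` S)" by (intro vec.card_ge_dim_independent) auto
  have "vec.subspace {u. bil u v = 0}"
    by (auto simp: vec.subspace_def bil_def sum.distrib algebra_simps simp flip: sum_distrib_left)
  then have "vec.span (a ` S) \<subseteq> {u. bil u v = 0}" by (intro vec.span_minimal) (use v S(1) in auto)
  then have z: "bil u v = 0" for u using sp by auto
  have "v $ i = 0" for i
  proof -
    have "bil (axis i 1) v = (\<Sum>k\<in>UNIV. if k = i then v $ k else 0)"
      unfolding bil_def by (intro sum.cong) (auto simp: axis_def)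
    then show ?thesis using z[of "axis i 1"] by simp
  qed
  then show "v = 0" by (simp add: vec_eq_iff)
qed

lemma arr_complement_Mset: "arr_complement n a b = Mset {..<n} (hyp_form a b) UNIV"
  by (auto simp: arr_complement_def Mset_def hyperplane_of_def)

lemma tw_cohom_dim_arr: "tw_cohom_dim (arr_top n a b) (gen_transport {..<n} (hyp_form a b) lam) q = hd_dim {..<n} (hyp_form a b) lam (Mset {..<n} (hyp_form a b) UNIV) q"
  unfolding arr_top_def arr_complement_Mset hd_dim_def
  by (rule tw_cohom_dim_cover) (auto simp: Mset_def cont_f)

lemma ls_cohom_dim_hd_dim: "ls_cohom_dim n a b lam q = hd_dim {..<n} (hyp_form a b) lam (Mset {..<n} (hyp_form a b) UNIV) q"
proof -
  have "arr_transport n a b lam = gen_transport {..<n} (hyp_form a b) lam"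
    by (auto simp: arr_transport_def gen_transport_def)
  then show ?thesis by (simp add: ls_cohom_dim_def tw_cohom_dim_arr)
qed

lemma betti_hd_dim: "betti (arr_top n a b) q = hd_dim {..<n} (hyp_form a b) (\<lambda>_. 0) (Mset {..<n} (hyp_form a b) UNIV) q"
proof -
  have "gen_transport {..<n} (hyp_form a b) (\<lambda>_. 0) = (\<lambda>_. 1)" by (auto simp: gen_transport_def)
  then show ?thesis using tw_cohom_dim_arr[of n a b "\<lambda>_. 0" q] by (simp add: betti_def)
qed

theorem theorem1p1:
  fixes n :: nat and a :: "nat \<Rightarrow> complex ^ 'l" and b :: "nat \<Rightarrow> complex"
    and lam :: "nat \<Rightarrow> complex"
  assumes hyperplanes: "\<forall>j<n. a j \<noteq> 0"
    and distinct: "\<forall>i<n. \<forall>j<n. i \<noteq> j \<longrightarrow> hyperplane_of a b i \<noteq> hyperplane_of a b j"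
    and essential: "essential_arr n a"
    and nonresonant: "\<forall>mu :: nat \<Rightarrow> complex.
           (\<Sum>q\<le>CARD('l). ls_cohom_dim n a b lam q) \<le> (\<Sum>q\<le>CARD('l). ls_cohom_dim n a b mu q)"
  shows "(\<forall>q. q \<noteq> CARD('l) \<longrightarrow> ls_cohom_dim n a b lam q = 0)
       \<and> ls_cohom_dim n a b lam CARD('l) = enat (nat \<bar>euler_char (arr_top n a b)\<bar>)"
proof -
  let ?J = "{..<n}" and ?f = "hyp_form a b" and ?d = "CARD('l)"
  define h where "h = (\<lambda>l q. hd_dim ?J ?f l (Mset ?J ?f UNIV) q)"
  have ls: "ls_cohom_dim n a b l q = h l q" for l q by (simp add: ls_cohom_dim_hd_dim h_def)
  have fin: "finite ?J" by simp
  have dU: "vec.dim (UNIV :: (complex ^ 'l) set) = ?d" by (rule vec_dim_card)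
  have U: "{x :: complex ^ 'l. x - 0 \<in> UNIV} = UNIV" by simp
  have big: "h l q = 0" if "q > ?d" for l q
    using cohomological_dimension[OF fin vec.subspace_UNIV, of q a b l 0, unfolded U dU, OF that] by (simp add: h_def van_hd_dim)
  have hfin: "h l q \<noteq> \<infinity>" for l q
    unfolding h_def by (rule hd_dim_finite[where f = ?f, OF fin affc_hyp_form convex_UNIV])
  have "generically (\<lambda>l. \<forall>q. q \<noteq> ?d \<longrightarrow> h l q = 0)"
    using generic_vanishing[OF fin vec.subspace_UNIV essential_kernel[OF essential], of b 0]
    unfolding U dU by (simp add: van_hd_dim h_def)
  \<comment> \<open>Semicontinuity is needed only in the top degree and at \<open>lam\<close>
    itself; it keeps the generic competitor from exceeding the top dimension at
    \<open>lam\<close>.\<close>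
  moreover have "generically (\<lambda>l. h l ?d \<le> h lam ?d)"
    unfolding generically_def h_def using hd_dim_usc[where f = ?f, OF fin affc_hyp_form convex_UNIV, of lam ?d] by blast
  ultimately have "\<exists>l. (\<forall>q. q \<noteq> ?d \<longrightarrow> h l q = 0) \<and> h l ?d \<le> h lam ?d"
    by (intro generically_ex generically_conj)
  then obtain mu where mu: "\<And>q. q \<noteq> ?d \<Longrightarrow> h mu q = 0" "h mu ?d \<le> h lam ?d" by auto
  have split: "(\<Sum>q\<le>?d. h l q) = (\<Sum>q<?d. h l q) + h l ?d" for l by (simp add: lessThan_Suc_atMost[symmetric])
  have "(\<Sum>q<?d. h mu q) = 0" by (rule sum.neutral) (use mu(1) in auto)
  then have le: "(\<Sum>q<?d. h lam q) + h lam ?d \<le> h mu ?d"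
    using nonresonant[rule_format, of mu] unfolding ls split by simp
  have "h lam ?d \<le> (\<Sum>q<?d. h lam q) + h lam ?d" by (rule add_increasing) simp_all
  then have eq: "h lam ?d = h mu ?d" using le mu(2) by (intro antisym) (rule order_trans)
  obtain e where e: "h mu ?d = enat e" using hfin[of mu ?d] by auto
  \<comment> \<open>Cancelling the common top term in \<open>enat\<close> is possible because it is
    the finite number \<open>e\<close>.\<close>
  have "(\<Sum>q<?d. h lam q) = 0"
    using le unfolding eq e by (cases "\<Sum>q<?d. h lam q") (auto simp: zero_enat_def)
  then have low: "h lam q = 0" if "q < ?d" for q using that by (auto simp: sum_eq_0_iff)
  obtain N ec where N: "\<And>l q. q \<ge> N \<Longrightarrow> h l q = 0" and ec: "\<And>l. (\<Sum>q<N. (-1) ^ q * int (the_enat (h l q))) = ec"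
    by (rule hd_dim_euler[where f = ?f, OF fin affc_hyp_form convex_UNIV]) (rule that[unfolded h_def])
  have e0: "the_enat 0 = 0" by (simp add: zero_enat_def)
  have "euler_char (arr_top n a b) = (\<Sum>q\<in>{q. h (\<lambda>_. 0) q \<noteq> 0}. (-1) ^ q * int (the_enat (h (\<lambda>_. 0) q)))"
    unfolding euler_char_def betti_hd_dim h_def ..
  also have "\<dots> = (\<Sum>q<N. (-1) ^ q * int (the_enat (h (\<lambda>_. 0) q)))"
  proof (rule sum.mono_neutral_left)
    show "{q. h (\<lambda>_. 0) q \<noteq> 0} \<subseteq> {..<N}" using N by (auto simp: not_le[symmetric])
  qed (auto simp: e0)
  \<comment> \<open>Betti numbers are the dimensions for weight 0, and the alternating sum is the
    same at \<open>mu\<close>, where a single degree survives.\<close>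
  finally have "euler_char (arr_top n a b) = (\<Sum>q<N. (-1) ^ q * int (the_enat (h mu q)))" using ec by simp
  also have "\<dots> = (\<Sum>q<N. if q = ?d then (-1) ^ ?d * int e else 0)"
    using mu(1) e by (intro sum.cong) (auto simp: e0)
  also have "\<dots> = (-1) ^ ?d * int e"
  \<comment> \<open>If the top degree is not below the bound \<open>N\<close>, the sum misses it,
    but then \<open>e\<close> is 0 and both sides vanish.\<close>
  proof (cases "?d < N")
    case False
    then have "e = 0" using N[of ?d mu] e by (simp add: zero_enat_def)
    then show ?thesis by simp
  qed simp
  finally have "\<bar>euler_char (arr_top n a b)\<bar> = int e" by (simp add: abs_mult power_abs)
  then have "h lam ?d = enat (nat \<bar>euler_char (arr_top n a b)\<bar>)" by (simp add: eq e)
  moreover have "h lam q = 0" if "q \<noteq> ?d" for q using low big that by (cases "q < ?d") auto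
  ultimately show ?thesis by (simp add: ls)
qed

end
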